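(* Let $T_n$ denote the regular tree of degree $n$. (i) There exists a reducible lattice $\Gamma_{3,23} \leq \mathrm{Aut}(T_3) \times \mathrm{Aut}(T_{23})$ acting regularly on the vertices of $T_3 \times T_{23}$, whose local action on $T_3$ (resp. $T_{23}$) is $\mathrm{Sym}(3)$ (resp. $\mathrm{Sym}(23)$). (ii) There exists a reducible lattice $\Gamma_{3,24} \leq \mathrm{Aut}(T_3) \times \mathrm{Aut}(T_{24})$ acting regularly on the vertices of $T_3 \times T_{24}$, whose local action on $T_3$ (resp. $T_{24}$) is $\mathrm{Sym}(3)$ (resp. $\mathrm{Sym}(24)$). (iii) There exists a reducible lattice $\Gamma_{3,47} \leq \mathrm{Aut}(T_3) \times \mathrm{Aut}(T_{47})$ acting regularly on the vertices of $T_3 \times T_{47}$, whose local action on $T_3$ (resp. $T_{47}$) is $\mathrm{Sym}(3)$ (resp. $\mathrm{Alt}(47)$). (iv) There exists a reducible lattice $\Gamma_{4,11663} \leq \mathrm{Aut}(T_4) \times \mathrm{Aut}(T_{11663})$ acting regularly on the vertices of $T_4 \times T_{11663}$, whose local action on $T_4$ (resp. $T_{11663}$) is $\mathrm{Sym}(4)$ (resp. $\mathrm{Alt}(11663)$). (v) For each $n \in \{19, 39, 79\}$ there exists a reducible lattice $\Gamma_{5,n} \leq \mathrm{Aut}(T_5) \times \mathrm{Aut}(T_n)$ acting regularly on the vertices of $T_5 \times T_n$, whose local action on $T_5$ is $\mathbf{C}_5 \rtimes \mathbf{C}_4$, and whose respective local action on $T_{19}$, $T_{39}$ and $T_{79}$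 is $\mathrm{Sym}(19)$, $\mathrm{Alt}(39)$ and $\mathrm{Alt}(79)$.
   Context: $\mathbf{C}_n$ denotes the cyclic group of order $n$; $\mathbf{C}_5\rtimes \mathbf{C}_4$ is the affine group $\mathbf{F}_5 \rtimes \mathbf{F}_5^*$ acting on $5$ points. "Acting regularly on the vertices of $T\times T'$" means acting freely and transitively on $VT\times VT'$. "Lattice" means cocompact lattice, i.e. a subgroup $\Gamma \leq \mathrm{Aut}(T)\times\mathrm{Aut}(T')$ acting on $T\times T'$ with finite stabilizers and finitely many orbits. A group acts freely on a tree if it acts freely on its vertices and no element inverts an edge. A lattice $\Gamma\leq \mathrm{Aut}(T_1)\times \mathrm{Aut}(T_2)$ in a product of two trees is reducible if it contains a finite index subgroup of the form $K_1 \times K_2$, where $K_i \leq \Gamma$ acts trivially on the tree $T_{3-i}$ and freely and cocompactly on $T_i$ for $i=1,2$ (here $T_1,T_2$ denote the first and second tree factors). The local action of $\Gamma$ at a vertex $v$ of a tree factor is the permutation group induced by the stabilizer $\Gamma_v$ on the set of edges emanating from $v$; for a vertex-transitive action these are pairwise isomorphic and give the local action of $\Gamma$ on that tree. *)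

theory Defs
  imports
    "HOL-Algebra.Group_Action"
    "HOL-Algebra.Sym_Groups"
    "Graph_Theory.Digraph_Component"
begin

section \<open>Regular trees\<close>

text \<open>
  An undirected simple graph is a \<^typ>\<open>'a pair_pre_digraph\<close> in which every edge is
  represented by both of its orientations. The predicate \<^const>\<open>Digraph_Component.tree\<close>
  cannot be used for such graphs, because it counts the walk along an edge and back as a
  cycle; hence the bound on the length of cycles below.
\<close>

definition is_regular_tree :: "nat \<Rightarrow> 'a pair_pre_digraph \<Rightarrow> bool" where
  "is_regular_tree n S \<longleftrightarrow>
     pair_bidirected_digraph S \<and>
     connected (with_proj S) \<and>
     (\<forall>p. pre_digraph.cycle (with_proj S) p \<longrightarrow> length p \<le> 2) \<and>
     (\<forall>v\<in>pverts S. finite (out_arcs (with_proj S) v) \<and> out_degree (with_proj S) v = n)"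

text \<open>
  A model of the regular tree of degree \<open>n\<close>: the Cayley graph of the free product of
  \<open>n\<close> copies of the group of order 2, whose elements are the words over \<open>{..<n}\<close> without
  equal neighbouring letters. See \<open>is_regular_tree_T\<close> below.
\<close>

definition T :: "nat \<Rightarrow> nat list pair_pre_digraph" where
  "T n = (let V = {w. set w \<subseteq> {..<n} \<and> distinct_adj w} in
     \<lparr> pverts = V,
       parcs = {(w, i # w) | i w. i # w \<in> V} \<union> {(i # w, w) | i w. i # w \<in> V} \<rparr>)"


section \<open>Automorphism groups and lattices\<close>

definition graph_Aut :: "'a pair_pre_digraph \<Rightarrow> ('a \<Rightarrow> 'a) monoid" where
  "graph_Aut S = (BijGroup (pverts S))
     \<lparr> carrier := {f \<in> Bij (pverts S).
         \<forall>u\<in>pverts S. \<forall>v\<in>pverts S. (f u, f v) \<in> parcs S \<longleftrightarrow> (u, v) \<in> parcs S} \<rparr>"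

text \<open>
  Cells of a graph are its vertices and its (unoriented) edges, both given by their sets of
  end points. The cells of the square complex \<open>S \<times> S'\<close> are the products of a cell of \<open>S\<close> and
  a cell of \<open>S'\<close>.
\<close>

definition cells :: "'a pair_pre_digraph \<Rightarrow> 'a set set" where
  "cells S = (\<lambda>v. {v}) ` pverts S \<union> (\<lambda>(u, v). {u, v}) ` parcs S"

definition cell_action :: "'a pair_pre_digraph \<Rightarrow> ('a \<Rightarrow> 'a) \<Rightarrow> 'a set \<Rightarrow> 'a set" where
  "cell_action S f = (\<lambda>c \<in> cells S. f ` c)"

definition prod_cell_action ::
  "'a pair_pre_digraph \<Rightarrow> 'b pair_pre_digraph \<Rightarrow>
     ('a \<Rightarrow> 'a) \<times> ('b \<Rightarrow> 'b) \<Rightarrow> 'a set \<times> 'b set \<Rightarrow> 'a set \<times> 'b set" where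
  "prod_cell_action S S' g = (\<lambda>(c, c') \<in> cells S \<times> cells S'. (fst g ` c, snd g ` c'))"

definition prod_vertex_action ::
  "'a pair_pre_digraph \<Rightarrow> 'b pair_pre_digraph \<Rightarrow>
     ('a \<Rightarrow> 'a) \<times> ('b \<Rightarrow> 'b) \<Rightarrow> 'a \<times> 'b \<Rightarrow> 'a \<times> 'b" where
  "prod_vertex_action S S' g = (\<lambda>(x, y) \<in> pverts S \<times> pverts S'. (fst g x, snd g y))"

text \<open>The subset \<open>\<Gamma>\<close> of \<open>Aut(S) \<times> Aut(S')\<close>, regarded as a group of its own.\<close>

abbreviation subgrp ::
  "'a pair_pre_digraph \<Rightarrow> 'b pair_pre_digraph \<Rightarrow>
     (('a \<Rightarrow> 'a) \<times> ('b \<Rightarrow> 'b)) set \<Rightarrow> (('a \<Rightarrow> 'a) \<times> ('b \<Rightarrow> 'b)) monoid" where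
  "subgrp S S' \<Gamma> \<equiv> (graph_Aut S \<times>\<times> graph_Aut S') \<lparr> carrier := \<Gamma> \<rparr>"

definition is_lattice ::
  "'a pair_pre_digraph \<Rightarrow> 'b pair_pre_digraph \<Rightarrow> (('a \<Rightarrow> 'a) \<times> ('b \<Rightarrow> 'b)) set \<Rightarrow> bool" where
  "is_lattice S S' \<Gamma> \<longleftrightarrow>
     subgroup \<Gamma> (graph_Aut S \<times>\<times> graph_Aut S') \<and>
     (\<forall>c \<in> cells S \<times> cells S'.
        finite (stabilizer (subgrp S S' \<Gamma>) (prod_cell_action S S') c)) \<and>
     finite (orbits (subgrp S S' \<Gamma>) (cells S \<times> cells S') (prod_cell_action S S'))"

definition acts_regularly ::
  "'a pair_pre_digraph \<Rightarrow> 'b pair_pre_digraph \<Rightarrow> (('a \<Rightarrow> 'a) \<times> ('b \<Rightarrow> 'b)) set \<Rightarrow> bool" where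
  "acts_regularly S S' \<Gamma> \<longleftrightarrow>
     (\<forall>x \<in> pverts S \<times> pverts S'.
        stabilizer (subgrp S S' \<Gamma>) (prod_vertex_action S S') x = {\<one>\<^bsub>subgrp S S' \<Gamma>\<^esub>}) \<and>
     (\<forall>x \<in> pverts S \<times> pverts S'. \<forall>y \<in> pverts S \<times> pverts S'.
        \<exists>g\<in>\<Gamma>. prod_vertex_action S S' g x = y)"


section \<open>Actions on one tree\<close>

text \<open>
  Here \<open>H\<close> is a group and \<open>\<pi>\<close> maps its elements to automorphisms of the graph \<open>S\<close>. For subgroups
  of \<open>Aut(S) \<times> Aut(S')\<close> the actions on the two factors are \<open>\<pi> = fst\<close> and \<open>\<pi> = snd\<close>.
\<close>

definition acts_trivially ::
  "('g, 'm) monoid_scheme \<Rightarrow> ('g \<Rightarrow> 'a \<Rightarrow> 'a) \<Rightarrow> 'a pair_pre_digraph \<Rightarrow> bool" where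
  "acts_trivially H \<pi> S \<longleftrightarrow> (\<forall>g\<in>carrier H. \<forall>v\<in>pverts S. \<pi> g v = v)"

definition acts_freely ::
  "('g, 'm) monoid_scheme \<Rightarrow> ('g \<Rightarrow> 'a \<Rightarrow> 'a) \<Rightarrow> 'a pair_pre_digraph \<Rightarrow> bool" where
  "acts_freely H \<pi> S \<longleftrightarrow>
     (\<forall>v\<in>pverts S. stabilizer H \<pi> v = {\<one>\<^bsub>H\<^esub>}) \<and>
     \<not> (\<exists>g\<in>carrier H. \<exists>(u, v)\<in>parcs S. \<pi> g u = v \<and> \<pi> g v = u)"

definition acts_cocompactly ::
  "('g, 'm) monoid_scheme \<Rightarrow> ('g \<Rightarrow> 'a \<Rightarrow> 'a) \<Rightarrow> 'a pair_pre_digraph \<Rightarrow> bool" where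
  "acts_cocompactly H \<pi> S \<longleftrightarrow> finite (orbits H (cells S) (\<lambda>g. cell_action S (\<pi> g)))"

text \<open>
  Elements of \<open>K\<^sub>1\<close> and \<open>K\<^sub>2\<close> as below commute and \<open>K\<^sub>1 \<inter> K\<^sub>2\<close> is trivial, so the product set
  \<open>K\<^sub>1 K\<^sub>2\<close> is the internal direct product \<open>K\<^sub>1 \<times> K\<^sub>2\<close>.
\<close>

definition is_reducible ::
  "'a pair_pre_digraph \<Rightarrow> 'b pair_pre_digraph \<Rightarrow> (('a \<Rightarrow> 'a) \<times> ('b \<Rightarrow> 'b)) set \<Rightarrow> bool" where
  "is_reducible S S' \<Gamma> \<longleftrightarrow>
     (\<exists>K\<^sub>1 K\<^sub>2.
        subgroup K\<^sub>1 (subgrp S S' \<Gamma>) \<and>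
        acts_trivially (subgrp S S' K\<^sub>1) snd S' \<and>
        acts_freely (subgrp S S' K\<^sub>1) fst S \<and>
        acts_cocompactly (subgrp S S' K\<^sub>1) fst S \<and>
        subgroup K\<^sub>2 (subgrp S S' \<Gamma>) \<and>
        acts_trivially (subgrp S S' K\<^sub>2) fst S \<and>
        acts_freely (subgrp S S' K\<^sub>2) snd S' \<and>
        acts_cocompactly (subgrp S S' K\<^sub>2) snd S' \<and>
        subgroup (K\<^sub>1 <#>\<^bsub>subgrp S S' \<Gamma>\<^esub> K\<^sub>2) (subgrp S S' \<Gamma>) \<and>
        finite (rcosets\<^bsub>subgrp S S' \<Gamma>\<^esub> (K\<^sub>1 <#>\<^bsub>subgrp S S' \<Gamma>\<^esub> K\<^sub>2)))"


section \<open>Local actions\<close>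

text \<open>
  As for \<^const>\<open>sym_group\<close>, permutations of a set are functions that are the identity outside
  of this set.
\<close>

definition local_action ::
  "('g, 'm) monoid_scheme \<Rightarrow> ('g \<Rightarrow> 'a \<Rightarrow> 'a) \<Rightarrow> 'a pair_pre_digraph \<Rightarrow> 'a \<Rightarrow>
     ('a \<times> 'a \<Rightarrow> 'a \<times> 'a) monoid" where
  "local_action H \<pi> S v =
     \<lparr> carrier = (\<lambda>g e. if e \<in> out_arcs (with_proj S) v then (\<pi> g (fst e), \<pi> g (snd e)) else e)
         ` stabilizer H \<pi> v,
       monoid.mult = (\<circ>), one = id \<rparr>"

definition perm_isomorphic ::
  "('a \<Rightarrow> 'a) monoid \<Rightarrow> 'a set \<Rightarrow> ('b \<Rightarrow> 'b) monoid \<Rightarrow> 'b set \<Rightarrow> bool" where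
  "perm_isomorphic P A Q B \<longleftrightarrow>
     (\<exists>\<theta>\<in>iso P Q. \<exists>f. bij_betw f A B \<and> (\<forall>p\<in>carrier P. \<forall>x\<in>A. f (p x) = \<theta> p (f x)))"

definition has_local_action ::
  "('g, 'm) monoid_scheme \<Rightarrow> ('g \<Rightarrow> 'a \<Rightarrow> 'a) \<Rightarrow> 'a pair_pre_digraph \<Rightarrow>
     ('b \<Rightarrow> 'b) monoid \<Rightarrow> 'b set \<Rightarrow> bool" where
  "has_local_action H \<pi> S Q B \<longleftrightarrow>
     (\<forall>v\<in>pverts S. perm_isomorphic (local_action H \<pi> S v) (out_arcs (with_proj S) v) Q B)"

text \<open>The affine group of the field with 5 elements in its action on the 5 points of the field.\<close>

definition affine_group_5 :: "(nat \<Rightarrow> nat) monoid" where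
  "affine_group_5 =
     \<lparr> carrier = {p. p permutes {0..<5} \<and>
         (\<exists>a\<in>{1..<5}. \<exists>b\<in>{0..<5}. \<forall>x\<in>{0..<5}. p x = (a * x + b) mod 5)},
       monoid.mult = (\<circ>), one = id \<rparr>"

text \<open>
  \<open>\<Gamma>\<close> is a reducible lattice acting regularly on the vertices of \<open>T\<^sub>m \<times> T\<^sub>n\<close> whose local actions
  on \<open>T\<^sub>m\<close> and \<open>T\<^sub>n\<close> are the permutation groups \<open>P\<close> on \<open>A\<close> and \<open>Q\<close> on \<open>B\<close>.
\<close>

definition regular_reducible_lattice ::
  "nat \<Rightarrow> nat \<Rightarrow> (nat \<Rightarrow> nat) monoid \<Rightarrow> nat set \<Rightarrow> (nat \<Rightarrow> nat) monoid \<Rightarrow> nat set \<Rightarrow>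
     ((nat list \<Rightarrow> nat list) \<times> (nat list \<Rightarrow> nat list)) set \<Rightarrow> bool" where
  "regular_reducible_lattice m n P A Q B \<Gamma> \<longleftrightarrow>
     is_lattice (T m) (T n) \<Gamma> \<and>
     is_reducible (T m) (T n) \<Gamma> \<and>
     acts_regularly (T m) (T n) \<Gamma> \<and>
     has_local_action (subgrp (T m) (T n) \<Gamma>) fst (T m) P A \<and>
     has_local_action (subgrp (T m) (T n) \<Gamma>) snd (T n) Q B"


section \<open>Sanity checks\<close>

lemma pverts_T: "pverts (T n) = {w. set w \<subseteq> {..<n} \<and> distinct_adj w}"
  by (simp add: T_def Let_def)

lemma parcs_T_iff:
  "(u, v) \<in> parcs (T n) \<longleftrightarrow>
     (u \<in> pverts (T n) \<and> v \<in> pverts (T n) \<and> ((\<exists>i. v = i # u) \<or> (\<exists>i. u = i # v)))"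
  by (auto simp: T_def Let_def dest: distinct_adj_ConsD)

lemma pair_bidirected_digraph_T: "pair_bidirected_digraph (T n)"
proof
  show "symmetric (with_proj (T n))"
    by (auto simp: symmetric_def sym_def parcs_T_iff)
qed (auto simp: parcs_T_iff)

lemma connected_T: "connected (with_proj (T n))"
proof -
  interpret pair_bidirected_digraph "T n" by (rule pair_bidirected_digraph_T)
  have sym: "symmetric (with_proj (T n))" by (rule pair_sym_arcs)
  have root: "reachable (with_proj (T n)) w []" if "w \<in> pverts (T n)" for w
    using that
  proof (induction w)
    case Nil
    then show ?case by (intro reachable_refl) simp
  next
    case (Cons i w)
    then have w: "w \<in> pverts (T n)" by (auto simp: pverts_T dest: distinct_adj_ConsD)
    then have "(i # w, w) \<in> parcs (T n)" using Cons.prems by (simp add: parcs_T_iff)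
    with Cons.IH[OF w] show ?case
      by (intro adj_reachable_trans[of "i # w" w]) auto
  qed
  have "reachable (with_proj (T n)) u v" if "u \<in> pverts (T n)" "v \<in> pverts (T n)" for u v
    using root[OF that(1)] symmetric_reachable[OF sym root[OF that(2)]] by (rule reachable_trans)
  moreover have "[] \<in> pverts (T n)" by (simp add: pverts_T)
  ultimately show ?thesis
    using reachable_mk_symmetric_eq sym
    by (auto simp: connected_def strongly_connected_def)
qed

lemma out_arcs_T:
  assumes "v \<in> pverts (T n)"
  shows "finite (out_arcs (with_proj (T n)) v) \<and> out_degree (with_proj (T n)) v = n"
proof -
  have inj: "inj_on (\<lambda>i. (v, i # v)) A" for A by (auto simp: inj_on_def)
  show ?thesis
  proof (cases v)
    case Nil
    have "out_arcs (with_proj (T n)) v = (\<lambda>i. (v, i # v)) ` {..<n}"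
      using assms Nil by (auto simp: out_arcs_def parcs_T_iff pverts_T)
    then show ?thesis
      by (simp add: out_degree_def card_image[OF inj])
  next
    case (Cons j w)
    have eq: "out_arcs (with_proj (T n)) v = insert (v, w) ((\<lambda>i. (v, i # v)) ` ({..<n} - {j}))"
      using assms Cons
      by (auto simp: out_arcs_def parcs_T_iff pverts_T dest: distinct_adj_ConsD)
    have "(v, w) \<notin> (\<lambda>i. (v, i # v)) ` ({..<n} - {j})" using Cons by auto
    moreover have "j < n" using assms Cons by (auto simp: pverts_T)
    ultimately show ?thesis
      by (simp add: out_degree_def eq card_image[OF inj] card_Diff_singleton)
  qed
qed

lemma length_cycle_T:
  assumes "pre_digraph.cycle (with_proj (T n)) p"
  shows "length p \<le> 2"
proof (rule ccontr)
  interpret pair_bidirected_digraph "T n" by (rule pair_bidirected_digraph_T)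
  assume len: "\<not> length p \<le> 2"
  define m where "m = length p"
  from assms obtain u where walk: "awalk u p u" and dist: "distinct (tl (pawalk_verts u p))"
    by (auto simp: cycle_def)
  define x where "x = (\<lambda>i. pawalk_verts u p ! i)"
  have "x 0 = hd (pawalk_verts u p)" "x m = last (pawalk_verts u p)"
    using length_awalk_verts[of u p]
    by (auto simp: x_def m_def hd_conv_nth last_conv_nth simp flip: length_greater_0_conv)
  then have x0: "x 0 = x m" using walk by (metis awhd_if_cas awlast_if_cas awalk_def)
  have arc: "(x i, x (Suc i)) \<in> parcs (T n)" if "i < m" for i
  proof -
    have "fst (p ! i) = x i \<and> snd (p ! i) = x (Suc i)"
      if "i < length p" "pcas v p w" "x = (\<lambda>i. pawalk_verts v p ! i)" for v w x and p :: "(nat list \<times> nat list) list" and i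
      using that
    proof (induction p arbitrary: v i x)
      case (Cons e p)
      show ?case
      proof (cases i)
        case 0
        then show ?thesis using Cons.prems by (cases p) auto
      next
        case (Suc k)
        then show ?thesis using Cons.prems Cons.IH[of k "snd e"] by auto
      qed
    qed simp
    then have "p ! i = (x i, x (Suc i))"
      using that walk unfolding awalk_def m_def x_def by (metis prod.collapse)
    moreover have "p ! i \<in> parcs (T n)" using that walk by (auto simp: m_def awalk_def)
    ultimately show ?thesis by simp
  qed
  have inj: "i = j" if "x i = x j" "i \<in> {1..m}" "j \<in> {1..m}" for i j
  proof -
    have "i - 1 = j - 1"
      using that dist length_awalk_verts[of u p]
        nth_eq_iff_index_eq[of "tl (pawalk_verts u p)" "i - 1" "j - 1"]
      by (auto simp: x_def m_def nth_tl)
    then show ?thesis using that by auto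
  qed
  have "Max ((\<lambda>j. length (x j)) ` {1..m}) \<in> (\<lambda>j. length (x j)) ` {1..m}"
    using len by (intro Max_in) (auto simp: m_def)
  then obtain k where k: "k \<in> {1..m}"
    and k_max: "length (x k) = Max ((\<lambda>j. length (x j)) ` {1..m})"
    by auto
  have max: "length (x j) \<le> length (x k)" if "j \<in> {1..m}" for j
    using that by (simp add: k_max)
  define a where "a = (if k = 1 then m else k - 1)"
  define b where "b = (if k = m then 1 else k + 1)"
  have ab: "a \<in> {1..m}" "b \<in> {1..m}" "a \<noteq> b"
    using k len by (auto simp: a_def b_def m_def)
  have "(x a, x k) \<in> parcs (T n)"
    using arc[of "k - 1"] k x0 by (auto simp: a_def)
  moreover have "(x k, x b) \<in> parcs (T n)"
  proof (cases "k = m")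
    case True
    have "0 < m" using len unfolding m_def by linarith
    from arc[OF this] show ?thesis using True x0 by (simp add: b_def)
  next
    case False
    then show ?thesis using arc[of k] k by (simp add: b_def)
  qed
  moreover have down: "v = tl w" if "(v, w) \<in> parcs (T n) \<or> (w, v) \<in> parcs (T n)"
      "length v \<le> length w" for v w
    using that by (auto simp: parcs_T_iff)
  ultimately have "x a = x b"
    using down[of "x a" "x k"] down[of "x b" "x k"] max[OF ab(1)] max[OF ab(2)] by simp
  with inj[of a b] ab show False by blast
qed

theorem is_regular_tree_T: "is_regular_tree n (T n)"
  unfolding is_regular_tree_def
  using pair_bidirected_digraph_T connected_T length_cycle_T out_arcs_T by blast

theorem group_graph_Aut:
  assumes "pair_wf_digraph S"
  shows "group (graph_Aut S)"
proof -
  interpret B: group "BijGroup (pverts S)" by (rule group_BijGroup)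
  let ?A = "carrier (graph_Aut S)"
  have "subgroup ?A (BijGroup (pverts S))"
  proof (rule B.subgroupI)
    show "?A \<subseteq> carrier (BijGroup (pverts S))"
      by (auto simp: graph_Aut_def BijGroup_def)
    have "\<one>\<^bsub>BijGroup (pverts S)\<^esub> \<in> ?A"
      by (simp add: graph_Aut_def BijGroup_def id_Bij)
    then show "?A \<noteq> {}" by blast
  next
    fix f assume "f \<in> ?A"
    then have f: "f \<in> Bij (pverts S)"
      and adj: "\<And>u v. u \<in> pverts S \<Longrightarrow> v \<in> pverts S \<Longrightarrow> (f u, f v) \<in> parcs S \<longleftrightarrow> (u, v) \<in> parcs S"
      by (auto simp: graph_Aut_def)
    have inv: "inv\<^bsub>BijGroup (pverts S)\<^esub> f = (\<lambda>x\<in>pverts S. inv_into (pverts S) f x)"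
      using f by (rule inv_BijGroup)
    have im: "f ` pverts S = pverts S"
      using f by (simp add: Bij_def bij_betw_def)
    have inv_in: "inv_into (pverts S) f u \<in> pverts S"
      and f_inv: "f (inv_into (pverts S) f u) = u" if "u \<in> pverts S" for u
      using that im by (auto intro: inv_into_into f_inv_into_f)
    have "(inv_into (pverts S) f u, inv_into (pverts S) f v) \<in> parcs S \<longleftrightarrow> (u, v) \<in> parcs S"
      if "u \<in> pverts S" "v \<in> pverts S" for u v
      using adj[OF inv_in inv_in, OF that] f_inv that by simp
    then show "inv\<^bsub>BijGroup (pverts S)\<^esub> f \<in> ?A"
      using restrict_inv_into_Bij[OF f] by (simp add: inv graph_Aut_def)
  next
    fix f g assume "f \<in> ?A" "g \<in> ?A"
    then show "f \<otimes>\<^bsub>BijGroup (pverts S)\<^esub> g \<in> ?A"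
      using Bij_imp_funcset[of g "pverts S"]
      by (auto simp: graph_Aut_def BijGroup_def compose_Bij compose_eq Pi_iff)
  qed
  then show ?thesis
    using B.subgroup_imp_group by (simp add: graph_Aut_def)
qed

end

theory Submission
  imports Defs "HOL-Computational_Algebra.Primes"
begin

text \<open>
  Let \<open>F\<close> be a finite group of permutations of a set \<open>V\<close> that is generated by a regular subgroup \<open>L\<close>
  and an involution \<open>\<tau>\<close>. Then \<open>F\<close> acts on the coset graph \<open>X\<close> with vertex set \<open>F / L\<close>, in which \<open>fL\<close> is
  adjacent to the cosets \<open>fl\<tau>L\<close>, and on a graph \<open>Y\<close> with vertex set \<open>V\<close> (complete, or complete
  bipartite in the case of \<open>T\<^sub>2\<^sub>4\<close>), and since \<open>F = F\<^sub>v L\<close> with \<open>F\<^sub>v \<inter> L = 1\<close>, it acts regularly on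
  the pairs of vertices of \<open>X\<close> and \<open>Y\<close>. The lifts of these pairs of actions to the universal covers
  of \<open>X\<close> and \<open>Y\<close> form a lattice that acts regularly on vertices; it is reducible because it contains
  the product of the two groups of deck transformations, with quotient \<open>F\<close>. Its local actions are
  those of \<open>L\<close> on \<open>L / (L \<inter> \<tau>L\<tau>)\<close> and of the point stabilizer \<open>F\<^sub>v\<close> on the neighbours of \<open>v\<close>.
  In each case \<open>F\<close> is shown to be symmetric or alternating by exhibiting a word in the generators
  a power of which is a 3-cycle.
\<close>

section \<open>Coverings of graphs by regular trees\<close>

text \<open>The groups L are vertex stabilizers of arc-transitive groups of tree automorphisms:
  Sym(4) and Sym(4) x C2 in degree 3, AGL(1,5) and its products with C2 and C4 in degree 5, and a
  maximal parabolic subgroup of G2(3), of order 11664, in degree 4. As L is regular, V is L itself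
  with left translations, so n is |L| - 1 for the complete graph and |L| / 2 for the bipartite one.
  With B = L \<inter> \<tau>L\<tau>, conjugation by \<tau> is an automorphism \<alpha> of B and
  \<tau>(bv) = \<alpha>(b)\<tau>(v); hence \<tau> is given by \<alpha> and its values at
  representatives of the cosets Bv. The normal forms of the points show these cosets as blocks, and
  the values, free up to \<tau>\<tau> = id, are chosen so that F is large and has the right parity.
  One 3-cycle suffices because words carry its first two points to v0 and g v0 for generators g,
  which links all points of V or of one half; no primitivity argument enters. With 11664 points,
  pointwise checks are too expensive: the identities there are polynomial identities over the field
  of three elements, and the cycles of the word are certified from one point each.\<close>

definition nbrs :: "nat \<Rightarrow> nat list \<Rightarrow> nat list set" where
  "nbrs n v = {w. (v, w) \<in> parcs (T n)}"

text \<open>Multiplication by the generator \<open>j\<close> in the free product of groups of order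
  2, cancellation included. It labels the edges at every vertex by \<open>{..<n}\<close>.\<close>

definition nbr :: "nat list \<Rightarrow> nat \<Rightarrow> nat list" where
  "nbr v j = (if v \<noteq> [] \<and> hd v = j then tl v else j # v)"

lemma parcs_in_pverts:
  "(u, v) \<in> parcs (T n) \<Longrightarrow> u \<in> pverts (T n)" "(u, v) \<in> parcs (T n) \<Longrightarrow> v \<in> pverts (T n)"
  by (auto simp: parcs_T_iff)

lemma nbrs_in_pverts: "w \<in> nbrs n v \<Longrightarrow> w \<in> pverts (T n)"
  by (auto simp: nbrs_def parcs_T_iff)

lemma nbrs_sym: "w \<in> nbrs n v \<longleftrightarrow> v \<in> nbrs n w"
  by (auto simp: nbrs_def parcs_T_iff)

lemma Nil_in_pverts [simp]: "[] \<in> pverts (T n)"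
  by (simp add: pverts_T)

lemma Cons_in_pvertsD: "i # w \<in> pverts (T n) \<Longrightarrow> w \<in> pverts (T n)"
  by (auto simp: pverts_T dest: distinct_adj_ConsD)

lemma Cons_in_nbrs:
  assumes "i # w \<in> pverts (T n)"
  shows "i # w \<in> nbrs n w" "w \<in> nbrs n (i # w)"
  using assms Cons_in_pvertsD[OF assms] by (auto simp: nbrs_def parcs_T_iff)

lemma bij_betw_nbr:
  assumes "v \<in> pverts (T n)"
  shows "bij_betw (nbr v) {..<n} (nbrs n v)"
proof (cases v)
  case Nil
  then show ?thesis
    by (auto simp: bij_betw_def inj_on_def nbr_def nbrs_def parcs_T_iff pverts_T)
next
  case (Cons i w)
  have "inj_on (nbr v) {..<n}"
    using Cons by (auto simp: inj_on_def nbr_def split: if_splits)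
  moreover have "nbr v ` {..<n} = nbrs n v"
  proof
    show "nbr v ` {..<n} \<subseteq> nbrs n v"
      using assms Cons
      by (auto simp: nbr_def nbrs_def parcs_T_iff pverts_T dest: distinct_adj_ConsD split: if_splits)
    show "nbrs n v \<subseteq> nbr v ` {..<n}"
    proof
      fix z assume z: "z \<in> nbrs n v"
      then have zV: "z \<in> pverts (T n)" by (rule nbrs_in_pverts)
      consider j where "z = j # v" | "z = w"
        using z Cons by (auto simp: nbrs_def parcs_T_iff)
      then show "z \<in> nbr v ` {..<n}"
      proof cases
        case 1
        then have "j < n" "j \<noteq> i" using zV Cons by (auto simp: pverts_T)
        then show ?thesis using 1 Cons by (auto simp: nbr_def image_iff intro!: bexI[of _ j])
      next
        case 2
        have "i < n" using assms Cons by (auto simp: pverts_T)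
        then show ?thesis using 2 Cons by (auto simp: nbr_def image_iff intro!: bexI[of _ i])
      qed
    qed
  qed
  ultimately show ?thesis by (simp add: bij_betw_def)
qed

text \<open>Connectedness of the tree as an induction rule: every vertex is joined to the root
  through its suffixes, so the property travels from \<open>u\<close> to \<open>[]\<close> and from
  there to \<open>v\<close>.\<close>

lemma pverts_connected_induct:
  assumes "u \<in> pverts (T n)" "P u"
    and step: "\<And>v w. v \<in> pverts (T n) \<Longrightarrow> P v \<Longrightarrow> w \<in> nbrs n v \<Longrightarrow> P w"
    and "v \<in> pverts (T n)"
  shows "P v"
proof -
  have Nil: "P []" using assms(1,2)
  proof (induction u)
    case Nil
    then show ?case by simp
  next
    case (Cons i w)
    then show ?case
      using step[of "i # w" w] Cons_in_nbrs[of i w n] Cons_in_pvertsD[of i w n] by blast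
  qed
  from assms(4) show ?thesis
  proof (induction v)
    case (Cons i w)
    then show ?case
      using step[of w "i # w"] Cons_in_nbrs[of i w n] Cons_in_pvertsD[of i w n] by blast
  qed (rule Nil)
qed

text \<open>The base graph is given by a neighbourhood function alone, so that it can live on any
  type, in particular on sets of cosets.\<close>

definition covering :: "nat \<Rightarrow> (nat list \<Rightarrow> 'x) \<Rightarrow> ('x \<Rightarrow> 'x set) \<Rightarrow> bool" where
  "covering n p N \<longleftrightarrow> (\<forall>v\<in>pverts (T n). bij_betw p (nbrs n v) (N (p v)))"

lemma coveringD:
  assumes "covering n p N" "v \<in> pverts (T n)"
  shows "inj_on p (nbrs n v)" "p ` nbrs n v = N (p v)"
  using assms by (auto simp: covering_def bij_betw_def)

lemma bij_betw_prescribed: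
  assumes "finite A" "finite B" "card A = card B" "x \<in> A" "y \<in> B"
  shows "\<exists>g. bij_betw g A B \<and> g x = y"
proof -
  obtain g where g: "bij_betw g A B"
    using assms finite_same_card_bij by blast
  have "g x \<in> B" using g assms by (auto simp: bij_betw_def)
  then have "bij_betw (Transposition.transpose (g x) y) B B"
    using assms permutes_imp_bij permutes_swap_id by metis
  with g have "bij_betw (Transposition.transpose (g x) y \<circ> g) A B" by (rule bij_betw_trans)
  then show ?thesis by (intro exI[of _ "Transposition.transpose (g x) y \<circ> g"]) simp
qed

text \<open>The graph is unfolded from \<open>x0\<close>. Besides the image of a vertex the
  recursion carries a labelling of the neighbours of that image by edge labels. When an edge
  labelled \<open>j\<close> is crossed, the labelling on the far side must send \<open>j\<close>
  back to the point just left; otherwise the star there would not be mapped bijectively.\<close>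

lemma covering_exists:
  fixes N :: "'x \<Rightarrow> 'x set"
  assumes x0: "x0 \<in> V"
    and deg: "\<And>x. x \<in> V \<Longrightarrow> finite (N x) \<and> card (N x) = n \<and> N x \<subseteq> V"
    and sym: "\<And>x y. x \<in> V \<Longrightarrow> y \<in> N x \<Longrightarrow> x \<in> N y"
  shows "\<exists>p. covering n p N \<and> p [] = x0 \<and> p ` pverts (T n) \<subseteq> V"
proof -
  define b where "b x i z = (SOME g. bij_betw g {..<n} (N x) \<and> g i = z)" for x i and z :: 'x
  have b: "bij_betw (b x i z) {..<n} (N x) \<and> b x i z i = z"
    if "x \<in> V" "i < n" "z \<in> N x" for x i z
  proof -
    have "finite (N x)" "card {..<n} = card (N x)" using deg[OF that(1)] by auto
    then have "\<exists>g. bij_betw g {..<n} (N x) \<and> g i = z"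
      using that(2,3) by (intro bij_betw_prescribed) auto
    then show ?thesis unfolding b_def by (rule someI_ex)
  qed
  obtain b0 where b0: "bij_betw b0 {..<n} (N x0)"
    using deg[OF x0] finite_same_card_bij[of "{..<n}" "N x0"] by auto
  define pp where "pp = rec_list (x0, b0)
     (\<lambda>j w (x, c). (c j, b (c j) j x))"
  have pp_Cons: "pp (j # w) = (snd (pp w) j, b (snd (pp w) j) j (fst (pp w)))" for j w
    by (simp add: pp_def split_beta)
  have pp_Nil: "pp [] = (x0, b0)" by (simp add: pp_def)
  \<comment> \<open>The last conjunct says that the label of the edge towards the root leads back to
    the parent; it yields the uniform description of all neighbours in \<open>nbr\<close>
    below.\<close>
  have inv: "fst (pp w) \<in> V \<and> bij_betw (snd (pp w)) {..<n} (N (fst (pp w))) \<and>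
      (\<forall>i u. w = i # u \<longrightarrow> snd (pp w) i = fst (pp u))"
    if "w \<in> pverts (T n)" for w using that
  proof (induction w)
    case Nil
    then show ?case using x0 b0 by (simp add: pp_Nil)
  next
    case (Cons j w)
    have j: "j < n" using Cons.prems by (auto simp: pverts_T)
    have IH: "fst (pp w) \<in> V" "bij_betw (snd (pp w)) {..<n} (N (fst (pp w)))"
      using Cons Cons_in_pvertsD by blast+
    then have *: "snd (pp w) j \<in> N (fst (pp w))" using j by (auto simp: bij_betw_def)
    then have "snd (pp w) j \<in> V" "fst (pp w) \<in> N (snd (pp w) j)"
      using deg[OF IH(1)] sym[OF IH(1)] by auto
    then show ?case using b[of "snd (pp w) j" j "fst (pp w)"] j by (simp add: pp_Cons)
  qed
  have nbr: "fst (pp (nbr w j)) = snd (pp w) j" if "w \<in> pverts (T n)" for w j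
    using inv[OF that] by (cases w) (auto simp: nbr_def pp_Cons)
  have "covering n (fst \<circ> pp) N"
    unfolding covering_def
  proof
    fix v assume v: "v \<in> pverts (T n)"
    have "bij_betw ((fst \<circ> pp) \<circ> nbr v) {..<n} (N ((fst \<circ> pp) v))"
      using inv[OF v] nbr[OF v] by (simp add: bij_betw_def inj_on_def image_def)
    then show "bij_betw (fst \<circ> pp) (nbrs n v) (N ((fst \<circ> pp) v))"
      using bij_betw_comp_iff[OF bij_betw_nbr[OF v]] by blast
  qed
  then show ?thesis using inv by (intro exI[of _ "fst \<circ> pp"]) (auto simp: pp_Nil)
qed

definition compat :: "('x \<Rightarrow> 'x set) \<Rightarrow> 'x set \<Rightarrow> ('x \<Rightarrow> 'x) \<Rightarrow> bool" where
  "compat N V a \<longleftrightarrow> (\<forall>x\<in>V. a x \<in> V \<and> a ` N x \<subseteq> N (a x))"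

text \<open>A lift of \<open>a\<close> for which bijectivity is still open; automorphisms arise in
  \<open>lifts_exists\<close> from two such maps.\<close>

definition morph ::
  "nat \<Rightarrow> (nat list \<Rightarrow> 'x) \<Rightarrow> ('x \<Rightarrow> 'x) \<Rightarrow> (nat list \<Rightarrow> nat list) \<Rightarrow> bool" where
  "morph n p a h \<longleftrightarrow> (\<forall>v\<in>pverts (T n).
     h v \<in> pverts (T n) \<and> p (h v) = a (p v) \<and> h ` nbrs n v \<subseteq> nbrs n (h v))"

lemma morphD:
  assumes "morph n p a h" "v \<in> pverts (T n)"
  shows "h v \<in> pverts (T n)" "p (h v) = a (p v)" "w \<in> nbrs n v \<Longrightarrow> h w \<in> nbrs n (h v)"
  using assms by (auto simp: morph_def)

text \<open>Two lifts that agree at a vertex agree at its neighbours: both images of a neighbour lie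
  in one star and over one point, and \<open>p\<close> is injective on stars.\<close>

lemma morph_unique:
  assumes cov: "covering n p N" and h: "morph n p a h" and k: "morph n p a k"
    and u: "u \<in> pverts (T n)" "h u = k u" and v: "v \<in> pverts (T n)"
  shows "h v = k v"
proof (rule pverts_connected_induct[where P = "\<lambda>v. h v = k v", OF u _ v])
  fix v w assume v: "v \<in> pverts (T n)" "h v = k v" and w: "w \<in> nbrs n v"
  have "h w \<in> nbrs n (h v)" "k w \<in> nbrs n (h v)"
    using morphD(3)[OF h v(1) w] morphD(3)[OF k v(1) w] v(2) by auto
  moreover have "p (h w) = p (k w)"
    using morphD(2)[OF h] morphD(2)[OF k] nbrs_in_pverts[OF w] by simp
  ultimately show "h w = k w"
    using coveringD(1)[OF cov morphD(1)[OF h v(1)]] by (auto dest: inj_onD)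
qed

lemma morph_compose:
  assumes "morph n p a h" "morph n p b k"
  shows "morph n p (a \<circ> b) (h \<circ> k)"
  unfolding morph_def
proof (intro ballI conjI)
  fix v assume v: "v \<in> pverts (T n)"
  note kv = morphD[OF assms(2) v]
  note hv = morphD[OF assms(1) kv(1)]
  show "(h \<circ> k) v \<in> pverts (T n)" "p ((h \<circ> k) v) = (a \<circ> b) (p v)"
    using kv hv by auto
  show "(h \<circ> k) ` nbrs n v \<subseteq> nbrs n ((h \<circ> k) v)" using kv(3) hv(3) by auto
qed

lemma morph_id: "morph n p id id"
  by (auto simp: morph_def)

text \<open>Lifting outward from the root: the image of \<open>i # v\<close> is the only neighbour
  of the image of \<open>v\<close> over \<open>a (p (i # v))\<close>. Each vertex is reached by a
  single path without backtracking, so no consistency condition arises.\<close>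

lemma morph_exists_Nil:
  assumes cov: "covering n p N" and pV: "p ` pverts (T n) \<subseteq> V" and a: "compat N V a"
    and w: "w \<in> pverts (T n)" "p w = a (p [])"
  shows "\<exists>h. morph n p a h \<and> h [] = w"
proof -
  define h where "h = rec_list w (\<lambda>i v z. THE y. y \<in> nbrs n z \<and> p y = a (p (i # v)))"
  have h_Cons: "h (i # v) = (THE y. y \<in> nbrs n (h v) \<and> p y = a (p (i # v)))" for i v
    by (simp add: h_def)
  have *: "h (i # v) \<in> nbrs n (h v) \<and> p (h (i # v)) = a (p (i # v))"
    if iv: "i # v \<in> pverts (T n)" and hv: "h v \<in> pverts (T n)" "p (h v) = a (p v)" for i v
  proof -
    have v: "v \<in> pverts (T n)" using iv by (rule Cons_in_pvertsD)
    have "p (i # v) \<in> N (p v)"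
      using coveringD(2)[OF cov v] Cons_in_nbrs(1)[OF iv] by auto
    then have "a (p (i # v)) \<in> N (p (h v))"
      using a pV v hv(2) by (auto simp: compat_def)
    then obtain y where "y \<in> nbrs n (h v)" "p y = a (p (i # v))"
      using coveringD(2)[OF cov hv(1)] by (metis imageE)
    then have "\<exists>!y. y \<in> nbrs n (h v) \<and> p y = a (p (i # v))"
      using coveringD(1)[OF cov hv(1)] by (metis inj_onD)
    from theI'[OF this] show ?thesis by (simp add: h_Cons)
  qed
  have inv: "h v \<in> pverts (T n) \<and> p (h v) = a (p v)" if "v \<in> pverts (T n)" for v
    using that
  proof (induction v)
    case Nil
    then show ?case using w by (simp add: h_def)
  next
    case (Cons i v)
    then show ?case
      using *[OF Cons.prems] Cons_in_pvertsD[OF Cons.prems] nbrs_in_pverts by blast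
  qed
  have step: "h (i # v) \<in> nbrs n (h v)" if "i # v \<in> pverts (T n)" for i v
    using *[OF that] inv[OF Cons_in_pvertsD[OF that]] by blast
  have "morph n p a h"
    unfolding morph_def
  proof (intro ballI conjI)
    fix v assume v: "v \<in> pverts (T n)"
    show "h v \<in> pverts (T n)" "p (h v) = a (p v)" using inv[OF v] by auto
    show "h ` nbrs n v \<subseteq> nbrs n (h v)"
    proof
      fix z assume "z \<in> h ` nbrs n v"
      then obtain u where u: "u \<in> nbrs n v" "z = h u" by auto
      then have uV: "u \<in> pverts (T n)" by (simp add: nbrs_in_pverts)
      have "(\<exists>i. u = i # v) \<or> (\<exists>i. v = i # u)" using u(1) by (auto simp: nbrs_def parcs_T_iff)
      then show "z \<in> nbrs n (h v)"
        using step uV v u(2) nbrs_sym by blast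
    qed
  qed
  then show ?thesis by (intro exI[of _ h]) (simp add: h_def)
qed

text \<open>A base vertex \<open>i # v\<close> is reduced to its parent. The parent has to go to the
  neighbour \<open>z\<close> of \<open>w\<close> over \<open>a (p v)\<close>, and then injectivity
  of \<open>p\<close> on the star of \<open>z\<close> leaves only \<open>w\<close> as the image of
  \<open>i # v\<close>.\<close>

lemma morph_exists:
  assumes cov: "covering n p N" and pV: "p ` pverts (T n) \<subseteq> V" and a: "compat N V a"
    and "v \<in> pverts (T n)" "w \<in> pverts (T n)" "p w = a (p v)"
  shows "\<exists>h. morph n p a h \<and> h v = w"
  using assms(4-)
proof (induction v arbitrary: w)
  case Nil
  then show ?case using morph_exists_Nil[OF cov pV a] by blast
next
  case (Cons i v)
  note iv = Cons.prems(1)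
  have v: "v \<in> pverts (T n)" using iv by (rule Cons_in_pvertsD)
  have "p v \<in> N (p (i # v))"
    using coveringD(2)[OF cov iv] Cons_in_nbrs(2)[OF iv] by auto
  then have "a (p v) \<in> N (p w)"
    using a pV iv Cons.prems(3) by (auto simp: compat_def)
  then obtain z where z: "z \<in> nbrs n w" "p z = a (p v)"
    using coveringD(2)[OF cov Cons.prems(2)] by (metis imageE)
  then obtain h where h: "morph n p a h" "h v = z"
    using Cons.IH[OF v nbrs_in_pverts] by blast
  have "h (i # v) \<in> nbrs n z" "w \<in> nbrs n z"
    using morphD(3)[OF h(1) v Cons_in_nbrs(1)[OF iv]] h(2) z(1) nbrs_sym by auto
  moreover have "p (h (i # v)) = p w"
    using morphD(2)[OF h(1) iv] Cons.prems(3) by simp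
  ultimately have "h (i # v) = w"
    using coveringD(1)[OF cov nbrs_in_pverts[OF z(1)]] by (auto dest: inj_onD)
  then show ?case using h by blast
qed

section \<open>Lifts as automorphisms of the tree\<close>

definition lifts ::
  "nat \<Rightarrow> (nat list \<Rightarrow> 'x) \<Rightarrow> ('x \<Rightarrow> 'x) \<Rightarrow> (nat list \<Rightarrow> nat list) \<Rightarrow> bool" where
  "lifts n p a h \<longleftrightarrow> h \<in> carrier (graph_Aut (T n)) \<and> (\<forall>v\<in>pverts (T n). p (h v) = a (p v))"

lemma graph_AutD:
  assumes "h \<in> carrier (graph_Aut (T n))"
  shows "h \<in> Bij (pverts (T n))" "h \<in> extensional (pverts (T n))"
    "bij_betw h (pverts (T n)) (pverts (T n))"
    "v \<in> pverts (T n) \<Longrightarrow> h v \<in> pverts (T n)"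
    "v \<in> pverts (T n) \<Longrightarrow> w \<in> pverts (T n) \<Longrightarrow> h w \<in> nbrs n (h v) \<longleftrightarrow> w \<in> nbrs n v"
  using assms by (auto simp: graph_Aut_def Bij_def nbrs_def bij_betw_def)

lemma lifts_imp_morph:
  assumes "lifts n p a h"
  shows "morph n p a h"
  using assms graph_AutD(4,5)[of h n] nbrs_in_pverts
  by (fastforce simp: lifts_def morph_def)

lemma lifts_unique:
  assumes cov: "covering n p N" and h: "lifts n p a h" and k: "lifts n p a k"
    and u: "u \<in> pverts (T n)" "h u = k u"
  shows "h = k"
proof (rule extensionalityI)
  show "h \<in> extensional (pverts (T n))" "k \<in> extensional (pverts (T n))"
    using h k graph_AutD(2) by (auto simp: lifts_def)
  show "h v = k v" if "v \<in> pverts (T n)" for v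
    using morph_unique[OF cov lifts_imp_morph[OF h] lifts_imp_morph[OF k] u that] .
qed

text \<open>A lift of \<open>a\<close> taking \<open>v\<close> to \<open>w\<close> and a lift of its
  inverse \<open>b\<close> taking \<open>w\<close> to \<open>v\<close> compose to lifts of the
  identity with a fixed vertex. By uniqueness these compositions are the identity.\<close>

lemma lifts_exists:
  assumes cov: "covering n p N" and pV: "p ` pverts (T n) \<subseteq> V"
    and a: "compat N V a" and b: "compat N V b" and ab: "a \<circ> b = id" "b \<circ> a = id"
    and vw: "v \<in> pverts (T n)" "w \<in> pverts (T n)" "p w = a (p v)"
  shows "\<exists>h. lifts n p a h \<and> h v = w"
proof -
  obtain h where h: "morph n p a h" "h v = w"
    using morph_exists[OF cov pV a vw] by blast
  have "p v = b (p w)" using ab(2) vw(3) by (metis comp_apply id_apply)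
  then obtain k where k: "morph n p b k" "k w = v"
    using morph_exists[OF cov pV b vw(2,1)] by blast
  have hk: "h (k u) = u" if "u \<in> pverts (T n)" for u
    using morph_unique[OF cov _ morph_id vw(2) _ that, of "h \<circ> k"]
      morph_compose[OF h(1) k(1)] h(2) k(2) ab(1) by simp
  have kh: "k (h u) = u" if "u \<in> pverts (T n)" for u
    using morph_unique[OF cov _ morph_id vw(1) _ that, of "k \<circ> h"]
      morph_compose[OF k(1) h(1)] h(2) k(2) ab(2) by simp
  \<comment> \<open>Elements of \<open>BijGroup\<close> are extensional, so the lift is cut down to
    the vertex set.\<close>
  define g where "g = restrict h (pverts (T n))"
  have "bij_betw h (pverts (T n)) (pverts (T n))"
    by (rule bij_betwI[where g = k]) (use morphD(1)[OF h(1)] morphD(1)[OF k(1)] hk kh in auto)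
  then have "g \<in> Bij (pverts (T n))" by (auto simp: g_def Bij_def bij_betw_def inj_on_def)
  moreover have "(h u, h u') \<in> parcs (T n) \<longleftrightarrow> (u, u') \<in> parcs (T n)"
    if u: "u \<in> pverts (T n)" "u' \<in> pverts (T n)" for u u'
    using morphD(3)[OF h(1) u(1), of u'] morphD(3)[OF k(1) morphD(1)[OF h(1) u(1)], of "h u'"]
      kh[OF u(1)] kh[OF u(2)] by (auto simp: nbrs_def)
  ultimately have "g \<in> carrier (graph_Aut (T n))"
    by (simp add: graph_Aut_def g_def)
  then have "lifts n p a g" using morphD(2)[OF h(1)] by (auto simp: lifts_def g_def)
  then show ?thesis using h(2) vw(1) by (intro exI[of _ g]) (simp add: g_def)
qed

lemma group_graph_Aut_T: "group (graph_Aut (T n))"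
proof -
  interpret pair_bidirected_digraph "T n" by (rule pair_bidirected_digraph_T)
  show ?thesis by (rule group_graph_Aut) unfold_locales
qed

lemma mult_graph_Aut:
  assumes "h \<in> carrier (graph_Aut (T n))" "k \<in> carrier (graph_Aut (T n))"
  shows "h \<otimes>\<^bsub>graph_Aut (T n)\<^esub> k = compose (pverts (T n)) h k"
  using graph_AutD(1)[OF assms(1)] graph_AutD(1)[OF assms(2)]
  by (simp add: graph_Aut_def BijGroup_def)

lemma mult_graph_Aut_apply:
  assumes "h \<in> carrier (graph_Aut (T n))" "k \<in> carrier (graph_Aut (T n))" "v \<in> pverts (T n)"
  shows "(h \<otimes>\<^bsub>graph_Aut (T n)\<^esub> k) v = h (k v)"
  using assms by (simp add: mult_graph_Aut compose_eq)

lemma one_graph_Aut_apply: "v \<in> pverts (T n) \<Longrightarrow> \<one>\<^bsub>graph_Aut (T n)\<^esub> v = v"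
  by (simp add: graph_Aut_def BijGroup_def)

lemma inv_graph_Aut_apply:
  assumes "h \<in> carrier (graph_Aut (T n))" "v \<in> pverts (T n)"
  shows "h ((inv\<^bsub>graph_Aut (T n)\<^esub> h) v) = v" "(inv\<^bsub>graph_Aut (T n)\<^esub> h) (h v) = v"
  using mult_graph_Aut_apply[OF assms(1) group.inv_closed[OF group_graph_Aut_T assms(1)] assms(2)]
    mult_graph_Aut_apply[OF group.inv_closed[OF group_graph_Aut_T assms(1)] assms(1) assms(2)]
    one_graph_Aut_apply[OF assms(2)] group.r_inv[OF group_graph_Aut_T assms(1)]
    group.l_inv[OF group_graph_Aut_T assms(1)] by simp_all

lemma lifts_one: "lifts n p id \<one>\<^bsub>graph_Aut (T n)\<^esub>"
  by (simp add: lifts_def one_graph_Aut_apply monoid.one_closed[OF group.is_monoid[OF group_graph_Aut_T]])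

lemma lifts_mult:
  assumes "lifts n p a h" "lifts n p b k"
  shows "lifts n p (a \<circ> b) (h \<otimes>\<^bsub>graph_Aut (T n)\<^esub> k)"
  using assms mult_graph_Aut_apply[of h n k] graph_AutD(4)[of k n]
    monoid.m_closed[OF group.is_monoid[OF group_graph_Aut_T[of n]]] by (auto simp: lifts_def)

lemma lifts_inv:
  assumes "lifts n p a h" "b \<circ> a = id"
  shows "lifts n p b (inv\<^bsub>graph_Aut (T n)\<^esub> h)"
  unfolding lifts_def
proof (intro conjI ballI)
  have h: "h \<in> carrier (graph_Aut (T n))" using assms by (simp add: lifts_def)
  then show i: "inv\<^bsub>graph_Aut (T n)\<^esub> h \<in> carrier (graph_Aut (T n))"
    by (rule group.inv_closed[OF group_graph_Aut_T])
  fix v assume v: "v \<in> pverts (T n)"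
  have "p v = a (p ((inv\<^bsub>graph_Aut (T n)\<^esub> h) v))"
    using inv_graph_Aut_apply(1)[OF h v] assms(1) graph_AutD(4)[OF i v]
    by (metis lifts_def)
  then show "p ((inv\<^bsub>graph_Aut (T n)\<^esub> h) v) = b (p v)"
    using assms(2) by (metis comp_apply id_apply)
qed

section \<open>Lattices from pairs of coverings\<close>

text \<open>\<open>r\<close> takes finitely many values and each of its fibres lies in one orbit, so
  there are at most as many orbits as values. It is applied with \<open>r\<close> the image of a
  cell in the base graph.\<close>

lemma finite_orbits:
  assumes "group G"
    and closed: "\<And>g x. g \<in> carrier G \<Longrightarrow> x \<in> E \<Longrightarrow> \<phi> g x \<in> E"
    and mult: "\<And>g h x. g \<in> carrier G \<Longrightarrow> h \<in> carrier G \<Longrightarrow> x \<in> E \<Longrightarrow>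
                \<phi> (g \<otimes>\<^bsub>G\<^esub> h) x = \<phi> g (\<phi> h x)"
    and one: "\<And>x. x \<in> E \<Longrightarrow> \<phi> \<one>\<^bsub>G\<^esub> x = x"
    and fin: "finite (r ` E)"
    and r: "\<And>x y. x \<in> E \<Longrightarrow> y \<in> E \<Longrightarrow> r x = r y \<Longrightarrow> \<exists>g\<in>carrier G. \<phi> g x = y"
  shows "finite (orbits G E \<phi>)"
proof -
  interpret group G by fact
  have orb: "orbit G \<phi> y \<subseteq> orbit G \<phi> x" if "x \<in> E" "g \<in> carrier G" "\<phi> g x = y" for x y g
  proof
    fix z assume "z \<in> orbit G \<phi> y"
    then obtain h where "h \<in> carrier G" "z = \<phi> h y" by (auto simp: orbit_def)
    then have "z = \<phi> (h \<otimes>\<^bsub>G\<^esub> g) x" "h \<otimes>\<^bsub>G\<^esub> g \<in> carrier G" using that mult by auto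
    then show "z \<in> orbit G \<phi> x" by (auto simp: orbit_def)
  qed
  have orb_eq: "orbit G \<phi> x = orbit G \<phi> y" if "x \<in> E" "y \<in> E" "r x = r y" for x y
  proof
    show "orbit G \<phi> x \<subseteq> orbit G \<phi> y"
      using r[OF that(2,1) that(3)[symmetric]] orb[OF that(2)] by blast
    show "orbit G \<phi> y \<subseteq> orbit G \<phi> x" using r[OF that] orb[OF that(1)] by blast
  qed
  then have "orbit G \<phi> x = orbit G \<phi> (SOME y. y \<in> E \<and> r y = r x)" if "x \<in> E" for x
  proof -
    have "\<exists>y. y \<in> E \<and> r y = r x" using that by blast
    from someI_ex[OF this] show ?thesis by (intro orb_eq[OF that]) auto
  qed
  then have "orbits G E \<phi> \<subseteq> (\<lambda>k. orbit G \<phi> (SOME y. y \<in> E \<and> r y = k)) ` r ` E"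
    by (auto simp: orbits_def)
  then show ?thesis using fin finite_subset by blast
qed

section \<open>Cells of the tree\<close>

lemma cells_cases:
  assumes "c \<in> cells (T n)" "u \<in> c" "w \<in> c"
  shows "u \<in> pverts (T n)" "w = u \<or> w \<in> nbrs n u"
  using assms by (auto simp: cells_def nbrs_def parcs_T_iff)

lemma cells_finite: "c \<in> cells (T n) \<Longrightarrow> finite c \<and> c \<noteq> {}"
  by (auto simp: cells_def)

lemma cells_image:
  assumes h: "h \<in> carrier (graph_Aut (T n))" and "c \<in> cells (T n)"
  shows "h ` c \<in> cells (T n)"
proof -
  consider v where "c = {v}" "v \<in> pverts (T n)"
    | u v where "c = {u, v}" "(u, v) \<in> parcs (T n)"
    using assms(2) by (auto simp: cells_def)
  then show ?thesis
  proof cases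
    case 1
    then show ?thesis using graph_AutD(4)[OF h] by (auto simp: cells_def)
  next
    case 2
    then have "(h u, h v) \<in> parcs (T n)"
      using graph_AutD(5)[OF h] parcs_in_pverts by (auto simp: nbrs_def)
    then show ?thesis using 2 by (force simp: cells_def)
  qed
qed

lemma mult_graph_Aut_image:
  assumes "h \<in> carrier (graph_Aut (T n))" "k \<in> carrier (graph_Aut (T n))" "c \<in> cells (T n)"
  shows "(h \<otimes>\<^bsub>graph_Aut (T n)\<^esub> k) ` c = h ` k ` c"
  unfolding image_image
  by (rule image_cong[OF refl]) (use mult_graph_Aut_apply[OF assms(1,2)] cells_cases[OF assms(3)] in blast)

lemma one_graph_Aut_image: "c \<in> cells (T n) \<Longrightarrow> \<one>\<^bsub>graph_Aut (T n)\<^esub> ` c = c"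
  using one_graph_Aut_apply cells_cases(1) by (auto simp: image_iff)

definition deck :: "nat \<Rightarrow> (nat list \<Rightarrow> 'x) \<Rightarrow> (nat list \<Rightarrow> nat list) set" where
  "deck n p = {h. lifts n p id h}"

lemma compat_id: "compat N V id"
  by (simp add: compat_def)

text \<open>The base graph has no loops, so \<open>p\<close> is injective on each cell. Hence a deck
  transformation taking one vertex \<open>u\<close> of \<open>c\<close> to the vertex of
  \<open>d\<close> over \<open>p u\<close> must take the other end point along.\<close>

lemma deck_cells:
  assumes cov: "covering n p N" and irr: "\<And>v. v \<in> pverts (T n) \<Longrightarrow> p v \<notin> N (p v)"
    and c: "c \<in> cells (T n)" and d: "d \<in> cells (T n)" and eq: "p ` c = p ` d"
  shows "\<exists>h\<in>deck n p. h ` c = d"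
proof -
  obtain u where u: "u \<in> c" using cells_finite[OF c] by auto
  then obtain w where w: "w \<in> d" "p w = p u" using eq by (metis imageE imageI)
  note V = cells_cases(1)[OF c u u] cells_cases(1)[OF d w(1) w(1)]
  have N: "p x \<in> N (p v)" if "x \<in> nbrs n v" "v \<in> pverts (T n)" for v x
    using coveringD(2)[OF cov that(2)] that(1) by auto
  have inj: "x = y" if "x \<in> d" "y \<in> d" "p x = p y" for x y
    using cells_cases[OF d that(1,2)] N irr that(3) by metis
  obtain h where h: "lifts n p id h" "h u = w"
    using lifts_exists[OF cov subset_UNIV compat_id compat_id _ _ V] w(2) by auto
  note hm = lifts_imp_morph[OF h(1)]
  have sub: "h x \<in> d" if x: "x \<in> c" for x
  proof (cases "x = u")
    case False
    then have xu: "x \<in> nbrs n u" using cells_cases[OF c u x] by simp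
    obtain y where y: "y \<in> d" "p y = p x" using eq x by (metis imageE imageI)
    have "p x \<noteq> p u" using N[OF xu V(1)] irr[OF V(1)] by auto
    then have "y \<noteq> w" using y(2) w(2) by auto
    then have "y \<in> nbrs n w" using cells_cases[OF d w(1) y(1)] by simp
    moreover have "h x \<in> nbrs n w" using morphD(3)[OF hm V(1) xu] h(2) by simp
    moreover have "p (h x) = p y"
      using morphD(2)[OF hm nbrs_in_pverts[OF xu]] y(2) by simp
    ultimately have "h x = y" using coveringD(1)[OF cov V(2)] by (auto dest: inj_onD)
    then show ?thesis using y by simp
  qed (use h w in simp)
  have "d \<subseteq> h ` c"
  proof
    fix y assume y: "y \<in> d"
    then obtain x where x: "x \<in> c" "p x = p y" using eq by (metis imageE imageI)
    have "p (h x) = p y" using morphD(2)[OF hm] cells_cases(1)[OF c x(1) x(1)] x(2) by simp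
    then show "y \<in> h ` c" using inj[OF sub[OF x(1)] y] x(1) by auto
  qed
  then show ?thesis using sub h(1) by (auto simp: deck_def)
qed

lemma finite_image_cells:
  assumes "finite (p ` pverts (T n))"
  shows "finite ((`) p ` cells (T n))"
proof (rule finite_subset)
  show "(`) p ` cells (T n) \<subseteq> Pow (p ` pverts (T n))"
    using cells_cases(1) by blast
qed (use assms in simp)

text \<open>Conjugation by \<open>F\<close> loses no information because the elements of
  \<open>P\<close> fix everything outside \<open>A\<close>; \<open>Q\<close> is its image.\<close>

lemma perm_isomorphic_conj:
  assumes bij: "bij_betw F A B"
    and P: "monoid.mult P = (\<circ>)" "\<And>l x. l \<in> carrier P \<Longrightarrow> x \<in> A \<Longrightarrow> l x \<in> A"
      "\<And>l x. l \<in> carrier P \<Longrightarrow> x \<notin> A \<Longrightarrow> l x = x"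
    and Q: "monoid.mult Q = (\<circ>)"
      "carrier Q = (\<lambda>l k. if k \<in> B then F (l (inv_into A F k)) else k) ` carrier P"
  shows "perm_isomorphic P A Q B"
proof -
  define \<theta> where "\<theta> = (\<lambda>l k. if k \<in> B then F (l (inv_into A F k)) else k)"
  have FA: "F x \<in> B" "inv_into A F (F x) = x" if "x \<in> A" for x
    using bij that by (auto simp: bij_betw_def)
  have iA: "inv_into A F k \<in> A" if "k \<in> B" for k
    using bij that by (metis bij_betw_def inv_into_into)
  have conj: "F (l x) = \<theta> l (F x)" if "l \<in> carrier P" "x \<in> A" for l x
    using FA[OF that(2)] by (simp add: \<theta>_def)
  have "inj_on \<theta> (carrier P)"
  proof (rule inj_onI, rule ext)
    fix l l' x assume l: "l \<in> carrier P" "l' \<in> carrier P" "\<theta> l = \<theta> l'"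
    show "l x = l' x"
    proof (cases "x \<in> A")
      case True
      then have "F (l x) = F (l' x)" using conj l by simp
      then show ?thesis using FA(2) P(2) l True by metis
    next
      case False
      then show ?thesis using P(3)[OF l(1)] P(3)[OF l(2)] by simp
    qed
  qed
  moreover have "\<theta> ` carrier P = carrier Q" using Q(2) by (simp add: \<theta>_def)
  moreover have "\<theta> (l \<circ> l') = \<theta> l \<circ> \<theta> l'" if "l \<in> carrier P" "l' \<in> carrier P" for l l'
    using FA P(2) iA that by (auto simp: \<theta>_def fun_eq_iff)
  ultimately have "\<theta> \<in> iso P Q"
    by (auto simp: iso_def hom_def bij_betw_def P(1) Q(1))
  then show ?thesis unfolding perm_isomorphic_def using bij conj by blast
qed

lemma out_arcs_T_eq: "out_arcs (with_proj (T n)) v = Pair v ` nbrs n v"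
  by (auto simp: out_arcs_def nbrs_def)

text \<open>The covering identifies the edges at \<open>v\<close> with the neighbours of
  \<open>p v\<close>, and under this identification a lift acts as the map that it lifts.
  \<open>S\<close> is the set of maps lifted by the stabilizer of \<open>v\<close>.\<close>

lemma perm_isomorphic_local_action:
  assumes cov: "covering n p N" and v: "v \<in> pverts (T n)"
    and lift: "\<And>g. g \<in> stabilizer H \<pi> v \<Longrightarrow> \<exists>a\<in>S. lifts n p a (\<pi> g)"
    and S: "\<And>a. a \<in> S \<Longrightarrow> \<exists>g\<in>stabilizer H \<pi> v. lifts n p a (\<pi> g)"
    and f: "bij_betw f (N (p v)) B"
    and Q: "monoid.mult Q = (\<circ>)"
      "carrier Q = (\<lambda>a k. if k \<in> B then f (a (inv_into (N (p v)) f k)) else k) ` S"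
  shows "perm_isomorphic (local_action H \<pi> (T n) v) (out_arcs (with_proj (T n)) v) Q B"
proof -
  let ?A = "out_arcs (with_proj (T n)) v"
  let ?l = "\<lambda>g e. if e \<in> ?A then (\<pi> g (fst e), \<pi> g (snd e)) else e"
  define F where "F e = f (p (snd e))" for e :: "nat list \<times> nat list"
  have "bij_betw snd ?A (nbrs n v)"
    by (auto simp: bij_betw_def inj_on_def out_arcs_T_eq image_image)
  moreover have "bij_betw p (nbrs n v) (N (p v))" using cov v by (auto simp: covering_def)
  ultimately have "bij_betw (f \<circ> (p \<circ> snd)) ?A B"
    using f by (intro bij_betw_trans)
  then have F: "bij_betw F ?A B" by (simp add: F_def[abs_def] comp_def)
  have lA: "?l g x \<in> ?A" if g: "g \<in> stabilizer H \<pi> v" and x: "x \<in> ?A" for g x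
  proof -
    obtain a where a: "lifts n p a (\<pi> g)" using lift[OF g] by blast
    have "\<pi> g v = v" using g by (simp add: stabilizer_def)
    then show ?thesis
      using x morphD(3)[OF lifts_imp_morph[OF a] v] by (auto simp: out_arcs_T_eq)
  qed
  have conj: "(\<lambda>k. if k \<in> B then F (?l g (inv_into ?A F k)) else k) =
      (\<lambda>k. if k \<in> B then f (a (inv_into (N (p v)) f k)) else k)"
    if "lifts n p a (\<pi> g)" for g a
  proof
    fix k
    show "(if k \<in> B then F (?l g (inv_into ?A F k)) else k) =
      (if k \<in> B then f (a (inv_into (N (p v)) f k)) else k)"
    proof (cases "k \<in> B")
      case True
      then have e: "inv_into ?A F k \<in> ?A" "F (inv_into ?A F k) = k"
        using F by (auto simp: bij_betw_def inv_into_into f_inv_into_f)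
      define w where "w = snd (inv_into ?A F k)"
      have w: "w \<in> nbrs n v" using e(1) by (auto simp: out_arcs_T_eq w_def)
      have "p w \<in> N (p v)" "f (p w) = k"
        using coveringD(2)[OF cov v] w e(2) by (auto simp: F_def w_def)
      then have "inv_into (N (p v)) f k = p w" using f by (auto simp: bij_betw_def)
      moreover have "F (?l g (inv_into ?A F k)) = f (a (p w))"
        using e(1) that nbrs_in_pverts[OF w] by (simp add: F_def w_def lifts_def)
      ultimately show ?thesis using True by simp
    qed simp
  qed
  have "carrier Q = (\<lambda>l k. if k \<in> B then F (l (inv_into ?A F k)) else k) ` ?l ` stabilizer H \<pi> v"
    (is "_ = ?R")
  proof
    show "carrier Q \<subseteq> ?R"
    proof
      fix q assume "q \<in> carrier Q"
      then obtain a where a: "a \<in> S"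
        "q = (\<lambda>k. if k \<in> B then f (a (inv_into (N (p v)) f k)) else k)" unfolding Q(2) by blast
      obtain g where g: "g \<in> stabilizer H \<pi> v" "lifts n p a (\<pi> g)" using S[OF a(1)] by blast
      show "q \<in> ?R" unfolding a(2) conj[OF g(2), symmetric]
        by (rule image_eqI[OF _ imageI[OF g(1)]]) (rule refl)
    qed
    show "?R \<subseteq> carrier Q"
    proof
      fix q assume "q \<in> ?R"
      then obtain g where g: "g \<in> stabilizer H \<pi> v"
        "q = (\<lambda>k. if k \<in> B then F (?l g (inv_into ?A F k)) else k)" by blast
      obtain a where a: "a \<in> S" "lifts n p a (\<pi> g)" using lift[OF g(1)] by blast
      show "q \<in> carrier Q" unfolding Q(2) g(2) conj[OF a(2)] using a(1) by blast
    qed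
  qed
  then have Q': "carrier Q = (\<lambda>l k. if k \<in> B then F (l (inv_into ?A F k)) else k) `
      carrier (local_action H \<pi> (T n) v)"
    by (simp only: local_action_def partial_object.simps)
  show ?thesis
  proof (rule perm_isomorphic_conj[OF F _ _ _ Q(1) Q'])
    show "monoid.mult (local_action H \<pi> (T n) v) = (\<circ>)" by (simp add: local_action_def)
    fix l x assume "l \<in> carrier (local_action H \<pi> (T n) v)"
    then obtain g where g: "g \<in> stabilizer H \<pi> v" "l = ?l g"
      by (auto simp only: local_action_def partial_object.simps)
    show "l x \<in> ?A" if "x \<in> ?A" using lA[OF g(1) that] unfolding g(2) .
    show "l x = x" if "x \<notin> ?A" unfolding g(2) using that by (rule if_not_P)
  qed
qed

text \<open>\<open>\<Phi>\<close> stands for the finite group acting regularly on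
  \<open>X \<times> Y\<close>. Its elements are maps of the whole types, and freeness asks for
  \<open>id\<close> itself. This holds for the action on cosets because that action is determined by
  a permutation of V.\<close>

locale covered_pair =
  fixes m n :: nat
    and p :: "nat list \<Rightarrow> 'x" and q :: "nat list \<Rightarrow> 'y"
    and N :: "'x \<Rightarrow> 'x set" and M :: "'y \<Rightarrow> 'y set"
    and X :: "'x set" and Y :: "'y set"
    and \<Phi> :: "(('x \<Rightarrow> 'x) \<times> ('y \<Rightarrow> 'y)) set"
  assumes covp: "covering m p N" and imp: "p ` pverts (T m) = X"
    and covq: "covering n q M" and imq: "q ` pverts (T n) = Y"
    and finite_X: "finite X" and finite_Y: "finite Y" and finite_\<Phi>: "finite \<Phi>"
    and irrefl_N: "\<And>x. x \<in> X \<Longrightarrow> x \<notin> N x" and irrefl_M: "\<And>y. y \<in> Y \<Longrightarrow> y \<notin> M y"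
    and id_\<Phi>: "(id, id) \<in> \<Phi>"
    and comp_\<Phi>: "\<And>a b c d. (a, b) \<in> \<Phi> \<Longrightarrow> (c, d) \<in> \<Phi> \<Longrightarrow> (a \<circ> c, b \<circ> d) \<in> \<Phi>"
    and inv_\<Phi>: "\<And>a b. (a, b) \<in> \<Phi> \<Longrightarrow>
      \<exists>c d. (c, d) \<in> \<Phi> \<and> a \<circ> c = id \<and> c \<circ> a = id \<and> b \<circ> d = id \<and> d \<circ> b = id"
    and compat_\<Phi>: "\<And>a b. (a, b) \<in> \<Phi> \<Longrightarrow> compat N X a \<and> compat M Y b"
    and trans_\<Phi>: "\<And>x x' y y'. x \<in> X \<Longrightarrow> x' \<in> X \<Longrightarrow> y \<in> Y \<Longrightarrow> y' \<in> Y \<Longrightarrow>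
      \<exists>(a, b)\<in>\<Phi>. a x = x' \<and> b y = y'"
    and free_\<Phi>: "\<And>a b x y. (a, b) \<in> \<Phi> \<Longrightarrow> x \<in> X \<Longrightarrow> y \<in> Y \<Longrightarrow> a x = x \<Longrightarrow> b y = y \<Longrightarrow>
      a = id \<and> b = id"
begin

definition \<Gamma> :: "((nat list \<Rightarrow> nat list) \<times> (nat list \<Rightarrow> nat list)) set" where
  "\<Gamma> = {(g, h). \<exists>(a, b)\<in>\<Phi>. lifts m p a g \<and> lifts n q b h}"

lemma \<Gamma>_E:
  assumes "\<gamma> \<in> \<Gamma>"
  obtains a b where "(a, b) \<in> \<Phi>" "lifts m p a (fst \<gamma>)" "lifts n q b (snd \<gamma>)"
  using assms by (auto simp: \<Gamma>_def)

lemma \<Gamma>_carrier: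
  assumes "\<gamma> \<in> \<Gamma>"
  shows "fst \<gamma> \<in> carrier (graph_Aut (T m))" "snd \<gamma> \<in> carrier (graph_Aut (T n))"
  using assms by (auto simp: \<Gamma>_def lifts_def)

abbreviation "A \<equiv> graph_Aut (T m) \<times>\<times> graph_Aut (T n)"
abbreviation "G \<equiv> subgrp (T m) (T n) \<Gamma>"

lemma group_A: "group A"
  by (intro DirProd_group group_graph_Aut_T)

text \<open>Used twice: with all of \<open>\<Phi>\<close> for the lattice, and with the trivial
  subgroup for the product of the two deck groups.\<close>

lemma subgroup_fibre:
  assumes \<Psi>: "\<Psi> \<subseteq> \<Phi>" "(id, id) \<in> \<Psi>"
    and comp: "\<And>a b c d. (a, b) \<in> \<Psi> \<Longrightarrow> (c, d) \<in> \<Psi> \<Longrightarrow> (a \<circ> c, b \<circ> d) \<in> \<Psi>"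
    and inv: "\<And>a b c d. (a, b) \<in> \<Psi> \<Longrightarrow> (c, d) \<in> \<Phi> \<Longrightarrow> c \<circ> a = id \<Longrightarrow> d \<circ> b = id \<Longrightarrow> (c, d) \<in> \<Psi>"
  shows "subgroup {(g, h). \<exists>(a, b)\<in>\<Psi>. lifts m p a g \<and> lifts n q b h} A"
proof (rule group.subgroupI[OF group_A])
  let ?H = "{(g, h). \<exists>(a, b)\<in>\<Psi>. lifts m p a g \<and> lifts n q b h}"
  show "?H \<subseteq> carrier A" by (auto simp: lifts_def)
  have "(\<one>\<^bsub>graph_Aut (T m)\<^esub>, \<one>\<^bsub>graph_Aut (T n)\<^esub>) \<in> ?H"
    by (auto intro!: bexI[OF _ \<Psi>(2)] lifts_one)
  then show "?H \<noteq> {}" by blast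
  fix \<gamma> assume \<gamma>: "\<gamma> \<in> ?H"
  then obtain g h a b where gh: "\<gamma> = (g, h)" "(a, b) \<in> \<Psi>" "lifts m p a g" "lifts n q b h" by blast
  then obtain c d where cd: "(c, d) \<in> \<Phi>" "c \<circ> a = id" "d \<circ> b = id"
    using inv_\<Phi> \<Psi>(1) by blast
  have "inv\<^bsub>A\<^esub> \<gamma> = (inv\<^bsub>graph_Aut (T m)\<^esub> g, inv\<^bsub>graph_Aut (T n)\<^esub> h)"
    using gh by (simp add: lifts_def inv_DirProd group_graph_Aut_T)
  then show "inv\<^bsub>A\<^esub> \<gamma> \<in> ?H"
    using lifts_inv[OF gh(3) cd(2)] lifts_inv[OF gh(4) cd(3)] inv[OF gh(2) cd] by auto
  fix \<gamma>' assume "\<gamma>' \<in> ?H"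
  then obtain g' h' a' b' where gh':
    "\<gamma>' = (g', h')" "(a', b') \<in> \<Psi>" "lifts m p a' g'" "lifts n q b' h'" by blast
  show "\<gamma> \<otimes>\<^bsub>A\<^esub> \<gamma>' \<in> ?H"
    using lifts_mult[OF gh(3) gh'(3)] lifts_mult[OF gh(4) gh'(4)] comp[OF gh(2) gh'(2)]
    by (auto simp: gh(1) gh'(1))
qed

lemma subgroup_\<Gamma>: "subgroup \<Gamma> A"
  unfolding \<Gamma>_def by (rule subgroup_fibre) (use id_\<Phi> comp_\<Phi> in auto)

lemma group_G: "group G"
  using group.subgroup_imp_group[OF group_A subgroup_\<Gamma>] .

lemma p_in_X: "v \<in> pverts (T m) \<Longrightarrow> p v \<in> X" and q_in_Y: "v \<in> pverts (T n) \<Longrightarrow> q v \<in> Y"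
  using imp imq by auto

lemma lift_pair:
  assumes "(a, b) \<in> \<Phi>"
    and "u \<in> pverts (T m)" "u' \<in> pverts (T m)" "p u' = a (p u)"
    and "v \<in> pverts (T n)" "v' \<in> pverts (T n)" "q v' = b (q v)"
  shows "\<exists>\<gamma>\<in>\<Gamma>. lifts m p a (fst \<gamma>) \<and> lifts n q b (snd \<gamma>) \<and> fst \<gamma> u = u' \<and> snd \<gamma> v = v'"
proof -
  obtain c d where cd: "(c, d) \<in> \<Phi>" "a \<circ> c = id" "c \<circ> a = id" "b \<circ> d = id" "d \<circ> b = id"
    using inv_\<Phi>[OF assms(1)] by blast
  note ab = compat_\<Phi>[OF assms(1)] compat_\<Phi>[OF cd(1)]
  obtain g where g: "lifts m p a g" "g u = u'"
    using lifts_exists[OF covp _ _ _ cd(2,3) assms(2-4), of X] ab imp by auto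
  obtain h where h: "lifts n q b h" "h v = v'"
    using lifts_exists[OF covq _ _ _ cd(4,5) assms(5-7), of Y] ab imq by auto
  have "(g, h) \<in> \<Gamma>" using g h assms(1) by (auto simp: \<Gamma>_def)
  then show ?thesis using g h by force
qed

text \<open>Two elements that agree at a pair of vertices lie over elements of \<open>\<Phi>\<close>
  that agree at the image of the pair. These coincide because \<open>\<Phi>\<close> acts freely, and
  then uniqueness of lifts applies in each factor.\<close>

lemma \<Gamma>_inj:
  assumes \<gamma>: "\<gamma> \<in> \<Gamma>" "\<gamma>' \<in> \<Gamma>" and u: "u \<in> pverts (T m)" and v: "v \<in> pverts (T n)"
    and eq: "fst \<gamma> u = fst \<gamma>' u" "snd \<gamma> v = snd \<gamma>' v"
  shows "\<gamma> = \<gamma>'"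
proof -
  obtain a b where ab: "(a, b) \<in> \<Phi>" "lifts m p a (fst \<gamma>)" "lifts n q b (snd \<gamma>)"
    using \<gamma>(1) by (rule \<Gamma>_E)
  obtain a' b' where ab': "(a', b') \<in> \<Phi>" "lifts m p a' (fst \<gamma>')" "lifts n q b' (snd \<gamma>')"
    using \<gamma>(2) by (rule \<Gamma>_E)
  obtain c d where cd: "(c, d) \<in> \<Phi>" "a' \<circ> c = id" "c \<circ> a' = id" "b' \<circ> d = id" "d \<circ> b' = id"
    using inv_\<Phi>[OF ab'(1)] by blast
  have e: "a (p u) = a' (p u)" "b (q v) = b' (q v)"
    using ab ab' eq u v by (metis lifts_def)+
  have "(c \<circ> a) (p u) = p u" "(d \<circ> b) (q v) = q v"
    using e cd(3,5) by (metis comp_apply id_apply)+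
  then have "c \<circ> a = id" "d \<circ> b = id"
    using free_\<Phi>[OF comp_\<Phi>[OF cd(1) ab(1)] p_in_X[OF u] q_in_Y[OF v]] by auto
  then have "a = a'" "b = b'" using cd(2,4) by (metis comp_assoc comp_id id_comp)+
  then have l: "lifts m p a' (fst \<gamma>)" "lifts n q b' (snd \<gamma>)" using ab by auto
  have "fst \<gamma> = fst \<gamma>'" "snd \<gamma> = snd \<gamma>'"
    by (rule lifts_unique[OF covp l(1) ab'(2) u eq(1)], rule lifts_unique[OF covq l(2) ab'(3) v eq(2)])
  then show ?thesis by (simp add: prod_eq_iff)
qed

lemma one_G: "\<one>\<^bsub>G\<^esub> = (\<one>\<^bsub>graph_Aut (T m)\<^esub>, \<one>\<^bsub>graph_Aut (T n)\<^esub>)"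
  by simp

lemma one_in_\<Gamma>: "(\<one>\<^bsub>graph_Aut (T m)\<^esub>, \<one>\<^bsub>graph_Aut (T n)\<^esub>) \<in> \<Gamma>"
  using subgroup.one_closed[OF subgroup_\<Gamma>] by simp

lemma acts_regularly_\<Gamma>: "acts_regularly (T m) (T n) \<Gamma>"
  unfolding acts_regularly_def
proof (intro conjI ballI)
  fix x assume x: "x \<in> pverts (T m) \<times> pverts (T n)"
  have "\<gamma> = \<one>\<^bsub>G\<^esub>" if "\<gamma> \<in> \<Gamma>" "prod_vertex_action (T m) (T n) \<gamma> x = x" for \<gamma>
    unfolding one_G
    by (rule \<Gamma>_inj[OF that(1) one_in_\<Gamma>, of "fst x" "snd x"])
      (use x that(2) one_graph_Aut_apply in \<open>auto simp: prod_vertex_action_def\<close>)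
  moreover have "prod_vertex_action (T m) (T n) \<one>\<^bsub>G\<^esub> x = x"
    using x by (auto simp: prod_vertex_action_def one_graph_Aut_apply)
  moreover have "carrier G = \<Gamma>" "\<one>\<^bsub>G\<^esub> \<in> \<Gamma>" using one_in_\<Gamma> by simp_all
  ultimately show "stabilizer G (prod_vertex_action (T m) (T n)) x = {\<one>\<^bsub>G\<^esub>}"
    unfolding stabilizer_def by blast
next
  fix x y assume x: "x \<in> pverts (T m) \<times> pverts (T n)" and y: "y \<in> pverts (T m) \<times> pverts (T n)"
  obtain u v u' v' where uv: "x = (u, v)" "y = (u', v')" by (cases x, cases y)
  note V = x[unfolded uv mem_Times_iff, simplified] y[unfolded uv mem_Times_iff, simplified]
  obtain a b where ab: "(a, b) \<in> \<Phi>" "a (p u) = p u'" "b (q v) = q v'"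
    using trans_\<Phi>[of "p u" "p u'" "q v" "q v'"] V p_in_X q_in_Y by blast
  obtain \<gamma> where "\<gamma> \<in> \<Gamma>" "fst \<gamma> u = u'" "snd \<gamma> v = v'"
    using lift_pair[OF ab(1), of u u' v v'] V ab by auto
  then show "\<exists>\<gamma>\<in>\<Gamma>. prod_vertex_action (T m) (T n) \<gamma> x = y"
    using V uv by (intro bexI[of _ \<gamma>]) (auto simp: prod_vertex_action_def)
qed

lemma prod_cell_action_closed:
  assumes "\<gamma> \<in> \<Gamma>" "c \<in> cells (T m) \<times> cells (T n)"
  shows "prod_cell_action (T m) (T n) \<gamma> c \<in> cells (T m) \<times> cells (T n)"
  using assms(2) \<Gamma>_carrier[OF assms(1)] cells_image by (auto simp: prod_cell_action_def)

lemma deck_pair: "g \<in> deck m p \<Longrightarrow> h \<in> deck n q \<Longrightarrow> (g, h) \<in> \<Gamma>"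
  using id_\<Phi> by (auto simp: deck_def \<Gamma>_def)

lemma irrefl_cov: "v \<in> pverts (T m) \<Longrightarrow> p v \<notin> N (p v)" "w \<in> pverts (T n) \<Longrightarrow> q w \<notin> M (q w)"
  using irrefl_N irrefl_M p_in_X q_in_Y by auto

text \<open>An element is determined by the images of one vertex in each factor, and an element of
  the stabilizer of a cell keeps these images in the cell; so stabilizers are finite. The orbits are
  finite in number already for the product of the deck groups, which is transitive on the pairs of
  cells over a given pair of base cells.\<close>

lemma is_lattice_\<Gamma>: "is_lattice (T m) (T n) \<Gamma>"
  unfolding is_lattice_def
proof (intro conjI ballI)
  show "subgroup \<Gamma> A" by (rule subgroup_\<Gamma>)
next
  fix c assume c: "c \<in> cells (T m) \<times> cells (T n)"
  then obtain c1 c2 where c12: "c = (c1, c2)" "c1 \<in> cells (T m)" "c2 \<in> cells (T n)" by blast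
  obtain u v where uv: "u \<in> c1" "v \<in> c2" using c12 cells_finite by (metis ex_in_conv)
  let ?S = "stabilizer G (prod_cell_action (T m) (T n)) c"
  have "inj_on (\<lambda>\<gamma>. (fst \<gamma> u, snd \<gamma> v)) ?S"
    using \<Gamma>_inj[OF _ _ cells_cases(1)[OF c12(2) uv(1,1)] cells_cases(1)[OF c12(3) uv(2,2)]]
    by (auto simp: inj_on_def stabilizer_def)
  moreover have "(\<lambda>\<gamma>. (fst \<gamma> u, snd \<gamma> v)) ` ?S \<subseteq> c1 \<times> c2"
    using c c12(1) uv by (auto simp: stabilizer_def prod_cell_action_def)
  moreover have "finite (c1 \<times> c2)" using cells_finite c12 by auto
  ultimately show "finite ?S" using finite_subset inj_on_finite by blast
next
  let ?E = "cells (T m) \<times> cells (T n)"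
  let ?r = "\<lambda>(c, d). (p ` c, q ` d)"
  show "finite (orbits G ?E (prod_cell_action (T m) (T n)))"
  proof (rule finite_orbits[OF group_G])
    show "prod_cell_action (T m) (T n) \<gamma> c \<in> ?E" if "\<gamma> \<in> carrier G" "c \<in> ?E" for \<gamma> c
      using prod_cell_action_closed that by simp
    show "prod_cell_action (T m) (T n) (\<gamma> \<otimes>\<^bsub>G\<^esub> \<gamma>') c =
        prod_cell_action (T m) (T n) \<gamma> (prod_cell_action (T m) (T n) \<gamma>' c)"
      if \<gamma>: "\<gamma> \<in> carrier G" "\<gamma>' \<in> carrier G" and "c \<in> ?E" for \<gamma> \<gamma>' c
    proof -
      obtain c1 c2 where c: "c = (c1, c2)" "c1 \<in> cells (T m)" "c2 \<in> cells (T n)"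
        using \<open>c \<in> ?E\<close> by blast
      have "\<gamma> \<in> \<Gamma>" "\<gamma>' \<in> \<Gamma>" using \<gamma> by auto
      note \<gamma>\<gamma>' = this[THEN \<Gamma>_carrier(1)] this[THEN \<Gamma>_carrier(2)]
      show ?thesis
        using mult_graph_Aut_image[OF \<gamma>\<gamma>'(1,2) c(2)] mult_graph_Aut_image[OF \<gamma>\<gamma>'(3,4) c(3)]
          cells_image[OF \<gamma>\<gamma>'(2) c(2)] cells_image[OF \<gamma>\<gamma>'(4) c(3)] c
        by (simp add: prod_cell_action_def mult_DirProd')
    qed
    show "prod_cell_action (T m) (T n) \<one>\<^bsub>G\<^esub> c = c" if "c \<in> ?E" for c
    proof -
      from that obtain c1 c2 where c: "c = (c1, c2)" "c1 \<in> cells (T m)" "c2 \<in> cells (T n)"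
        by blast
      then show ?thesis
        using one_graph_Aut_image[OF c(2)] one_graph_Aut_image[OF c(3)]
        by (simp add: prod_cell_action_def)
    qed
    have "?r ` ?E \<subseteq> (`) p ` cells (T m) \<times> (`) q ` cells (T n)" by auto
    then show "finite (?r ` ?E)"
      by (rule finite_subset)
        (intro finite_cartesian_product finite_image_cells; use finite_X finite_Y imp imq in simp)
    show "\<exists>\<gamma>\<in>carrier G. prod_cell_action (T m) (T n) \<gamma> c = d"
      if cd: "c \<in> ?E" "d \<in> ?E" "?r c = ?r d" for c d
    proof -
      obtain c1 c2 d1 d2 where e: "c = (c1, c2)" "d = (d1, d2)" by (cases c, cases d)
      obtain g where g: "g \<in> deck m p" "g ` c1 = d1"
        using deck_cells[OF covp irrefl_cov(1), of c1 d1] cd e by auto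
      obtain h where h: "h \<in> deck n q" "h ` c2 = d2"
        using deck_cells[OF covq irrefl_cov(2), of c2 d2] cd e by auto
      show ?thesis
        using deck_pair[OF g(1) h(1)] g(2) h(2) cd e
        by (intro bexI[of _ "(g, h)"]) (auto simp: prod_cell_action_def)
    qed
  qed
qed

definition "K1 = {(g, h). g \<in> deck m p \<and> h = \<one>\<^bsub>graph_Aut (T n)\<^esub>}"
definition "K2 = {(g, h). g = \<one>\<^bsub>graph_Aut (T m)\<^esub> \<and> h \<in> deck n q}"

end

section \<open>Groups of deck transformations\<close>

lemma deck_one: "\<one>\<^bsub>graph_Aut (T n)\<^esub> \<in> deck n p"
  by (simp add: deck_def lifts_one)

lemma deck_mult: "g \<in> deck n p \<Longrightarrow> h \<in> deck n p \<Longrightarrow> g \<otimes>\<^bsub>graph_Aut (T n)\<^esub> h \<in> deck n p"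
  using lifts_mult[of n p id g id h] by (simp add: deck_def)

lemma deck_inv: "g \<in> deck n p \<Longrightarrow> inv\<^bsub>graph_Aut (T n)\<^esub> g \<in> deck n p"
  using lifts_inv[of n p id g id] by (simp add: deck_def)

lemma deck_carrier: "g \<in> deck n p \<Longrightarrow> g \<in> carrier (graph_Aut (T n))"
  by (simp add: deck_def lifts_def)

lemma deck_fixed:
  assumes "covering n p N" "g \<in> deck n p" "v \<in> pverts (T n)" "g v = v"
  shows "g = \<one>\<^bsub>graph_Aut (T n)\<^esub>"
  using lifts_unique[OF assms(1) _ lifts_one assms(3)] assms one_graph_Aut_apply[OF assms(3)]
  by (auto simp: deck_def)

text \<open>An inversion would interchange the ends of an edge, which lie over different vertices
  because the base graph has no loops; a deck transformation preserves the fibres of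
  \<open>p\<close>.\<close>

lemma acts_freely_deck:
  assumes cov: "covering n p N" and irr: "\<And>v. v \<in> pverts (T n) \<Longrightarrow> p v \<notin> N (p v)"
    and \<pi>: "\<And>\<gamma>. \<gamma> \<in> carrier H \<Longrightarrow> \<pi> \<gamma> \<in> deck n p"
    and one: "\<one>\<^bsub>H\<^esub> \<in> carrier H" "\<And>\<gamma>. \<gamma> \<in> carrier H \<Longrightarrow> \<pi> \<gamma> = \<one>\<^bsub>graph_Aut (T n)\<^esub> \<longleftrightarrow> \<gamma> = \<one>\<^bsub>H\<^esub>"
  shows "acts_freely H \<pi> (T n)"
  unfolding acts_freely_def
proof (intro conjI ballI notI)
  fix v assume v: "v \<in> pverts (T n)"
  have "\<gamma> = \<one>\<^bsub>H\<^esub>" if "\<gamma> \<in> carrier H" "\<pi> \<gamma> v = v" for \<gamma>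
    using deck_fixed[OF cov \<pi> v] one(2) that by blast
  moreover have "\<pi> \<one>\<^bsub>H\<^esub> v = v" using one one_graph_Aut_apply[OF v] by metis
  ultimately show "stabilizer H \<pi> v = {\<one>\<^bsub>H\<^esub>}" using one(1) unfolding stabilizer_def by blast
next
  assume "\<exists>\<gamma>\<in>carrier H. \<exists>(u, v)\<in>parcs (T n). \<pi> \<gamma> u = v \<and> \<pi> \<gamma> v = u"
  then obtain \<gamma> u v where \<gamma>: "\<gamma> \<in> carrier H" "(u, v) \<in> parcs (T n)" "\<pi> \<gamma> u = v" by blast
  have u: "u \<in> pverts (T n)" using \<gamma>(2) by (rule parcs_in_pverts)
  have "p v = p u" using \<pi>[OF \<gamma>(1)] \<gamma>(3) u by (auto simp: deck_def lifts_def)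
  moreover have "p v \<in> N (p u)" using coveringD(2)[OF cov u] \<gamma>(2) by (auto simp: nbrs_def)
  ultimately show False using irr[OF u] by simp
qed

lemma acts_cocompactly_deck:
  assumes cov: "covering n p N" and irr: "\<And>v. v \<in> pverts (T n) \<Longrightarrow> p v \<notin> N (p v)"
    and fin: "finite (p ` pverts (T n))"
    and H: "group H" "\<pi> ` carrier H = deck n p" "\<pi> \<one>\<^bsub>H\<^esub> = \<one>\<^bsub>graph_Aut (T n)\<^esub>"
    and mult: "\<And>\<gamma> \<gamma>'. \<gamma> \<in> carrier H \<Longrightarrow> \<gamma>' \<in> carrier H \<Longrightarrow>
      \<pi> (\<gamma> \<otimes>\<^bsub>H\<^esub> \<gamma>') = \<pi> \<gamma> \<otimes>\<^bsub>graph_Aut (T n)\<^esub> \<pi> \<gamma>'"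
  shows "acts_cocompactly H \<pi> (T n)"
  unfolding acts_cocompactly_def
proof (rule finite_orbits[OF H(1), where r = "image p"])
  have \<pi>: "\<pi> \<gamma> \<in> carrier (graph_Aut (T n))" if "\<gamma> \<in> carrier H" for \<gamma>
    using that H(2) deck_carrier by blast
  show "cell_action (T n) (\<pi> \<gamma>) c \<in> cells (T n)" if "\<gamma> \<in> carrier H" "c \<in> cells (T n)" for \<gamma> c
    using cells_image[OF \<pi>[OF that(1)] that(2)] that(2) by (simp add: cell_action_def)
  show "cell_action (T n) (\<pi> (\<gamma> \<otimes>\<^bsub>H\<^esub> \<gamma>')) c =
      cell_action (T n) (\<pi> \<gamma>) (cell_action (T n) (\<pi> \<gamma>') c)"
    if "\<gamma> \<in> carrier H" "\<gamma>' \<in> carrier H" "c \<in> cells (T n)" for \<gamma> \<gamma>' c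
    using mult[OF that(1,2)] mult_graph_Aut_image[OF \<pi>[OF that(1)] \<pi>[OF that(2)] that(3)]
      cells_image[OF \<pi>[OF that(2)] that(3)] that(3) by (simp add: cell_action_def)
  show "cell_action (T n) (\<pi> \<one>\<^bsub>H\<^esub>) c = c" if "c \<in> cells (T n)" for c
    using that by (simp add: cell_action_def H(3) one_graph_Aut_image)
  show "finite ((`) p ` cells (T n))" using fin by (rule finite_image_cells)
  show "\<exists>\<gamma>\<in>carrier H. cell_action (T n) (\<pi> \<gamma>) c = d"
    if cd: "c \<in> cells (T n)" "d \<in> cells (T n)" "p ` c = p ` d" for c d
  proof -
    obtain h where h: "h \<in> deck n p" "h ` c = d" using deck_cells[OF cov irr cd] by blast
    then obtain \<gamma> where "\<gamma> \<in> carrier H" "\<pi> \<gamma> = h" using H(2) by (metis imageE)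
    then show ?thesis using h cd(1) by (auto simp: cell_action_def)
  qed
qed

lemma mult_inv_mult:
  assumes "group G" "x \<in> carrier G" "y \<in> carrier G"
  shows "x \<otimes>\<^bsub>G\<^esub> inv\<^bsub>G\<^esub> y \<otimes>\<^bsub>G\<^esub> y = x"
proof -
  interpret group G by fact
  show ?thesis using assms by (simp add: m_assoc)
qed

context covered_pair
begin

lemma subgroup_K: "subgroup (deck m p \<times> deck n q) A"
proof -
  have "{(g, h). \<exists>(a, b)\<in>{(id, id)}. lifts m p a g \<and> lifts n q b h} = deck m p \<times> deck n q"
    by (auto simp: deck_def)
  then show ?thesis using subgroup_fibre[of "{(id, id)}"] id_\<Phi> by (auto simp: comp_def id_def)
qed

lemma subgroup_deck: "subgroup (deck k r) (graph_Aut (T k))"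
  by (rule group.subgroupI[OF group_graph_Aut_T])
    (use deck_one deck_mult deck_inv deck_carrier in \<open>blast+\<close>)

lemma K_eq: "K1 = deck m p \<times> {\<one>\<^bsub>graph_Aut (T n)\<^esub>}" "K2 = {\<one>\<^bsub>graph_Aut (T m)\<^esub>} \<times> deck n q"
  by (auto simp: K1_def K2_def)

lemma subgroup_K1: "subgroup K1 A" and subgroup_K2: "subgroup K2 A"
  unfolding K_eq
  by (intro DirProd_subgroups group_graph_Aut_T subgroup_deck group.triv_subgroup)+

lemma K_subset: "K1 \<subseteq> \<Gamma>" "K2 \<subseteq> \<Gamma>" "deck m p \<times> deck n q \<subseteq> \<Gamma>"
  using deck_pair deck_one by (auto simp: K_eq)

lemma K1_K2: "K1 <#>\<^bsub>G\<^esub> K2 = deck m p \<times> deck n q"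
proof -
  have "(g, \<one>\<^bsub>graph_Aut (T n)\<^esub>) \<otimes>\<^bsub>G\<^esub> (\<one>\<^bsub>graph_Aut (T m)\<^esub>, h) = (g, h)"
    if "g \<in> deck m p" "h \<in> deck n q" for g h
    using that[THEN deck_carrier] group.is_monoid[OF group_graph_Aut_T]
    by (simp add: monoid.r_one monoid.l_one)
  then show ?thesis unfolding set_mult_def K_eq by (auto simp del: mult_DirProd)
qed

text \<open>The cosets of the deck product are the fibres of the map from the lattice to
  \<open>\<Phi>\<close>, so finiteness of \<open>\<Phi>\<close> bounds their number.\<close>

lemma finite_index: "finite (rcosets\<^bsub>G\<^esub> (deck m p \<times> deck n q))"
proof -
  let ?K = "deck m p \<times> deck n q"
  let ?F = "\<lambda>(a, b). {(g, h). lifts m p a g \<and> lifts n q b h}"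
  have "?K #>\<^bsub>G\<^esub> \<gamma> \<in> ?F ` \<Phi>" if \<gamma>: "\<gamma> \<in> \<Gamma>" for \<gamma>
  proof -
    obtain a b where ab: "(a, b) \<in> \<Phi>" "lifts m p a (fst \<gamma>)" "lifts n q b (snd \<gamma>)"
      using \<gamma> by (rule \<Gamma>_E)
    obtain c d where cd: "(c, d) \<in> \<Phi>" "a \<circ> c = id" "c \<circ> a = id" "b \<circ> d = id" "d \<circ> b = id"
      using inv_\<Phi>[OF ab(1)] by blast
    have "?K #>\<^bsub>G\<^esub> \<gamma> = ?F (a, b)"
    proof
      show "?K #>\<^bsub>G\<^esub> \<gamma> \<subseteq> ?F (a, b)"
        using lifts_mult[of m p id _ a "fst \<gamma>"] lifts_mult[of n q id _ b "snd \<gamma>"] ab(2,3)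
        by (auto simp: r_coset_def deck_def mult_DirProd')
      show "?F (a, b) \<subseteq> ?K #>\<^bsub>G\<^esub> \<gamma>"
      proof
        fix \<gamma>' assume "\<gamma>' \<in> ?F (a, b)"
        then have l: "lifts m p a (fst \<gamma>')" "lifts n q b (snd \<gamma>')" by auto
        define k1 where "k1 = fst \<gamma>' \<otimes>\<^bsub>graph_Aut (T m)\<^esub> inv\<^bsub>graph_Aut (T m)\<^esub> (fst \<gamma>)"
        define k2 where "k2 = snd \<gamma>' \<otimes>\<^bsub>graph_Aut (T n)\<^esub> inv\<^bsub>graph_Aut (T n)\<^esub> (snd \<gamma>)"
        have k: "k1 \<in> deck m p" "k2 \<in> deck n q"
          using lifts_mult[OF l(1) lifts_inv[OF ab(2) cd(3)]]
            lifts_mult[OF l(2) lifts_inv[OF ab(3) cd(5)]] cd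
          by (auto simp: deck_def k1_def k2_def)
        have c: "fst \<gamma>' \<in> carrier (graph_Aut (T m))" "snd \<gamma>' \<in> carrier (graph_Aut (T n))"
          "fst \<gamma> \<in> carrier (graph_Aut (T m))" "snd \<gamma> \<in> carrier (graph_Aut (T n))"
          using l ab by (auto simp: lifts_def)
        have "k1 \<otimes>\<^bsub>graph_Aut (T m)\<^esub> fst \<gamma> = fst \<gamma>'"
          using c by (simp add: k1_def group_graph_Aut_T mult_inv_mult)
        moreover have "k2 \<otimes>\<^bsub>graph_Aut (T n)\<^esub> snd \<gamma> = snd \<gamma>'"
          using c by (simp add: k2_def group_graph_Aut_T mult_inv_mult)
        ultimately have "\<gamma>' = (k1, k2) \<otimes>\<^bsub>G\<^esub> \<gamma>" by (simp add: mult_DirProd')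
        then show "\<gamma>' \<in> ?K #>\<^bsub>G\<^esub> \<gamma>" unfolding r_coset_def using k by blast
      qed
    qed
    then show ?thesis using ab(1) by blast
  qed
  then have "rcosets\<^bsub>G\<^esub> ?K \<subseteq> ?F ` \<Phi>" unfolding RCOSETS_def by auto
  then show ?thesis by (rule finite_subset) (use finite_\<Phi> in simp)
qed

lemma is_reducible_\<Gamma>: "is_reducible (T m) (T n) \<Gamma>"
  unfolding is_reducible_def
proof (intro exI conjI)
  note incl = group.subgroup_incl[OF group_A _ subgroup_\<Gamma>]
  show "subgroup K1 G" "subgroup K2 G"
    using incl[OF subgroup_K1] incl[OF subgroup_K2] K_subset by auto
  show "subgroup (K1 <#>\<^bsub>G\<^esub> K2) G"
    unfolding K1_K2 using incl[OF subgroup_K] K_subset by auto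
  show "finite (rcosets\<^bsub>G\<^esub> (K1 <#>\<^bsub>G\<^esub> K2))" unfolding K1_K2 by (rule finite_index)
  show "acts_trivially (subgrp (T m) (T n) K1) snd (T n)"
    by (auto simp: acts_trivially_def K_eq one_graph_Aut_apply)
  show "acts_trivially (subgrp (T m) (T n) K2) fst (T m)"
    by (auto simp: acts_trivially_def K_eq one_graph_Aut_apply)
  show "acts_freely (subgrp (T m) (T n) K1) fst (T m)"
    by (rule acts_freely_deck[OF covp irrefl_cov(1)]) (auto simp: K_eq deck_one)
  show "acts_freely (subgrp (T m) (T n) K2) snd (T n)"
    by (rule acts_freely_deck[OF covq irrefl_cov(2)]) (auto simp: K_eq deck_one)
  show "acts_cocompactly (subgrp (T m) (T n) K1) fst (T m)"
    by (rule acts_cocompactly_deck[OF covp irrefl_cov(1)])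
      (use imp finite_X group.subgroup_imp_group[OF group_A subgroup_K1] in
        \<open>auto simp: K_eq mult_DirProd' image_iff\<close>)
  show "acts_cocompactly (subgrp (T m) (T n) K2) snd (T n)"
    by (rule acts_cocompactly_deck[OF covq irrefl_cov(2)])
      (use imq finite_Y group.subgroup_imp_group[OF group_A subgroup_K2] in
        \<open>auto simp: K_eq mult_DirProd' image_iff\<close>)
qed

text \<open>The stabilizer of \<open>v\<close> lifts exactly the first components that fix
  \<open>p v\<close>, because a pair in \<open>\<Phi>\<close> can be lifted with a prescribed image
  of \<open>v\<close> in the fibre, in particular with \<open>v\<close> itself.\<close>

lemma has_local_action_fst:
  assumes Q: "monoid.mult Q = (\<circ>)"
    and f: "\<And>x. x \<in> X \<Longrightarrow> \<exists>f. bij_betw f (N x) B \<and>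
      carrier Q = (\<lambda>a k. if k \<in> B then f (a (inv_into (N x) f k)) else k) ` {a. \<exists>b. (a, b) \<in> \<Phi> \<and> a x = x}"
  shows "has_local_action G fst (T m) Q B"
  unfolding has_local_action_def
proof
  fix v assume v: "v \<in> pverts (T m)"
  obtain f where f: "bij_betw f (N (p v)) B" "carrier Q =
      (\<lambda>a k. if k \<in> B then f (a (inv_into (N (p v)) f k)) else k) ` {a. \<exists>b. (a, b) \<in> \<Phi> \<and> a (p v) = p v}"
    using f[OF p_in_X[OF v]] by blast
  show "perm_isomorphic (local_action G fst (T m) v) (out_arcs (with_proj (T m)) v) Q B"
  proof (rule perm_isomorphic_local_action[OF covp v _ _ f(1) Q f(2)])
    fix \<gamma> assume "\<gamma> \<in> stabilizer G fst v"
    then have \<gamma>: "\<gamma> \<in> \<Gamma>" "fst \<gamma> v = v" by (auto simp: stabilizer_def)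
    obtain a b where "(a, b) \<in> \<Phi>" "lifts m p a (fst \<gamma>)" using \<gamma>(1) by (rule \<Gamma>_E)
    then show "\<exists>a\<in>{a. \<exists>b. (a, b) \<in> \<Phi> \<and> a (p v) = p v}. lifts m p a (fst \<gamma>)"
      using \<gamma>(2) v by (force simp: lifts_def)
  next
    fix a assume "a \<in> {a. \<exists>b. (a, b) \<in> \<Phi> \<and> a (p v) = p v}"
    then obtain b where b: "(a, b) \<in> \<Phi>" "a (p v) = p v" by blast
    \<comment> \<open>The second component must be lifted as well, but it may go anywhere; the root
      serves as its base vertex.\<close>
    have "b (q []) \<in> Y" using compat_\<Phi>[OF b(1)] q_in_Y[OF Nil_in_pverts] by (auto simp: compat_def)
    then obtain w where "w \<in> pverts (T n)" "q w = b (q [])" using imq by (metis imageE)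
    then obtain \<gamma> where "\<gamma> \<in> \<Gamma>" "lifts m p a (fst \<gamma>)" "fst \<gamma> v = v"
      using lift_pair[OF b(1) v v _ Nil_in_pverts] b(2) by metis
    then show "\<exists>\<gamma>\<in>stabilizer G fst v. lifts m p a (fst \<gamma>)"
      by (intro bexI[of _ \<gamma>]) (auto simp: stabilizer_def)
  qed
qed

lemma has_local_action_snd:
  assumes Q: "monoid.mult Q = (\<circ>)"
    and f: "\<And>y. y \<in> Y \<Longrightarrow> \<exists>f. bij_betw f (M y) B \<and>
      carrier Q = (\<lambda>b k. if k \<in> B then f (b (inv_into (M y) f k)) else k) ` {b. \<exists>a. (a, b) \<in> \<Phi> \<and> b y = y}"
  shows "has_local_action G snd (T n) Q B"
  unfolding has_local_action_def
proof
  fix v assume v: "v \<in> pverts (T n)"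
  obtain f where f: "bij_betw f (M (q v)) B" "carrier Q =
      (\<lambda>b k. if k \<in> B then f (b (inv_into (M (q v)) f k)) else k) ` {b. \<exists>a. (a, b) \<in> \<Phi> \<and> b (q v) = q v}"
    using f[OF q_in_Y[OF v]] by blast
  show "perm_isomorphic (local_action G snd (T n) v) (out_arcs (with_proj (T n)) v) Q B"
  proof (rule perm_isomorphic_local_action[OF covq v _ _ f(1) Q f(2)])
    fix \<gamma> assume "\<gamma> \<in> stabilizer G snd v"
    then have \<gamma>: "\<gamma> \<in> \<Gamma>" "snd \<gamma> v = v" by (auto simp: stabilizer_def)
    obtain a b where "(a, b) \<in> \<Phi>" "lifts n q b (snd \<gamma>)" using \<gamma>(1) by (rule \<Gamma>_E)
    then show "\<exists>b\<in>{b. \<exists>a. (a, b) \<in> \<Phi> \<and> b (q v) = q v}. lifts n q b (snd \<gamma>)"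
      using \<gamma>(2) v by (force simp: lifts_def)
  next
    fix b assume "b \<in> {b. \<exists>a. (a, b) \<in> \<Phi> \<and> b (q v) = q v}"
    then obtain a where a: "(a, b) \<in> \<Phi>" "b (q v) = q v" by blast
    have "a (p []) \<in> X" using compat_\<Phi>[OF a(1)] p_in_X[OF Nil_in_pverts] by (auto simp: compat_def)
    then obtain w where "w \<in> pverts (T m)" "p w = a (p [])" using imp by (metis imageE)
    then obtain \<gamma> where "\<gamma> \<in> \<Gamma>" "lifts n q b (snd \<gamma>)" "snd \<gamma> v = v"
      using lift_pair[OF a(1) Nil_in_pverts _ _ v v] a(2) by metis
    then show "\<exists>\<gamma>\<in>stabilizer G snd v. lifts n q b (snd \<gamma>)"
      by (intro bexI[of _ \<gamma>]) (auto simp: stabilizer_def)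
  qed
qed

end

section \<open>Coset graphs of finite groups\<close>

text \<open>Products of generators without inverses, so that induction has a single step case. For
  permutations of a finite type this is already the generated group, see
  \<open>mgen_inv\<close>.\<close>

inductive_set mgen :: "('v \<Rightarrow> 'v) set \<Rightarrow> ('v \<Rightarrow> 'v) set" for G where
  mgen_id: "id \<in> mgen G"
| mgen_step: "g \<in> G \<Longrightarrow> f \<in> mgen G \<Longrightarrow> g \<circ> f \<in> mgen G"

lemma mgen_comp: "f \<in> mgen G \<Longrightarrow> g \<in> mgen G \<Longrightarrow> f \<circ> g \<in> mgen G"
  by (induction rule: mgen.induct) (auto simp: comp_assoc intro: mgen.intros)

lemma mgen_incl: "g \<in> G \<Longrightarrow> g \<in> mgen G"
  using mgen_step[OF _ mgen_id] by simp

lemma mgen_least: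
  assumes "G \<subseteq> mgen H"
  shows "mgen G \<subseteq> mgen H"
proof
  fix f assume "f \<in> mgen G"
  then show "f \<in> mgen H" using assms by induction (auto intro: mgen_id mgen_comp)
qed

lemma mgen_bij:
  assumes "\<And>g. g \<in> G \<Longrightarrow> bij g" "f \<in> mgen G"
  shows "bij f"
  using assms(2)
proof induction
  case mgen_id
  show ?case by (rule bij_id)
next
  case (mgen_step g f)
  then show ?case using assms(1) bij_comp by blast
qed

lemma mgen_funpow: "f \<in> mgen G \<Longrightarrow> f ^^ k \<in> mgen G"
  by (induction k) (auto intro: mgen_id mgen_comp)

lemma mgen_inv:
  fixes f :: "'v::finite \<Rightarrow> 'v"
  assumes G: "\<And>g. g \<in> G \<Longrightarrow> bij g" and f: "f \<in> mgen G"
  shows "inv' f \<in> mgen G"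
proof -
  have "bij f" using mgen_bij[OF G f] .
  then have "permutation f" using permutes_imp_permutation[of UNIV f] bij_imp_permutes[of f UNIV] by simp
  then obtain k where "f ^^ k = id" "k > 0" using permutation_is_nilpotent by blast
  then obtain j where j: "f ^^ Suc j = id" by (cases k) auto
  then have "inv' f = f ^^ j"
    by (intro inv_unique_comp) (simp_all flip: funpow.simps(2) funpow_Suc_right)
  then show ?thesis using mgen_funpow[OF f] by simp
qed

text \<open>Via \<open>l \<mapsto> l v0\<close> the fibres of \<open>\<kappa>\<close> correspond to
  the left cosets in L of B = L \<inter> \<tau>L\<tau>. Thus \<open>A\<close> labels these cosets,
  and the coset graph has degree \<open>card A\<close>.\<close>

locale coset_graph =
  fixes L :: "('v::finite \<Rightarrow> 'v) set" and \<tau> :: "'v \<Rightarrow> 'v" and \<kappa> :: "'v \<Rightarrow> 'k"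
    and v0 :: 'v and A :: "'k set"
  assumes L_bij: "\<And>l. l \<in> L \<Longrightarrow> bij l" and L_id: "id \<in> L"
    and L_comp: "\<And>l l'. l \<in> L \<Longrightarrow> l' \<in> L \<Longrightarrow> l \<circ> l' \<in> L"
    and L_trans: "\<And>u v. \<exists>l\<in>L. l u = v" and L_free: "\<And>l u. l \<in> L \<Longrightarrow> l u = u \<Longrightarrow> l = id"
    and \<tau>\<tau>: "\<tau> \<circ> \<tau> = id"
    and \<kappa>_cong: "\<And>l u v. l \<in> L \<Longrightarrow> \<kappa> u = \<kappa> v \<Longrightarrow> \<kappa> (l u) = \<kappa> (l v)"
    and \<kappa>_stab: "\<And>l. l \<in> L \<Longrightarrow> \<kappa> (l v0) = \<kappa> v0 \<longleftrightarrow> \<tau> \<circ> l \<circ> \<tau> \<in> L"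
    and \<kappa>_range: "range \<kappa> = A" and card_A: "1 < card A"
begin

definition "F = mgen (insert \<tau> L)"
definition lcos :: "('v \<Rightarrow> 'v) \<Rightarrow> ('v \<Rightarrow> 'v) set" where "lcos f = (\<circ>) f ` L"
definition "X = lcos ` F"
definition "N C = (\<lambda>f. lcos (f \<circ> \<tau>)) ` C"

lemma \<tau>_bij: "bij \<tau>"
  using \<tau>\<tau> by (intro o_bij)

lemma F_bij: "f \<in> F \<Longrightarrow> bij f"
  unfolding F_def using L_bij \<tau>_bij mgen_bij[of "insert \<tau> L"] by blast

lemma F_id: "id \<in> F" and F_comp: "f \<in> F \<Longrightarrow> g \<in> F \<Longrightarrow> f \<circ> g \<in> F" and F_\<tau>: "\<tau> \<in> F"
  and F_L: "l \<in> L \<Longrightarrow> l \<in> F"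
  by (auto simp: F_def intro: mgen_id mgen_comp mgen_incl)

lemma F_inv: "f \<in> F \<Longrightarrow> inv' f \<in> F"
  unfolding F_def using L_bij \<tau>_bij mgen_inv[of "insert \<tau> L" f] by blast

lemma F_inv_comp: "f \<in> F \<Longrightarrow> inv' f \<circ> f = id" "f \<in> F \<Longrightarrow> f \<circ> inv' f = id"
  using F_bij by (metis bij_is_inj inj_iff, metis bij_is_surj surj_iff)

lemma L_inv: "l \<in> L \<Longrightarrow> inv' l \<in> L"
proof -
  assume l: "l \<in> L"
  obtain k where k: "k \<in> L" "k (l v0) = v0" using L_trans by blast
  then have "k \<circ> l = id" using L_free[OF L_comp[OF k(1) l], of v0] by simp
  then have "k = inv' l" using F_inv_comp(2)[OF F_L[OF l]] by (metis comp_assoc comp_id id_comp)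
  then show ?thesis using k(1) by simp
qed

lemma lcos_self: "f \<in> lcos f"
  unfolding lcos_def using L_id by (metis comp_id imageI)

lemma lcos_mult: "l \<in> L \<Longrightarrow> lcos (f \<circ> l) = lcos f"
proof
  assume l: "l \<in> L"
  show "lcos (f \<circ> l) \<subseteq> lcos f" using L_comp[OF l] by (auto simp: lcos_def comp_assoc)
  show "lcos f \<subseteq> lcos (f \<circ> l)"
  proof
    fix g assume "g \<in> lcos f"
    then obtain k where k: "k \<in> L" "g = f \<circ> k" by (auto simp: lcos_def)
    then have "g = f \<circ> l \<circ> (inv' l \<circ> k)"
      using F_inv_comp(2)[OF F_L[OF l]] by (metis comp_assoc comp_id)
    then show "g \<in> lcos (f \<circ> l)" using L_comp[OF L_inv[OF l] k(1)] by (auto simp: lcos_def)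
  qed
qed

lemma lcos_eq: "g \<in> lcos f \<Longrightarrow> lcos g = lcos f"
proof -
  assume "g \<in> lcos f"
  then obtain l where "l \<in> L" "g = f \<circ> l" by (auto simp: lcos_def)
  then show ?thesis using lcos_mult by simp
qed

lemma image_lcos: "(\<circ>) g ` lcos f = lcos (g \<circ> f)"
  by (auto simp: lcos_def image_image comp_assoc)

lemma N_lcos: "N (lcos f) = (\<lambda>l. lcos (f \<circ> l \<circ> \<tau>)) ` L"
  by (auto simp: N_def lcos_def[of f] image_image)

lemma image_N: "image ((\<circ>) g) ` N C = N ((\<circ>) g ` C)"
  by (auto simp: N_def image_image image_lcos comp_assoc)

text \<open>Both sides say that \<open>inv' l \<circ> l'\<close> lies in B, the intersection of L
  with its conjugate by \<tau>. This is why the neighbours of a coset correspond to the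
  labels.\<close>

lemma lcos_eq_iff:
  assumes "f \<in> F" "l \<in> L" "l' \<in> L"
  shows "lcos (f \<circ> l \<circ> \<tau>) = lcos (f \<circ> l' \<circ> \<tau>) \<longleftrightarrow> \<kappa> (l v0) = \<kappa> (l' v0)"
proof -
  define k where "k = inv' l \<circ> l'"
  have k: "k \<in> L" and l': "l' = l \<circ> k"
    using L_comp[OF L_inv] assms F_inv_comp(2)[OF F_L[OF assms(2)]]
    by (auto simp: k_def comp_assoc[symmetric])
  have "lcos (f \<circ> l \<circ> \<tau>) = lcos (f \<circ> l' \<circ> \<tau>) \<longleftrightarrow> f \<circ> l' \<circ> \<tau> \<in> lcos (f \<circ> l \<circ> \<tau>)"
    using lcos_eq lcos_self by metis
  also have "\<dots> \<longleftrightarrow> \<tau> \<circ> k \<circ> \<tau> \<in> L"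
  proof
    assume "f \<circ> l' \<circ> \<tau> \<in> lcos (f \<circ> l \<circ> \<tau>)"
    then obtain j where j: "j \<in> L" "f \<circ> l' \<circ> \<tau> = f \<circ> l \<circ> \<tau> \<circ> j" by (auto simp: lcos_def)
    have "inj (f \<circ> l)" using F_bij[OF F_comp[OF assms(1) F_L[OF assms(2)]]] by (rule bij_is_inj)
    moreover have "(f \<circ> l) \<circ> (k \<circ> \<tau>) = (f \<circ> l) \<circ> (\<tau> \<circ> j)" using j(2) l' by (simp add: comp_assoc)
    ultimately have "k \<circ> \<tau> = \<tau> \<circ> j" by (metis fun.inj_map_strong inj_eq fun_eq_iff comp_apply)
    then have "\<tau> \<circ> k \<circ> \<tau> = \<tau> \<circ> \<tau> \<circ> j" by (simp add: comp_assoc)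
    then show "\<tau> \<circ> k \<circ> \<tau> \<in> L" using \<tau>\<tau> j(1) by simp
  next
    assume "\<tau> \<circ> k \<circ> \<tau> \<in> L"
    moreover have "f \<circ> l' \<circ> \<tau> = f \<circ> l \<circ> \<tau> \<circ> (\<tau> \<circ> k \<circ> \<tau>)"
      using \<tau>\<tau> unfolding l' by (metis comp_assoc comp_id)
    ultimately show "f \<circ> l' \<circ> \<tau> \<in> lcos (f \<circ> l \<circ> \<tau>)" by (auto simp: lcos_def)
  qed
  also have "\<dots> \<longleftrightarrow> \<kappa> (k v0) = \<kappa> v0" using \<kappa>_stab[OF k] by simp
  also have "\<dots> \<longleftrightarrow> \<kappa> (l v0) = \<kappa> (l' v0)"
  proof
    assume "\<kappa> (k v0) = \<kappa> v0"
    then show "\<kappa> (l v0) = \<kappa> (l' v0)" using \<kappa>_cong[OF assms(2), of "k v0" v0] l' by simp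
  next
    assume "\<kappa> (l v0) = \<kappa> (l' v0)"
    then have "\<kappa> (inv' l (l v0)) = \<kappa> (inv' l (l' v0))" by (rule \<kappa>_cong[OF L_inv[OF assms(2)]])
    then show "\<kappa> (k v0) = \<kappa> v0"
      using F_inv_comp(1)[OF F_L[OF assms(2)]] by (metis comp_apply id_apply k_def)
  qed
  finally show ?thesis .
qed

definition "rep k = (SOME l. l \<in> L \<and> \<kappa> (l v0) = k)"

lemma rep: "k \<in> A \<Longrightarrow> rep k \<in> L \<and> \<kappa> (rep k v0) = k"
proof -
  assume "k \<in> A"
  then obtain v where "\<kappa> v = k" using \<kappa>_range by blast
  moreover obtain l where "l \<in> L" "l v0 = v" using L_trans by blast
  ultimately have "\<exists>l. l \<in> L \<and> \<kappa> (l v0) = k" by blast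
  then show ?thesis unfolding rep_def by (rule someI_ex)
qed

lemma bij_betw_N:
  assumes f: "f \<in> F"
  shows "bij_betw (\<lambda>k. lcos (f \<circ> rep k \<circ> \<tau>)) A (N (lcos f))"
  unfolding bij_betw_def
proof
  show "inj_on (\<lambda>k. lcos (f \<circ> rep k \<circ> \<tau>)) A"
    using lcos_eq_iff[OF f] rep by (auto simp: inj_on_def)
  show "(\<lambda>k. lcos (f \<circ> rep k \<circ> \<tau>)) ` A = N (lcos f)"
  proof
    show "(\<lambda>k. lcos (f \<circ> rep k \<circ> \<tau>)) ` A \<subseteq> N (lcos f)" using rep by (auto simp: N_lcos)
    show "N (lcos f) \<subseteq> (\<lambda>k. lcos (f \<circ> rep k \<circ> \<tau>)) ` A"
    proof
      fix C assume "C \<in> N (lcos f)"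
      then obtain l where l: "l \<in> L" "C = lcos (f \<circ> l \<circ> \<tau>)" by (auto simp: N_lcos)
      have k: "\<kappa> (l v0) \<in> A" using \<kappa>_range by auto
      have "C = lcos (f \<circ> rep (\<kappa> (l v0)) \<circ> \<tau>)"
        using lcos_eq_iff[OF f l(1)] rep[OF k] l(2) by auto
      then show "C \<in> (\<lambda>k. lcos (f \<circ> rep k \<circ> \<tau>)) ` A" using k by blast
    qed
  qed
qed

lemma finite_F: "finite F"
  by (rule finite_subset[OF subset_UNIV]) simp

lemma N_subset: "C \<in> X \<Longrightarrow> N C \<subseteq> X"
  using F_comp F_L F_\<tau> by (auto simp: X_def N_lcos)

lemma N_sym: "C \<in> X \<Longrightarrow> D \<in> N C \<Longrightarrow> C \<in> N D"
proof -
  assume "C \<in> X" "D \<in> N C"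
  then obtain f l where fl: "f \<in> F" "C = lcos f" "l \<in> L" "D = lcos (f \<circ> l \<circ> \<tau>)"
    by (auto simp: X_def N_lcos)
  have "C = lcos (f \<circ> l \<circ> \<tau> \<circ> \<tau>)" using fl lcos_mult \<tau>\<tau> by (simp add: comp_assoc)
  then show "C \<in> N D" using lcos_self fl(4) by (auto simp: N_def)
qed

text \<open>If \<tau> lay in L, then so would all conjugates of elements of L by \<tau>, and
  \<kappa> would be constant.\<close>

lemma \<tau>_notin_L: "\<tau> \<notin> L"
proof
  assume "\<tau> \<in> L"
  then have "\<kappa> (l v0) = \<kappa> v0" if "l \<in> L" for l using \<kappa>_stab L_comp that by auto
  then have "\<kappa> v = \<kappa> v0" for v using L_trans by metis
  then have "A = {\<kappa> v0}" using \<kappa>_range by auto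
  then show False using card_A by simp
qed

lemma N_irrefl: "C \<in> X \<Longrightarrow> C \<notin> N C"
proof
  assume "C \<in> X" "C \<in> N C"
  then obtain f l where fl: "f \<in> F" "C = lcos f" "l \<in> L" "C = lcos (f \<circ> l \<circ> \<tau>)"
    by (auto simp: X_def N_lcos)
  then have "f \<circ> l \<circ> \<tau> \<in> lcos f" using lcos_self by metis
  then obtain j where j: "j \<in> L" "f \<circ> l \<circ> \<tau> = f \<circ> j" by (auto simp: lcos_def)
  have "l \<circ> \<tau> = j" using j(2) F_inv_comp(1)[OF fl(1)] by (metis comp_assoc id_comp)
  then have "\<tau> = inv' l \<circ> j"
    using F_inv_comp(1)[OF F_L[OF fl(3)]] by (metis comp_assoc id_comp)
  then show False using \<tau>_notin_L L_comp[OF L_inv[OF fl(3)] j(1)] by simp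
qed

text \<open>A word is read from left to right while multiplying the coset representative on the
  right: a letter from L keeps the coset, the letter \<tau> passes to a neighbour.\<close>

lemma X_connected:
  assumes "lcos id \<in> Z" and step: "\<And>C. C \<in> Z \<Longrightarrow> N C \<subseteq> Z"
  shows "X \<subseteq> Z"
proof -
  have "lcos (f \<circ> h) \<in> Z" if "h \<in> mgen (insert \<tau> L)" "lcos f \<in> Z" for f h
    using that
  proof (induction arbitrary: f)
    case (mgen_step g h)
    have "lcos (f \<circ> g) \<in> Z"
    proof (cases "g = \<tau>")
      case True
      have "lcos (f \<circ> \<tau>) \<in> N (lcos f)" using lcos_self by (auto simp: N_def)
      then show ?thesis using True step mgen_step.prems by blast
    next
      case False
      then show ?thesis using mgen_step.hyps(1) mgen_step.prems lcos_mult by simp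
    qed
    from mgen_step.IH[OF this] show ?case by (simp only: comp_assoc)
  qed simp
  from this[of _ id] show ?thesis using assms(1) by (auto simp: X_def F_def)
qed

end

lemma covering_onto:
  assumes cov: "covering n p N" and "p [] = x0" "p ` pverts (T n) \<subseteq> V"
    and conn: "\<And>Z. x0 \<in> Z \<Longrightarrow> (\<And>x. x \<in> Z \<Longrightarrow> N x \<subseteq> Z) \<Longrightarrow> V \<subseteq> Z"
  shows "p ` pverts (T n) = V"
proof
  have "N x \<subseteq> p ` pverts (T n)" if "x \<in> p ` pverts (T n)" for x
    using that coveringD(2)[OF cov] nbrs_in_pverts by blast
  moreover have "x0 \<in> p ` pverts (T n)" using assms(2) Nil_in_pverts by (metis imageI)
  ultimately show "V \<subseteq> p ` pverts (T n)" using conn by blast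
qed fact

theorem (in coset_graph) lattice_exists:
  fixes E :: "'v \<Rightarrow> 'v set" and P Q :: "(nat \<Rightarrow> nat) monoid"
  assumes m: "card A = m"
    and E: "\<And>v. card (E v) = n" "\<And>v. v \<notin> E v" "\<And>u v. u \<in> E v \<Longrightarrow> v \<in> E u"
    and E_conn: "\<And>Z. v0 \<in> Z \<Longrightarrow> (\<And>v. v \<in> Z \<Longrightarrow> E v \<subseteq> Z) \<Longrightarrow> Z = UNIV"
    and E_F: "\<And>f v. f \<in> F \<Longrightarrow> f ` E v \<subseteq> E (f v)"
    and P: "monoid.mult P = (\<circ>)" "bij_betw \<phi> A B"
      "carrier P = (\<lambda>l k. if k \<in> B then \<phi> (\<kappa> (l (SOME v. \<phi> (\<kappa> v) = k))) else k) ` L"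
    and Q: "monoid.mult Q = (\<circ>)"
      "\<And>y. \<exists>f. bij_betw f (E y) D \<and>
        carrier Q = (\<lambda>b k. if k \<in> D then f (b (inv_into (E y) f k)) else k) ` {b \<in> F. b y = y}"
  shows "\<exists>\<Gamma>. regular_reducible_lattice m n P B Q D \<Gamma>"
proof -
  have deg: "finite (N C) \<and> card (N C) = m \<and> N C \<subseteq> X" if C: "C \<in> X" for C
  proof -
    obtain f where "f \<in> F" "C = lcos f" using C by (auto simp: X_def)
    then have "bij_betw (\<lambda>k. lcos (f \<circ> rep k \<circ> \<tau>)) A (N C)" using bij_betw_N by simp
    moreover have "finite A" using card_A by (metis card.infinite not_one_less_zero)
    ultimately show ?thesis
      using N_subset[OF C] m by (metis bij_betw_finite bij_betw_same_card)
  qed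
  have X0: "lcos id \<in> X" using F_id by (auto simp: X_def)
  obtain p where p: "covering m p N" "p [] = lcos id" "p ` pverts (T m) \<subseteq> X"
    using covering_exists[where N = N and n = m, OF X0 deg N_sym] by blast
  have pX: "p ` pverts (T m) = X" by (rule covering_onto[OF p X_connected])
  obtain q where q: "covering n q E" "q [] = v0" "q ` pverts (T n) \<subseteq> UNIV"
    using covering_exists[of v0 UNIV E n] E(1,3) by auto
  have qY: "q ` pverts (T n) = UNIV"
    by (rule covering_onto[OF q]) (use E_conn in blast)
  \<comment> \<open>An element of \<open>F\<close> acts on cosets by left multiplication; both
    actions are recorded in one pair.\<close>
  define \<Phi> :: "((('v \<Rightarrow> 'v) set \<Rightarrow> ('v \<Rightarrow> 'v) set) \<times> ('v \<Rightarrow> 'v)) set" where "\<Phi> = (\<lambda>f. (image ((\<circ>) f), f)) ` F"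
  have \<Phi>_iff: "(a, b) \<in> \<Phi> \<longleftrightarrow> b \<in> F \<and> a = image ((\<circ>) b)" for a b by (auto simp: \<Phi>_def)
  have im_comp: "image ((\<circ>) f) \<circ> image ((\<circ>) g) = image ((\<circ>) (f \<circ> g))" for f g :: "'v \<Rightarrow> 'v"
    by (auto simp: fun_eq_iff image_image comp_assoc)
  have im_id: "image ((\<circ>) id) = (id :: ('v \<Rightarrow> 'v) set \<Rightarrow> _)" by (auto simp: fun_eq_iff)
  have im_X: "(\<circ>) g ` C \<in> X" if "g \<in> F" "C \<in> X" for g C
    using that F_comp by (auto simp: X_def image_lcos)
  interpret covered_pair m n p q N E X UNIV \<Phi>
  proof
    show "finite X" "finite \<Phi>" using finite_F by (auto simp: X_def \<Phi>_def)
    show "(id, id) \<in> \<Phi>" using F_id by (simp add: \<Phi>_iff im_id)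
    show "(a \<circ> c, b \<circ> d) \<in> \<Phi>" if "(a, b) \<in> \<Phi>" "(c, d) \<in> \<Phi>" for a b c d
      using that F_comp by (simp add: \<Phi>_iff im_comp)
    show "\<exists>c d. (c, d) \<in> \<Phi> \<and> a \<circ> c = id \<and> c \<circ> a = id \<and> b \<circ> d = id \<and> d \<circ> b = id"
      if "(a, b) \<in> \<Phi>" for a b
    proof -
      have b: "b \<in> F" "a = image ((\<circ>) b)" using that by (auto simp: \<Phi>_iff)
      show ?thesis
        by (intro exI[of _ "image ((\<circ>) (inv' b))"] exI[of _ "inv' b"])
          (simp add: \<Phi>_iff F_inv b im_comp F_inv_comp im_id)
    qed
    show "compat N X a \<and> compat E UNIV b" if "(a, b) \<in> \<Phi>" for a b
      using that im_X E_F image_N by (auto simp: \<Phi>_iff compat_def)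
    show "\<exists>(a, b)\<in>\<Phi>. a C = C' \<and> b y = y'" if C: "C \<in> X" "C' \<in> X" for C C' y y'
    proof -
      obtain f f' where f: "f \<in> F" "C = lcos f" "f' \<in> F" "C' = lcos f'" using C by (auto simp: X_def)
      \<comment> \<open>The elements taking \<open>lcos f\<close> to \<open>lcos f'\<close> are the
        \<open>f' \<circ> l \<circ> inv' f\<close> with \<open>l\<close> in L, and transitivity of L
        on V allows a choice of \<open>l\<close> that also matches \<open>y\<close> with
        \<open>y'\<close>.\<close>
      obtain l where l: "l \<in> L" "l (inv' f y) = inv' f' y'" using L_trans by blast
      define g where "g = f' \<circ> l \<circ> inv' f"
      have "g \<in> F" using f l by (auto simp: g_def intro: F_comp F_L F_inv)
      moreover have "g \<circ> f = f' \<circ> l" using F_inv_comp(1)[OF f(1)] by (simp add: g_def comp_assoc)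
      then have "(\<circ>) g ` C = C'" using lcos_mult[OF l(1)] f by (simp add: image_lcos)
      moreover have "g y = y'"
        using l(2) F_bij[OF f(3)] by (simp add: g_def bij_is_surj surj_f_inv_f)
      ultimately show ?thesis by (intro bexI[of _ "(image ((\<circ>) g), g)"]) (auto simp: \<Phi>_iff)
    qed
    show "a = id \<and> b = id" if ab: "(a, b) \<in> \<Phi>" and C: "C \<in> X" "a C = C" "b y = y" for a b C y
    proof -
      obtain f where f: "f \<in> F" "C = lcos f" using C(1) by (auto simp: X_def)
      have b: "b \<in> F" "a = image ((\<circ>) b)" using ab by (auto simp: \<Phi>_iff)
      have "b \<circ> f \<in> lcos f" using C(2) f b lcos_self by (auto simp: image_lcos)
      \<comment> \<open>An element fixing the coset of \<open>f\<close> is the conjugate by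
        \<open>f\<close> of some \<open>l\<close> in L; if it also fixes \<open>y\<close>, then
        \<open>l\<close> has a fixed point and is trivial.\<close>
      then obtain l where l: "l \<in> L" "b \<circ> f = f \<circ> l" by (auto simp: lcos_def)
      have "f (l (inv' f y)) = f (inv' f y)"
        using l(2) C(3) F_bij[OF f(1)] by (metis bij_is_surj comp_apply surj_f_inv_f)
      then have "l (inv' f y) = inv' f y" using F_bij[OF f(1)] by (simp add: bij_is_inj inj_eq)
      then have "l = id" using L_free l(1) by blast
      then have "b = id" using l(2) F_inv_comp(2)[OF f(1)] by (metis comp_assoc comp_id)
      then show ?thesis using b im_id by simp
    qed
    show "C \<notin> N C" if "C \<in> X" for C using N_irrefl[OF that] .
  qed (use p(1) pX q(1) qY E(2) in auto)
  have "has_local_action G snd (T n) Q D"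
  proof (rule has_local_action_snd[OF Q(1)])
    have "{b. \<exists>a. (a, b) \<in> \<Phi> \<and> b y = y} = {b \<in> F. b y = y}" for y by (auto simp: \<Phi>_iff)
    then show "\<exists>f. bij_betw f (E y) D \<and> carrier Q =
        (\<lambda>b k. if k \<in> D then f (b (inv_into (E y) f k)) else k) ` {b. \<exists>a. (a, b) \<in> \<Phi> \<and> b y = y}" for y
      using Q(2)[of y] by simp
  qed
  moreover have "has_local_action G fst (T m) P B"
  proof (rule has_local_action_fst[OF P(1)])
    fix C assume "C \<in> X"
    then obtain f where f: "f \<in> F" "C = lcos f" by (auto simp: X_def)
    define \<beta> where "\<beta> k = lcos (f \<circ> rep k \<circ> \<tau>)" for k
    have \<beta>: "bij_betw \<beta> A (N C)" using bij_betw_N[OF f(1)] f(2) by (simp add: \<beta>_def[abs_def])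
    define h where "h = \<phi> \<circ> inv_into A \<beta>"
    have h: "bij_betw h (N C) B"
      unfolding h_def using bij_betw_trans[OF bij_betw_inv_into[OF \<beta>] P(2)] .
    have h_\<beta>: "h (\<beta> k) = \<phi> k" if "k \<in> A" for k
      using \<beta> that by (simp add: h_def bij_betw_def)
    have inv_h: "inv_into (N C) h (\<phi> k) = \<beta> k" if "k \<in> A" for k
      using h \<beta> h_\<beta>[OF that] that by (metis bij_betw_def imageI inv_into_f_f)
    \<comment> \<open>With the neighbours of \<open>lcos f\<close> labelled through
      \<open>\<beta>\<close>, the conjugate of \<open>l\<close> by \<open>f\<close> acts on the
      labels as \<open>l\<close> acts on the values of \<kappa>. The choice operator only picks some
      point with a given label; by \<open>\<kappa>_cong\<close> all such points give the same
      result.\<close>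
    have conj: "(if k \<in> B then h ((\<circ>) (f \<circ> l \<circ> inv' f) ` inv_into (N C) h k) else k) =
        (if k \<in> B then \<phi> (\<kappa> (l (SOME v. \<phi> (\<kappa> v) = k))) else k)" if l: "l \<in> L" for l k
    proof (cases "k \<in> B")
      case True
      then obtain j where j: "j \<in> A" "k = \<phi> j" using P(2) by (auto simp: bij_betw_def)
      have "\<phi> (\<kappa> (SOME v. \<phi> (\<kappa> v) = k)) = k"
        by (rule someI_ex[of "\<lambda>v. \<phi> (\<kappa> v) = k"]) (use j \<kappa>_range in blast)
      then have s: "\<kappa> (SOME v. \<phi> (\<kappa> v) = k) = j"
        using P(2) j \<kappa>_range by (metis bij_betw_inv_into_left rangeI)
      have "(\<circ>) (f \<circ> l \<circ> inv' f) ` \<beta> j = lcos (f \<circ> (l \<circ> rep j) \<circ> \<tau>)"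
        using F_inv_comp(1)[OF f(1)] unfolding \<beta>_def image_lcos by (metis comp_assoc comp_id)
      also have "\<dots> = \<beta> (\<kappa> ((l \<circ> rep j) v0))"
        unfolding \<beta>_def using rep[OF j(1)] rep[of "\<kappa> ((l \<circ> rep j) v0)"] \<kappa>_range l L_comp
        by (subst lcos_eq_iff[OF f(1)]) auto
      finally have "h ((\<circ>) (f \<circ> l \<circ> inv' f) ` inv_into (N C) h k) = \<phi> (\<kappa> (l (rep j v0)))"
        using inv_h[OF j(1)] h_\<beta> \<kappa>_range j(2) by auto
      moreover have "\<kappa> (l (rep j v0)) = \<kappa> (l (SOME v. \<phi> (\<kappa> v) = k))"
        using \<kappa>_cong[OF l] rep[OF j(1)] s by simp
      ultimately show ?thesis using True by simp
    qed simp
    have "{a. \<exists>b. (a, b) \<in> \<Phi> \<and> a C = C} = (\<lambda>l. image ((\<circ>) (f \<circ> l \<circ> inv' f))) ` L"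
    proof
      show "(\<lambda>l. image ((\<circ>) (f \<circ> l \<circ> inv' f))) ` L \<subseteq> {a. \<exists>b. (a, b) \<in> \<Phi> \<and> a C = C}"
      proof
        fix a :: "('v \<Rightarrow> 'v) set \<Rightarrow> ('v \<Rightarrow> 'v) set"
        assume "a \<in> (\<lambda>l. image ((\<circ>) (f \<circ> l \<circ> inv' f))) ` L"
        then obtain l where l: "l \<in> L" "a = image ((\<circ>) (f \<circ> l \<circ> inv' f))" by blast
        have "f \<circ> l \<circ> inv' f \<in> F" using f l F_comp F_L F_inv by blast
        moreover have "f \<circ> l \<circ> inv' f \<circ> f = f \<circ> l" using F_inv_comp(1)[OF f(1)] by (simp add: comp_assoc)
        then have "a C = C" using f(2) l lcos_mult[OF l(1)] by (simp add: image_lcos)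
        ultimately show "a \<in> {a. \<exists>b. (a, b) \<in> \<Phi> \<and> a C = C}" using l(2) by (auto simp: \<Phi>_iff)
      qed
      show "{a. \<exists>b. (a, b) \<in> \<Phi> \<and> a C = C} \<subseteq> (\<lambda>l. image ((\<circ>) (f \<circ> l \<circ> inv' f))) ` L"
      proof
        fix a assume "a \<in> {a. \<exists>b. (a, b) \<in> \<Phi> \<and> a C = C}"
        then obtain b where b: "b \<in> F" "a = image ((\<circ>) b)" "a C = C" by (auto simp: \<Phi>_iff)
        have "b \<circ> f \<in> lcos f" using b(2,3) f(2) lcos_self by (auto simp: image_lcos)
        then obtain l where l: "l \<in> L" "b \<circ> f = f \<circ> l" by (auto simp: lcos_def)
        then have "b = f \<circ> l \<circ> inv' f"
          using F_inv_comp(2)[OF f(1)] by (metis comp_assoc comp_id)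
        then show "a \<in> (\<lambda>l. image ((\<circ>) (f \<circ> l \<circ> inv' f))) ` L" using l(1) b(2) by blast
      qed
    qed
    then have "(\<lambda>a k. if k \<in> B then h (a (inv_into (N C) h k)) else k) ` {a. \<exists>b. (a, b) \<in> \<Phi> \<and> a C = C}
        = carrier P"
      unfolding P(3) by (simp add: image_image conj cong: image_cong_simp)
    then show "\<exists>h. bij_betw h (N C) B \<and> carrier P =
        (\<lambda>a k. if k \<in> B then h (a (inv_into (N C) h k)) else k) ` {a. \<exists>b. (a, b) \<in> \<Phi> \<and> a C = C}"
      using h by blast
  qed
  ultimately show ?thesis
    unfolding regular_reducible_lattice_def
    using is_lattice_\<Gamma> is_reducible_\<Gamma> acts_regularly_\<Gamma> by blast
qed

section \<open>Generating alternating groups\<close>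

definition cyc3 :: "'v \<Rightarrow> 'v \<Rightarrow> 'v \<Rightarrow> 'v \<Rightarrow> 'v" where
  "cyc3 a b c x = (if x = a then b else if x = b then c else if x = c then a else x)"

lemma cyc3_rotate: "distinct [a, b, c] \<Longrightarrow> cyc3 a b c = cyc3 b c a"
  by (auto simp: cyc3_def fun_eq_iff)

lemma cyc3_comp_self: "distinct [a, b, c] \<Longrightarrow> cyc3 a b c \<circ> cyc3 a b c = cyc3 a c b"
  by (auto simp: cyc3_def fun_eq_iff)

lemma transpose_comp_cyc3:
  "distinct [a, b, c] \<Longrightarrow>
     Transposition.transpose a b \<circ> Transposition.transpose b c = cyc3 a b c"
  by (auto simp: cyc3_def fun_eq_iff Transposition.transpose_def)

text \<open>Two transpositions sharing a point compose to a 3-cycle or to the identity; disjoint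
  ones are bridged by inserting the transposition of \<open>d\<close> and \<open>a\<close>
  twice.\<close>

lemma transpose_comp_in:
  assumes comp: "\<And>f g. f \<in> S \<Longrightarrow> g \<in> S \<Longrightarrow> f \<circ> g \<in> S" and "id \<in> S"
    and cyc: "\<And>a b c. a \<in> C \<Longrightarrow> b \<in> C \<Longrightarrow> c \<in> C \<Longrightarrow> distinct [a, b, c] \<Longrightarrow> cyc3 a b c \<in> S"
    and abcd: "a \<in> C" "b \<in> C" "c \<in> C" "d \<in> C" "a \<noteq> b" "c \<noteq> d"
  shows "Transposition.transpose c d \<circ> Transposition.transpose a b \<in> S"
proof -
  have share: "Transposition.transpose x y \<circ> Transposition.transpose y z \<in> S"
    if "x \<in> C" "y \<in> C" "z \<in> C" "x \<noteq> y" "y \<noteq> z" for x y z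
  proof (cases "x = z")
    case True
    then show ?thesis using \<open>id \<in> S\<close> by (metis transpose_comp_involutory transpose_commute)
  next
    case False
    then show ?thesis using that cyc[of x y z] transpose_comp_cyc3[of x y z] by auto
  qed
  consider "d = a" | "d = b" | "d \<noteq> a" "d \<noteq> b" by blast
  then show ?thesis
  proof cases
    case 1
    then show ?thesis using share[of c a b] abcd by simp
  next
    case 2
    then show ?thesis using share[of c b a] abcd by (simp add: transpose_commute)
  next
    case 3
    have "Transposition.transpose c d \<circ> Transposition.transpose a b =
        (Transposition.transpose c d \<circ> Transposition.transpose d a) \<circ>
        (Transposition.transpose d a \<circ> Transposition.transpose a b)"
      by (simp add: fun_eq_iff)
    then show ?thesis using comp[OF share[of c d a] share[of d a b]] abcd 3 by simp
  qed
qed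

text \<open>The induction strips one transposition at a time and so alternates the parity. For odd
  \<open>p\<close> the invariant therefore speaks about \<open>p\<close> multiplied by an arbitrary
  transposition.\<close>

lemma evenperm_in:
  assumes comp: "\<And>f g. f \<in> S \<Longrightarrow> g \<in> S \<Longrightarrow> f \<circ> g \<in> S" and id: "id \<in> S"
    and cyc: "\<And>a b c. a \<in> C \<Longrightarrow> b \<in> C \<Longrightarrow> c \<in> C \<Longrightarrow> distinct [a, b, c] \<Longrightarrow> cyc3 a b c \<in> S"
    and p: "p permutes C" "finite C" "evenperm p"
  shows "p \<in> S"
proof -
  have "(evenperm p \<longrightarrow> p \<in> S) \<and>
    (\<not> evenperm p \<longrightarrow> (\<forall>a\<in>C. \<forall>b\<in>C. a \<noteq> b \<longrightarrow> Transposition.transpose a b \<circ> p \<in> S))"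
    using p(1,2)
  proof (induction rule: permutes_induct)
    case id
    show ?case using \<open>id \<in> S\<close> by (simp only: evenperm_id simp_thms)
  next
    case (swap a b p)
    have "permutation p" by (rule permutes_imp_permutation[OF p(2) swap.hyps(4)])
    then have "evenperm (Transposition.transpose a b \<circ> p) \<longleftrightarrow> \<not> evenperm p"
      using evenperm_comp[OF permutation_swap_id, of p a b] evenperm_swap[of a b] swap(3) by simp
    moreover have "Transposition.transpose c d \<circ> (Transposition.transpose a b \<circ> p) \<in> S"
      if "evenperm p" "c \<in> C" "d \<in> C" "c \<noteq> d" for c d
      using comp[OF transpose_comp_in[OF comp id cyc swap(1,2) that(2,3) swap(3) that(4)], of p]
        swap.IH that(1) by (simp add: comp_assoc)
    ultimately show ?case using swap by blast
  qed
  then show ?thesis using p(3) by blast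
qed

section \<open>Permutation groups containing a 3-cycle\<close>

lemma cyc3_conj:
  assumes "bij f"
  shows "f \<circ> cyc3 a b c \<circ> inv' f = cyc3 (f a) (f b) (f c)"
proof
  fix x
  obtain y where "x = f y" using assms by (metis bij_pointE)
  then show "(f \<circ> cyc3 a b c \<circ> inv' f) x = cyc3 (f a) (f b) (f c) x"
    using assms by (auto simp: cyc3_def bij_is_inj inj_eq)
qed

locale perm_group =
  fixes F :: "('v \<Rightarrow> 'v) set"
  assumes bij: "\<And>f. f \<in> F \<Longrightarrow> bij f" and id: "id \<in> F"
    and comp: "\<And>f g. f \<in> F \<Longrightarrow> g \<in> F \<Longrightarrow> f \<circ> g \<in> F" and inv: "\<And>f. f \<in> F \<Longrightarrow> inv' f \<in> F"
begin

lemma conj: "f \<in> F \<Longrightarrow> cyc3 a b c \<in> F \<Longrightarrow> cyc3 (f a) (f b) (f c) \<in> F"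
  using cyc3_conj[OF bij] comp inv by metis

lemma cyc3_rev: "cyc3 a b c \<in> F \<Longrightarrow> distinct [a, b, c] \<Longrightarrow> cyc3 a c b \<in> F"
  using comp cyc3_comp_self by metis

lemma cyc3_rot: "cyc3 a b c \<in> F \<Longrightarrow> distinct [a, b, c] \<Longrightarrow> cyc3 b c a \<in> F"
  using cyc3_rotate by metis

text \<open>Points that occur together in a 3-cycle of \<open>F\<close>. The relation is an
  \<open>F\<close>-invariant equivalence, and \<open>F\<close> contains all 3-cycles within a class
  (\<open>linked_cyc3\<close>). Hence an orbit inside one class carries its whole alternating group.
  This takes the place of Jordan's theorem on primitive groups.\<close>

definition linked (infix "\<approx>" 50) where
  "x \<approx> y \<longleftrightarrow> x = y \<or> (\<exists>z. distinct [x, y, z] \<and> cyc3 x y z \<in> F)"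

lemma linked_refl: "x \<approx> x"
  by (simp add: linked_def)

lemma linked_sym: "x \<approx> y \<Longrightarrow> y \<approx> x"
  unfolding linked_def using cyc3_rev cyc3_rot
  by (metis distinct_length_2_or_more distinct_singleton)

lemma linked_image: "f \<in> F \<Longrightarrow> x \<approx> y \<Longrightarrow> f x \<approx> f y"
proof (cases "x = y")
  case False
  assume f: "f \<in> F" and "x \<approx> y"
  then obtain z where "distinct [x, y, z]" "cyc3 x y z \<in> F" using False by (auto simp: linked_def)
  then show ?thesis
    unfolding linked_def using conj[OF f] bij[OF f]
    by (intro disjI2 exI[of _ "f z"]) (auto simp: bij_is_inj inj_eq)
qed (simp add: linked_def)

text \<open>In general the conjugate of (x y z) by (y u v) is a 3-cycle through \<open>x\<close> and
  \<open>u\<close>. In the other two cases one of the given cycles already consists of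
  \<open>x\<close>, \<open>y\<close> and \<open>u\<close>.\<close>

lemma linked_trans:
  assumes "x \<approx> y" "y \<approx> u"
  shows "x \<approx> u"
proof (cases "x = y \<or> y = u \<or> x = u")
  case True
  then show ?thesis using assms linked_refl by auto
next
  case False
  then obtain z v where z: "distinct [x, y, z]" "cyc3 x y z \<in> F"
    and v: "distinct [y, u, v]" "cyc3 y u v \<in> F"
    using assms by (auto simp: linked_def)
  consider "v = x" | "u = z" | "v \<noteq> x" "u \<noteq> z" by blast
  then show ?thesis
  proof cases
    case 1
    then have "cyc3 x y u \<in> F" using v cyc3_rotate[of x y u] by auto
    then have "cyc3 x u y \<in> F" using cyc3_rev[of x y u] False by auto
    then show ?thesis unfolding linked_def using False by (intro disjI2 exI[of _ y]) auto
  next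
    case 2
    then have "cyc3 x u y \<in> F" using z cyc3_rev by auto
    then show ?thesis unfolding linked_def using False by (intro disjI2 exI[of _ y]) auto
  next
    case 3
    have "cyc3 (cyc3 y u v x) (cyc3 y u v y) (cyc3 y u v z) \<in> F"
      using conj[OF v(2) z(2)] .
    moreover have "cyc3 y u v x = x" "cyc3 y u v y = u" using 3 False by (auto simp: cyc3_def)
    moreover have "cyc3 y u v z \<noteq> x" "cyc3 y u v z \<noteq> u" using 3 False z(1) v(1)
      by (auto simp: cyc3_def)
    ultimately show ?thesis unfolding linked_def using False
      by (intro disjI2 exI[of _ "cyc3 y u v z"]) auto
  qed
qed

text \<open>From \<open>z \<approx> w\<close> one gets a 3-cycle (z w v), and conjugating (x y z) by
  it replaces \<open>z\<close> by \<open>w\<close> if \<open>v\<close> is neither \<open>x\<close>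
  nor \<open>y\<close>. In the two exceptional cases (z y w) is obtained instead, and conjugating (x
  y z) by that gives the inverse of the wanted cycle.\<close>

lemma linked_cyc3:
  assumes "x \<approx> y" "x \<approx> w" and d: "distinct [x, y, w]"
  shows "cyc3 x y w \<in> F"
proof (cases "cyc3 x y w \<in> F")
  case False
  obtain z where z: "distinct [x, y, z]" "cyc3 x y z \<in> F" using assms by (auto simp: linked_def)
  have "z \<noteq> w" using False z(2) by auto
  have "x \<approx> z"
    unfolding linked_def using cyc3_rev[OF z(2,1)] z(1) by (intro disjI2 exI[of _ y]) auto
  then have "z \<approx> w" using assms(2) linked_trans linked_sym by blast
  then obtain v where v: "distinct [z, w, v]" "cyc3 z w v \<in> F"
    using \<open>z \<noteq> w\<close> by (auto simp: linked_def)
  have 1: "cyc3 (cyc3 z w v x) (cyc3 z w v y) (cyc3 z w v z) \<in> F"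
    using conj[OF v(2) z(2)] .
  have 2: "cyc3 x y w \<in> F" if "cyc3 z y w \<in> F"
  proof -
    have "cyc3 (cyc3 z y w x) (cyc3 z y w y) (cyc3 z y w z) \<in> F"
      using conj[OF that z(2)] .
    then have "cyc3 x w y \<in> F" using z(1) d \<open>z \<noteq> w\<close> by (auto simp: cyc3_def)
    then show ?thesis using cyc3_rev[of x w y] d by auto
  qed
  consider "v = x" | "v = y" | "v \<noteq> x" "v \<noteq> y" by blast
  then show ?thesis
  proof cases
    case 1
    then show ?thesis using \<open>cyc3 (cyc3 z w v x) _ _ \<in> F\<close> 2 z(1) d v(1) by (auto simp: cyc3_def)
  next
    case 2
    then have D: "cyc3 x z w \<in> F"
      using 1 z(1) d v(1) by (auto simp: cyc3_def)
    have "cyc3 (cyc3 x z w x) (cyc3 x z w y) (cyc3 x z w z) \<in> F"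
      using conj[OF D z(2)] .
    then have "cyc3 z y w \<in> F" using z(1) d \<open>z \<noteq> w\<close> by (auto simp: cyc3_def)
    then show ?thesis using \<open>cyc3 z y w \<in> F \<Longrightarrow> cyc3 x y w \<in> F\<close> by blast
  next
    case 3
    then show ?thesis using 1 z(1) d v(1) by (auto simp: cyc3_def)
  qed
qed

text \<open>An element taking \<open>c\<close> and \<open>d\<close> to \<open>v0\<close> and
  \<open>g v0\<close> carries the known link between \<open>c\<close> and \<open>d\<close> to one
  between \<open>v0\<close> and \<open>g v0\<close>. By invariance under the generators
  \<open>v0\<close> is then linked to its whole orbit.\<close>

lemma evenperm_in_F:
  assumes G: "G \<subseteq> F" and cde: "cyc3 c d e \<in> F" "distinct [c, d, e]"
    and link: "\<And>g. g \<in> G \<Longrightarrow> \<exists>f\<in>F. f c = v0 \<and> f d = g v0"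
    and p: "p permutes (\<lambda>h. h v0) ` mgen G" "finite ((\<lambda>h. h v0) ` mgen G)" "evenperm p"
  shows "p \<in> F"
proof (rule evenperm_in[OF comp id _ p])
  have cd: "c \<approx> d" unfolding linked_def using cde by blast
  have step: "v0 \<approx> g v0" if "g \<in> G" for g
    using link[OF that] linked_image[OF _ cd] by metis
  have v0: "v0 \<approx> h v0" if "h \<in> mgen G" for h
    using that
  proof induction
    case (mgen_step g h)
    then have "g v0 \<approx> g (h v0)" using linked_image G by blast
    then show ?case using step[OF mgen_step(1)] linked_trans by simp
  qed (simp add: linked_refl)
  then have "u \<approx> v" if "u \<in> (\<lambda>h. h v0) ` mgen G" "v \<in> (\<lambda>h. h v0) ` mgen G" for u v
    using that linked_trans linked_sym by blast
  then show "cyc3 x y z \<in> F" if "x \<in> (\<lambda>h. h v0) ` mgen G" "y \<in> (\<lambda>h. h v0) ` mgen G"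
    "z \<in> (\<lambda>h. h v0) ` mgen G" "distinct [x, y, z]" for x y z
    using linked_cyc3 that by blast
qed

lemma funpow_in: "f \<in> F \<Longrightarrow> f ^^ k \<in> F"
  by (induction k) (auto intro: id comp)

text \<open>Apart from (c d e) every cycle of \<open>w\<close> has a length dividing
  \<open>M\<close>, and \<open>M\<close> is prime to 3. So the \<open>M\<close>-th power of
  \<open>w\<close> is (c d e) or its inverse.\<close>

lemma cyc3_from_word:
  assumes w: "w \<in> F" and cde: "w c = d" "w d = e" "w e = c" "distinct [c, d, e]"
    and M: "\<not> 3 dvd M"
    and other: "\<And>x. x \<notin> {c, d, e} \<Longrightarrow> \<exists>l. l dvd M \<and> (w ^^ l) x = x"
  shows "cyc3 c d e \<in> F"
proof -
  have period: "(w ^^ (l * k)) x = x" if "(w ^^ l) x = x" for l k x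
    using that by (induction k) (auto simp: funpow_add)
  have fixed: "(w ^^ M) x = x" if "x \<notin> {c, d, e}" for x
    using other[OF that] period by (auto simp: dvd_def)
  have split: "(w ^^ M) x = (w ^^ (M mod 3)) ((w ^^ (3 * (M div 3))) x)" for x
    by (metis comp_apply funpow_add mod_mult_div_eq)
  have w3: "(w ^^ 3) x = x" if "x \<in> {c, d, e}" for x
    using that cde by (auto simp: numeral_3_eq_3)
  have wM: "(w ^^ M) x = (w ^^ (M mod 3)) x" if "x \<in> {c, d, e}" for x
    using split[of x] period[OF w3[OF that]] by simp
  have "M mod 3 \<noteq> 0" "M mod 3 < 3" using M by (simp_all add: dvd_eq_mod_eq_0)
  then have "M mod 3 = 1 \<or> M mod 3 = 2" by linarith
  then show ?thesis
  proof
    assume "M mod 3 = 1"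
    then have "w ^^ M = cyc3 c d e" using wM fixed cde by (auto simp: fun_eq_iff cyc3_def)
    then show ?thesis using funpow_in[OF w] by metis
  next
    assume "M mod 3 = 2"
    then have "w ^^ M = cyc3 c e d"
      using wM fixed cde by (auto simp: fun_eq_iff cyc3_def numeral_2_eq_2)
    then show ?thesis using funpow_in[OF w, of M] cyc3_rev[of c e d] cde by auto
  qed
qed

end

text \<open>A certificate for regularity and for L \<inter> \<tau>L\<tau> = B, where B is generated
  by \<open>Bg\<close>. L is free because it commutes with a transitive group, that of the right
  translations \<open>Rg\<close>. B lies in the intersection because its generators do. Since B is
  transitive on the labels other than that of \<open>v0\<close>, anything more in the intersection
  would bring in \<open>w\<close>; but the conjugate of \<open>w\<close> by \<tau> fails to commute
  with \<open>r\<close> and so is not in L.\<close>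

lemma coset_graphI:
  fixes Lg Rg Bg :: "('v::finite \<Rightarrow> 'v) set" and \<kappa> :: "'v \<Rightarrow> nat"
  assumes Lb: "\<And>l. l \<in> Lg \<Longrightarrow> bij l" and Rb: "\<And>r. r \<in> Rg \<Longrightarrow> bij r"
    and comm: "\<And>l r x. l \<in> Lg \<Longrightarrow> r \<in> Rg \<Longrightarrow> l (r x) = r (l x)"
    and orbL: "\<And>v. \<exists>l\<in>mgen Lg. l v0 = v" and orbR: "\<And>v. \<exists>r\<in>mgen Rg. r v0 = v"
    and \<tau>\<tau>: "\<And>x. \<tau> (\<tau> x) = x"
    and \<pi>: "\<And>l v. l \<in> Lg \<Longrightarrow> \<pi> l (\<kappa> v) = \<kappa> (l v)"
    and Bg: "Bg \<subseteq> mgen Lg" "\<And>b. b \<in> Bg \<Longrightarrow> \<tau> \<circ> b \<circ> \<tau> \<in> mgen Lg"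
    and orbB: "\<And>v. \<kappa> v = \<kappa> v0 \<Longrightarrow> \<exists>b\<in>mgen Bg. b v0 = v"
    and w: "w \<in> mgen Lg" "r \<in> Rg" "\<tau> (w (\<tau> (r u))) \<noteq> r (\<tau> (w (\<tau> u)))"
    and transB: "\<And>v. \<kappa> v \<noteq> \<kappa> v0 \<Longrightarrow> \<exists>b\<in>mgen Bg. \<kappa> (b (w v0)) = \<kappa> v"
    and A: "range \<kappa> = A" "1 < card A"
  shows "coset_graph (mgen Lg) \<tau> \<kappa> v0 A"
proof -
  let ?L = "mgen Lg"
  have Lbij: "bij l" if "l \<in> ?L" for l using mgen_bij[OF Lb that] .
  have Rbij: "bij r" if "r \<in> mgen Rg" for r using mgen_bij[OF Rb that] .
  have Linv: "inv' l \<in> ?L" if "l \<in> ?L" for l using mgen_inv[OF Lb that] .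
  have inv1: "inv' l (l x) = x" "l (inv' l x) = x" if "l \<in> ?L" for l x
    using Lbij[OF that] by (simp_all add: bij_is_inj bij_is_surj surj_f_inv_f)
  have comm1: "l (r x) = r (l x)" if "l \<in> ?L" "r \<in> Rg" for l r x
    using that
  proof (induction arbitrary: x)
    case (mgen_step g f)
    then show ?case using comm[OF mgen_step(1) mgen_step(4), of "f x"] by simp
  qed simp
  have comm2: "l (r x) = r (l x)" if "r \<in> mgen Rg" "l \<in> ?L" for l r x
    using that
  proof (induction arbitrary: x)
    case (mgen_step g f)
    then show ?case using comm1[OF mgen_step(4) mgen_step(1), of "f x"] by simp
  qed simp
  have free: "l = id" if l: "l \<in> ?L" "l u = u" for l u
  proof -
    obtain r where r: "r \<in> mgen Rg" "r v0 = u" using orbR by blast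
    have "r (l v0) = r v0" using comm2[OF r(1) l(1), of v0] r(2) l(2) by simp
    then have l0: "l v0 = v0" using Rbij[OF r(1)] by (simp add: bij_is_inj inj_eq)
    show ?thesis
    proof
      fix v
      obtain r' where r': "r' \<in> mgen Rg" "r' v0 = v" using orbR by blast
      then show "l v = id v" using comm2[OF r'(1) l(1), of v0] l0 by simp
    qed
  qed
  have trans: "\<exists>l\<in>?L. l u = v" for u v
  proof -
    obtain k where k: "k \<in> ?L" "k v0 = u" using orbL by blast
    obtain k' where k': "k' \<in> ?L" "k' v0 = v" using orbL by blast
    have "(k' \<circ> inv' k) u = v" using k k' inv1(1)[OF k(1)] by auto
    then show ?thesis using mgen_comp[OF k'(1) Linv[OF k(1)]] by blast
  qed
  have eq: "l = l'" if "l \<in> ?L" "l' \<in> ?L" "l v0 = l' v0" for l l'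
  proof -
    have "inv' l \<circ> l' = id"
      by (rule free[OF mgen_comp[OF Linv[OF that(1)] that(2)], of v0]) (simp add: that(3)[symmetric] inv1 that(1))
    then have "l' x = l x" for x using inv1(2)[OF that(1), of "l' x"] by (simp add: fun_eq_iff)
    then show ?thesis by (simp add: fun_eq_iff)
  qed
  have cong: "\<kappa> (l u) = \<kappa> (l v)" if l: "l \<in> ?L" and uv: "\<kappa> u = \<kappa> v" for l u v
    using l
  proof induction
    case mgen_id
    show ?case using uv by (simp only: id_apply)
  next
    case (mgen_step g f)
    have "\<kappa> (g (f u)) = \<pi> g (\<kappa> (f u))" by (rule \<pi>[OF mgen_step(1), symmetric])
    also have "\<dots> = \<pi> g (\<kappa> (f v))" by (simp only: mgen_step.IH)
    also have "\<dots> = \<kappa> (g (f v))" by (rule \<pi>[OF mgen_step(1)])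
    finally show ?case by (simp only: comp_apply)
  qed
  define D where "D = {l \<in> ?L. \<tau> \<circ> l \<circ> \<tau> \<in> ?L}"
  have \<tau>_comp: "\<tau> \<circ> (l \<circ> l') \<circ> \<tau> = (\<tau> \<circ> l \<circ> \<tau>) \<circ> (\<tau> \<circ> l' \<circ> \<tau>)" for l l'
    by (simp add: fun_eq_iff \<tau>\<tau>)
  have DL: "l \<in> ?L" "\<tau> \<circ> l \<circ> \<tau> \<in> ?L" if "l \<in> D" for l
    using that by (simp_all only: D_def mem_Collect_eq)
  have DI: "l \<in> D" if "l \<in> ?L" "\<tau> \<circ> l \<circ> \<tau> \<in> ?L" for l
    using that by (simp only: D_def mem_Collect_eq simp_thms)
  have D_comp: "l \<circ> l' \<in> D" if "l \<in> D" "l' \<in> D" for l l'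
    using mgen_comp[OF DL(1)[OF that(1)] DL(1)[OF that(2)]]
      mgen_comp[OF DL(2)[OF that(1)] DL(2)[OF that(2)]]
    by (intro DI) (simp_all only: \<tau>_comp)
  have D_inv: "inv' l \<in> D" if l: "l \<in> D" for l
  proof -
    note l' = DL[OF l]
    have "inv' (\<tau> \<circ> l \<circ> \<tau>) = \<tau> \<circ> inv' l \<circ> \<tau>"
      by (intro inv_unique_comp) (simp_all add: fun_eq_iff \<tau>\<tau> inv1[OF l'(1)])
    then show ?thesis using Linv[OF l'(1)] Linv[OF l'(2)] by (intro DI) simp_all
  qed
  have BD: "b \<in> D" if "b \<in> mgen Bg" for b
    using that
  proof induction
    case mgen_id
    have "\<tau> \<circ> id \<circ> \<tau> = id" by (simp add: fun_eq_iff \<tau>\<tau>)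
    then show ?case by (intro DI) (simp_all only: mgen.mgen_id)
  next
    case (mgen_step g f)
    have "g \<in> D" by (rule DI[OF subsetD[OF Bg(1) mgen_step(1)] Bg(2)[OF mgen_step(1)]])
    then show ?case using mgen_step.IH by (rule D_comp)
  qed
  \<comment> \<open>By regularity an element of L is known from its value at \<open>v0\<close>, so
    one that preserves the label of \<open>v0\<close> equals an element of B.\<close>
  have fib: "l \<in> D" if lL: "l \<in> ?L" and fx: "\<kappa> (l v0) = \<kappa> v0" for l
  proof -
    obtain b where b: "b \<in> mgen Bg" "b v0 = l v0" using orbB[OF fx] by blast
    have "b = l" by (rule eq[OF DL(1)[OF BD[OF b(1)]] lL b(2)])
    then show ?thesis using BD[OF b(1)] by (simp only:)
  qed
  have w_notin: "w \<notin> D"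
  proof
    assume "w \<in> D"
    from comm1[OF DL(2)[OF this] w(2), of u] w(3) show False by (simp only: comp_apply)
  qed
  have "\<kappa> (l v0) = \<kappa> v0" if l: "l \<in> D" for l
  proof (rule ccontr)
    assume "\<kappa> (l v0) \<noteq> \<kappa> v0"
    from transB[OF this] obtain b where b: "b \<in> mgen Bg" "\<kappa> (b (w v0)) = \<kappa> (l v0)" by blast
    note lL = DL(1)[OF l] and bL = DL(1)[OF BD[OF b(1)]]
    \<comment> \<open>\<open>b\<close> moves the label of \<open>w v0\<close> to that of
      \<open>l v0\<close>, so \<open>k\<close> preserves the label of \<open>v0\<close> and lies in
      \<open>D\<close>. Then \<open>w\<close>, being the product of \<open>inv' b\<close>,
      \<open>l\<close> and \<open>k\<close>, lies in \<open>D\<close> too.\<close>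
    define k where "k = inv' l \<circ> (b \<circ> w)"
    have k: "k \<in> ?L" unfolding k_def by (rule mgen_comp[OF Linv[OF lL] mgen_comp[OF bL w(1)]])
    have "\<kappa> (k v0) = \<kappa> v0"
      using cong[OF Linv[OF lL] b(2)] inv1(1)[OF lL] by (simp add: k_def)
    then have "inv' b \<circ> (l \<circ> k) \<in> D"
      by (intro D_comp D_inv BD[OF b(1)] l fib[OF k])
    moreover have "inv' b \<circ> (l \<circ> k) = w"
      by (simp add: fun_eq_iff k_def inv1[OF lL] inv1[OF bL])
    ultimately show False using w_notin by (simp only: simp_thms)
  qed
  then have stab: "\<kappa> (l v0) = \<kappa> v0 \<longleftrightarrow> \<tau> \<circ> l \<circ> \<tau> \<in> ?L" if "l \<in> ?L" for l
    using fib[OF that] DI[OF that] DL(2)[of l] by blast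
  show ?thesis
  proof
    show "bij l" if "l \<in> ?L" for l by (rule Lbij[OF that])
    show "id \<in> ?L" by (rule mgen_id)
    show "l \<circ> l' \<in> ?L" if "l \<in> ?L" "l' \<in> ?L" for l l' by (rule mgen_comp[OF that])
    show "\<exists>l\<in>?L. l u = v" for u v by (rule trans)
    show "l = id" if "l \<in> ?L" "l u = u" for l u by (rule free[OF that])
    show "\<tau> \<circ> \<tau> = id" by (simp add: fun_eq_iff \<tau>\<tau>)
    show "\<kappa> (l u) = \<kappa> (l v)" if "l \<in> ?L" "\<kappa> u = \<kappa> v" for l u v by (rule cong[OF that])
    show "\<kappa> (l v0) = \<kappa> v0 \<longleftrightarrow> \<tau> \<circ> l \<circ> \<tau> \<in> ?L" if "l \<in> ?L" for l by (rule stab[OF that])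
  qed (fact A)+
qed

lemma carrier_from_gens:
  fixes \<kappa> :: "'v \<Rightarrow> nat"
  assumes \<pi>: "\<And>l v. l \<in> Lg \<Longrightarrow> \<pi> l (\<kappa> v) = \<kappa> (l v)" "\<And>l k. l \<in> Lg \<Longrightarrow> k \<notin> A \<Longrightarrow> \<pi> l k = k"
    and A: "range \<kappa> = A"
  shows "(\<lambda>l k. if k \<in> A then \<kappa> (l (SOME v. \<kappa> v = k)) else k) ` mgen Lg = mgen (\<pi> ` Lg)"
    (is "?pr ` _ = _")
proof -
  have s: "\<kappa> (SOME v. \<kappa> v = k) = k" if "k \<in> A" for k
    by (rule someI_ex[of "\<lambda>v. \<kappa> v = k"]) (use A that in auto)
  have id: "?pr id = id" using s by (auto simp: fun_eq_iff)
  have step: "?pr (g \<circ> f) = \<pi> g \<circ> ?pr f" if "g \<in> Lg" for g f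
    using \<pi>(1)[OF that] \<pi>(2)[OF that] by (auto simp: fun_eq_iff)
  show ?thesis
  proof
    show "?pr ` mgen Lg \<subseteq> mgen (\<pi> ` Lg)"
    proof
      fix f assume "f \<in> ?pr ` mgen Lg"
      then obtain l where l: "l \<in> mgen Lg" "f = ?pr l" by blast
      from l(1) have "?pr l \<in> mgen (\<pi> ` Lg)"
      proof induction
        case mgen_id
        show ?case unfolding id by (rule mgen.mgen_id)
      next
        case (mgen_step g f)
        then show ?case unfolding step[OF mgen_step(1)] by (intro mgen.mgen_step) auto
      qed
      then show "f \<in> mgen (\<pi> ` Lg)" unfolding l(2) .
    qed
    show "mgen (\<pi> ` Lg) \<subseteq> ?pr ` mgen Lg"
    proof
      fix f assume "f \<in> mgen (\<pi> ` Lg)"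
      then show "f \<in> ?pr ` mgen Lg"
      proof induction
        case mgen_id
        show ?case by (rule image_eqI[where x = id], rule id[symmetric], rule mgen.mgen_id)
      next
        case (mgen_step g f)
        then obtain l h where lh: "l \<in> Lg" "g = \<pi> l" "h \<in> mgen Lg" "f = ?pr h" by blast
        show ?case unfolding lh(2,4) step[OF lh(1), symmetric]
          by (rule imageI[OF mgen.mgen_step[OF lh(1,3)]])
      qed
    qed
  qed
qed

text \<open>The flag \<open>ev\<close> treats the alternating and the symmetric group at once;
  renumbering the points by a bijection preserves parity.\<close>

lemma carrier_alt_sym:
  fixes F :: "('v \<Rightarrow> 'v) set"
  assumes fin: "finite S" and card: "card S = n"
    and R: "R = {p. p permutes S \<and> (ev \<longrightarrow> evenperm p)}"
    and K: "(\<lambda>b. restrict_id b S) ` K = R"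
  shows "\<exists>f. bij_betw f S {1..n} \<and> carrier (if ev then alt_group n else sym_group n) =
     (\<lambda>b k. if k \<in> {1..n} then f (b (inv_into S f k)) else k) ` K"
proof -
  obtain f where f: "bij_betw f S {1..n}"
    using finite_same_card_bij[OF fin, of "{1..n}"] card by auto
  have inv: "inv_into S f k \<in> S" if "k \<in> {1..n}" for k
    using f that by (metis bij_betw_def inv_into_into)
  have mp: "(\<lambda>k. if k \<in> {1..n} then f (b (inv_into S f k)) else k) =
      map_permutation S f (restrict_id b S)" for b
    using f inv by (auto simp: map_permutation_def restrict_id_def bij_betw_def fun_eq_iff)
  have "(\<lambda>b k. if k \<in> {1..n} then f (b (inv_into S f k)) else k) ` K = map_permutation S f ` R"
    unfolding K[symmetric] image_image mp ..
  also have "map_permutation S f ` R = carrier (if ev then alt_group n else sym_group n)"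
  proof
    have inj: "inj_on f S" using f by (simp add: bij_betw_def)
    show "map_permutation S f ` R \<subseteq> carrier (if ev then alt_group n else sym_group n)"
      using map_permutation_permutes[OF f] evenperm_map_permutation[OF inj _ fin]
      by (auto simp: R alt_group_carrier sym_group_carrier)
    show "carrier (if ev then alt_group n else sym_group n) \<subseteq> map_permutation S f ` R"
    proof
      fix q assume q: "q \<in> carrier (if ev then alt_group n else sym_group n)"
      then have q': "q permutes {1..n}" "ev \<longrightarrow> evenperm q"
        by (auto simp: alt_group_carrier sym_group_carrier split: if_splits)
      have g: "bij_betw (inv_into S f) {1..n} S" using f by (rule bij_betw_inv_into)
      define p where "p = map_permutation {1..n} (inv_into S f) q"
      have "p permutes S" unfolding p_def using map_permutation_permutes[OF g q'(1)] .
      moreover have "evenperm p \<longleftrightarrow> evenperm q"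
        unfolding p_def using g q'(1) by (intro evenperm_map_permutation) (auto simp: bij_betw_def)
      moreover have "map_permutation S f p = q"
        unfolding p_def by (rule map_permutation_compose_inv[OF g q'(1)])
          (use f in \<open>metis bij_betw_inv_into_right\<close>)
      ultimately show "q \<in> map_permutation S f ` R" using q'(2) by (auto simp: R)
    qed
  qed
  finally show ?thesis by (intro exI[of _ f] conjI f) (rule sym)
qed

theorem (in coset_graph) lattice_complete:
  assumes n: "card (UNIV :: 'v set) = n + 1" "0 < n"
    and P: "monoid.mult P = (\<circ>)" "bij_betw \<phi> A B"
      "carrier P = (\<lambda>l k. if k \<in> B then \<phi> (\<kappa> (l (SOME v. \<phi> (\<kappa> v) = k))) else k) ` L"
    and F: "\<And>f. f \<in> F \<longleftrightarrow> bij f \<and> (ev \<longrightarrow> evenperm f)"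
  shows "\<exists>\<Gamma>. regular_reducible_lattice (card A) n P B (if ev then alt_group n else sym_group n) {1..n} \<Gamma>"
proof (rule lattice_exists[where E = "\<lambda>v. UNIV - {v}"])
  show "card (UNIV - {v}) = n" for v :: 'v using n by (simp add: card_Diff_singleton)
  show "Z = UNIV" if Z: "v0 \<in> Z" "\<And>v. v \<in> Z \<Longrightarrow> UNIV - {v} \<subseteq> Z" for Z using Z(2)[OF Z(1)] Z(1) by auto
  show "f ` (UNIV - {v}) \<subseteq> UNIV - {f v}" if "f \<in> F" for f v
    using F_bij[OF that] by (auto simp: bij_is_inj inj_eq)
  show "monoid.mult (if ev then alt_group n else sym_group n) = (\<circ>)"
    by (simp add: alt_group_mult sym_group_mult)
  fix y
  show "\<exists>f. bij_betw f (UNIV - {y}) {1..n} \<and> carrier (if ev then alt_group n else sym_group n) =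
     (\<lambda>b k. if k \<in> {1..n} then f (b (inv_into (UNIV - {y}) f k)) else k) ` {b \<in> F. b y = y}"
  proof (rule carrier_alt_sym)
    show "card (UNIV - {y}) = n" using n by (simp add: card_Diff_singleton)
    have r: "restrict_id b (UNIV - {y}) = b" if "b y = y" for b
      using that by (auto simp: restrict_id_def fun_eq_iff)
    have "(\<lambda>b. restrict_id b (UNIV - {y})) ` {b \<in> F. b y = y} = {b \<in> F. b y = y}"
      using r by force
    also have "\<dots> = {p. p permutes (UNIV - {y}) \<and> (ev \<longrightarrow> evenperm p)}"
    proof -
      have "p permutes (UNIV - {y}) \<longleftrightarrow> bij p \<and> p y = y" for p
        by (auto simp: permutes_def bij_iff)
      then show ?thesis using F by auto
    qed
    finally show "(\<lambda>b. restrict_id b (UNIV - {y})) ` {b \<in> F. b y = y} =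
      {p. p permutes (UNIV - {y}) \<and> (ev \<longrightarrow> evenperm p)}" .
  qed simp_all
qed (use P in auto)

section \<open>Lattices from explicit generators\<close>

lemma bij_funpow_id:
  assumes "\<And>x. (g ^^ Suc k) x = x"
  shows "bij g"
proof -
  have "g \<circ> g ^^ k = id" "g ^^ k \<circ> g = id"
    using assms by (auto simp: fun_eq_iff funpow_swap1)
  then show ?thesis by (intro o_bij)
qed

section \<open>Parity of permutations of a finite type\<close>

lemma bij_permutes_UNIV: "bij p \<Longrightarrow> p permutes UNIV"
  by (rule bij_imp_permutes) simp_all

lemma permutation_bij: "bij (p :: 'v::finite \<Rightarrow> 'v) \<Longrightarrow> permutation p"
  by (rule permutes_imp_permutation[of UNIV]) (simp_all add: bij_permutes_UNIV)

text \<open>An involution moving 2k points is a product of k transpositions; one of them is split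
  off in each step of the induction.\<close>

lemma evenperm_involution_aux:
  fixes p :: "'v::finite \<Rightarrow> 'v"
  assumes "\<And>x. p (p x) = x"
  shows "\<exists>k. card {x. p x \<noteq> x} = 2 * k \<and> (evenperm p \<longleftrightarrow> even k)"
  using assms
proof (induction "card {x. p x \<noteq> x}" arbitrary: p rule: less_induct)
  case less
  show ?case
  proof (cases "p = id")
    case True
    have "card {x. p x \<noteq> x} = 0" unfolding True by simp
    moreover have "evenperm p" unfolding True by (rule evenperm_id[THEN iffD2, OF TrueI])
    ultimately show ?thesis by (intro exI[of _ 0]) simp
  next
    case False
    then obtain a where a: "p a \<noteq> a" by (auto simp: fun_eq_iff)
    define b where "b = p a"
    have ab: "a \<noteq> b" "p a = b" "p b = a" using a less.prems by (auto simp: b_def)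
    define q where "q = Transposition.transpose a b \<circ> p"
    have p_ab: "p x \<noteq> a \<and> p x \<noteq> b" if "x \<noteq> a" "x \<noteq> b" for x
      using that ab less.prems by metis
    have q: "q a = a" "q b = b" "q x = p x" if "x \<noteq> a" "x \<noteq> b" for x
      using ab p_ab[OF that] by (simp_all add: q_def)
    then have q': "q x = (if x = a then a else if x = b then b else p x)" for x
      using ab by (auto simp: q_def)
    have invol: "q (q x) = x" for x using p_ab[of x] less.prems[of x] by (simp add: q')
    have set: "{x. p x \<noteq> x} = insert a (insert b {x. q x \<noteq> x})" using ab by (auto simp: q')
    have card: "card {x. p x \<noteq> x} = card {x. q x \<noteq> x} + 2"
      unfolding set using ab by (simp add: q')
    obtain k where k: "card {x. q x \<noteq> x} = 2 * k" "evenperm q \<longleftrightarrow> even k"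
      using less.hyps[of q] card invol by auto
    have "bij p" using less.prems by (intro o_bij[where g = p]) (auto simp: fun_eq_iff)
    then have "evenperm q \<longleftrightarrow> \<not> evenperm p"
      unfolding q_def using ab(1)
      by (subst evenperm_comp) (auto simp: permutation_bij evenperm_swap permutation_swap_id)
    then show ?thesis using k card by (intro exI[of _ "Suc k"]) auto
  qed
qed

lemma evenperm_involution:
  fixes p :: "'v::finite \<Rightarrow> 'v"
  assumes "\<And>x. p (p x) = x"
  shows "evenperm p \<longleftrightarrow> 4 dvd card {x. p x \<noteq> x}"
proof -
  obtain k where k: "card {x. p x \<noteq> x} = 2 * k" "evenperm p \<longleftrightarrow> even k"
    using evenperm_involution_aux[OF assms] by blast
  have "4 dvd 2 * k \<longleftrightarrow> even k" by presburger
  then show ?thesis using k by simp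
qed

definition act :: "('v \<Rightarrow> 'v) list \<Rightarrow> 'v \<Rightarrow> 'v" where
  "act fs x = foldr (\<lambda>f. f) fs x"

lemma act_simps [simp]: "act [] x = x" "act (f # fs) x = f (act fs x)"
  by (simp_all add: act_def)

lemma act_in_mgen: "set fs \<subseteq> G \<Longrightarrow> act fs \<in> mgen G"
proof (induction fs)
  case Nil
  have "act [] = (id :: 'a \<Rightarrow> 'a)" by (simp add: fun_eq_iff)
  then show ?case by (simp only: mgen_id)
next
  case (Cons f fs)
  have "act (f # fs) = f \<circ> act fs" by (simp add: fun_eq_iff)
  then show ?case by (simp only:) (rule mgen_step; use Cons in simp)
qed

definition orb :: "('v \<Rightarrow> 'v) set \<Rightarrow> 'v \<Rightarrow> 'v set" where
  "orb G v = (\<lambda>h. h v) ` mgen G"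

lemma orb_self: "v \<in> orb G v"
  unfolding orb_def by (rule image_eqI[OF _ mgen_id]) simp

lemma orb_step: "u \<in> orb G v \<Longrightarrow> g \<in> G \<Longrightarrow> g u \<in> orb G v"
proof -
  assume "u \<in> orb G v" and g: "g \<in> G"
  then obtain h where h: "h \<in> mgen G" "u = h v" by (auto simp: orb_def)
  show ?thesis unfolding orb_def
    by (rule image_eqI[OF _ mgen_step[OF g h(1)]]) (simp add: h(2))
qed

lemma mgen_transpositions:
  assumes "finite A" and G: "\<And>g. g \<in> G \<Longrightarrow> g permutes A"
    and t: "\<And>a b. a \<in> A \<Longrightarrow> b \<in> A \<Longrightarrow> a \<noteq> b \<Longrightarrow> Transposition.transpose a b \<in> mgen G"
  shows "mgen G = {p. p permutes A}"
proof
  show "mgen G \<subseteq> {p. p permutes A}"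
  proof
    fix f assume "f \<in> mgen G"
    then show "f \<in> {p. p permutes A}"
    proof induction
      case mgen_id
      show ?case by (simp only: permutes_id mem_Collect_eq)
    next
      case (mgen_step g f)
      then show ?case using G permutes_compose by blast
    qed
  qed
  show "{p. p permutes A} \<subseteq> mgen G"
  proof
    fix p assume "p \<in> {p. p permutes A}"
    then have "p permutes A" by simp
    then show "p \<in> mgen G" using \<open>finite A\<close>
    proof (induction rule: permutes_induct)
      case (swap a b p)
      then show ?case using mgen_comp t by blast
    qed (rule mgen_id)
  qed
qed

text \<open>The hypotheses of \<open>coset_graphI\<close> in terms of finite lists of generators, a
  form that evaluation can check on small types. \<open>LP\<close> pairs each generator of L with
  the permutation that it induces on the labels. A word \<open>ls\<close> witnesses that the
  conjugate of a generator of B by \<tau> is in L.\<close>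

locale gen_data =
  fixes LP :: "(('v::finite \<Rightarrow> 'v) \<times> (nat \<Rightarrow> nat)) list" and Rg Bg :: "('v \<Rightarrow> 'v) list"
    and \<tau> w :: "'v \<Rightarrow> 'v" and v0 :: 'v and \<kappa> :: "'v \<Rightarrow> nat" and A :: "nat set"
  assumes L_all: "list_all (\<lambda>(l, \<rho>). bij l \<and> (\<forall>v. \<rho> (\<kappa> v) = \<kappa> (l v)) \<and> (\<forall>k. k \<notin> A \<longrightarrow> \<rho> k = k)) LP"
    and R_all: "list_all bij Rg"
    and comm_all: "list_all (\<lambda>l. list_all (\<lambda>r. \<forall>x. l (r x) = r (l x)) Rg) (map fst LP)"
    and orbL: "orb (fst ` set LP) v0 = UNIV" and orbR: "orb (set Rg) v0 = UNIV"
    and invol: "\<And>x. \<tau> (\<tau> x) = x"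
    and B_subset: "set Bg \<subseteq> fst ` set LP"
    and B_all: "list_all (\<lambda>b. \<exists>ls. set ls \<subseteq> fst ` set LP \<and> (\<forall>x. \<tau> (b (\<tau> x)) = act ls x)) Bg"
    and orbB: "\<And>v. \<kappa> v = \<kappa> v0 \<Longrightarrow> v \<in> orb (set Bg) v0"
    and w: "w \<in> fst ` set LP" "\<exists>r\<in>set Rg. \<exists>u. \<tau> (w (\<tau> (r u))) \<noteq> r (\<tau> (w (\<tau> u)))"
      "\<And>v. \<kappa> v \<noteq> \<kappa> v0 \<Longrightarrow> \<exists>u\<in>orb (set Bg) (w v0). \<kappa> u = \<kappa> v"
    and A: "range \<kappa> = A" "1 < card A"
begin

lemma L: "(l, \<rho>) \<in> set LP \<Longrightarrow> bij l \<and> (\<forall>v. \<rho> (\<kappa> v) = \<kappa> (l v)) \<and> (\<forall>k. k \<notin> A \<longrightarrow> \<rho> k = k)"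
  using L_all by (auto simp: list_all_iff)

lemma R: "r \<in> set Rg \<Longrightarrow> bij r"
  using R_all by (auto simp: list_all_iff)

lemma comm: "l \<in> fst ` set LP \<Longrightarrow> r \<in> set Rg \<Longrightarrow> l (r x) = r (l x)"
  using comm_all by (auto simp: list_all_iff)

lemma B: "b \<in> set Bg \<Longrightarrow> \<exists>ls. set ls \<subseteq> fst ` set LP \<and> (\<forall>x. \<tau> (b (\<tau> x)) = act ls x)"
  using B_all by (auto simp: list_all_iff)

definition "Lg = fst ` set LP"

definition "\<pi> l k = (if k \<in> A then \<kappa> (l (SOME v. \<kappa> v = k)) else k)"

lemma \<pi>_eq: "(l, \<rho>) \<in> set LP \<Longrightarrow> \<pi> l = \<rho>"
proof
  assume l: "(l, \<rho>) \<in> set LP"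
  fix k
  show "\<pi> l k = \<rho> k"
  proof (cases "k \<in> A")
    case True
    then have "\<kappa> (SOME v. \<kappa> v = k) = k" using A(1) by (intro someI_ex[of "\<lambda>v. \<kappa> v = k"]) auto
    then show ?thesis using L[OF l] True by (metis \<pi>_def)
  qed (use L[OF l] in \<open>simp add: \<pi>_def\<close>)
qed

lemma \<pi>_Lg: "l \<in> Lg \<Longrightarrow> \<pi> l (\<kappa> v) = \<kappa> (l v)" "l \<in> Lg \<Longrightarrow> k \<notin> A \<Longrightarrow> \<pi> l k = k"
  using \<pi>_eq L unfolding Lg_def by fastforce+

lemma \<pi>_image: "\<pi> ` Lg = snd ` set LP"
  using \<pi>_eq unfolding Lg_def by force

sublocale coset_graph "mgen Lg" \<tau> \<kappa> v0 A
proof -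
  obtain r u where r: "r \<in> set Rg" "\<tau> (w (\<tau> (r u))) \<noteq> r (\<tau> (w (\<tau> u)))" using w(2) by blast
  show "coset_graph (mgen Lg) \<tau> \<kappa> v0 A"
  proof (rule coset_graphI[where Rg = "set Rg" and Bg = "set Bg" and w = w and r = r and u = u and \<pi> = \<pi>])
    show "bij l" if "l \<in> Lg" for l using that L unfolding Lg_def by fastforce
    show "l (r x) = r (l x)" if "l \<in> Lg" "r \<in> set Rg" for l r x
      using comm that unfolding Lg_def by blast
    show "\<exists>l\<in>mgen Lg. l v0 = v" for v
      using orbL unfolding orb_def Lg_def by (metis UNIV_I imageE)
    show "\<exists>r\<in>mgen (set Rg). r v0 = v" for v
      using orbR unfolding orb_def by (metis UNIV_I imageE)
    show "set Bg \<subseteq> mgen Lg" using B_subset mgen_incl unfolding Lg_def by blast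
    show "\<tau> \<circ> b \<circ> \<tau> \<in> mgen Lg" if b: "b \<in> set Bg" for b
    proof -
      obtain ls where ls: "set ls \<subseteq> Lg" "\<forall>x. \<tau> (b (\<tau> x)) = act ls x"
        using B[OF b] unfolding Lg_def by blast
      have "\<tau> \<circ> b \<circ> \<tau> = act ls" using ls(2) by (simp add: fun_eq_iff)
      then show ?thesis using act_in_mgen[OF ls(1)] by simp
    qed
    show "\<exists>b\<in>mgen (set Bg). b v0 = v" if "\<kappa> v = \<kappa> v0" for v
      using orbB[OF that] unfolding orb_def by blast
    show "w \<in> mgen Lg" using w(1) mgen_incl unfolding Lg_def by blast
    show "\<exists>b\<in>mgen (set Bg). \<kappa> (b (w v0)) = \<kappa> v" if "\<kappa> v \<noteq> \<kappa> v0" for v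
      using w(3)[OF that] unfolding orb_def by blast
    show "\<pi> l (\<kappa> v) = \<kappa> (l v)" if "l \<in> Lg" for l v using \<pi>_Lg(1)[OF that] .
  qed (use R r invol A in auto)
qed

lemma F_eq: "F = mgen (insert \<tau> Lg)"
  unfolding F_def
proof
  have "mgen Lg \<subseteq> mgen (insert \<tau> Lg)" by (rule mgen_least) (auto intro: mgen_incl)
  then show "mgen (insert \<tau> (mgen Lg)) \<subseteq> mgen (insert \<tau> Lg)"
    by (intro mgen_least) (auto intro: mgen_incl)
  show "mgen (insert \<tau> Lg) \<subseteq> mgen (insert \<tau> (mgen Lg))"
    by (rule mgen_least) (auto intro: mgen_incl)
qed

lemma act_in_F: "set fs \<subseteq> insert \<tau> Lg \<Longrightarrow> act fs \<in> F"
  unfolding F_eq by (rule act_in_mgen)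

lemma carrier_P:
  "(\<lambda>l k. if k \<in> A then \<kappa> (l (SOME v. \<kappa> v = k)) else k) ` mgen Lg = mgen (snd ` set LP)"
  unfolding \<pi>_image[symmetric] by (rule carrier_from_gens) (use \<pi>_Lg A in auto)

sublocale F: perm_group F
  using F_bij F_id F_comp F_inv by unfold_locales

text \<open>The 3-cycle and the links put the alternating group of V into \<open>F\<close>. The
  parity of the generators then decides between the alternating and the symmetric group.\<close>

theorem complete_lattice:
  assumes P: "monoid.mult P = (\<circ>)" "carrier P = mgen (snd ` set LP)" and m: "card A = m"
    and n: "card (UNIV :: 'v set) = n + 1" "0 < n"
    and cyc: "cyc3 c d e \<in> F" "distinct [c, d, e]"
    and link: "\<And>g. g \<in> Lg \<Longrightarrow> \<exists>fs. set fs \<subseteq> insert \<tau> Lg \<and> act fs c = v0 \<and> act fs d = g v0"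
    and parity: "if ev then \<forall>g\<in>insert \<tau> Lg. evenperm g else \<exists>g\<in>insert \<tau> Lg. \<not> evenperm g"
  shows "\<exists>\<Gamma>. regular_reducible_lattice m n P A (if ev then alt_group n else sym_group n) {1..n} \<Gamma>"
proof -
  have alt: "p \<in> F" if "bij p" "evenperm p" for p
  proof (rule F.evenperm_in_F[OF _ cyc, of Lg v0])
    show "Lg \<subseteq> F" unfolding F_eq by (auto intro: mgen_incl)
    show "\<exists>f\<in>F. f c = v0 \<and> f d = g v0" if "g \<in> Lg" for g using link[OF that] act_in_F by blast
    have "(\<lambda>h. h v0) ` mgen Lg = UNIV" using orbL by (simp add: orb_def Lg_def)
    then show "p permutes (\<lambda>h. h v0) ` mgen Lg" using that(1) by (simp add: bij_permutes_UNIV)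
  qed (use that in simp_all)
  have perm: "permutation p" if "p \<in> F" for p using F_bij[OF that] by (rule permutation_bij)
  have F_iff: "f \<in> F \<longleftrightarrow> bij f \<and> (ev \<longrightarrow> evenperm f)" for f
  proof (cases ev)
    case True
    have "evenperm f" if "f \<in> mgen (insert \<tau> Lg)" for f
      using that
    proof induction
      case mgen_id
      show ?case by (simp only: evenperm_id)
    next
      case (mgen_step g f)
      then have gf: "g \<in> F" "f \<in> F" unfolding F_eq by (auto intro: mgen_incl)
      have "evenperm (g \<circ> f)"
        using evenperm_comp[OF perm[OF gf(1)] perm[OF gf(2)]] mgen_step parity True by auto
      then show ?case by (simp only: comp_def)
    qed
    then show ?thesis using alt F_bij True unfolding F_eq by blast
  next
    case False
    then obtain g where g: "g \<in> F" "\<not> evenperm g"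
      using parity unfolding F_eq by (auto intro: mgen_incl)
    have "f \<in> F" if f: "bij f" for f
    proof (cases "evenperm f")
      case False
      have "bij (g \<circ> f)" "evenperm (g \<circ> f)"
        using bij_comp[OF f F_bij[OF g(1)]] evenperm_comp[OF perm[OF g(1)] permutation_bij[OF f]] g False
        by simp_all
      then have "inv' g \<circ> (g \<circ> f) \<in> F" using alt F_comp F_inv[OF g(1)] by blast
      then show ?thesis using F_inv_comp(1)[OF g(1)] by (simp add: comp_assoc[symmetric])
    qed (rule alt[OF f])
    then show ?thesis using False F_bij by blast
  qed
  have "\<exists>\<Gamma>. regular_reducible_lattice (card A) n P A (if ev then alt_group n else sym_group n) {1..n} \<Gamma>"
  proof (rule lattice_complete[where \<phi> = "\<lambda>k. k"])
    show "bij_betw (\<lambda>k. k) A A" using bij_betw_id[of A] by (simp add: id_def)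
    show "carrier P = (\<lambda>l k. if k \<in> A then \<kappa> (l (SOME v. \<kappa> v = k)) else k) ` mgen Lg"
      unfolding P(2) carrier_P ..
  qed (use n P(1) F_iff in auto)
  then show ?thesis by (simp only: m)
qed

end

lemma linkI:
  "set fs \<subseteq> S \<Longrightarrow> act fs c = u \<Longrightarrow> act fs d = v \<Longrightarrow>
     \<exists>fs. set fs \<subseteq> S \<and> act fs c = u \<and> act fs d = v"
  by blast

theorem complete_graph_lattice:
  fixes LP :: "(('v::finite \<Rightarrow> 'v) \<times> (nat \<Rightarrow> nat)) list"
  assumes data: "gen_data LP Rg Bg \<tau> w v0 \<kappa> A"
    and P: "monoid.mult P = (\<circ>)" "carrier P = mgen (snd ` set LP)" and m: "card A = m"
    and n: "card (UNIV :: 'v set) = n + 1" "0 < n"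
    and word: "set ws \<subseteq> insert \<tau> (fst ` set LP)" "act ws c = d" "act ws d = e" "act ws e = c"
      "distinct [c, d, e]"
    and M: "\<not> 3 dvd M" "\<And>x. x \<notin> {c, d, e} \<Longrightarrow> \<exists>l. l dvd M \<and> (act ws ^^ l) x = x"
    and link: "list_all (\<lambda>g. \<exists>fs. set fs \<subseteq> insert \<tau> (fst ` set LP) \<and> act fs c = v0 \<and> act fs d = g v0)
      (map fst LP)"
    and parity: "if ev then list_all evenperm (\<tau> # map fst LP) else \<not> list_all evenperm (\<tau> # map fst LP)"
  shows "\<exists>\<Gamma>. regular_reducible_lattice m n P A (if ev then alt_group n else sym_group n) {1..n} \<Gamma>"
proof -
  interpret gen_data LP Rg Bg \<tau> w v0 \<kappa> A by fact
  have word': "set ws \<subseteq> insert \<tau> Lg" using word(1) by (simp add: Lg_def)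
  show ?thesis
  proof (rule complete_lattice[OF P m n])
    show "cyc3 c d e \<in> F"
      by (rule F.cyc3_from_word[OF act_in_F[OF word'] word(2-5) M])
    show "\<exists>fs. set fs \<subseteq> insert \<tau> Lg \<and> act fs c = v0 \<and> act fs d = g v0" if "g \<in> Lg" for g
      using link that by (auto simp: Lg_def list_all_iff)
    show "if ev then \<forall>g\<in>insert \<tau> Lg. evenperm g else \<exists>g\<in>insert \<tau> Lg. \<not> evenperm g"
      using parity by (auto simp: Lg_def list_all_iff split: if_splits)
  qed (rule word(5))
qed

section \<open>Evaluation of finite data\<close>

primrec pows :: "('v \<Rightarrow> 'v) \<Rightarrow> nat \<Rightarrow> 'v list \<Rightarrow> 'v list" where
  "pows g 0 xs = xs"
| "pows g (Suc k) xs = xs @ pows g k (map g xs)"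

text \<open>Sweeps out an orbit: each entry adds the translates of the list under the powers of one
  generator up to the given exponent. All listed points lie in the orbit, so transitivity becomes a
  membership test.\<close>

fun spread :: "(('v \<Rightarrow> 'v) \<times> nat) list \<Rightarrow> 'v list \<Rightarrow> 'v list" where
  "spread [] xs = xs"
| "spread ((g, k) # gs) xs = spread gs (pows g k xs)"

lemma pows_orb: "g \<in> G \<Longrightarrow> set xs \<subseteq> orb G v \<Longrightarrow> set (pows g k xs) \<subseteq> orb G v"
proof (induction k arbitrary: xs)
  case (Suc k)
  have "set (map g xs) \<subseteq> orb G v" using Suc.prems orb_step by fastforce
  then show ?case using Suc.IH[OF Suc.prems(1)] Suc.prems(2) by simp
qed simp

lemma spread_orb: "fst ` set gs \<subseteq> G \<Longrightarrow> set xs \<subseteq> orb G v \<Longrightarrow> set (spread gs xs) \<subseteq> orb G v"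
  by (induction gs xs rule: spread.induct) (auto simp: pows_orb)

lemma spread_orb_single: "fst ` set gs \<subseteq> G \<Longrightarrow> u \<in> set (spread gs [v]) \<Longrightarrow> u \<in> orb G v"
  using spread_orb[of gs G "[v]" v] orb_self[of v G] by auto

lemma orb_UNIV_spread:
  assumes "fst ` set gs \<subseteq> G" "\<forall>x. x \<in> set (spread gs [v])"
  shows "orb G v = UNIV"
  using spread_orb_single[OF assms(1)] assms(2) by blast

text \<open>Iteration driven by the constructors of the binary numeral, so that evaluation needs no
  arithmetic on \<open>nat\<close>.\<close>

fun it :: "num \<Rightarrow> ('v \<Rightarrow> 'v) \<Rightarrow> 'v \<Rightarrow> 'v" where
  "it Num.One f x = f x"
| "it (Num.Bit0 n) f x = it n f (it n f x)"
| "it (Num.Bit1 n) f x = f (it n f (it n f x))"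

lemma it_eq: "it n f x = (f ^^ numeral n) x"
proof (induction n f x rule: it.induct)
  case (2 n f x)
  then show ?case by (simp only: it.simps numeral_Bit0 funpow_add comp_apply)
next
  case (3 n f x)
  have "numeral (num.Bit1 n) = Suc (numeral n + numeral n)" by (simp only: numeral_Bit1 Suc_eq_plus1)
  then show ?case using 3 by (simp only: it.simps funpow.simps funpow_add comp_apply)
qed simp

text \<open>\<open>id\<close> appears because some generators of L act trivially on the
  labels.\<close>

lemma sym3_mgen:
  "carrier (sym_group 3) =
     mgen {Transposition.transpose 1 2, Transposition.transpose 2 3, id}"
    (is "_ = mgen ?G")
proof -
  have t: "Transposition.transpose (1::nat) 2 \<in> mgen ?G" "Transposition.transpose (2::nat) 3 \<in> mgen ?G"
    by (auto intro: mgen_incl)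
  have eq: "Transposition.transpose (1::nat) 3 =
      Transposition.transpose 1 2 \<circ> (Transposition.transpose 2 3 \<circ> Transposition.transpose 1 2)"
    by (auto simp: fun_eq_iff Transposition.transpose_def)
  have t13: "Transposition.transpose (1::nat) 3 \<in> mgen ?G"
    unfolding eq by (intro mgen_comp t)
  have "mgen ?G = {p. p permutes {1..3}}"
  proof (rule mgen_transpositions)
    fix a b :: nat assume ab: "a \<in> {1..3}" "b \<in> {1..3}" "a \<noteq> b"
    then have "a \<in> {1, 2, 3}" "b \<in> {1, 2, 3}" by auto
    then show "Transposition.transpose a b \<in> mgen ?G"
      using t t13 ab(3) by (auto simp: transpose_commute)
  next
    fix g assume "g \<in> ?G"
    then show "g permutes {1..3}"
      by (auto intro: permutes_swap_id permutes_id simp del: id_apply)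
  qed simp
  then show ?thesis by (auto simp: sym_group_carrier)
qed

lemma card_enum: "card {x :: 'a::enum. P x} = length (filter P Enum.enum)"
proof -
  have "{x. P x} = set (filter P Enum.enum)" by (simp add: enum_UNIV)
  then show ?thesis by (simp only: distinct_card distinct_filter enum_distinct)
qed

lemma bij_it: "\<forall>x. it k f x = x \<Longrightarrow> bij f"
  unfolding it_eq numeral_eq_Suc by (rule bij_funpow_id) blast

lemma orb_ex_spread:
  assumes "fst ` set gs \<subseteq> G" "\<exists>u\<in>set (spread gs [v]). P u"
  shows "\<exists>u\<in>orb G v. P u"
proof -
  from assms(2) obtain u where u: "u \<in> set (spread gs [v])" "P u" ..
  show ?thesis by (rule bexI[of P, OF u(2)], rule spread_orb_single[OF assms(1) u(1)])
qed

lemma evenperm_involution_enum: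
  fixes f :: "'v::enum \<Rightarrow> 'v"
  assumes "\<forall>x. f (f x) = x"
  shows "evenperm f \<longleftrightarrow> 4 dvd length (filter (\<lambda>x. f x \<noteq> x) Enum.enum)"
  using evenperm_involution[of f] assms card_enum[of "\<lambda>x. f x \<noteq> x"] by simp

lemma evenperm_odd_order:
  fixes f :: "'v::finite \<Rightarrow> 'v"
  assumes "\<forall>x. it (num.Bit1 k) f x = x"
  shows "evenperm f"
proof -
  have f: "bij f" using assms by (rule bij_it)
  have pow: "bij (f ^^ j) \<and> (evenperm (f ^^ j) \<longleftrightarrow> evenperm f \<or> even j)" for j
  proof (induction j)
    case 0
    show ?case by (simp only: funpow.simps bij_id evenperm_id even_zero simp_thms)
  next
    case (Suc j)
    have eq: "f ^^ Suc j = f \<circ> f ^^ j" by (simp only: funpow.simps)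
    have "bij (f \<circ> f ^^ j)" by (rule bij_comp[OF conjunct1[OF Suc.IH] f])
    moreover have "evenperm (f \<circ> f ^^ j) \<longleftrightarrow> evenperm f = evenperm (f ^^ j)"
      by (rule evenperm_comp[OF permutation_bij[OF f] permutation_bij[OF conjunct1[OF Suc.IH]]])
    ultimately show ?case using Suc.IH unfolding eq even_Suc by blast
  qed
  have "f ^^ numeral (num.Bit1 k) = id" using assms unfolding it_eq by (intro ext) (simp only: id_apply)
  then have "evenperm (f ^^ numeral (num.Bit1 k))" by (simp only: evenperm_id)
  then show ?thesis using pow[of "numeral (num.Bit1 k)"] by simp
qed

section \<open>The affine group of the field with five elements\<close>

definition "dbl5 x = (if x < 5 then 2 * x mod 5 else x :: nat)"
definition "inc5 x = (if x < 5 then (x + 1) mod 5 else x :: nat)"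

lemma mgen_insert_id: "mgen (insert id G) = mgen G"
proof
  show "mgen (insert id G) \<subseteq> mgen G"
    by (rule mgen_least) (use mgen_id mgen_incl in blast)
  show "mgen G \<subseteq> mgen (insert id G)"
    by (rule mgen_least) (auto intro: mgen_incl)
qed

text \<open>2 is a primitive root modulo 5, so doubling generates all multiplications by units.
  Every affine map is a power of \<open>dbl5\<close> followed by a power of
  \<open>inc5\<close>.\<close>

lemma affine_mgen: "carrier affine_group_5 = mgen {dbl5, inc5}"
proof
  have set5: "{0..<5} = {0, 1, 2, 3, 4 :: nat}" by auto
  have d: "dbl5 permutes {0..<5}"
    by (rule bij_imp_permutes) (simp_all add: set5 bij_betw_def inj_on_def dbl5_def, auto)
  have i: "inc5 permutes {0..<5}"
    by (rule bij_imp_permutes) (simp_all add: set5 bij_betw_def inj_on_def inc5_def, auto)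
  show "mgen {dbl5, inc5} \<subseteq> carrier affine_group_5"
  proof
    fix f assume "f \<in> mgen {dbl5, inc5}"
    then have "f permutes {0..<5} \<and> (\<exists>a b. \<not> 5 dvd a \<and> (\<forall>x<5. f x = (a * x + b) mod 5))"
    proof induction
      case mgen_id
      have "\<exists>a b. \<not> 5 dvd a \<and> (\<forall>x<5. x = (a * x + b) mod (5::nat))"
        by (intro exI[of _ 1] exI[of _ 0]) simp
      then show ?case using permutes_id[of "{0..<5::nat}"] by (simp add: id_def)
    next
      case (mgen_step g f)
      then obtain a b where ab: "\<not> 5 dvd a" "\<And>x. x < 5 \<Longrightarrow> f x = (a * x + b) mod 5"
        by blast
      have perm: "(\<lambda>x. g (f x)) permutes {0..<5}"
        using permutes_compose[of f _ g] mgen_step d i by (auto simp: comp_def)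
      from mgen_step(1) have "g = dbl5 \<or> g = inc5" by simp
      then show ?case
      proof
        assume g: "g = dbl5"
        have "g (f x) = (2 * a * x + 2 * b) mod 5" if "x < 5" for x
        proof -
          have "g (f x) = 2 * ((a * x + b) mod 5) mod 5" using ab(2)[OF that] by (simp add: g dbl5_def)
          then show ?thesis by (simp only: mod_mult_right_eq distrib_left mult.assoc)
        qed
        moreover have "\<not> 5 dvd 2 * a" using ab(1) by presburger
        ultimately show ?case using perm unfolding comp_def by blast
      next
        assume g: "g = inc5"
        have "g (f x) = (a * x + (b + 1)) mod 5" if "x < 5" for x
        proof -
          have "g (f x) = ((a * x + b) mod 5 + 1) mod 5" using ab(2)[OF that] by (simp add: g inc5_def)
          then show ?thesis by (simp only: mod_add_left_eq add.assoc)
        qed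
        then show ?case using perm ab(1) unfolding comp_def by blast
      qed
    qed
    then obtain a b where f: "f permutes {0..<5}" and ab: "\<not> 5 dvd a"
      "\<And>x. x < 5 \<Longrightarrow> f x = (a * x + b) mod 5"
      by blast
    have "f x = (a mod 5 * x + b mod 5) mod 5" if "x \<in> {0..<5}" for x
    proof -
      have "(a * x + b) mod 5 = (a mod 5 * x + b mod 5) mod 5"
        by (rule mod_add_cong) (simp_all only: mod_mult_left_eq mod_mod_trivial)
      then show ?thesis using ab(2)[of x] that by simp
    qed
    moreover have "a mod 5 \<in> {1..<5}" "b mod 5 \<in> {0..<5}" using ab(1) by (auto simp: dvd_eq_mod_eq_0)
    ultimately have "\<exists>a\<in>{1..<5}. \<exists>b\<in>{0..<5}. \<forall>x\<in>{0..<5}. f x = (a * x + b) mod 5" by blast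
    then show "f \<in> carrier affine_group_5" using f by (simp add: affine_group_5_def)
  qed
  show "carrier affine_group_5 \<subseteq> mgen {dbl5, inc5}"
  proof
    fix p assume "p \<in> carrier affine_group_5"
    then obtain a b where p: "p permutes {0..<5}" and ab: "a \<in> {1..<5}" "b \<in> {0..<5}"
      "\<forall>x\<in>{0..<5}. p x = (a * x + b) mod 5"
      by (auto simp: affine_group_5_def)
    have out: "(inc5 ^^ j) x = x" "(dbl5 ^^ j) x = x" if "\<not> x < 5" for j x
      using that by (induction j) (simp_all add: inc5_def dbl5_def)
    have ins1: "(inc5 ^^ j) x = (x + j) mod 5" if "x < 5" for j x
    proof (induction j)
      case (Suc j)
      then show ?case by (simp add: inc5_def mod_Suc_eq)
    qed (use that in simp)
    have ins2: "(dbl5 ^^ j) x = 2 ^ j * x mod 5" if "x < 5" for j x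
    proof (induction j)
      case (Suc j)
      then show ?case by (simp add: dbl5_def mod_mult_right_eq mult.assoc)
    qed (use that in simp)
    note ins = ins1 ins2
    have "a = 1 \<or> a = 2 \<or> a = 3 \<or> a = 4" using ab(1) by auto
    then obtain k :: nat where k: "2 ^ k mod 5 = a"
      using that[of 0] that[of 1] that[of 2] that[of 3] by (elim disjE) auto
    have "p x = (inc5 ^^ b \<circ> dbl5 ^^ k) x" for x
    proof (cases "x < 5")
      case True
      have "p x = ((2 ^ k mod 5) * x + b) mod 5" using ab(3) True k by simp
      also have "\<dots> = (inc5 ^^ b \<circ> dbl5 ^^ k) x"
        using ins(2)[OF True, of k] ins(1)[of "2 ^ k * x mod 5" b]
          mod_add_cong[OF mod_mult_left_eq refl, of "2 ^ k" 5 x b]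
        by (simp add: mod_add_left_eq)
      finally show ?thesis .
    next
      case False
      then show ?thesis using out p by (simp add: permutes_not_in)
    qed
    then have "p = inc5 ^^ b \<circ> dbl5 ^^ k" by (simp add: fun_eq_iff)
    then show "p \<in> mgen {dbl5, inc5}" by (simp only:) (intro mgen_comp mgen_funpow mgen_incl; simp)
  qed
qed

text \<open>The units modulo 5 in the order of the powers of 2; multiplication by 2 thus becomes the
  cyclic shift \<open>rot\<close>.\<close>

datatype u5 = U1 | U2 | U4 | U3
datatype f5 = F0 | F1 | F2 | F3 | F4

instantiation u5 :: enum
begin
definition "enum_class.enum = [U1, U2, U4, U3]"
definition "enum_class.enum_all P \<longleftrightarrow> P U1 \<and> P U2 \<and> P U4 \<and> P U3"
definition "enum_class.enum_ex P \<longleftrightarrow> P U1 \<or> P U2 \<or> P U4 \<or> P U3"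
instance
proof
  have *: "UNIV = {U1, U2, U4, U3}" by (auto intro: u5.exhaust)
  show "UNIV = set (enum_class.enum :: u5 list)" by (simp add: enum_u5_def *)
  show "distinct (enum_class.enum :: u5 list)" by (simp add: enum_u5_def)
  show "enum_class.enum_all P \<longleftrightarrow> Ball UNIV P" for P :: "u5 \<Rightarrow> bool"
    unfolding * by (simp add: enum_all_u5_def)
  show "enum_class.enum_ex P \<longleftrightarrow> Bex UNIV P" for P :: "u5 \<Rightarrow> bool"
    unfolding * by (simp add: enum_ex_u5_def)
qed
end

instantiation f5 :: enum
begin
definition "enum_class.enum = [F0, F1, F2, F3, F4]"
definition "enum_class.enum_all P \<longleftrightarrow> P F0 \<and> P F1 \<and> P F2 \<and> P F3 \<and> P F4"
definition "enum_class.enum_ex P \<longleftrightarrow> P F0 \<or> P F1 \<or> P F2 \<or> P F3 \<or> P F4"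
instance
proof
  have *: "UNIV = {F0, F1, F2, F3, F4}" by (auto intro: f5.exhaust)
  show "UNIV = set (enum_class.enum :: f5 list)" by (simp add: enum_f5_def *)
  show "distinct (enum_class.enum :: f5 list)" by (simp add: enum_f5_def)
  show "enum_class.enum_all P \<longleftrightarrow> Ball UNIV P" for P :: "f5 \<Rightarrow> bool"
    unfolding * by (simp add: enum_all_f5_def)
  show "enum_class.enum_ex P \<longleftrightarrow> Bex UNIV P" for P :: "f5 \<Rightarrow> bool"
    unfolding * by (simp add: enum_ex_f5_def)
qed
end

fun rot :: "u5 \<Rightarrow> u5" where "rot U1 = U2" | "rot U2 = U4" | "rot U4 = U3" | "rot U3 = U1"
fun inc :: "f5 \<Rightarrow> f5" where "inc F0 = F1" | "inc F1 = F2" | "inc F2 = F3" | "inc F3 = F4" | "inc F4 = F0"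
fun dbl :: "f5 \<Rightarrow> f5" where "dbl F0 = F0" | "dbl F1 = F2" | "dbl F2 = F4" | "dbl F3 = F1" | "dbl F4 = F3"
fun uinv :: "u5 \<Rightarrow> u5" where "uinv U1 = U1" | "uinv U2 = U3" | "uinv U4 = U4" | "uinv U3 = U2"
fun umul :: "u5 \<Rightarrow> u5 \<Rightarrow> u5" where
  "umul U1 a = a" | "umul U2 a = rot a" | "umul U4 a = rot (rot a)" | "umul U3 a = rot (rot (rot a))"
fun scale :: "u5 \<Rightarrow> f5 \<Rightarrow> f5" where
  "scale U1 b = b" | "scale U2 b = dbl b" | "scale U4 b = dbl (dbl b)" | "scale U3 b = dbl (dbl (dbl b))"
fun shift :: "u5 \<Rightarrow> f5 \<Rightarrow> f5" where
  "shift U1 b = inc b" | "shift U2 b = inc (inc b)" | "shift U4 b = inc (inc (inc (inc b)))"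
| "shift U3 b = inc (inc (inc b))"
fun val5 :: "f5 \<Rightarrow> nat" where "val5 F0 = 0" | "val5 F1 = 1" | "val5 F2 = 2" | "val5 F3 = 3" | "val5 F4 = 4"

text \<open>The pair \<open>(a, b)\<close> stands for the affine map x \<mapsto> a(x + b).
  Composition with x \<mapsto> 2x and x \<mapsto> x + 1 is given by \<open>la\<close> and
  \<open>lb\<close> on the left, by \<open>ra\<close> and \<open>rb\<close> on the right, and
  \<open>kappa5\<close> is the value at 0. In this form the right cosets of the stabilizer of 0 are
  the blocks of constant \<open>b\<close>, on which \<tau> is defined one by one. The last
  coordinate is left for a direct factor.\<close>

fun la :: "u5 \<times> f5 \<times> 'c \<Rightarrow> u5 \<times> f5 \<times> 'c" where "la (a, b, c) = (rot a, b, c)"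
fun lb :: "u5 \<times> f5 \<times> 'c \<Rightarrow> u5 \<times> f5 \<times> 'c" where "lb (a, b, c) = (a, shift (uinv a) b, c)"
fun ra :: "u5 \<times> f5 \<times> 'c \<Rightarrow> u5 \<times> f5 \<times> 'c" where "ra (a, b, c) = (rot a, scale U3 b, c)"
fun rb :: "u5 \<times> f5 \<times> 'c \<Rightarrow> u5 \<times> f5 \<times> 'c" where "rb (a, b, c) = (a, inc b, c)"
fun kappa5 :: "u5 \<times> f5 \<times> 'c \<Rightarrow> nat" where "kappa5 (a, b, c) = val5 (scale a b)"

lemma range_kappa5: "range (kappa5 :: u5 \<times> f5 \<times> 'c \<Rightarrow> nat) = {0..<5}"
proof
  have "val5 b \<in> {0..<5}" for b by (cases b) auto
  then show "range (kappa5 :: u5 \<times> f5 \<times> 'c \<Rightarrow> nat) \<subseteq> {0..<5}" by auto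
  have "val5 b \<in> range (kappa5 :: u5 \<times> f5 \<times> 'c \<Rightarrow> nat)" for b
    by (rule range_eqI[of _ _ "(U1, b, undefined)"]) simp
  moreover have "{0..<5} = {val5 F0, val5 F1, val5 F2, val5 F3, val5 F4}" by auto
  ultimately show "{0..<5} \<subseteq> range (kappa5 :: u5 \<times> f5 \<times> 'c \<Rightarrow> nat)"
    by (simp only: insert_subset empty_subsetI simp_thms)
qed

text \<open>A four-cycle of the units is the product of these two involutions.\<close>

fun ua :: "u5 \<times> 'd \<Rightarrow> u5 \<times> 'd" where "ua (a, d) = (uinv a, d)"
fun ub :: "u5 \<times> 'd \<Rightarrow> u5 \<times> 'd" where "ub (a, d) = (rot (uinv a), d)"

lemma evenperm_comp_involutions:
  fixes f g h :: "'v::enum \<Rightarrow> 'v"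
  assumes f: "\<forall>x. f (f x) = x" "4 dvd length (filter (\<lambda>x. f x \<noteq> x) Enum.enum)"
    and g: "\<forall>x. g (g x) = x" "4 dvd length (filter (\<lambda>x. g x \<noteq> x) Enum.enum)"
    and h: "\<forall>x. h x = f (g x)"
  shows "evenperm h"
proof -
  have b: "bij f" "bij g"
    using bij_funpow_id[of 1 f] bij_funpow_id[of 1 g] f(1) g(1) by simp_all
  have h': "h = f \<circ> g" using h by (intro ext) (simp only: comp_apply)
  have "evenperm f" "evenperm g"
    using f(2) g(2) by (simp_all only: evenperm_involution_enum[OF f(1)] evenperm_involution_enum[OF g(1)])
  then show ?thesis unfolding h'
    by (simp only: evenperm_comp[OF permutation_bij[OF b(1)] permutation_bij[OF b(2)]])
qed

lemma affine_mgen_id: "carrier affine_group_5 = mgen {dbl5, inc5, id}"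
proof -
  have "{dbl5, inc5, id} = insert id {dbl5, inc5}" by blast
  then show ?thesis by (simp only: affine_mgen mgen_insert_id)
qed

text \<open>SL(2,2) in Bruhat form: \<open>(a, None)\<close> is x^a and \<open>(a, Some c)\<close>
  is x^a w x^c, with involutions x and w such that wxw = xwx. \<open>sl2\<close> and
  \<open>sr2\<close> multiply by w on the left and on the right, \<open>tr2\<close> by x on the
  right, and \<open>line2\<close> numbers the left cosets of the group generated by x, that is, the
  points of the projective line.\<close>

fun sl2 :: "bool \<Rightarrow> bool option \<Rightarrow> bool \<times> bool option" where
  "sl2 a None = (False, Some a)"
| "sl2 True (Some c) = (True, Some (\<not> c))"
| "sl2 False (Some c) = (c, None)"

fun sr2 :: "bool \<Rightarrow> bool option \<Rightarrow> bool \<times> bool option" where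
  "sr2 a None = (a, Some False)"
| "sr2 a (Some True) = (\<not> a, Some True)"
| "sr2 a (Some False) = (a, None)"

fun tr2 :: "bool \<Rightarrow> bool option \<Rightarrow> bool \<times> bool option" where
  "tr2 a None = (\<not> a, None)"
| "tr2 a (Some c) = (a, Some (\<not> c))"

fun line2 :: "bool \<Rightarrow> bool option \<Rightarrow> nat" where
  "line2 a None = 1"
| "line2 True (Some c) = 3"
| "line2 False (Some c) = 2"

lemma line2_range: "line2 a i \<in> {1..3}"
  by (cases "(a, i)" rule: line2.cases) auto

lemma line2_onto: "k \<in> {1..3} \<Longrightarrow> \<exists>a i. line2 a i = k"
proof -
  assume "k \<in> {1..3}"
  then have "k = line2 False None \<or> k = line2 False (Some False) \<or> k = line2 True (Some False)" by auto
  then show ?thesis by metis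
qed

section \<open>The complete bipartite case\<close>

text \<open>\<chi> is constant on no neighbourhood step of L, so \<open>F\<close> preserves the
  partition into the two fibres of \<chi>. It contains the alternating group of each fibre. The
  stabilizer of \<open>y\<close> still induces the full symmetric group on the opposite fibre,
  because \<tau> is odd there and its effect on the fibre of \<open>y\<close> can be corrected
  separately.\<close>

theorem (in gen_data) bipartite_lattice:
  fixes \<chi> :: "'v \<Rightarrow> bool"
  assumes P: "monoid.mult P = (\<circ>)" "carrier P = mgen (snd ` set LP)" and m: "card A = m"
    and n: "\<And>b. card {u. \<chi> u = b} = n" "2 < n"
    and cyc: "cyc3 c d e \<in> F" "distinct [c, d, e]"
    and \<chi>: "\<And>x. \<chi> (\<tau> x) = \<chi> x" "\<And>l x. l \<in> fst ` set LP \<Longrightarrow> \<chi> (l x) \<longleftrightarrow> \<not> \<chi> x"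
    and G: "G \<subseteq> F" "\<And>u. \<chi> u = \<chi> v0 \<Longrightarrow> u \<in> orb G v0"
      "\<And>g. g \<in> G \<Longrightarrow> \<exists>fs. set fs \<subseteq> insert \<tau> (fst ` set LP) \<and> act fs c = v0 \<and> act fs d = g v0"
    and odd: "\<And>b. \<not> evenperm (\<lambda>x. if \<chi> x = b then \<tau> x else x)"
  shows "\<exists>\<Gamma>. regular_reducible_lattice m n P A (sym_group n) {1..n} \<Gamma>"
proof -
  have perm: "permutation p" if "p \<in> F" for p using F_bij[OF that] by (rule permutation_bij)
  have perm': "permutation p" if "p permutes S" for p :: "'v \<Rightarrow> 'v" and S
    using that by (intro permutes_imp_permutation[of S]) simp_all
  have alt0: "p \<in> F" if "p permutes {u. \<chi> u = \<chi> v0}" "evenperm p" for p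
  proof (rule F.evenperm_in_F[OF G(1) cyc])
    show "\<exists>f\<in>F. f c = v0 \<and> f d = g v0" if "g \<in> G" for g
      using G(3)[OF that] act_in_F unfolding Lg_def by blast
    have "{u. \<chi> u = \<chi> v0} \<subseteq> (\<lambda>h. h v0) ` mgen G" using G(2) by (auto simp: orb_def)
    then show "p permutes (\<lambda>h. h v0) ` mgen G" using that(1) permutes_subset by blast
  qed (use that in simp_all)
  have flip: "\<exists>s. \<forall>x. \<chi> (f x) \<longleftrightarrow> \<chi> x \<noteq> s" if "f \<in> F" for f
    using that unfolding F_eq
  proof induction
    case mgen_id
    show ?case by (intro exI[of _ False]) simp
  next
    case (mgen_step g f)
    then obtain s where s: "\<forall>x. \<chi> (f x) \<longleftrightarrow> \<chi> x \<noteq> s" by blast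
    have "(\<forall>x. \<chi> (g x) = \<chi> x) \<or> (\<forall>x. \<chi> (g x) \<longleftrightarrow> \<not> \<chi> x)"
      using mgen_step(1) \<chi> by (auto simp: Lg_def)
    then show ?case
    proof
      assume "\<forall>x. \<chi> (g x) = \<chi> x"
      then show ?case using s by (intro exI[of _ s]) simp
    next
      assume "\<forall>x. \<chi> (g x) \<longleftrightarrow> \<not> \<chi> x"
      then show ?case using s by (intro exI[of _ "\<not> s"]) simp
    qed
  qed
  have "w \<in> Lg" using w(1) by (simp add: Lg_def)
  then have wF: "w \<in> F" unfolding F_eq by (simp add: mgen_incl)
  have alt: "p \<in> F" if p: "p permutes {u. \<chi> u = b}" "evenperm p" for p b
  proof (cases "b = \<chi> v0")
    case False
    have bw: "bij w" by (rule F_bij[OF wF])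
    \<comment> \<open>\<open>w\<close> exchanges the two fibres of \<chi>, so conjugation by it
      transfers even permutations from one to the other.\<close>
    define q where "q = inv' w \<circ> (p \<circ> w)"
    have iw: "w (inv' w x) = x" "inv' w (w x) = x" for x
      using bw by (simp_all add: bij_is_surj surj_f_inv_f bij_is_inj)
    have "bij q" unfolding q_def using bw permutes_bij[OF p(1)] by (intro bij_comp bij_imp_bij_inv)
    moreover have "q x = x" if "x \<notin> {u. \<chi> u = \<chi> v0}" for x
    proof -
      have "w x \<notin> {u. \<chi> u = b}" using that False \<chi>(2)[OF w(1), of x] by auto
      then show ?thesis using p(1) iw by (simp add: q_def permutes_not_in)
    qed
    ultimately have "q permutes {u. \<chi> u = \<chi> v0}" by (auto simp: permutes_def bij_iff)
    moreover have "evenperm q"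
      unfolding q_def using p(2) perm[OF wF] perm[OF F_inv[OF wF]] perm'[OF p(1)]
      by (simp add: evenperm_comp evenperm_inv permutation_compose)
    ultimately have "q \<in> F" by (rule alt0)
    then have "w \<circ> (q \<circ> inv' w) \<in> F" by (intro F_comp wF F_inv)
    also have "w \<circ> (q \<circ> inv' w) = p" by (simp add: q_def fun_eq_iff iw)
    finally show ?thesis .
  qed (use alt0 p in simp)
  define E where "E v = {u. \<chi> u = (\<not> \<chi> v)}" for v
  have cardE: "card (E v) = n" for v unfolding E_def by (rule n(1))
  have "\<exists>\<Gamma>. regular_reducible_lattice m n P A (if False then alt_group n else sym_group n) {1..n} \<Gamma>"
  proof (rule lattice_exists[where E = E and \<phi> = "\<lambda>k. k"])
    show "Z = UNIV" if Z: "v0 \<in> Z" "\<And>v. v \<in> Z \<Longrightarrow> E v \<subseteq> Z" for Z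
    proof -
      have "E v0 \<noteq> {}" using cardE[of v0] n(2) by auto
      then obtain u where u: "u \<in> E v0" by blast
      then have "E v0 \<union> E u \<subseteq> Z" using Z by blast
      moreover have "E v0 \<union> E u = UNIV" using u by (auto simp: E_def)
      ultimately show ?thesis by blast
    qed
    show "f ` E v \<subseteq> E (f v)" if "f \<in> F" for f v using flip[OF that] by (auto simp: E_def)
    show "bij_betw (\<lambda>k. k) A A" using bij_betw_id[of A] by (simp add: id_def)
    show "carrier P = (\<lambda>l k. if k \<in> A then \<kappa> (l (SOME v. \<kappa> v = k)) else k) ` mgen Lg"
      unfolding P(2) carrier_P ..
    fix y
    show "\<exists>f. bij_betw f (E y) {1..n} \<and> carrier (if False then alt_group n else sym_group n) =
     (\<lambda>b k. if k \<in> {1..n} then f (b (inv_into (E y) f k)) else k) ` {b \<in> F. b y = y}"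
    proof (rule carrier_alt_sym[OF _ cardE])
      show "(\<lambda>b. restrict_id b (E y)) ` {b \<in> F. b y = y} = {p. p permutes E y \<and> (False \<longrightarrow> evenperm p)}"
      proof (intro equalityI subsetI)
        fix p assume "p \<in> (\<lambda>b. restrict_id b (E y)) ` {b \<in> F. b y = y}"
        then obtain b where b: "b \<in> F" "b y = y" "p = restrict_id b (E y)" by blast
        obtain s where s: "\<forall>x. \<chi> (b x) \<longleftrightarrow> \<chi> x \<noteq> s" using flip[OF b(1)] by blast
        have "\<not> s" using s b(2) by metis
        then have "\<chi> (b x) = \<chi> x" for x using s by simp
        then have "b x \<in> E y \<longleftrightarrow> x \<in> E y" for x by (simp add: E_def)
        then have "bij_betw b (E y) (E y)"
          using F_bij[OF b(1)] unfolding bij_betw_def inj_on_def bij_def surj_def by (auto simp: image_iff) metis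
        then show "p \<in> {p. p permutes E y \<and> (False \<longrightarrow> evenperm p)}"
          unfolding b(3) by (simp add: permutes_restrict_id)
      next
        fix p assume "p \<in> {p. p permutes E y \<and> (False \<longrightarrow> evenperm p)}"
        then have p: "p permutes E y" by simp
        have yE: "y \<notin> E y" by (simp add: E_def)
        have "\<exists>b\<in>F. b y = y \<and> restrict_id b (E y) = p"
        proof (cases "evenperm p")
          case True
          then have "p \<in> F" using alt p unfolding E_def by blast
          moreover have "p y = y" using p yE by (rule permutes_not_in)
          moreover have "restrict_id p (E y) = p"
            using permutes_not_in[OF p] by (auto simp: restrict_id_def fun_eq_iff)
          ultimately show ?thesis by blast
        next
          case False
          \<comment> \<open>\<open>s\<close> is \<tau> restricted to the fibre opposite to
            \<open>y\<close>. For odd \<open>p\<close> the product \<open>p \<circ> s\<close> is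
            even, hence in \<open>F\<close>; a further factor \<tau> restores \<open>p\<close> on
            that fibre but may move \<open>y\<close>.\<close>
          define s where "s x = (if \<chi> x = (\<not> \<chi> y) then \<tau> x else x)" for x
          have ss: "s (s x) = x" for x by (simp add: s_def \<chi>(1) invol)
          have "bij s" by (rule o_bij[where g = s]) (simp_all add: fun_eq_iff ss)
          then have s: "s permutes E y" by (auto simp: permutes_def bij_iff s_def E_def)
          have "\<not> evenperm s" using odd[of "\<not> \<chi> y"] by (simp add: s_def[abs_def])
          then have "evenperm (p \<circ> s)"
            using False by (simp add: evenperm_comp[OF perm'[OF p] perm'[OF s]])
          moreover have "p \<circ> s permutes E y" using s p by (rule permutes_compose)
          ultimately have psF: "p \<circ> s \<in> F" using alt unfolding E_def by blast
          have \<tau>F: "\<tau> \<in> F" unfolding F_eq by (rule mgen_incl) simp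
          \<comment> \<open>\<open>h\<close> repairs the image of \<open>y\<close> without touching
            the opposite fibre. When \<tau> moves \<open>y\<close>, it is a 3-cycle in the fibre of
            \<open>y\<close>, and a third point exists there because \<open>2 < n\<close>.\<close>
          obtain h where h: "h \<in> F" "h (\<tau> y) = y" "\<And>x. x \<in> E y \<Longrightarrow> h x = x"
          proof (cases "\<tau> y = y")
            case True
            show ?thesis by (rule that[OF F_id]) (simp_all add: True)
          next
            case False
            let ?C = "{u. \<chi> u = \<chi> y}"
            have "?C - {y, \<tau> y} \<noteq> {}"
            proof
              assume "?C - {y, \<tau> y} = {}"
              then have "card ?C \<le> card {y, \<tau> y}" by (intro card_mono) auto
              also have "\<dots> \<le> 2" by (simp add: card_insert_if)
              finally show False using n(1)[of "\<chi> y"] n(2) by simp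
            qed
            then obtain z where z: "\<chi> z = \<chi> y" "z \<noteq> y" "z \<noteq> \<tau> y" by blast
            have dist: "distinct [\<tau> y, y, z]" using False z by auto
            have eq: "cyc3 (\<tau> y) y z = Transposition.transpose (\<tau> y) y \<circ> Transposition.transpose y z"
              by (rule transpose_comp_cyc3[OF dist, symmetric])
            have "cyc3 (\<tau> y) y z permutes ?C"
              unfolding eq using z \<chi>(1) by (intro permutes_compose permutes_swap_id) auto
            moreover have "evenperm (cyc3 (\<tau> y) y z)"
              unfolding eq using dist by (simp add: evenperm_comp permutation_swap_id evenperm_swap)
            ultimately have "cyc3 (\<tau> y) y z \<in> F" by (rule alt)
            then show ?thesis
              by (rule that) (use z \<chi>(1)[of y] in \<open>auto simp: cyc3_def E_def\<close>)
          qed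
          have "h \<circ> ((p \<circ> s) \<circ> \<tau>) \<in> F" using h(1) psF \<tau>F F_comp by blast
          moreover have "(h \<circ> ((p \<circ> s) \<circ> \<tau>)) y = y"
          proof -
            have "s (\<tau> y) = \<tau> y" by (simp add: s_def \<chi>(1))
            moreover have "p (\<tau> y) = \<tau> y" using p by (rule permutes_not_in) (simp add: E_def \<chi>(1))
            ultimately show ?thesis using h(2) by simp
          qed
          moreover have "restrict_id (h \<circ> ((p \<circ> s) \<circ> \<tau>)) (E y) = p"
          proof
            fix x
            show "restrict_id (h \<circ> ((p \<circ> s) \<circ> \<tau>)) (E y) x = p x"
            proof (cases "x \<in> E y")
              case True
              then have "s (\<tau> x) = x" by (simp add: s_def \<chi>(1) invol E_def)
              moreover have "h (p x) = p x" using h(3) permutes_in_image[OF p] True by simp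
              ultimately show ?thesis using True by (simp add: restrict_id_def)
            qed (simp add: restrict_id_def permutes_not_in[OF p])
          qed
          ultimately show ?thesis by blast
        qed
        then show "p \<in> (\<lambda>b. restrict_id b (E y)) ` {b \<in> F. b y = y}" by blast
      qed
    qed simp_all
  qed (use m P(1) cardE in \<open>auto simp: E_def sym_group_mult\<close>)
  then show ?thesis by simp
qed

section \<open>Lattices on products with the trivalent tree\<close>

text \<open>The group Sym(4) as 2^2 : SL(2,2). The coordinates \<open>y\<close> and \<open>p\<close>
  describe the normal four-group, and \<open>a\<close>, \<open>i\<close> the linear part in Bruhat
  form. B is the dihedral group of order 8 given by \<open>i = None\<close>, and the three values of
  \<open>i\<close> are its right cosets.\<close>

type_synonym ptA = "bool \<times> bool \<times> bool \<times> bool option"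

fun lw_A :: "ptA \<Rightarrow> ptA" where "lw_A (y, p, a, i) = (p, y, sl2 a i)"
fun lx_A :: "ptA \<Rightarrow> ptA" where "lx_A (y, p, a, i) = (y, p \<noteq> y, \<not> a, i)"
fun ly_A :: "ptA \<Rightarrow> ptA" where "ly_A (y, p, a, i) = (\<not> y, p, a, i)"
fun rw_A :: "ptA \<Rightarrow> ptA" where "rw_A (y, p, a, i) = (y, p, sr2 a i)"
fun rx_A :: "ptA \<Rightarrow> ptA" where "rx_A (y, p, a, i) = (y, p, tr2 a i)"
text \<open>Right translation shifts \<open>(y, p)\<close> by the image of the first basis vector
  under the linear part.\<close>

fun ry_A :: "ptA \<Rightarrow> ptA" where
  "ry_A (y, p, a, None) = (\<not> y, p \<noteq> a, a, None)"
| "ry_A (y, p, a, Some c) = (y \<noteq> c, p = (a \<and> c), a, Some c)"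
text \<open>On every block of constant \<open>i\<close> this is the automorphism of the dihedral
  group that exchanges \<open>lx_A\<close> and \<open>ly_A\<close>. The term
  \<open>y \<and> a\<close> arises when the exchanged factors are brought back into normal
  order.\<close>

fun tau_A :: "ptA \<Rightarrow> ptA" where "tau_A (y, p, a, i) = (a, p \<noteq> (y \<and> a), y, i)"
fun kappa_A :: "ptA \<Rightarrow> nat" where "kappa_A (y, p, a, i) = line2 a i"

definition "o_A = (False, False, False, None :: bool option)"

lemma range_kappa_A: "range kappa_A = {1..3}"
proof
  show "range kappa_A \<subseteq> {1..3}" using line2_range by auto
  show "{1..3} \<subseteq> range kappa_A"
  proof
    fix k :: nat assume "k \<in> {1..3}"
    then obtain a i where "line2 a i = k" using line2_onto by blast
    then show "k \<in> range kappa_A" by (intro range_eqI[of _ _ "(False, False, a, i)"]) simp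
  qed
qed

lemma A_checks:
  "\<forall>x. it (num.Bit0 num.One) lw_A x = x"
  "\<forall>x. it (num.Bit0 num.One) lx_A x = x"
  "\<forall>x. it (num.Bit0 num.One) ly_A x = x"
  "\<forall>x. it (num.Bit0 num.One) rw_A x = x"
  "\<forall>x. it (num.Bit0 num.One) rx_A x = x"
  "\<forall>x. it (num.Bit0 num.One) ry_A x = x"
  "\<forall>x. lw_A (rw_A x) = rw_A (lw_A x)"
  "\<forall>x. lw_A (rx_A x) = rx_A (lw_A x)"
  "\<forall>x. lw_A (ry_A x) = ry_A (lw_A x)"
  "\<forall>x. lx_A (rw_A x) = rw_A (lx_A x)"
  "\<forall>x. lx_A (rx_A x) = rx_A (lx_A x)"
  "\<forall>x. lx_A (ry_A x) = ry_A (lx_A x)"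
  "\<forall>x. ly_A (rw_A x) = rw_A (ly_A x)"
  "\<forall>x. ly_A (rx_A x) = rx_A (ly_A x)"
  "\<forall>x. ly_A (ry_A x) = ry_A (ly_A x)"
  "\<forall>x. tau_A (tau_A x) = x"
  "\<forall>x. tau_A (lx_A (tau_A x)) = act [ly_A] x"
  "\<forall>x. tau_A (ly_A (tau_A x)) = act [lx_A] x"
  "\<forall>x. Transposition.transpose 1 2 (kappa_A x) = kappa_A (lw_A x)"
  "\<forall>x. Transposition.transpose 2 3 (kappa_A x) = kappa_A (lx_A x)"
  "\<forall>x. id (kappa_A x) = kappa_A (ly_A x)"
  by code_simp+

text \<open>These supply, in order, transitivity of the left and of the right translations,
  transitivity of B on the fibre of the base label and on the remaining labels, and the failure of
  the conjugate of \<open>lw_A\<close> to be a left translation.\<close>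

lemma A_orbits:
  "\<forall>x. x \<in> set (spread [(lx_A, 1), (lw_A, 1), (lx_A, 1), (ly_A, 1), (lw_A, 1), (ly_A, 1)] [o_A])"
  "\<forall>x. x \<in> set (spread [(ry_A, 1), (rw_A, 1), (ry_A, 1), (rx_A, 1), (rw_A, 1), (rx_A, 1), (rw_A, 1), (ry_A, 1)] [o_A])"
  "\<forall>x. kappa_A x = kappa_A o_A \<longrightarrow> x \<in> set (spread [(lx_A, 1), (ly_A, 1), (lx_A, 1), (ly_A, 1)] [o_A])"
  "\<forall>x. kappa_A x \<noteq> kappa_A o_A \<longrightarrow> (\<exists>u \<in> set (spread [(lx_A, 1), (ly_A, 1)] [lw_A o_A]). kappa_A u = kappa_A x)"
  "\<exists>r\<in>set [rw_A, rx_A, ry_A]. \<exists>u. tau_A (lw_A (tau_A (r u))) \<noteq> r (tau_A (lw_A (tau_A u)))"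
  by code_simp+

lemma A_bij: "bij lw_A" "bij lx_A" "bij ly_A" "bij rw_A" "bij rx_A" "bij ry_A"
  by (rule bij_it, rule A_checks)+

abbreviation "A_word \<equiv> [lx_A, lw_A, tau_A, ly_A, lw_A, lx_A, tau_A, lw_A, ly_A, tau_A, lw_A, tau_A, lw_A, lx_A, ly_A, tau_A, lx_A, lw_A, tau_A, lw_A, tau_A, lw_A, tau_A]"
abbreviation "c_A \<equiv> (False, True, False, Some False) :: ptA"
abbreviation "d_A \<equiv> (False, True, True, Some True) :: ptA"
abbreviation "e_A \<equiv> (False, True, True, None) :: ptA"

text \<open>The numeral is 16, a common multiple of the lengths of all cycles other than the
  3-cycle.\<close>

lemma A_word:
  "act A_word c_A = d_A" "act A_word d_A = e_A" "act A_word e_A = c_A"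
  "\<forall>x. x \<notin> {c_A, d_A, e_A} \<longrightarrow> it (num.Bit0 (num.Bit0 (num.Bit0 (num.Bit0 num.One)))) (act A_word) x = x"
  by code_simp+

lemma A_links:
  "act [ly_A, lx_A, lw_A, tau_A, lw_A, tau_A, lw_A, tau_A, lw_A, tau_A, lw_A, tau_A, lw_A, tau_A, lx_A, lw_A, tau_A, lw_A, tau_A, lw_A, tau_A, lx_A, ly_A, lw_A, tau_A] c_A = o_A" "act [ly_A, lx_A, lw_A, tau_A, lw_A, tau_A, lw_A, tau_A, lw_A, tau_A, lw_A, tau_A, lw_A, tau_A, lx_A, lw_A, tau_A, lw_A, tau_A, lw_A, tau_A, lx_A, ly_A, lw_A, tau_A] d_A = lw_A o_A"
  "act [ly_A, tau_A, lw_A, tau_A, lw_A, tau_A, lw_A, tau_A, lw_A, tau_A, lw_A, tau_A, lw_A, tau_A, lw_A, tau_A, lw_A, tau_A, lx_A, ly_A, lw_A, tau_A] c_A = o_A" "act [ly_A, tau_A, lw_A, tau_A, lw_A, tau_A, lw_A, tau_A, lw_A, tau_A, lw_A, tau_A, lw_A, tau_A, lw_A, tau_A, lw_A, tau_A, lx_A, ly_A, lw_A, tau_A] d_A = lx_A o_A"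
  "act [lx_A, lw_A, tau_A, lw_A, tau_A, lw_A, tau_A, lw_A, tau_A, lw_A, tau_A, lw_A, tau_A, lw_A, tau_A, lw_A, tau_A, lx_A, ly_A, lw_A, tau_A] c_A = o_A" "act [lx_A, lw_A, tau_A, lw_A, tau_A, lw_A, tau_A, lw_A, tau_A, lw_A, tau_A, lw_A, tau_A, lw_A, tau_A, lw_A, tau_A, lx_A, ly_A, lw_A, tau_A] d_A = ly_A o_A"
  by code_simp+

definition "LP_A = [(lw_A, Transposition.transpose 1 2), (lx_A, Transposition.transpose 2 3), (ly_A, id)]"

lemma fst_LP_A: "map fst LP_A = [lw_A, lx_A, ly_A]" "fst ` set LP_A = {lw_A, lx_A, ly_A}"
  by (simp_all add: LP_A_def)

lemma gen_data_A: "gen_data LP_A [rw_A, rx_A, ry_A] [lx_A, ly_A] tau_A lw_A o_A kappa_A {1..3}"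
proof
  show "list_all (\<lambda>(l, \<rho>). bij l \<and> (\<forall>v. \<rho> (kappa_A v) = kappa_A (l v)) \<and> (\<forall>k. k \<notin> {1..3} \<longrightarrow> \<rho> k = k)) LP_A"
    unfolding LP_A_def list.pred_inject prod.case
    by (intro conjI list.pred_inject(1) A_bij A_checks(19,20,21)) (auto simp: Transposition.transpose_def dbl5_def inc5_def)
  show "list_all bij [rw_A, rx_A, ry_A]"
    unfolding list.pred_inject by (intro conjI list.pred_inject(1) A_bij)
  show "list_all (\<lambda>l. list_all (\<lambda>r. \<forall>x. l (r x) = r (l x)) [rw_A, rx_A, ry_A]) (map fst LP_A)"
    unfolding fst_LP_A list.pred_inject by (intro conjI list.pred_inject(1) A_checks)
  show "orb (fst ` set LP_A) o_A = UNIV"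
    by (rule orb_UNIV_spread[OF _ A_orbits(1)]) (simp add: fst_LP_A)
  show "orb (set [rw_A, rx_A, ry_A]) o_A = UNIV"
    by (rule orb_UNIV_spread[OF _ A_orbits(2)]) simp
  show "v \<in> orb (set [lx_A, ly_A]) o_A" if "kappa_A v = kappa_A o_A" for v
    by (rule spread_orb_single[OF _ A_orbits(3)[rule_format, OF that]]) simp
  show "\<exists>u\<in>orb (set [lx_A, ly_A]) (lw_A o_A). kappa_A u = kappa_A v" if v: "kappa_A v \<noteq> kappa_A o_A" for v
    by (rule orb_ex_spread[OF _ A_orbits(4)[rule_format, OF v]]) simp
  show "list_all (\<lambda>b. \<exists>ls. set ls \<subseteq> fst ` set LP_A \<and> (\<forall>x. tau_A (b (tau_A x)) = act ls x)) [lx_A, ly_A]"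
    unfolding list.pred_inject fst_LP_A
    by (intro conjI list.pred_inject(1); rule exI, rule conjI[rotated], rule A_checks, simp)
  show "\<exists>r\<in>set [rw_A, rx_A, ry_A]. \<exists>u. tau_A (lw_A (tau_A (r u))) \<noteq> r (tau_A (lw_A (tau_A u)))"
    by (rule A_orbits(5))
  show "tau_A (tau_A x) = x" for x using A_checks(16) by blast
  show "range kappa_A = {1..3}" by (rule range_kappa_A)
  show "1 < card ({1..3} :: nat set)" by simp
qed (simp_all add: fst_LP_A)

lemma A_parity: "\<not> evenperm tau_A"
  unfolding evenperm_involution_enum[OF A_checks(16)] by code_simp

theorem lattice_3_23:
  "\<exists>\<Gamma>. regular_reducible_lattice 3 23 (sym_group 3) {1..3} (sym_group 23) {1..23} \<Gamma>"
proof -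
  have "\<exists>\<Gamma>. regular_reducible_lattice 3 23 (sym_group 3) {1..3}
      (if False then alt_group 23 else sym_group 23) {1..23} \<Gamma>"
  proof (rule complete_graph_lattice[OF gen_data_A, where ws = A_word and c = c_A and d = d_A
        and e = e_A and M = 16])
    show "\<exists>l. l dvd 16 \<and> (act A_word ^^ l) x = x" if "x \<notin> {c_A, d_A, e_A}" for x
      using A_word(4)[rule_format, OF that] by (intro exI[of _ 16]) (simp only: it_eq dvd_refl simp_thms)
    show "list_all (\<lambda>g. \<exists>fs. set fs \<subseteq> insert tau_A (fst ` set LP_A) \<and> act fs c_A = o_A \<and>
        act fs d_A = g o_A) (map fst LP_A)"
      unfolding fst_LP_A list.pred_inject
      by (intro conjI list.pred_inject(1); rule linkI[rotated], rule A_links, rule A_links, simp)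
    show "if False then list_all evenperm (tau_A # map fst LP_A)
        else \<not> list_all evenperm (tau_A # map fst LP_A)"
      using A_parity by (simp add: fst_LP_A)
    show "carrier (sym_group 3) = mgen (snd ` set LP_A)"
      unfolding sym3_mgen LP_A_def by simp
    show "card (UNIV :: ptA set) = 23 + 1" unfolding card_UNIV_length_enum by code_simp
    show "set A_word \<subseteq> insert tau_A (fst ` set LP_A)" by (simp add: fst_LP_A)
  qed (simp_all add: A_word(1-3) sym_group_mult affine_group_5_def)
  then show ?thesis by simp
qed

text \<open>The group Sym(4) x C2 as 2^3 : SL(2,2), with \<open>q\<close> the coordinate of the
  central factor. B has order 16.\<close>

type_synonym ptB = "bool \<times> bool \<times> bool \<times> bool \<times> bool option"

fun lw_B :: "ptB \<Rightarrow> ptB" where "lw_B (y, p, q, a, i) = (p, y, q, sl2 a i)"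
fun lx_B :: "ptB \<Rightarrow> ptB" where "lx_B (y, p, q, a, i) = (y, p \<noteq> y, q \<noteq> y, \<not> a, i)"
fun ly_B :: "ptB \<Rightarrow> ptB" where "ly_B (y, p, q, a, i) = (\<not> y, p, q, a, i)"
fun lp_B :: "ptB \<Rightarrow> ptB" where "lp_B (y, p, q, a, i) = (y, \<not> p, q, a, i)"
fun lq_B :: "ptB \<Rightarrow> ptB" where "lq_B (y, p, q, a, i) = (y, p, \<not> q, a, i)"
fun rw_B :: "ptB \<Rightarrow> ptB" where "rw_B (y, p, q, a, i) = (y, p, q, sr2 a i)"
fun rx_B :: "ptB \<Rightarrow> ptB" where "rx_B (y, p, q, a, i) = (y, p, q, tr2 a i)"
fun ry_B :: "ptB \<Rightarrow> ptB" where
  "ry_B (y, p, q, a, None) = (\<not> y, p \<noteq> a, q \<noteq> a, a, None)"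
| "ry_B (y, p, q, a, Some c) = (y \<noteq> c, p = (a \<and> c), q \<noteq> (c \<noteq> (a \<and> c)), a, Some c)"
fun kappa_B :: "ptB \<Rightarrow> nat" where "kappa_B (y, p, q, a, i) = line2 a i"

definition "o_B = (False, False, False, False, None :: bool option)"

lemma range_kappa_B: "range kappa_B = {1..3}"
proof
  show "range kappa_B \<subseteq> {1..3}" using line2_range by auto
  show "{1..3} \<subseteq> range kappa_B"
  proof
    fix k :: nat assume "k \<in> {1..3}"
    then obtain a i where "line2 a i = k" using line2_onto by blast
    then show "k \<in> range kappa_B" by (intro range_eqI[of _ _ "(False, False, False, a, i)"]) simp
  qed
qed

text \<open>The automorphism of B exchanges \<open>lx_B\<close> with \<open>ly_B\<close> and
  \<open>lp_B\<close> with \<open>lq_B\<close>; in addition the two blocks with \<open>i\<close>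
  different from \<open>None\<close> change places.\<close>

fun tau_B47 :: "ptB \<Rightarrow> ptB" where
  "tau_B47 (y, p, q, a, i) = (a, q \<noteq> (y \<and> a), p \<noteq> (y \<and> a), y, map_option Not i)"

lemma B47_checks:
  "\<forall>x. it (num.Bit0 num.One) lw_B x = x"
  "\<forall>x. it (num.Bit0 num.One) lx_B x = x"
  "\<forall>x. it (num.Bit0 num.One) ly_B x = x"
  "\<forall>x. it (num.Bit0 num.One) lp_B x = x"
  "\<forall>x. it (num.Bit0 num.One) lq_B x = x"
  "\<forall>x. it (num.Bit0 num.One) rw_B x = x"
  "\<forall>x. it (num.Bit0 num.One) rx_B x = x"
  "\<forall>x. it (num.Bit0 num.One) ry_B x = x"
  "\<forall>x. lw_B (rw_B x) = rw_B (lw_B x)"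
  "\<forall>x. lw_B (rx_B x) = rx_B (lw_B x)"
  "\<forall>x. lw_B (ry_B x) = ry_B (lw_B x)"
  "\<forall>x. lx_B (rw_B x) = rw_B (lx_B x)"
  "\<forall>x. lx_B (rx_B x) = rx_B (lx_B x)"
  "\<forall>x. lx_B (ry_B x) = ry_B (lx_B x)"
  "\<forall>x. ly_B (rw_B x) = rw_B (ly_B x)"
  "\<forall>x. ly_B (rx_B x) = rx_B (ly_B x)"
  "\<forall>x. ly_B (ry_B x) = ry_B (ly_B x)"
  "\<forall>x. lp_B (rw_B x) = rw_B (lp_B x)"
  "\<forall>x. lp_B (rx_B x) = rx_B (lp_B x)"
  "\<forall>x. lp_B (ry_B x) = ry_B (lp_B x)"
  "\<forall>x. lq_B (rw_B x) = rw_B (lq_B x)"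
  "\<forall>x. lq_B (rx_B x) = rx_B (lq_B x)"
  "\<forall>x. lq_B (ry_B x) = ry_B (lq_B x)"
  "\<forall>x. tau_B47 (tau_B47 x) = x"
  "\<forall>x. tau_B47 (lx_B (tau_B47 x)) = act [ly_B] x"
  "\<forall>x. tau_B47 (ly_B (tau_B47 x)) = act [lx_B] x"
  "\<forall>x. tau_B47 (lp_B (tau_B47 x)) = act [lq_B] x"
  "\<forall>x. tau_B47 (lq_B (tau_B47 x)) = act [lp_B] x"
  "\<forall>x. Transposition.transpose 1 2 (kappa_B x) = kappa_B (lw_B x)"
  "\<forall>x. Transposition.transpose 2 3 (kappa_B x) = kappa_B (lx_B x)"
  "\<forall>x. id (kappa_B x) = kappa_B (ly_B x)"
  "\<forall>x. id (kappa_B x) = kappa_B (lp_B x)"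
  "\<forall>x. id (kappa_B x) = kappa_B (lq_B x)"
  by code_simp+

lemma B47_orbits:
  "\<forall>x. x \<in> set (spread [(lx_B, 1), (lw_B, 1), (lx_B, 1), (ly_B, 1), (lp_B, 1), (lq_B, 1)] [o_B])"
  "\<forall>x. x \<in> set (spread [(ry_B, 1), (rw_B, 1), (ry_B, 1), (rx_B, 1), (ry_B, 1), (rw_B, 1), (rx_B, 1), (rw_B, 1), (rx_B, 1)] [o_B])"
  "\<forall>x. kappa_B x = kappa_B o_B \<longrightarrow> x \<in> set (spread [(lx_B, 1), (ly_B, 1), (lp_B, 1), (lq_B, 1)] [o_B])"
  "\<forall>x. kappa_B x \<noteq> kappa_B o_B \<longrightarrow> (\<exists>u \<in> set (spread [(lx_B, 1)] [lw_B o_B]). kappa_B u = kappa_B x)"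
  "\<exists>r\<in>set [rw_B, rx_B, ry_B]. \<exists>u. tau_B47 (lw_B (tau_B47 (r u))) \<noteq> r (tau_B47 (lw_B (tau_B47 u)))"
  by code_simp+

lemma B47_bij: "bij lw_B" "bij lx_B" "bij ly_B" "bij lp_B" "bij lq_B" "bij rw_B" "bij rx_B" "bij ry_B"
  by (rule bij_it, rule B47_checks)+

abbreviation "B47_word \<equiv> [lw_B, tau_B47, ly_B, lx_B, lw_B, tau_B47, lw_B, lx_B, tau_B47, lw_B, tau_B47, lw_B, tau_B47, lw_B, lx_B, lw_B, tau_B47, lw_B, tau_B47, lx_B, lw_B, tau_B47]"
abbreviation "c_B47 \<equiv> (False, False, True, True, Some False) :: ptB"
abbreviation "d_B47 \<equiv> (False, True, True, False, Some False) :: ptB"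
abbreviation "e_B47 \<equiv> (False, True, False, False, Some True) :: ptB"

text \<open>The numerals are 16 and 23, which leads to the exponent 368 = 16 * 23.\<close>

lemma B47_word:
  "act B47_word c_B47 = d_B47" "act B47_word d_B47 = e_B47" "act B47_word e_B47 = c_B47"
  "\<forall>x. x \<notin> {c_B47, d_B47, e_B47} \<longrightarrow> it (num.Bit0 (num.Bit0 (num.Bit0 (num.Bit0 num.One)))) (act B47_word) x = x \<or> it (num.Bit1 (num.Bit1 (num.Bit1 (num.Bit0 num.One)))) (act B47_word) x = x"
  by code_simp+

lemma B47_links:
  "act [ly_B, lx_B, tau_B47, lw_B, tau_B47, lw_B, tau_B47, lw_B, lx_B, tau_B47, lw_B, tau_B47, lw_B, tau_B47, lw_B, tau_B47, lp_B, lw_B] c_B47 = o_B" "act [ly_B, lx_B, tau_B47, lw_B, tau_B47, lw_B, tau_B47, lw_B, lx_B, tau_B47, lw_B, tau_B47, lw_B, tau_B47, lw_B, tau_B47, lp_B, lw_B] d_B47 = lw_B o_B"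
  "act [ly_B, lx_B, tau_B47, lw_B, tau_B47, lw_B, tau_B47, lw_B, tau_B47, lw_B, tau_B47, lw_B, tau_B47, lw_B, tau_B47, lw_B, tau_B47, lx_B, lw_B, tau_B47, lw_B] c_B47 = o_B" "act [ly_B, lx_B, tau_B47, lw_B, tau_B47, lw_B, tau_B47, lw_B, tau_B47, lw_B, tau_B47, lw_B, tau_B47, lw_B, tau_B47, lw_B, tau_B47, lx_B, lw_B, tau_B47, lw_B] d_B47 = lx_B o_B"
  "act [lx_B, lw_B, lp_B, tau_B47, lw_B, tau_B47, lw_B, tau_B47, lw_B, lx_B, tau_B47, lw_B, tau_B47, lw_B, tau_B47, lw_B, tau_B47, lw_B, tau_B47, lw_B] c_B47 = o_B" "act [lx_B, lw_B, lp_B, tau_B47, lw_B, tau_B47, lw_B, tau_B47, lw_B, lx_B, tau_B47, lw_B, tau_B47, lw_B, tau_B47, lw_B, tau_B47, lw_B, tau_B47, lw_B] d_B47 = ly_B o_B"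
  "act [lw_B, lx_B, ly_B, tau_B47, lw_B, tau_B47, lw_B, tau_B47, lw_B, tau_B47, lw_B, tau_B47, lw_B, tau_B47, ly_B, lx_B, lw_B, tau_B47, lw_B, tau_B47, lw_B] c_B47 = o_B" "act [lw_B, lx_B, ly_B, tau_B47, lw_B, tau_B47, lw_B, tau_B47, lw_B, tau_B47, lw_B, tau_B47, lw_B, tau_B47, ly_B, lx_B, lw_B, tau_B47, lw_B, tau_B47, lw_B] d_B47 = lp_B o_B"
  "act [lw_B, tau_B47, lw_B, tau_B47, lw_B, tau_B47, lw_B, tau_B47, lw_B, tau_B47, lw_B, tau_B47, lw_B, tau_B47, lw_B, tau_B47, lw_B, tau_B47, lx_B, ly_B] c_B47 = o_B" "act [lw_B, tau_B47, lw_B, tau_B47, lw_B, tau_B47, lw_B, tau_B47, lw_B, tau_B47, lw_B, tau_B47, lw_B, tau_B47, lw_B, tau_B47, lw_B, tau_B47, lx_B, ly_B] d_B47 = lq_B o_B"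
  by code_simp+

definition "LP_B47 = [(lw_B, Transposition.transpose 1 2), (lx_B, Transposition.transpose 2 3), (ly_B, id), (lp_B, id), (lq_B, id)]"

lemma fst_LP_B47: "map fst LP_B47 = [lw_B, lx_B, ly_B, lp_B, lq_B]" "fst ` set LP_B47 = {lw_B, lx_B, ly_B, lp_B, lq_B}"
  by (simp_all add: LP_B47_def)

lemma gen_data_B47: "gen_data LP_B47 [rw_B, rx_B, ry_B] [lx_B, ly_B, lp_B, lq_B] tau_B47 lw_B o_B kappa_B {1..3}"
proof
  show "list_all (\<lambda>(l, \<rho>). bij l \<and> (\<forall>v. \<rho> (kappa_B v) = kappa_B (l v)) \<and> (\<forall>k. k \<notin> {1..3} \<longrightarrow> \<rho> k = k)) LP_B47"
    unfolding LP_B47_def list.pred_inject prod.case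
    by (intro conjI list.pred_inject(1) B47_bij B47_checks(29,30,31,32,33)) (auto simp: Transposition.transpose_def dbl5_def inc5_def)
  show "list_all bij [rw_B, rx_B, ry_B]"
    unfolding list.pred_inject by (intro conjI list.pred_inject(1) B47_bij)
  show "list_all (\<lambda>l. list_all (\<lambda>r. \<forall>x. l (r x) = r (l x)) [rw_B, rx_B, ry_B]) (map fst LP_B47)"
    unfolding fst_LP_B47 list.pred_inject by (intro conjI list.pred_inject(1) B47_checks)
  show "orb (fst ` set LP_B47) o_B = UNIV"
    by (rule orb_UNIV_spread[OF _ B47_orbits(1)]) (simp add: fst_LP_B47)
  show "orb (set [rw_B, rx_B, ry_B]) o_B = UNIV"
    by (rule orb_UNIV_spread[OF _ B47_orbits(2)]) simp
  show "v \<in> orb (set [lx_B, ly_B, lp_B, lq_B]) o_B" if "kappa_B v = kappa_B o_B" for v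
    by (rule spread_orb_single[OF _ B47_orbits(3)[rule_format, OF that]]) simp
  show "\<exists>u\<in>orb (set [lx_B, ly_B, lp_B, lq_B]) (lw_B o_B). kappa_B u = kappa_B v" if v: "kappa_B v \<noteq> kappa_B o_B" for v
    by (rule orb_ex_spread[OF _ B47_orbits(4)[rule_format, OF v]]) simp
  show "list_all (\<lambda>b. \<exists>ls. set ls \<subseteq> fst ` set LP_B47 \<and> (\<forall>x. tau_B47 (b (tau_B47 x)) = act ls x)) [lx_B, ly_B, lp_B, lq_B]"
    unfolding list.pred_inject fst_LP_B47
    by (intro conjI list.pred_inject(1); rule exI, rule conjI[rotated], rule B47_checks, simp)
  show "\<exists>r\<in>set [rw_B, rx_B, ry_B]. \<exists>u. tau_B47 (lw_B (tau_B47 (r u))) \<noteq> r (tau_B47 (lw_B (tau_B47 u)))"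
    by (rule B47_orbits(5))
  show "tau_B47 (tau_B47 x) = x" for x using B47_checks(24) by blast
  show "range kappa_B = {1..3}" by (rule range_kappa_B)
  show "1 < card ({1..3} :: nat set)" by simp
qed (simp_all add: fst_LP_B47)

lemma B47_parity:
  "evenperm tau_B47" "evenperm lw_B" "evenperm lx_B" "evenperm ly_B" "evenperm lp_B" "evenperm lq_B"
proof -
  show "evenperm tau_B47" unfolding evenperm_involution_enum[OF B47_checks(24)] by code_simp
  show "evenperm lw_B" unfolding evenperm_involution_enum[OF B47_checks(1)[unfolded it.simps]] by code_simp
  show "evenperm lx_B" unfolding evenperm_involution_enum[OF B47_checks(2)[unfolded it.simps]] by code_simp
  show "evenperm ly_B" unfolding evenperm_involution_enum[OF B47_checks(3)[unfolded it.simps]] by code_simp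
  show "evenperm lp_B" unfolding evenperm_involution_enum[OF B47_checks(4)[unfolded it.simps]] by code_simp
  show "evenperm lq_B" unfolding evenperm_involution_enum[OF B47_checks(5)[unfolded it.simps]] by code_simp
qed

theorem lattice_3_47:
  "\<exists>\<Gamma>. regular_reducible_lattice 3 47 (sym_group 3) {1..3} (alt_group 47) {1..47} \<Gamma>"
proof -
  have "\<exists>\<Gamma>. regular_reducible_lattice 3 47 (sym_group 3) {1..3}
      (if True then alt_group 47 else sym_group 47) {1..47} \<Gamma>"
  proof (rule complete_graph_lattice[OF gen_data_B47, where ws = B47_word and c = c_B47 and d = d_B47
        and e = e_B47 and M = 368])
    show "\<exists>l. l dvd 368 \<and> (act B47_word ^^ l) x = x" if "x \<notin> {c_B47, d_B47, e_B47}" for x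
      using B47_word(4)[rule_format, OF that] unfolding it_eq by (elim disjE) (rule exI, rule conjI[rotated], assumption, simp)+
    show "list_all (\<lambda>g. \<exists>fs. set fs \<subseteq> insert tau_B47 (fst ` set LP_B47) \<and> act fs c_B47 = o_B \<and>
        act fs d_B47 = g o_B) (map fst LP_B47)"
      unfolding fst_LP_B47 list.pred_inject
      by (intro conjI list.pred_inject(1); rule linkI[rotated], rule B47_links, rule B47_links, simp)
    show "if True then list_all evenperm (tau_B47 # map fst LP_B47)
        else \<not> list_all evenperm (tau_B47 # map fst LP_B47)"
      using B47_parity by (simp add: fst_LP_B47)
    show "carrier (sym_group 3) = mgen (snd ` set LP_B47)"
      unfolding sym3_mgen LP_B47_def by simp
    show "card (UNIV :: ptB set) = 47 + 1" unfolding card_UNIV_length_enum by code_simp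
    show "set B47_word \<subseteq> insert tau_B47 (fst ` set LP_B47)" by (simp add: fst_LP_B47)
  qed (simp_all add: B47_word(1-3) sym_group_mult affine_group_5_def)
  then show ?thesis by simp
qed

text \<open>The same automorphism of B as for \<open>tau_B47\<close>, but every block stays in
  place, and the block \<open>Some False\<close> is translated by \<open>lp_B\<close> and
  \<open>lq_B\<close>.\<close>

fun tau_B24 :: "ptB \<Rightarrow> ptB" where
  "tau_B24 (y, p, q, a, i) =
     (a, (q \<noteq> (y \<and> a)) \<noteq> (i = Some False), (p \<noteq> (y \<and> a)) \<noteq> (i = Some False), y, i)"

text \<open>The homomorphism from L to C2 that is nontrivial on each of the five generators. The map
  \<open>tau_B24\<close> preserves it, so the group generated cannot be 2-transitive on the 48
  points, and the complete bipartite graph between the two fibres replaces the complete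
  graph.\<close>

fun chi_B24 :: "ptB \<Rightarrow> bool" where
  "chi_B24 (y, p, q, a, i) = ((((y \<noteq> p) \<noteq> q) \<noteq> a) \<noteq> (i = Some False))"

lemma B24_checks:
  "\<forall>x. it (num.Bit0 num.One) lw_B x = x"
  "\<forall>x. it (num.Bit0 num.One) lx_B x = x"
  "\<forall>x. it (num.Bit0 num.One) ly_B x = x"
  "\<forall>x. it (num.Bit0 num.One) lp_B x = x"
  "\<forall>x. it (num.Bit0 num.One) lq_B x = x"
  "\<forall>x. it (num.Bit0 num.One) rw_B x = x"
  "\<forall>x. it (num.Bit0 num.One) rx_B x = x"
  "\<forall>x. it (num.Bit0 num.One) ry_B x = x"
  "\<forall>x. lw_B (rw_B x) = rw_B (lw_B x)"
  "\<forall>x. lw_B (rx_B x) = rx_B (lw_B x)"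
  "\<forall>x. lw_B (ry_B x) = ry_B (lw_B x)"
  "\<forall>x. lx_B (rw_B x) = rw_B (lx_B x)"
  "\<forall>x. lx_B (rx_B x) = rx_B (lx_B x)"
  "\<forall>x. lx_B (ry_B x) = ry_B (lx_B x)"
  "\<forall>x. ly_B (rw_B x) = rw_B (ly_B x)"
  "\<forall>x. ly_B (rx_B x) = rx_B (ly_B x)"
  "\<forall>x. ly_B (ry_B x) = ry_B (ly_B x)"
  "\<forall>x. lp_B (rw_B x) = rw_B (lp_B x)"
  "\<forall>x. lp_B (rx_B x) = rx_B (lp_B x)"
  "\<forall>x. lp_B (ry_B x) = ry_B (lp_B x)"
  "\<forall>x. lq_B (rw_B x) = rw_B (lq_B x)"
  "\<forall>x. lq_B (rx_B x) = rx_B (lq_B x)"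
  "\<forall>x. lq_B (ry_B x) = ry_B (lq_B x)"
  "\<forall>x. tau_B24 (tau_B24 x) = x"
  "\<forall>x. tau_B24 (lx_B (tau_B24 x)) = act [ly_B] x"
  "\<forall>x. tau_B24 (ly_B (tau_B24 x)) = act [lx_B] x"
  "\<forall>x. tau_B24 (lp_B (tau_B24 x)) = act [lq_B] x"
  "\<forall>x. tau_B24 (lq_B (tau_B24 x)) = act [lp_B] x"
  "\<forall>x. Transposition.transpose 1 2 (kappa_B x) = kappa_B (lw_B x)"
  "\<forall>x. Transposition.transpose 2 3 (kappa_B x) = kappa_B (lx_B x)"
  "\<forall>x. id (kappa_B x) = kappa_B (ly_B x)"
  "\<forall>x. id (kappa_B x) = kappa_B (lp_B x)"
  "\<forall>x. id (kappa_B x) = kappa_B (lq_B x)"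
  by code_simp+

lemma B24_orbits:
  "\<forall>x. x \<in> set (spread [(lx_B, 1), (lw_B, 1), (lx_B, 1), (ly_B, 1), (lp_B, 1), (lq_B, 1)] [o_B])"
  "\<forall>x. x \<in> set (spread [(ry_B, 1), (rw_B, 1), (ry_B, 1), (rx_B, 1), (ry_B, 1), (rw_B, 1), (rx_B, 1), (rw_B, 1), (rx_B, 1)] [o_B])"
  "\<forall>x. kappa_B x = kappa_B o_B \<longrightarrow> x \<in> set (spread [(lx_B, 1), (ly_B, 1), (lp_B, 1), (lq_B, 1)] [o_B])"
  "\<forall>x. kappa_B x \<noteq> kappa_B o_B \<longrightarrow> (\<exists>u \<in> set (spread [(lx_B, 1)] [lw_B o_B]). kappa_B u = kappa_B x)"
  "\<exists>r\<in>set [rw_B, rx_B, ry_B]. \<exists>u. tau_B24 (lw_B (tau_B24 (r u))) \<noteq> r (tau_B24 (lw_B (tau_B24 u)))"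
  by code_simp+

lemma B24_bij: "bij lw_B" "bij lx_B" "bij ly_B" "bij lp_B" "bij lq_B" "bij rw_B" "bij rx_B" "bij ry_B"
  by (rule bij_it, rule B24_checks)+

abbreviation "B24_word \<equiv> [lw_B, tau_B24, lx_B, lw_B, tau_B24, lw_B, tau_B24, ly_B, lw_B, tau_B24]"
abbreviation "c_B24 \<equiv> (True, False, False, False, Some False) :: ptB"
abbreviation "d_B24 \<equiv> (True, False, False, True, Some True) :: ptB"
abbreviation "e_B24 \<equiv> (True, True, False, True, Some False) :: ptB"

definition "cyc xs x = (case map_of (zip xs (rotate1 xs)) x of None \<Rightarrow> x | Some y \<Rightarrow> y)"

text \<open>A power of the word, written out as a 7-cycle. Its conjugate \<open>R_B24\<close> is a
  7-cycle that shares with it only the point \<open>e_B24\<close>, and two cycles meeting in one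
  point have a 3-cycle as commutator.\<close>

fun Q_B24 :: "ptB \<Rightarrow> ptB" where
  "Q_B24 (y, p, q, a, None) = (y, p, q, a, None)"
| "Q_B24 (y, p, q, a, Some i) = cyc [(False, True, False, True, Some True), (True, True, False, True, Some False), (True, False, False, False, Some False), (False, True, True, False, Some True), (False, True, True, True, Some False), (True, False, True, True, Some False), (True, False, True, False, Some True)] (y, p, q, a, Some i)"

definition R_B24 :: "ptB \<Rightarrow> ptB" where
  "R_B24 x = lw_B (ly_B (Q_B24 (ly_B (lw_B x))))"

text \<open>The numerals are 60 and 6. The sixth power inverts a 7-cycle, so the second identity
  computes the commutator of \<open>Q_B24\<close> and \<open>R_B24\<close>.\<close>

lemma B24_word:
  "\<forall>x. Q_B24 x = it (num.Bit0 (num.Bit0 (num.Bit1 (num.Bit1 (num.Bit1 num.One))))) (act B24_word) x"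
  "\<forall>x. cyc3 c_B24 d_B24 e_B24 x = Q_B24 (R_B24 (it (num.Bit0 (num.Bit1 num.One)) Q_B24 (it (num.Bit0 (num.Bit1 num.One)) R_B24 x)))"
  by code_simp+

text \<open>Products of two generators preserve \<open>chi_B24\<close>. These four already act
  transitively on the fibre of the base point, so links are needed only for them.\<close>

definition "G_B24 = map (\<lambda>l. lw_B \<circ> l) [lx_B, ly_B, lp_B, lq_B]"

lemma B24_links:
  "act [lw_B, lq_B, tau_B24, lw_B, tau_B24, lw_B] c_B24 = o_B" "act [lw_B, lq_B, tau_B24, lw_B, tau_B24, lw_B] d_B24 = (lw_B \<circ> lx_B) o_B"
  "act [lw_B, lx_B, tau_B24, lw_B, tau_B24, lw_B, tau_B24, lw_B, tau_B24, lw_B, tau_B24, lw_B, tau_B24, lq_B, ly_B, lw_B] c_B24 = o_B" "act [lw_B, lx_B, tau_B24, lw_B, tau_B24, lw_B, tau_B24, lw_B, tau_B24, lw_B, tau_B24, lw_B, tau_B24, lq_B, ly_B, lw_B] d_B24 = (lw_B \<circ> ly_B) o_B"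
  "act [ly_B, tau_B24, lw_B, tau_B24, lw_B, tau_B24, lw_B, tau_B24, lw_B, tau_B24, lw_B, tau_B24, lw_B, tau_B24, lp_B, ly_B, lw_B] c_B24 = o_B" "act [ly_B, tau_B24, lw_B, tau_B24, lw_B, tau_B24, lw_B, tau_B24, lw_B, tau_B24, lw_B, tau_B24, lw_B, tau_B24, lp_B, ly_B, lw_B] d_B24 = (lw_B \<circ> lp_B) o_B"
  "act [lw_B, lx_B, lw_B, tau_B24, lw_B, tau_B24, lw_B, tau_B24, lw_B, tau_B24, lw_B, lx_B, ly_B, tau_B24, lw_B, tau_B24, lw_B, tau_B24, lw_B, tau_B24, lw_B, tau_B24, lw_B, tau_B24, lx_B, ly_B, lx_B, lw_B] c_B24 = o_B" "act [lw_B, lx_B, lw_B, tau_B24, lw_B, tau_B24, lw_B, tau_B24, lw_B, tau_B24, lw_B, lx_B, ly_B, tau_B24, lw_B, tau_B24, lw_B, tau_B24, lw_B, tau_B24, lw_B, tau_B24, lw_B, tau_B24, lx_B, ly_B, lx_B, lw_B] d_B24 = (lw_B \<circ> lq_B) o_B"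
  by code_simp+

lemma B24_parts:
  "\<forall>x. chi_B24 (tau_B24 x) = chi_B24 x"
  "\<forall>x. chi_B24 (lw_B x) = (\<not> chi_B24 x)"
  "\<forall>x. chi_B24 (lx_B x) = (\<not> chi_B24 x)"
  "\<forall>x. chi_B24 (ly_B x) = (\<not> chi_B24 x)"
  "\<forall>x. chi_B24 (lp_B x) = (\<not> chi_B24 x)"
  "\<forall>x. chi_B24 (lq_B x) = (\<not> chi_B24 x)"
  "\<forall>x. chi_B24 x = chi_B24 o_B \<longrightarrow> x \<in> set (spread [(lw_B \<circ> ly_B, 1), (lw_B \<circ> lq_B, 1), (lw_B \<circ> lx_B, 1), (lw_B \<circ> lp_B, 1), (lw_B \<circ> lq_B, 1)] [o_B])"
  "length (filter (\<lambda>x. chi_B24 x = True) Enum.enum) = 24"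
  "length (filter (\<lambda>x. chi_B24 x = False) Enum.enum) = 24"
  by code_simp+

lemma B24_parity: "\<not> evenperm (\<lambda>x. if chi_B24 x = b then tau_B24 x else x)"
proof -
  have "\<forall>x. (if chi_B24 (if chi_B24 x = b then tau_B24 x else x) = b
      then tau_B24 (if chi_B24 x = b then tau_B24 x else x) else if chi_B24 x = b then tau_B24 x else x) = x"
    for b by (cases b; simp only:; code_simp)
  note invol = this
  show ?thesis
    unfolding evenperm_involution_enum[OF invol] by (cases b; simp only:; code_simp)
qed

definition "LP_B24 = [(lw_B, Transposition.transpose 1 2), (lx_B, Transposition.transpose 2 3), (ly_B, id), (lp_B, id), (lq_B, id)]"

lemma fst_LP_B24: "map fst LP_B24 = [lw_B, lx_B, ly_B, lp_B, lq_B]" "fst ` set LP_B24 = {lw_B, lx_B, ly_B, lp_B, lq_B}"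
  by (simp_all add: LP_B24_def)

lemma gen_data_B24: "gen_data LP_B24 [rw_B, rx_B, ry_B] [lx_B, ly_B, lp_B, lq_B] tau_B24 lw_B o_B kappa_B {1..3}"
proof
  show "list_all (\<lambda>(l, \<rho>). bij l \<and> (\<forall>v. \<rho> (kappa_B v) = kappa_B (l v)) \<and> (\<forall>k. k \<notin> {1..3} \<longrightarrow> \<rho> k = k)) LP_B24"
    unfolding LP_B24_def list.pred_inject prod.case
    by (intro conjI list.pred_inject(1) B24_bij B24_checks(29,30,31,32,33)) (auto simp: Transposition.transpose_def dbl5_def inc5_def)
  show "list_all bij [rw_B, rx_B, ry_B]"
    unfolding list.pred_inject by (intro conjI list.pred_inject(1) B24_bij)
  show "list_all (\<lambda>l. list_all (\<lambda>r. \<forall>x. l (r x) = r (l x)) [rw_B, rx_B, ry_B]) (map fst LP_B24)"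
    unfolding fst_LP_B24 list.pred_inject by (intro conjI list.pred_inject(1) B24_checks)
  show "orb (fst ` set LP_B24) o_B = UNIV"
    by (rule orb_UNIV_spread[OF _ B24_orbits(1)]) (simp add: fst_LP_B24)
  show "orb (set [rw_B, rx_B, ry_B]) o_B = UNIV"
    by (rule orb_UNIV_spread[OF _ B24_orbits(2)]) simp
  show "v \<in> orb (set [lx_B, ly_B, lp_B, lq_B]) o_B" if "kappa_B v = kappa_B o_B" for v
    by (rule spread_orb_single[OF _ B24_orbits(3)[rule_format, OF that]]) simp
  show "\<exists>u\<in>orb (set [lx_B, ly_B, lp_B, lq_B]) (lw_B o_B). kappa_B u = kappa_B v" if v: "kappa_B v \<noteq> kappa_B o_B" for v
    by (rule orb_ex_spread[OF _ B24_orbits(4)[rule_format, OF v]]) simp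
  show "list_all (\<lambda>b. \<exists>ls. set ls \<subseteq> fst ` set LP_B24 \<and> (\<forall>x. tau_B24 (b (tau_B24 x)) = act ls x)) [lx_B, ly_B, lp_B, lq_B]"
    unfolding list.pred_inject fst_LP_B24
    by (intro conjI list.pred_inject(1); rule exI, rule conjI[rotated], rule B24_checks, simp)
  show "\<exists>r\<in>set [rw_B, rx_B, ry_B]. \<exists>u. tau_B24 (lw_B (tau_B24 (r u))) \<noteq> r (tau_B24 (lw_B (tau_B24 u)))"
    by (rule B24_orbits(5))
  show "tau_B24 (tau_B24 x) = x" for x using B24_checks(24) by blast
  show "range kappa_B = {1..3}" by (rule range_kappa_B)
  show "1 < card ({1..3} :: nat set)" by simp
qed (simp_all add: fst_LP_B24)

theorem lattice_3_24:
  "\<exists>\<Gamma>. regular_reducible_lattice 3 24 (sym_group 3) {1..3} (sym_group 24) {1..24} \<Gamma>"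
proof -
  interpret gen_data LP_B24 "[rw_B, rx_B, ry_B]" "[lx_B, ly_B, lp_B, lq_B]" tau_B24 lw_B o_B kappa_B "{1..3}"
    by (rule gen_data_B24)
  have Lg: "Lg = {lw_B, lx_B, ly_B, lp_B, lq_B}" unfolding Lg_def fst_LP_B24 ..
  have inF: "lw_B \<in> F" "lx_B \<in> F" "ly_B \<in> F" "lp_B \<in> F" "lq_B \<in> F"
    unfolding F_eq by (rule mgen_incl, simp add: Lg)+
  have W: "act B24_word \<in> F" by (rule act_in_F) (simp add: Lg)
  have it_F: "(\<lambda>x. it k f x) \<in> F" if "f \<in> F" for k f
  proof -
    have "(\<lambda>x. it k f x) = f ^^ numeral k" by (intro ext it_eq)
    then show ?thesis using that unfolding F_eq by (simp only: mgen_funpow)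
  qed
  have Q_eq: "Q_B24 = (\<lambda>x. it (num.Bit0 (num.Bit0 (num.Bit1 (num.Bit1 (num.Bit1 num.One))))) (act B24_word) x)" using B24_word(1) by blast
  have Q: "Q_B24 \<in> F" unfolding Q_eq by (rule it_F[OF W])
  have R_eq: "R_B24 = lw_B \<circ> (ly_B \<circ> (Q_B24 \<circ> (ly_B \<circ> lw_B)))"
    by (intro ext) (simp only: R_B24_def comp_apply)
  have R: "R_B24 \<in> F" unfolding R_eq by (intro F_comp inF Q)
  have cyc_eq: "cyc3 c_B24 d_B24 e_B24 = Q_B24 \<circ> (R_B24 \<circ> ((\<lambda>x. it (num.Bit0 (num.Bit1 num.One)) Q_B24 x) \<circ> (\<lambda>x. it (num.Bit0 (num.Bit1 num.One)) R_B24 x)))"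
    using B24_word(2) by (intro ext) (simp only: comp_apply)
  have cyc: "cyc3 c_B24 d_B24 e_B24 \<in> F"
    unfolding cyc_eq by (intro F_comp it_F Q R)
  show ?thesis
  proof (rule bipartite_lattice[where \<chi> = chi_B24 and G = "set G_B24", OF _ _ _ _ _ cyc])
    show "carrier (sym_group 3) = mgen (snd ` set LP_B24)"
      unfolding sym3_mgen LP_B24_def by simp
    show "card {u. chi_B24 u = b} = 24" for b
      unfolding card_enum using B24_parts(8,9) by (cases b) (simp_all only:)
    show "chi_B24 (tau_B24 x) = chi_B24 x" for x using B24_parts(1) by blast
    show "chi_B24 (l x) = (\<not> chi_B24 x)" if "l \<in> fst ` set LP_B24" for l x
      using that B24_parts(2-6)[THEN spec, of x] unfolding fst_LP_B24 by (elim insertE emptyE) (simp_all only: simp_thms)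
    show "set G_B24 \<subseteq> F"
    proof -
      have "lw_B \<circ> lx_B \<in> F" "lw_B \<circ> ly_B \<in> F" "lw_B \<circ> lp_B \<in> F" "lw_B \<circ> lq_B \<in> F"
        by (intro F_comp inF)+
      then show ?thesis unfolding G_B24_def list.map list.set by (simp only: insert_subset empty_subsetI simp_thms)
    qed
    show "u \<in> orb (set G_B24) o_B" if "chi_B24 u = chi_B24 o_B" for u
      by (rule spread_orb_single[OF _ B24_parts(7)[rule_format, OF that]]) (auto simp: G_B24_def)
    show "\<exists>fs. set fs \<subseteq> insert tau_B24 (fst ` set LP_B24) \<and> act fs c_B24 = o_B \<and> act fs d_B24 = g o_B"
      if "g \<in> set G_B24" for g
    proof -
      have "list_all (\<lambda>g. \<exists>fs. set fs \<subseteq> insert tau_B24 (fst ` set LP_B24) \<and> act fs c_B24 = o_B \<and> act fs d_B24 = g o_B) G_B24"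
        unfolding G_B24_def list.map list.pred_inject fst_LP_B24
        by (intro conjI list.pred_inject(1); rule linkI[rotated], rule B24_links, rule B24_links, simp)
      then show ?thesis using that unfolding list_all_iff by blast
    qed
    show "\<not> evenperm (\<lambda>x. if chi_B24 x = b then tau_B24 x else x)" for b by (rule B24_parity)
  qed (simp_all add: sym_group_mult)
qed

section \<open>Lattices on products with the five-valent tree\<close>

type_synonym ptF1 = "u5 \<times> f5 \<times> unit"

abbreviation "kappa_F1 \<equiv> (kappa5 :: ptF1 \<Rightarrow> nat)"
abbreviation "la_F1 \<equiv> (la :: ptF1 \<Rightarrow> ptF1)"
abbreviation "lb_F1 \<equiv> (lb :: ptF1 \<Rightarrow> ptF1)"
abbreviation "ra_F1 \<equiv> (ra :: ptF1 \<Rightarrow> ptF1)"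
abbreviation "rb_F1 \<equiv> (rb :: ptF1 \<Rightarrow> ptF1)"
text \<open>B is the cyclic group generated by \<open>la_F1\<close>, its automorphism is inversion,
  and no block is moved. The factors 3 and 2 in the blocks \<open>F1\<close> and \<open>F2\<close>
  are the free constants of the construction.\<close>

fun tau_F1 :: "ptF1 \<Rightarrow> ptF1" where
  "tau_F1 (a, F0, c) = (uinv a, F0, c)"
| "tau_F1 (a, F1, c) = (umul U3 (uinv a), F1, c)"
| "tau_F1 (a, F2, c) = (rot (uinv a), F2, c)"
| "tau_F1 (a, F3, c) = (uinv a, F3, c)"
| "tau_F1 (a, F4, c) = (uinv a, F4, c)"

definition "o_F1 = (U1, F0, ())"

lemma F1_checks:
  "\<forall>x. it (num.Bit0 (num.Bit0 num.One)) la_F1 x = x"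
  "\<forall>x. it (num.Bit1 (num.Bit0 num.One)) lb_F1 x = x"
  "\<forall>x. it (num.Bit0 (num.Bit0 num.One)) ra_F1 x = x"
  "\<forall>x. it (num.Bit1 (num.Bit0 num.One)) rb_F1 x = x"
  "\<forall>x. la_F1 (ra_F1 x) = ra_F1 (la_F1 x)"
  "\<forall>x. la_F1 (rb_F1 x) = rb_F1 (la_F1 x)"
  "\<forall>x. lb_F1 (ra_F1 x) = ra_F1 (lb_F1 x)"
  "\<forall>x. lb_F1 (rb_F1 x) = rb_F1 (lb_F1 x)"
  "\<forall>x. tau_F1 (tau_F1 x) = x"
  "\<forall>x. tau_F1 (la_F1 (tau_F1 x)) = act [la_F1, la_F1, la_F1] x"
  "\<forall>x. dbl5 (kappa_F1 x) = kappa_F1 (la_F1 x)"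
  "\<forall>x. inc5 (kappa_F1 x) = kappa_F1 (lb_F1 x)"
  by code_simp+

lemma F1_orbits:
  "\<forall>x. x \<in> set (spread [(la_F1, 3), (lb_F1, 4)] [o_F1])"
  "\<forall>x. x \<in> set (spread [(ra_F1, 3), (rb_F1, 4)] [o_F1])"
  "\<forall>x. kappa_F1 x = kappa_F1 o_F1 \<longrightarrow> x \<in> set (spread [(la_F1, 3)] [o_F1])"
  "\<forall>x. kappa_F1 x \<noteq> kappa_F1 o_F1 \<longrightarrow> (\<exists>u \<in> set (spread [(la_F1, 3)] [lb_F1 o_F1]). kappa_F1 u = kappa_F1 x)"
  "\<exists>r\<in>set [ra_F1, rb_F1]. \<exists>u. tau_F1 (lb_F1 (tau_F1 (r u))) \<noteq> r (tau_F1 (lb_F1 (tau_F1 u)))"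
  by code_simp+

lemma F1_bij: "bij la_F1" "bij lb_F1" "bij ra_F1" "bij rb_F1"
  by (rule bij_it, rule F1_checks)+

abbreviation "F1_word \<equiv> [lb_F1, la_F1, la_F1, tau_F1, lb_F1, lb_F1, lb_F1, tau_F1, lb_F1, lb_F1, lb_F1, tau_F1, lb_F1, tau_F1, lb_F1, tau_F1, lb_F1, lb_F1, tau_F1]"
abbreviation "c_F1 \<equiv> (U1, F2, ()) :: ptF1"
abbreviation "d_F1 \<equiv> (U2, F1, ()) :: ptF1"
abbreviation "e_F1 \<equiv> (U4, F1, ()) :: ptF1"

text \<open>The numeral is 17, the number of points outside the 3-cycle.\<close>

lemma F1_word:
  "act F1_word c_F1 = d_F1" "act F1_word d_F1 = e_F1" "act F1_word e_F1 = c_F1"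
  "\<forall>x. x \<notin> {c_F1, d_F1, e_F1} \<longrightarrow> it (num.Bit1 (num.Bit0 (num.Bit0 (num.Bit0 num.One)))) (act F1_word) x = x"
  by code_simp+

lemma F1_links:
  "act [lb_F1, lb_F1, lb_F1] c_F1 = o_F1" "act [lb_F1, lb_F1, lb_F1] d_F1 = la_F1 o_F1"
  "act [la_F1, tau_F1, lb_F1, la_F1, tau_F1, lb_F1, la_F1, tau_F1, lb_F1, lb_F1] c_F1 = o_F1" "act [la_F1, tau_F1, lb_F1, la_F1, tau_F1, lb_F1, la_F1, tau_F1, lb_F1, lb_F1] d_F1 = lb_F1 o_F1"
  by code_simp+

definition "LP_F1 = [(la_F1, dbl5), (lb_F1, inc5)]"

lemma fst_LP_F1: "map fst LP_F1 = [la_F1, lb_F1]" "fst ` set LP_F1 = {la_F1, lb_F1}"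
  by (simp_all add: LP_F1_def)

lemma gen_data_F1: "gen_data LP_F1 [ra_F1, rb_F1] [la_F1] tau_F1 lb_F1 o_F1 kappa_F1 {0..<5}"
proof
  show "list_all (\<lambda>(l, \<rho>). bij l \<and> (\<forall>v. \<rho> (kappa_F1 v) = kappa_F1 (l v)) \<and> (\<forall>k. k \<notin> {0..<5} \<longrightarrow> \<rho> k = k)) LP_F1"
    unfolding LP_F1_def list.pred_inject prod.case
    by (intro conjI list.pred_inject(1) F1_bij F1_checks(11,12)) (auto simp: Transposition.transpose_def dbl5_def inc5_def)
  show "list_all bij [ra_F1, rb_F1]"
    unfolding list.pred_inject by (intro conjI list.pred_inject(1) F1_bij)
  show "list_all (\<lambda>l. list_all (\<lambda>r. \<forall>x. l (r x) = r (l x)) [ra_F1, rb_F1]) (map fst LP_F1)"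
    unfolding fst_LP_F1 list.pred_inject by (intro conjI list.pred_inject(1) F1_checks)
  show "orb (fst ` set LP_F1) o_F1 = UNIV"
    by (rule orb_UNIV_spread[OF _ F1_orbits(1)]) (simp add: fst_LP_F1)
  show "orb (set [ra_F1, rb_F1]) o_F1 = UNIV"
    by (rule orb_UNIV_spread[OF _ F1_orbits(2)]) simp
  show "v \<in> orb (set [la_F1]) o_F1" if "kappa_F1 v = kappa_F1 o_F1" for v
    by (rule spread_orb_single[OF _ F1_orbits(3)[rule_format, OF that]]) simp
  show "\<exists>u\<in>orb (set [la_F1]) (lb_F1 o_F1). kappa_F1 u = kappa_F1 v" if v: "kappa_F1 v \<noteq> kappa_F1 o_F1" for v
    by (rule orb_ex_spread[OF _ F1_orbits(4)[rule_format, OF v]]) simp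
  show "list_all (\<lambda>b. \<exists>ls. set ls \<subseteq> fst ` set LP_F1 \<and> (\<forall>x. tau_F1 (b (tau_F1 x)) = act ls x)) [la_F1]"
    unfolding list.pred_inject fst_LP_F1
    by (intro conjI list.pred_inject(1); rule exI, rule conjI[rotated], rule F1_checks, simp)
  show "\<exists>r\<in>set [ra_F1, rb_F1]. \<exists>u. tau_F1 (lb_F1 (tau_F1 (r u))) \<noteq> r (tau_F1 (lb_F1 (tau_F1 u)))"
    by (rule F1_orbits(5))
  show "tau_F1 (tau_F1 x) = x" for x using F1_checks(9) by blast
  show "range kappa_F1 = {0..<5}" by (rule range_kappa5)
  show "1 < card ({0..<5} :: nat set)" by simp
qed (simp_all add: fst_LP_F1)

lemma F1_parity: "\<not> evenperm tau_F1"
  unfolding evenperm_involution_enum[OF F1_checks(9)] by code_simp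

theorem lattice_5_19:
  "\<exists>\<Gamma>. regular_reducible_lattice 5 19 affine_group_5 {0..<5} (sym_group 19) {1..19} \<Gamma>"
proof -
  have "\<exists>\<Gamma>. regular_reducible_lattice 5 19 affine_group_5 {0..<5}
      (if False then alt_group 19 else sym_group 19) {1..19} \<Gamma>"
  proof (rule complete_graph_lattice[OF gen_data_F1, where ws = F1_word and c = c_F1 and d = d_F1
        and e = e_F1 and M = 17])
    show "\<exists>l. l dvd 17 \<and> (act F1_word ^^ l) x = x" if "x \<notin> {c_F1, d_F1, e_F1}" for x
      using F1_word(4)[rule_format, OF that] by (intro exI[of _ 17]) (simp only: it_eq dvd_refl simp_thms)
    show "list_all (\<lambda>g. \<exists>fs. set fs \<subseteq> insert tau_F1 (fst ` set LP_F1) \<and> act fs c_F1 = o_F1 \<and>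
        act fs d_F1 = g o_F1) (map fst LP_F1)"
      unfolding fst_LP_F1 list.pred_inject
      by (intro conjI list.pred_inject(1); rule linkI[rotated], rule F1_links, rule F1_links, simp)
    show "if False then list_all evenperm (tau_F1 # map fst LP_F1)
        else \<not> list_all evenperm (tau_F1 # map fst LP_F1)"
      using F1_parity by (simp add: fst_LP_F1)
    show "carrier affine_group_5 = mgen (snd ` set LP_F1)"
      unfolding affine_mgen LP_F1_def by simp
    show "card (UNIV :: ptF1 set) = 19 + 1" unfolding card_UNIV_length_enum by code_simp
    show "set F1_word \<subseteq> insert tau_F1 (fst ` set LP_F1)" by (simp add: fst_LP_F1)
  qed (simp_all add: F1_word(1-3) sym_group_mult affine_group_5_def)
  then show ?thesis by simp
qed

type_synonym ptF2 = "u5 \<times> f5 \<times> bool"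

abbreviation "kappa_F2 \<equiv> (kappa5 :: ptF2 \<Rightarrow> nat)"
abbreviation "la_F2 \<equiv> (la :: ptF2 \<Rightarrow> ptF2)"
abbreviation "lb_F2 \<equiv> (lb :: ptF2 \<Rightarrow> ptF2)"
abbreviation "ra_F2 \<equiv> (ra :: ptF2 \<Rightarrow> ptF2)"
abbreviation "rb_F2 \<equiv> (rb :: ptF2 \<Rightarrow> ptF2)"
text \<open>The generator of the central factor C2. Being central it is its own right translation,
  and it is listed on both sides.\<close>

fun lc_F2 :: "ptF2 \<Rightarrow> ptF2" where "lc_F2 (a, b, c) = (a, b, \<not> c)"
text \<open>The automorphism of B = C4 x C2 fixes \<open>la_F2\<close> and multiplies
  \<open>lc_F2\<close> by the square of \<open>la_F2\<close>, which explains the factor 4 for true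
  \<open>c\<close>. The blocks \<open>F2\<close> and \<open>F3\<close> are exchanged.\<close>

fun tau_F2 :: "ptF2 \<Rightarrow> ptF2" where
  "tau_F2 (a, F0, c) = (if c then umul U4 a else a, F0, c)"
| "tau_F2 (a, F1, c) = (rot (if c then umul U4 a else a), F1, \<not> c)"
| "tau_F2 (a, F2, c) = (rot (if c then umul U4 a else a), F3, c)"
| "tau_F2 (a, F3, c) = (umul U3 (if c then umul U4 a else a), F2, c)"
| "tau_F2 (a, F4, c) = (umul U3 (if c then umul U4 a else a), F4, \<not> c)"

definition "o_F2 = (U1, F0, False)"

lemma F2_checks:
  "\<forall>x. it (num.Bit0 (num.Bit0 num.One)) la_F2 x = x"
  "\<forall>x. it (num.Bit1 (num.Bit0 num.One)) lb_F2 x = x"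
  "\<forall>x. it (num.Bit0 num.One) lc_F2 x = x"
  "\<forall>x. it (num.Bit0 (num.Bit0 num.One)) ra_F2 x = x"
  "\<forall>x. it (num.Bit1 (num.Bit0 num.One)) rb_F2 x = x"
  "\<forall>x. it (num.Bit0 num.One) lc_F2 x = x"
  "\<forall>x. la_F2 (ra_F2 x) = ra_F2 (la_F2 x)"
  "\<forall>x. la_F2 (rb_F2 x) = rb_F2 (la_F2 x)"
  "\<forall>x. la_F2 (lc_F2 x) = lc_F2 (la_F2 x)"
  "\<forall>x. lb_F2 (ra_F2 x) = ra_F2 (lb_F2 x)"
  "\<forall>x. lb_F2 (rb_F2 x) = rb_F2 (lb_F2 x)"
  "\<forall>x. lb_F2 (lc_F2 x) = lc_F2 (lb_F2 x)"
  "\<forall>x. lc_F2 (ra_F2 x) = ra_F2 (lc_F2 x)"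
  "\<forall>x. lc_F2 (rb_F2 x) = rb_F2 (lc_F2 x)"
  "\<forall>x. lc_F2 (lc_F2 x) = lc_F2 (lc_F2 x)"
  "\<forall>x. tau_F2 (tau_F2 x) = x"
  "\<forall>x. tau_F2 (la_F2 (tau_F2 x)) = act [la_F2] x"
  "\<forall>x. tau_F2 (lc_F2 (tau_F2 x)) = act [la_F2, la_F2, lc_F2] x"
  "\<forall>x. dbl5 (kappa_F2 x) = kappa_F2 (la_F2 x)"
  "\<forall>x. inc5 (kappa_F2 x) = kappa_F2 (lb_F2 x)"
  "\<forall>x. id (kappa_F2 x) = kappa_F2 (lc_F2 x)"
  by code_simp+

lemma F2_orbits:
  "\<forall>x. x \<in> set (spread [(la_F2, 3), (lc_F2, 1), (lb_F2, 4)] [o_F2])"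
  "\<forall>x. x \<in> set (spread [(ra_F2, 3), (lc_F2, 1), (rb_F2, 4)] [o_F2])"
  "\<forall>x. kappa_F2 x = kappa_F2 o_F2 \<longrightarrow> x \<in> set (spread [(la_F2, 3), (lc_F2, 1)] [o_F2])"
  "\<forall>x. kappa_F2 x \<noteq> kappa_F2 o_F2 \<longrightarrow> (\<exists>u \<in> set (spread [(la_F2, 3)] [lb_F2 o_F2]). kappa_F2 u = kappa_F2 x)"
  "\<exists>r\<in>set [ra_F2, rb_F2, lc_F2]. \<exists>u. tau_F2 (lb_F2 (tau_F2 (r u))) \<noteq> r (tau_F2 (lb_F2 (tau_F2 u)))"
  by code_simp+

lemma F2_bij: "bij la_F2" "bij lb_F2" "bij lc_F2" "bij ra_F2" "bij rb_F2" "bij lc_F2"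
  by (rule bij_it, rule F2_checks)+

abbreviation "F2_word \<equiv> [lb_F2, tau_F2, lb_F2, la_F2, tau_F2, lb_F2, tau_F2]"
abbreviation "c_F2 \<equiv> (U1, F3, False) :: ptF2"
abbreviation "d_F2 \<equiv> (U4, F0, False) :: ptF2"
abbreviation "e_F2 \<equiv> (U3, F4, True) :: ptF2"

text \<open>The numeral is 37 = 40 - 3.\<close>

lemma F2_word:
  "act F2_word c_F2 = d_F2" "act F2_word d_F2 = e_F2" "act F2_word e_F2 = c_F2"
  "\<forall>x. x \<notin> {c_F2, d_F2, e_F2} \<longrightarrow> it (num.Bit1 (num.Bit0 (num.Bit1 (num.Bit0 (num.Bit0 num.One))))) (act F2_word) x = x"
  by code_simp+

lemma F2_links:
  "act [la_F2, lb_F2, lc_F2, tau_F2, lb_F2, lb_F2, tau_F2, lb_F2, tau_F2, lb_F2, tau_F2, lb_F2, tau_F2, lc_F2, lb_F2, la_F2] c_F2 = o_F2" "act [la_F2, lb_F2, lc_F2, tau_F2, lb_F2, lb_F2, tau_F2, lb_F2, tau_F2, lb_F2, tau_F2, lb_F2, tau_F2, lc_F2, lb_F2, la_F2] d_F2 = la_F2 o_F2"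
  "act [tau_F2, lb_F2, la_F2, lb_F2, tau_F2, lb_F2, tau_F2, lb_F2, tau_F2, la_F2, lb_F2, lb_F2] c_F2 = o_F2" "act [tau_F2, lb_F2, la_F2, lb_F2, tau_F2, lb_F2, tau_F2, lb_F2, tau_F2, la_F2, lb_F2, lb_F2] d_F2 = lb_F2 o_F2"
  "act [la_F2, lb_F2, tau_F2, lb_F2, tau_F2, lb_F2, la_F2, lb_F2] c_F2 = o_F2" "act [la_F2, lb_F2, tau_F2, lb_F2, tau_F2, lb_F2, la_F2, lb_F2] d_F2 = lc_F2 o_F2"
  by code_simp+

definition "LP_F2 = [(la_F2, dbl5), (lb_F2, inc5), (lc_F2, id)]"

lemma fst_LP_F2: "map fst LP_F2 = [la_F2, lb_F2, lc_F2]" "fst ` set LP_F2 = {la_F2, lb_F2, lc_F2}"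
  by (simp_all add: LP_F2_def)

lemma gen_data_F2: "gen_data LP_F2 [ra_F2, rb_F2, lc_F2] [la_F2, lc_F2] tau_F2 lb_F2 o_F2 kappa_F2 {0..<5}"
proof
  show "list_all (\<lambda>(l, \<rho>). bij l \<and> (\<forall>v. \<rho> (kappa_F2 v) = kappa_F2 (l v)) \<and> (\<forall>k. k \<notin> {0..<5} \<longrightarrow> \<rho> k = k)) LP_F2"
    unfolding LP_F2_def list.pred_inject prod.case
    by (intro conjI list.pred_inject(1) F2_bij F2_checks(19,20,21)) (auto simp: Transposition.transpose_def dbl5_def inc5_def)
  show "list_all bij [ra_F2, rb_F2, lc_F2]"
    unfolding list.pred_inject by (intro conjI list.pred_inject(1) F2_bij)
  show "list_all (\<lambda>l. list_all (\<lambda>r. \<forall>x. l (r x) = r (l x)) [ra_F2, rb_F2, lc_F2]) (map fst LP_F2)"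
    unfolding fst_LP_F2 list.pred_inject by (intro conjI list.pred_inject(1) F2_checks)
  show "orb (fst ` set LP_F2) o_F2 = UNIV"
    by (rule orb_UNIV_spread[OF _ F2_orbits(1)]) (simp add: fst_LP_F2)
  show "orb (set [ra_F2, rb_F2, lc_F2]) o_F2 = UNIV"
    by (rule orb_UNIV_spread[OF _ F2_orbits(2)]) simp
  show "v \<in> orb (set [la_F2, lc_F2]) o_F2" if "kappa_F2 v = kappa_F2 o_F2" for v
    by (rule spread_orb_single[OF _ F2_orbits(3)[rule_format, OF that]]) simp
  show "\<exists>u\<in>orb (set [la_F2, lc_F2]) (lb_F2 o_F2). kappa_F2 u = kappa_F2 v" if v: "kappa_F2 v \<noteq> kappa_F2 o_F2" for v
    by (rule orb_ex_spread[OF _ F2_orbits(4)[rule_format, OF v]]) simp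
  show "list_all (\<lambda>b. \<exists>ls. set ls \<subseteq> fst ` set LP_F2 \<and> (\<forall>x. tau_F2 (b (tau_F2 x)) = act ls x)) [la_F2, lc_F2]"
    unfolding list.pred_inject fst_LP_F2
    by (intro conjI list.pred_inject(1); rule exI, rule conjI[rotated], rule F2_checks, simp)
  show "\<exists>r\<in>set [ra_F2, rb_F2, lc_F2]. \<exists>u. tau_F2 (lb_F2 (tau_F2 (r u))) \<noteq> r (tau_F2 (lb_F2 (tau_F2 u)))"
    by (rule F2_orbits(5))
  show "tau_F2 (tau_F2 x) = x" for x using F2_checks(16) by blast
  show "range kappa_F2 = {0..<5}" by (rule range_kappa5)
  show "1 < card ({0..<5} :: nat set)" by simp
qed (simp_all add: fst_LP_F2)

lemma F2_parity: "evenperm tau_F2" "evenperm la_F2" "evenperm lb_F2" "evenperm lc_F2"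
proof -
  show "evenperm tau_F2" unfolding evenperm_involution_enum[OF F2_checks(16)] by code_simp
  show "evenperm la_F2"
    by (rule evenperm_comp_involutions[where f = ub and g = ua]; code_simp)
  show "evenperm lb_F2" by (rule evenperm_odd_order, rule F2_checks)
  show "evenperm lc_F2" unfolding evenperm_involution_enum[OF F2_checks(3)[unfolded it.simps]] by code_simp
qed

theorem lattice_5_39:
  "\<exists>\<Gamma>. regular_reducible_lattice 5 39 affine_group_5 {0..<5} (alt_group 39) {1..39} \<Gamma>"
proof -
  have "\<exists>\<Gamma>. regular_reducible_lattice 5 39 affine_group_5 {0..<5}
      (if True then alt_group 39 else sym_group 39) {1..39} \<Gamma>"
  proof (rule complete_graph_lattice[OF gen_data_F2, where ws = F2_word and c = c_F2 and d = d_F2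
        and e = e_F2 and M = 37])
    show "\<exists>l. l dvd 37 \<and> (act F2_word ^^ l) x = x" if "x \<notin> {c_F2, d_F2, e_F2}" for x
      using F2_word(4)[rule_format, OF that] by (intro exI[of _ 37]) (simp only: it_eq dvd_refl simp_thms)
    show "list_all (\<lambda>g. \<exists>fs. set fs \<subseteq> insert tau_F2 (fst ` set LP_F2) \<and> act fs c_F2 = o_F2 \<and>
        act fs d_F2 = g o_F2) (map fst LP_F2)"
      unfolding fst_LP_F2 list.pred_inject
      by (intro conjI list.pred_inject(1); rule linkI[rotated], rule F2_links, rule F2_links, simp)
    show "if True then list_all evenperm (tau_F2 # map fst LP_F2)
        else \<not> list_all evenperm (tau_F2 # map fst LP_F2)"
      using F2_parity by (simp add: fst_LP_F2)
    show "carrier affine_group_5 = mgen (snd ` set LP_F2)"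
      unfolding affine_mgen_id LP_F2_def by simp
    show "card (UNIV :: ptF2 set) = 39 + 1" unfolding card_UNIV_length_enum by code_simp
    show "set F2_word \<subseteq> insert tau_F2 (fst ` set LP_F2)" by (simp add: fst_LP_F2)
  qed (simp_all add: F2_word(1-3) sym_group_mult affine_group_5_def)
  then show ?thesis by simp
qed

type_synonym ptF4 = "u5 \<times> f5 \<times> u5"

abbreviation "kappa_F4 \<equiv> (kappa5 :: ptF4 \<Rightarrow> nat)"
abbreviation "la_F4 \<equiv> (la :: ptF4 \<Rightarrow> ptF4)"
abbreviation "lb_F4 \<equiv> (lb :: ptF4 \<Rightarrow> ptF4)"
abbreviation "ra_F4 \<equiv> (ra :: ptF4 \<Rightarrow> ptF4)"
abbreviation "rb_F4 \<equiv> (rb :: ptF4 \<Rightarrow> ptF4)"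
fun lc_F4 :: "ptF4 \<Rightarrow> ptF4" where "lc_F4 (a, b, c) = (a, b, rot c)"
text \<open>The automorphism of B = C4 x C4 exchanges the two factors. The blocks \<open>F3\<close>
  and \<open>F4\<close> change places, and shifts by units occur in the blocks \<open>F2\<close>,
  \<open>F3\<close> and \<open>F4\<close>.\<close>

fun tau_F4 :: "ptF4 \<Rightarrow> ptF4" where
  "tau_F4 (a, F0, c) = (c, F0, a)"
| "tau_F4 (a, F1, c) = (c, F1, a)"
| "tau_F4 (a, F2, c) = (rot c, F2, umul U3 a)"
| "tau_F4 (a, F3, c) = (rot c, F4, a)"
| "tau_F4 (a, F4, c) = (c, F3, umul U3 a)"

text \<open>The product \<open>vb \<circ> va\<close> is \<open>lc_F4\<close>, as
  \<open>ub \<circ> ua\<close> is \<open>la\<close>; this settles the parity of a product of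
  4-cycles.\<close>

fun va :: "ptF4 \<Rightarrow> ptF4" where "va (a, b, c) = (a, b, uinv c)"
fun vb :: "ptF4 \<Rightarrow> ptF4" where "vb (a, b, c) = (a, b, rot (uinv c))"

definition "o_F4 = (U1, F0, U1)"

lemma F4_checks:
  "\<forall>x. it (num.Bit0 (num.Bit0 num.One)) la_F4 x = x"
  "\<forall>x. it (num.Bit1 (num.Bit0 num.One)) lb_F4 x = x"
  "\<forall>x. it (num.Bit0 (num.Bit0 num.One)) lc_F4 x = x"
  "\<forall>x. it (num.Bit0 (num.Bit0 num.One)) ra_F4 x = x"
  "\<forall>x. it (num.Bit1 (num.Bit0 num.One)) rb_F4 x = x"
  "\<forall>x. it (num.Bit0 (num.Bit0 num.One)) lc_F4 x = x"
  "\<forall>x. la_F4 (ra_F4 x) = ra_F4 (la_F4 x)"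
  "\<forall>x. la_F4 (rb_F4 x) = rb_F4 (la_F4 x)"
  "\<forall>x. la_F4 (lc_F4 x) = lc_F4 (la_F4 x)"
  "\<forall>x. lb_F4 (ra_F4 x) = ra_F4 (lb_F4 x)"
  "\<forall>x. lb_F4 (rb_F4 x) = rb_F4 (lb_F4 x)"
  "\<forall>x. lb_F4 (lc_F4 x) = lc_F4 (lb_F4 x)"
  "\<forall>x. lc_F4 (ra_F4 x) = ra_F4 (lc_F4 x)"
  "\<forall>x. lc_F4 (rb_F4 x) = rb_F4 (lc_F4 x)"
  "\<forall>x. lc_F4 (lc_F4 x) = lc_F4 (lc_F4 x)"
  "\<forall>x. tau_F4 (tau_F4 x) = x"
  "\<forall>x. tau_F4 (la_F4 (tau_F4 x)) = act [lc_F4] x"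
  "\<forall>x. tau_F4 (lc_F4 (tau_F4 x)) = act [la_F4] x"
  "\<forall>x. dbl5 (kappa_F4 x) = kappa_F4 (la_F4 x)"
  "\<forall>x. inc5 (kappa_F4 x) = kappa_F4 (lb_F4 x)"
  "\<forall>x. id (kappa_F4 x) = kappa_F4 (lc_F4 x)"
  by code_simp+

lemma F4_orbits:
  "\<forall>x. x \<in> set (spread [(la_F4, 3), (lc_F4, 3), (lb_F4, 4)] [o_F4])"
  "\<forall>x. x \<in> set (spread [(ra_F4, 3), (lc_F4, 3), (rb_F4, 4)] [o_F4])"
  "\<forall>x. kappa_F4 x = kappa_F4 o_F4 \<longrightarrow> x \<in> set (spread [(la_F4, 3), (lc_F4, 3)] [o_F4])"
  "\<forall>x. kappa_F4 x \<noteq> kappa_F4 o_F4 \<longrightarrow> (\<exists>u \<in> set (spread [(la_F4, 3)] [lb_F4 o_F4]). kappa_F4 u = kappa_F4 x)"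
  "\<exists>r\<in>set [ra_F4, rb_F4, lc_F4]. \<exists>u. tau_F4 (lb_F4 (tau_F4 (r u))) \<noteq> r (tau_F4 (lb_F4 (tau_F4 u)))"
  by code_simp+

lemma F4_bij: "bij la_F4" "bij lb_F4" "bij lc_F4" "bij ra_F4" "bij rb_F4" "bij lc_F4"
  by (rule bij_it, rule F4_checks)+

abbreviation "F4_word \<equiv> [lc_F4, lb_F4, tau_F4, lb_F4, lc_F4, la_F4, tau_F4]"
abbreviation "c_F4 \<equiv> (U2, F0, U3) :: ptF4"
abbreviation "d_F4 \<equiv> (U4, F0, U2) :: ptF4"
abbreviation "e_F4 \<equiv> (U3, F0, U4) :: ptF4"

text \<open>The numeral is 77 = 80 - 3, which is prime to 3.\<close>

lemma F4_word:
  "act F4_word c_F4 = d_F4" "act F4_word d_F4 = e_F4" "act F4_word e_F4 = c_F4"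
  "\<forall>x. x \<notin> {c_F4, d_F4, e_F4} \<longrightarrow> it (num.Bit1 (num.Bit0 (num.Bit1 (num.Bit1 (num.Bit0 (num.Bit0 num.One)))))) (act F4_word) x = x"
  by code_simp+

lemma F4_links:
  "act [lc_F4, lc_F4, tau_F4, lb_F4, lb_F4, tau_F4, lb_F4, tau_F4, lc_F4, lb_F4] c_F4 = o_F4" "act [lc_F4, lc_F4, tau_F4, lb_F4, lb_F4, tau_F4, lb_F4, tau_F4, lc_F4, lb_F4] d_F4 = la_F4 o_F4"
  "act [la_F4, lb_F4, lb_F4, lc_F4, lc_F4, lc_F4, tau_F4, lb_F4, tau_F4, lb_F4, tau_F4, lc_F4, lb_F4, la_F4] c_F4 = o_F4" "act [la_F4, lb_F4, lb_F4, lc_F4, lc_F4, lc_F4, tau_F4, lb_F4, tau_F4, lb_F4, tau_F4, lc_F4, lb_F4, la_F4] d_F4 = lb_F4 o_F4"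
  "act [lb_F4, la_F4, lb_F4, tau_F4, lb_F4, tau_F4, lc_F4, la_F4, lb_F4] c_F4 = o_F4" "act [lb_F4, la_F4, lb_F4, tau_F4, lb_F4, tau_F4, lc_F4, la_F4, lb_F4] d_F4 = lc_F4 o_F4"
  by code_simp+

definition "LP_F4 = [(la_F4, dbl5), (lb_F4, inc5), (lc_F4, id)]"

lemma fst_LP_F4: "map fst LP_F4 = [la_F4, lb_F4, lc_F4]" "fst ` set LP_F4 = {la_F4, lb_F4, lc_F4}"
  by (simp_all add: LP_F4_def)

lemma gen_data_F4: "gen_data LP_F4 [ra_F4, rb_F4, lc_F4] [la_F4, lc_F4] tau_F4 lb_F4 o_F4 kappa_F4 {0..<5}"
proof
  show "list_all (\<lambda>(l, \<rho>). bij l \<and> (\<forall>v. \<rho> (kappa_F4 v) = kappa_F4 (l v)) \<and> (\<forall>k. k \<notin> {0..<5} \<longrightarrow> \<rho> k = k)) LP_F4"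
    unfolding LP_F4_def list.pred_inject prod.case
    by (intro conjI list.pred_inject(1) F4_bij F4_checks(19,20,21)) (auto simp: Transposition.transpose_def dbl5_def inc5_def)
  show "list_all bij [ra_F4, rb_F4, lc_F4]"
    unfolding list.pred_inject by (intro conjI list.pred_inject(1) F4_bij)
  show "list_all (\<lambda>l. list_all (\<lambda>r. \<forall>x. l (r x) = r (l x)) [ra_F4, rb_F4, lc_F4]) (map fst LP_F4)"
    unfolding fst_LP_F4 list.pred_inject by (intro conjI list.pred_inject(1) F4_checks)
  show "orb (fst ` set LP_F4) o_F4 = UNIV"
    by (rule orb_UNIV_spread[OF _ F4_orbits(1)]) (simp add: fst_LP_F4)
  show "orb (set [ra_F4, rb_F4, lc_F4]) o_F4 = UNIV"
    by (rule orb_UNIV_spread[OF _ F4_orbits(2)]) simp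
  show "v \<in> orb (set [la_F4, lc_F4]) o_F4" if "kappa_F4 v = kappa_F4 o_F4" for v
    by (rule spread_orb_single[OF _ F4_orbits(3)[rule_format, OF that]]) simp
  show "\<exists>u\<in>orb (set [la_F4, lc_F4]) (lb_F4 o_F4). kappa_F4 u = kappa_F4 v" if v: "kappa_F4 v \<noteq> kappa_F4 o_F4" for v
    by (rule orb_ex_spread[OF _ F4_orbits(4)[rule_format, OF v]]) simp
  show "list_all (\<lambda>b. \<exists>ls. set ls \<subseteq> fst ` set LP_F4 \<and> (\<forall>x. tau_F4 (b (tau_F4 x)) = act ls x)) [la_F4, lc_F4]"
    unfolding list.pred_inject fst_LP_F4
    by (intro conjI list.pred_inject(1); rule exI, rule conjI[rotated], rule F4_checks, simp)
  show "\<exists>r\<in>set [ra_F4, rb_F4, lc_F4]. \<exists>u. tau_F4 (lb_F4 (tau_F4 (r u))) \<noteq> r (tau_F4 (lb_F4 (tau_F4 u)))"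
    by (rule F4_orbits(5))
  show "tau_F4 (tau_F4 x) = x" for x using F4_checks(16) by blast
  show "range kappa_F4 = {0..<5}" by (rule range_kappa5)
  show "1 < card ({0..<5} :: nat set)" by simp
qed (simp_all add: fst_LP_F4)

lemma F4_parity: "evenperm tau_F4" "evenperm la_F4" "evenperm lb_F4" "evenperm lc_F4"
proof -
  show "evenperm tau_F4" unfolding evenperm_involution_enum[OF F4_checks(16)] by code_simp
  show "evenperm la_F4"
    by (rule evenperm_comp_involutions[where f = ub and g = ua]; code_simp)
  show "evenperm lb_F4" by (rule evenperm_odd_order, rule F4_checks)
  show "evenperm lc_F4"
    by (rule evenperm_comp_involutions[where f = vb and g = va]; code_simp)
qed

theorem lattice_5_79:
  "\<exists>\<Gamma>. regular_reducible_lattice 5 79 affine_group_5 {0..<5} (alt_group 79) {1..79} \<Gamma>"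
proof -
  have "\<exists>\<Gamma>. regular_reducible_lattice 5 79 affine_group_5 {0..<5}
      (if True then alt_group 79 else sym_group 79) {1..79} \<Gamma>"
  proof (rule complete_graph_lattice[OF gen_data_F4, where ws = F4_word and c = c_F4 and d = d_F4
        and e = e_F4 and M = 77])
    show "\<exists>l. l dvd 77 \<and> (act F4_word ^^ l) x = x" if "x \<notin> {c_F4, d_F4, e_F4}" for x
      using F4_word(4)[rule_format, OF that] by (intro exI[of _ 77]) (simp only: it_eq dvd_refl simp_thms)
    show "list_all (\<lambda>g. \<exists>fs. set fs \<subseteq> insert tau_F4 (fst ` set LP_F4) \<and> act fs c_F4 = o_F4 \<and>
        act fs d_F4 = g o_F4) (map fst LP_F4)"
      unfolding fst_LP_F4 list.pred_inject
      by (intro conjI list.pred_inject(1); rule linkI[rotated], rule F4_links, rule F4_links, simp)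
    show "if True then list_all evenperm (tau_F4 # map fst LP_F4)
        else \<not> list_all evenperm (tau_F4 # map fst LP_F4)"
      using F4_parity by (simp add: fst_LP_F4)
    show "carrier affine_group_5 = mgen (snd ` set LP_F4)"
      unfolding affine_mgen_id LP_F4_def by simp
    show "card (UNIV :: ptF4 set) = 79 + 1" unfolding card_UNIV_length_enum by code_simp
    show "set F4_word \<subseteq> insert tau_F4 (fst ` set LP_F4)" by (simp add: fst_LP_F4)
  qed (simp_all add: F4_word(1-3) sym_group_mult affine_group_5_def)
  then show ?thesis by simp
qed

section \<open>The lattice on the product with the four-valent tree\<close>

text \<open>The field of three elements as a datatype: its constructors serve case analysis and
  evaluation, its ring structure serves symbolic identities.\<close>

datatype z3 = Z0 | Z1 | Z2

instantiation z3 :: comm_ring_1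
begin
definition "zero_z3 = Z0"
definition "one_z3 = Z1"
fun plus_z3 where
  "Z0 + y = (y::z3)" | "Z1 + Z0 = Z1" | "Z1 + Z1 = Z2" | "Z1 + Z2 = Z0"
| "Z2 + Z0 = Z2" | "Z2 + Z1 = Z0" | "Z2 + Z2 = Z1"
fun uminus_z3 where "- Z0 = Z0" | "- Z1 = Z2" | "- Z2 = Z1"
definition "x - y = x + - (y::z3)"
fun times_z3 where
  "Z0 * y = (Z0::z3)" | "Z1 * y = y" | "Z2 * y = - y"
instance
proof
  fix a b c :: z3
  show "a * b * c = a * (b * c)" by (cases a; cases b; cases c) auto
  show "a * b = b * a" by (cases a; cases b) auto
  show "1 * a = a" by (simp add: one_z3_def)
  show "a + b + c = a + (b + c)" by (cases a; cases b; cases c) auto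
  show "a + b = b + a" by (cases a; cases b) auto
  show "0 + a = a" by (simp add: zero_z3_def)
  show "- a + a = 0" by (cases a) (auto simp: zero_z3_def)
  show "a - b = a + - b" by (simp add: minus_z3_def)
  show "(a + b) * c = a * c + b * c" by (cases a; cases b; cases c) auto
  show "(0::z3) \<noteq> 1" by (simp add: zero_z3_def one_z3_def)
qed
end

lemma z3_UNIV: "UNIV = {Z0, Z1, Z2}"
  by (auto intro: z3.exhaust)

instance z3 :: finite
  by standard (simp add: z3_UNIV)

text \<open>Rewrite rules for polynomial functions over the field of three elements: subtraction and
  numerals disappear, three equal summands cancel, and a cube reduces to its base. Together with the
  commutative laws in \<open>z3_norm\<close> they prove identities without enumerating the
  variables.\<close>

lemma z3_sum_normal:
  fixes x y z :: z3
  shows "Z0 = 0" "Z1 = 1" "Z2 = 1 + 1" "- x = x + x" "x - y = x + (y + y)"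
    "x + (x + x) = 0" "x + (x + (x + z)) = z" "x * (x * x) = x" "x * (x * (x * z)) = x * z"
    "(x + y) * z = x * z + y * z" "z * (x + y) = z * x + z * y"
    "(2 :: z3) = 1 + 1" "(3 :: z3) = 0" "(6 :: z3) = 0" "x + 0 = x" "0 + x = x" "0 * x = 0" "x * 0 = 0" "1 * x = x" "x * 1 = x"
proof -
  show "(2 :: z3) = 1 + 1" "(3 :: z3) = 0" "(6 :: z3) = 0"
    by (simp_all add: numeral_eq_Suc zero_z3_def one_z3_def flip: of_nat_numeral)
qed (cases x; cases y; cases z; simp add: zero_z3_def one_z3_def minus_z3_def)+

lemmas z3_norm = z3_sum_normal add.assoc add.commute add.left_commute mult.assoc mult.commute mult.left_commute

lemma z3_minus [simp]: "Z0 - x = - x" "x - Z0 = x" "x - Z1 = x + Z2" "x - Z2 = x + Z1"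
  by (cases x; simp only: minus_z3_def uminus_z3.simps plus_z3.simps)+

text \<open>The maximal parabolic subgroup (3^2 x 3^(1+2)) : GL(2,3) of G2(3). In the radical
  \<open>p\<close> and \<open>q\<close> are the coordinates of the factor 3^2 and \<open>y\<close>,
  \<open>r\<close>, \<open>s\<close> those of the Heisenberg group with centre \<open>s\<close>. The
  rest is an element of GL(2,3) in Bruhat form: a transvection \<open>a\<close>, the signs
  \<open>h\<close> and \<open>k\<close> of a diagonal matrix, and the coset \<open>i\<close> of the
  Borel subgroup B, which has order 2916.\<close>

type_synonym ptG = "z3 \<times> z3 \<times> z3 \<times> z3 \<times> z3 \<times> z3 \<times> bool \<times> bool \<times> z3 option"

fun sg :: "bool \<Rightarrow> z3 \<Rightarrow> z3" where "sg True x = - x" | "sg False x = x"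

text \<open>Left multiplication by a Weyl element on Bruhat forms, the analogue of
  \<open>sl2\<close>. The last clause moves it past a nontrivial transvection, which also changes
  the diagonal signs.\<close>

fun wg :: "z3 \<Rightarrow> bool \<Rightarrow> bool \<Rightarrow> z3 option \<Rightarrow> z3 \<times> bool \<times> bool \<times> z3 option" where
  "wg a h k None = (Z0, k, h, Some (sg (h \<noteq> k) a))"
| "wg Z0 h k (Some c) = (sg (h \<noteq> k) c, k, h, None)"
| "wg a h k (Some c) = (a, (k \<noteq> (sg (h \<noteq> k) a = Z2)), (h \<noteq> (sg (h \<noteq> k) a = Z1)), Some (sg (h \<noteq> k) a + c))"

fun lw_G :: "ptG \<Rightarrow> ptG" where
  "lw_G (y, p, q, r, s, a, h, k, i) = (r, q, p, y, - s, wg a h k i)"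
fun lx_G :: "ptG \<Rightarrow> ptG" where
  "lx_G (y, p, q, r, s, a, h, k, i) = (y, p - y, q - p - y, r + y, s, a + Z1, h, k, i)"
fun ly_G :: "ptG \<Rightarrow> ptG" where
  "ly_G (y, p, q, r, s, a, h, k, i) = (y + Z1, p, q, r, s + r, a, h, k, i)"
fun lp_G :: "ptG \<Rightarrow> ptG" where
  "lp_G (y, p, q, r, s, a, h, k, i) = (y, p + Z1, q, r, s, a, h, k, i)"
fun lq_G :: "ptG \<Rightarrow> ptG" where
  "lq_G (y, p, q, r, s, a, h, k, i) = (y, p, q + Z1, r, s, a, h, k, i)"
fun lr_G :: "ptG \<Rightarrow> ptG" where
  "lr_G (y, p, q, r, s, a, h, k, i) = (y, p, q, r + Z1, s - y, a, h, k, i)"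
fun ls_G :: "ptG \<Rightarrow> ptG" where
  "ls_G (y, p, q, r, s, a, h, k, i) = (y, p, q, r, s + Z1, a, h, k, i)"
fun lh_G :: "ptG \<Rightarrow> ptG" where
  "lh_G (y, p, q, r, s, a, h, k, i) = (- y, p, - q, r, - s, - a, \<not> h, k, i)"
fun lk_G :: "ptG \<Rightarrow> ptG" where
  "lk_G (y, p, q, r, s, a, h, k, i) = (y, - p, q, - r, - s, - a, h, \<not> k, i)"
text \<open>In each block of constant \<open>i\<close> the map \<open>tau_G\<close> is the
  automorphism of B described by \<open>G_conj\<close>, followed by a translation in the directions
  of \<open>p\<close> and \<open>r\<close>. \<open>kk\<close> is its amount, nonzero only in the
  block \<open>Some Z2\<close>, with a sign depending on the diagonal entry
  \<open>k\<close>.\<close>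

fun kk :: "bool \<Rightarrow> z3 option \<Rightarrow> z3" where
  "kk False (Some Z2) = Z1" | "kk True (Some Z2) = Z2" | "kk _ _ = Z0"

fun tau_G :: "ptG \<Rightarrow> ptG" where
  "tau_G (y, p, q, r, s, a, h, k, i) = (let v = kk k i; ay = a * y in
     (a, r + v - ay, s + r * y - v * y - ay * y, p + ay - v, q - p * a - v * a, y, (h \<noteq> k), k, i))"

fun gx :: "z3 \<times> bool \<times> bool \<times> z3 option \<Rightarrow> z3 \<times> bool \<times> bool \<times> z3 option" where
  "gx (a, h, k, None) = (a + sg (h \<noteq> k) Z1, h, k, None)"
| "gx (a, h, k, Some c) = (a, h, k, Some (c + Z1))"

fun gw :: "z3 \<times> bool \<times> bool \<times> z3 option \<Rightarrow> z3 \<times> bool \<times> bool \<times> z3 option" where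
  "gw (a, h, k, None) = (a, h, k, Some Z0)"
| "gw (a, h, k, Some Z0) = (a, h, k, None)"
| "gw (a, h, k, Some c) = (a + sg (h \<noteq> k) c, h \<noteq> (c = Z2), k \<noteq> (c = Z1), Some c)"

fun rx_G :: "ptG \<Rightarrow> ptG" where "rx_G (y, p, q, r, s, g) = (y, p, q, r, s, gx g)"
fun rw_G :: "ptG \<Rightarrow> ptG" where "rw_G (y, p, q, r, s, g) = (y, p, q, r, s, gw g)"

text \<open>The conjugate of the root element of \<open>ly_G\<close> by an element of GL(2,3). Right
  translation by the root element multiplies the radical part by this conjugate, and the terms added
  to \<open>s\<close> in \<open>ry_G\<close> come from the Heisenberg multiplication.\<close>

fun rv :: "z3 \<times> bool \<times> bool \<times> z3 option \<Rightarrow> z3 \<times> z3 \<times> z3 \<times> z3" where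
  "rv (a, h, k, None) = (sg h Z1, - sg h a, - sg h (a * a), sg h a)"
| "rv (a, h, k, Some c) = (let y = sg h c; p = - sg k (c * c) in
     (y, p - a * y, - y - a * p - a * a * y, sg k Z1 + a * y))"

fun ry_G :: "ptG \<Rightarrow> ptG" where
  "ry_G (y, p, q, r, s, g) = (case rv g of (y', p', q', r') \<Rightarrow>
     (y + y', p + p', q + q', r + r', s + r' * y - r * y', g))"

fun kappa_G :: "ptG \<Rightarrow> nat" where
  "kappa_G (y, p, q, r, s, a, h, k, None) = 1"
| "kappa_G (y, p, q, r, s, a, h, k, Some c) = (case a of Z0 \<Rightarrow> 2 | Z1 \<Rightarrow> 3 | Z2 \<Rightarrow> 4)"

definition "o_G = (Z0, Z0, Z0, Z0, Z0, Z0, False, False, None :: z3 option)"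

lemma z3_option_cases: "(i = None \<Longrightarrow> P) \<Longrightarrow> (i = Some Z0 \<Longrightarrow> P) \<Longrightarrow> (i = Some Z1 \<Longrightarrow> P) \<Longrightarrow> (i = Some Z2 \<Longrightarrow> P) \<Longrightarrow> P"
  by (metis option.exhaust z3.exhaust)

lemma ptG_all: "(\<And>y p q r s a h k i. P (y, p, q, r, s, a, h, k, i)) \<Longrightarrow> \<forall>x :: ptG. P x"
  by auto

text \<open>With 11664 points, such statements are proved symbolically here and in the next lemmas:
  \<open>y\<close>, \<open>p\<close>, \<open>q\<close>, \<open>r\<close>, \<open>s\<close> remain
  variables of polynomial identities, and if a case distinction is needed it runs only over the 48
  values of the other coordinates.\<close>

lemma G_order:
  "\<forall>x. it (num.Bit0 num.One) lw_G x = x"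
  "\<forall>x. it (num.Bit1 num.One) lx_G x = x"
  "\<forall>x. it (num.Bit1 num.One) ly_G x = x"
  "\<forall>x. it (num.Bit1 num.One) lp_G x = x"
  "\<forall>x. it (num.Bit1 num.One) lq_G x = x"
  "\<forall>x. it (num.Bit1 num.One) lr_G x = x"
  "\<forall>x. it (num.Bit1 num.One) ls_G x = x"
  "\<forall>x. it (num.Bit0 num.One) lh_G x = x"
  "\<forall>x. it (num.Bit0 num.One) lk_G x = x"
  "\<forall>x. it (num.Bit0 num.One) rw_G x = x"
  "\<forall>x. it (num.Bit1 num.One) rx_G x = x"
  "\<forall>x. it (num.Bit1 num.One) ry_G x = x"
  by (rule ptG_all; ((simp add: Let_def; fail) | (simp add: Let_def; simp only: z3_norm simp_thms; fail) | (rename_tac y p q r s a h k i, case_tac i rule: z3_option_cases; case_tac a; case_tac h; case_tac k; ((simp add: Let_def Transposition.transpose_def; fail) | (simp add: Let_def; simp only: z3_norm simp_thms; fail)))))+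

lemma G_tau:
  "\<forall>x. tau_G (tau_G x) = x"
  by (rule ptG_all; ((simp add: Let_def; fail) | (simp add: Let_def; simp only: z3_norm simp_thms; fail) | (rename_tac y p q r s a h k i, case_tac i rule: z3_option_cases; case_tac a; case_tac h; case_tac k; ((simp add: Let_def Transposition.transpose_def; fail) | (simp add: Let_def; simp only: z3_norm simp_thms; fail)))))+

lemma G_comm_lw:
  "\<forall>x. lw_G (rw_G x) = rw_G (lw_G x)"
  "\<forall>x. lw_G (rx_G x) = rx_G (lw_G x)"
  "\<forall>x. lw_G (ry_G x) = ry_G (lw_G x)"
  by (rule ptG_all; ((simp add: Let_def; fail) | (simp add: Let_def; simp only: z3_norm simp_thms; fail) | (rename_tac y p q r s a h k i, case_tac i rule: z3_option_cases; case_tac a; case_tac h; case_tac k; ((simp add: Let_def Transposition.transpose_def; fail) | (simp add: Let_def; simp only: z3_norm simp_thms; fail)))))+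

lemma G_comm_lx:
  "\<forall>x. lx_G (rw_G x) = rw_G (lx_G x)"
  "\<forall>x. lx_G (rx_G x) = rx_G (lx_G x)"
  "\<forall>x. lx_G (ry_G x) = ry_G (lx_G x)"
  by (rule ptG_all; ((simp add: Let_def; fail) | (simp add: Let_def; simp only: z3_norm simp_thms; fail) | (rename_tac y p q r s a h k i, case_tac i rule: z3_option_cases; case_tac a; case_tac h; case_tac k; ((simp add: Let_def Transposition.transpose_def; fail) | (simp add: Let_def; simp only: z3_norm simp_thms; fail)))))+

lemma G_comm_ly:
  "\<forall>x. ly_G (rw_G x) = rw_G (ly_G x)"
  "\<forall>x. ly_G (rx_G x) = rx_G (ly_G x)"
  "\<forall>x. ly_G (ry_G x) = ry_G (ly_G x)"
  by (rule ptG_all; ((simp add: Let_def; fail) | (simp add: Let_def; simp only: z3_norm simp_thms; fail) | (rename_tac y p q r s a h k i, case_tac i rule: z3_option_cases; case_tac a; case_tac h; case_tac k; ((simp add: Let_def Transposition.transpose_def; fail) | (simp add: Let_def; simp only: z3_norm simp_thms; fail)))))+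

lemma G_comm_lp:
  "\<forall>x. lp_G (rw_G x) = rw_G (lp_G x)"
  "\<forall>x. lp_G (rx_G x) = rx_G (lp_G x)"
  "\<forall>x. lp_G (ry_G x) = ry_G (lp_G x)"
  by (rule ptG_all; ((simp add: Let_def; fail) | (simp add: Let_def; simp only: z3_norm simp_thms; fail) | (rename_tac y p q r s a h k i, case_tac i rule: z3_option_cases; case_tac a; case_tac h; case_tac k; ((simp add: Let_def Transposition.transpose_def; fail) | (simp add: Let_def; simp only: z3_norm simp_thms; fail)))))+

lemma G_comm_lq:
  "\<forall>x. lq_G (rw_G x) = rw_G (lq_G x)"
  "\<forall>x. lq_G (rx_G x) = rx_G (lq_G x)"
  "\<forall>x. lq_G (ry_G x) = ry_G (lq_G x)"
  by (rule ptG_all; ((simp add: Let_def; fail) | (simp add: Let_def; simp only: z3_norm simp_thms; fail) | (rename_tac y p q r s a h k i, case_tac i rule: z3_option_cases; case_tac a; case_tac h; case_tac k; ((simp add: Let_def Transposition.transpose_def; fail) | (simp add: Let_def; simp only: z3_norm simp_thms; fail)))))+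

lemma G_comm_lr:
  "\<forall>x. lr_G (rw_G x) = rw_G (lr_G x)"
  "\<forall>x. lr_G (rx_G x) = rx_G (lr_G x)"
  "\<forall>x. lr_G (ry_G x) = ry_G (lr_G x)"
  by (rule ptG_all; ((simp add: Let_def; fail) | (simp add: Let_def; simp only: z3_norm simp_thms; fail) | (rename_tac y p q r s a h k i, case_tac i rule: z3_option_cases; case_tac a; case_tac h; case_tac k; ((simp add: Let_def Transposition.transpose_def; fail) | (simp add: Let_def; simp only: z3_norm simp_thms; fail)))))+

lemma G_comm_ls:
  "\<forall>x. ls_G (rw_G x) = rw_G (ls_G x)"
  "\<forall>x. ls_G (rx_G x) = rx_G (ls_G x)"
  "\<forall>x. ls_G (ry_G x) = ry_G (ls_G x)"
  by (rule ptG_all; ((simp add: Let_def; fail) | (simp add: Let_def; simp only: z3_norm simp_thms; fail) | (rename_tac y p q r s a h k i, case_tac i rule: z3_option_cases; case_tac a; case_tac h; case_tac k; ((simp add: Let_def Transposition.transpose_def; fail) | (simp add: Let_def; simp only: z3_norm simp_thms; fail)))))+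

lemma G_comm_lh:
  "\<forall>x. lh_G (rw_G x) = rw_G (lh_G x)"
  "\<forall>x. lh_G (rx_G x) = rx_G (lh_G x)"
  "\<forall>x. lh_G (ry_G x) = ry_G (lh_G x)"
  by (rule ptG_all; ((simp add: Let_def; fail) | (simp add: Let_def; simp only: z3_norm simp_thms; fail) | (rename_tac y p q r s a h k i, case_tac i rule: z3_option_cases; case_tac a; case_tac h; case_tac k; ((simp add: Let_def Transposition.transpose_def; fail) | (simp add: Let_def; simp only: z3_norm simp_thms; fail)))))+

lemma G_comm_lk:
  "\<forall>x. lk_G (rw_G x) = rw_G (lk_G x)"
  "\<forall>x. lk_G (rx_G x) = rx_G (lk_G x)"
  "\<forall>x. lk_G (ry_G x) = ry_G (lk_G x)"
  by (rule ptG_all; ((simp add: Let_def; fail) | (simp add: Let_def; simp only: z3_norm simp_thms; fail) | (rename_tac y p q r s a h k i, case_tac i rule: z3_option_cases; case_tac a; case_tac h; case_tac k; ((simp add: Let_def Transposition.transpose_def; fail) | (simp add: Let_def; simp only: z3_norm simp_thms; fail)))))+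

text \<open>The graph automorphism of the Borel subgroup of G2(3), which in characteristic 3
  exchanges long and short roots: the simple root elements \<open>lx_G\<close> and
  \<open>ly_G\<close> are interchanged, and the other root elements in pairs.\<close>

lemma G_conj:
  "\<forall>x. tau_G (lx_G (tau_G x)) = act [ly_G] x"
  "\<forall>x. tau_G (ly_G (tau_G x)) = act [lx_G] x"
  "\<forall>x. tau_G (lp_G (tau_G x)) = act [lr_G] x"
  "\<forall>x. tau_G (lr_G (tau_G x)) = act [lp_G] x"
  "\<forall>x. tau_G (lq_G (tau_G x)) = act [ls_G] x"
  "\<forall>x. tau_G (ls_G (tau_G x)) = act [lq_G] x"
  "\<forall>x. tau_G (lh_G (tau_G x)) = act [lh_G] x"
  "\<forall>x. tau_G (lk_G (tau_G x)) = act [lh_G, lk_G] x"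
  by (rule ptG_all; ((simp add: Let_def; fail) | (simp add: Let_def; simp only: z3_norm simp_thms; fail) | (rename_tac y p q r s a h k i, case_tac i rule: z3_option_cases; case_tac a; case_tac h; case_tac k; ((simp add: Let_def Transposition.transpose_def; fail) | (simp add: Let_def; simp only: z3_norm simp_thms; fail)))))+

lemma G_pi:
  "\<forall>x. (Transposition.transpose 1 2) (kappa_G x) = kappa_G (lw_G x)"
  "\<forall>x. (Transposition.transpose 2 3 \<circ> Transposition.transpose 3 4) (kappa_G x) = kappa_G (lx_G x)"
  "\<forall>x. (id) (kappa_G x) = kappa_G (ly_G x)"
  "\<forall>x. (id) (kappa_G x) = kappa_G (lp_G x)"
  "\<forall>x. (id) (kappa_G x) = kappa_G (lq_G x)"
  "\<forall>x. (id) (kappa_G x) = kappa_G (lr_G x)"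
  "\<forall>x. (id) (kappa_G x) = kappa_G (ls_G x)"
  "\<forall>x. (Transposition.transpose 3 4) (kappa_G x) = kappa_G (lh_G x)"
  "\<forall>x. (Transposition.transpose 3 4) (kappa_G x) = kappa_G (lk_G x)"
  by (rule ptG_all; ((simp add: Let_def; fail) | (simp add: Let_def; simp only: z3_norm simp_thms; fail) | (rename_tac y p q r s a h k i, case_tac i rule: z3_option_cases; case_tac a; case_tac h; case_tac k; ((simp add: Let_def Transposition.transpose_def; fail) | (simp add: Let_def; simp only: z3_norm simp_thms; fail)))))+

text \<open>Any nonzero \<open>d\<close> generates the additive group, so closure under adding
  \<open>d\<close> acts as an induction rule; orbits are filled coordinate by coordinate with
  it.\<close>

lemma z3_step:
  assumes "P t0" "\<And>t. P t \<Longrightarrow> P (t + d)" "d \<noteq> Z0"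
  shows "P t"
proof -
  have "P (t0 + d)" "P (t0 + d + d)" using assms(1,2) by blast+
  moreover have "t = t0 \<or> t = t0 + d \<or> t = t0 + d + d"
    using assms(3) by (cases t; cases t0; cases d; simp)
  ultimately show ?thesis using assms(1) by blast
qed

lemma z3_mult_right: "x * Z0 = Z0" "x * Z1 = x" "x * Z2 = - x" "x + Z0 = x"
  by (cases x; simp)+

text \<open>The coordinates are filled in an order in which each generator disturbs only coordinates
  that are still zero or already arbitrary. \<open>r\<close> comes last because \<open>lr_G\<close>
  also moves \<open>s\<close>.\<close>

lemma G_borel_orbit:
  assumes G: "{lx_G, ly_G, lp_G, lq_G, lr_G, ls_G, lh_G, lk_G} \<subseteq> G"
    and 0: "(Z0, Z0, Z0, Z0, Z0, Z0, False, False, i) \<in> orb G v"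
  shows "(y, p, q, r, s, a, h, k, i) \<in> orb G v"
proof -
  have step: "lx_G u \<in> orb G v" "ly_G u \<in> orb G v" "lp_G u \<in> orb G v" "lq_G u \<in> orb G v"
    "lr_G u \<in> orb G v" "ls_G u \<in> orb G v" "lh_G u \<in> orb G v" "lk_G u \<in> orb G v" if "u \<in> orb G v" for u
    using G by (auto intro!: orb_step[OF that])
  have a: "(Z0, Z0, Z0, Z0, Z0, a, False, False, i) \<in> orb G v" for a
    by (rule z3_step[where P = "\<lambda>t. (Z0, Z0, Z0, Z0, Z0, t, False, False, i) \<in> orb G v" and ?t0.0 = Z0 and d = Z1], rule 0, drule step(1)) (simp_all add: zero_z3_def)
  have h: "(Z0, Z0, Z0, Z0, Z0, a, h, False, i) \<in> orb G v" for a h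
    using a[of a] step(7)[OF a[of "- a"]] by (cases h) simp_all
  have k: "(Z0, Z0, Z0, Z0, Z0, a, h, k, i) \<in> orb G v"
    using h[of a h] step(8)[OF h[of "- a" h]] by (cases k) simp_all
  have y: "(y, Z0, Z0, Z0, Z0, a, h, k, i) \<in> orb G v"
    by (rule z3_step[where P = "\<lambda>t. (t, Z0, Z0, Z0, Z0, a, h, k, i) \<in> orb G v" and ?t0.0 = Z0 and d = Z1], rule k, drule step(2)) (simp_all add: zero_z3_def)
  have p: "(y, p, Z0, Z0, Z0, a, h, k, i) \<in> orb G v"
    by (rule z3_step[where P = "\<lambda>t. (y, t, Z0, Z0, Z0, a, h, k, i) \<in> orb G v" and ?t0.0 = Z0 and d = Z1], rule y, drule step(3)) (simp_all add: zero_z3_def)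
  have q: "(y, p, q, Z0, Z0, a, h, k, i) \<in> orb G v"
    by (rule z3_step[where P = "\<lambda>t. (y, p, t, Z0, Z0, a, h, k, i) \<in> orb G v" and ?t0.0 = Z0 and d = Z1], rule p, drule step(4)) (simp_all add: zero_z3_def)
  have s: "(y, p, q, Z0, s, a, h, k, i) \<in> orb G v" for s
    by (rule z3_step[where P = "\<lambda>t. (y, p, q, Z0, t, a, h, k, i) \<in> orb G v" and ?t0.0 = Z0 and d = Z1], rule q, drule step(6)) (simp_all add: zero_z3_def)
  have "\<forall>s. (y, p, q, r, s, a, h, k, i) \<in> orb G v"
  proof (rule z3_step[where P = "\<lambda>t. \<forall>s. (y, p, q, t, s, a, h, k, i) \<in> orb G v" and ?t0.0 = Z0 and d = Z1])
    fix t assume t: "\<forall>s. (y, p, q, t, s, a, h, k, i) \<in> orb G v"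
    show "\<forall>s. (y, p, q, t + Z1, s, a, h, k, i) \<in> orb G v"
    proof
      fix s
      show "(y, p, q, t + Z1, s, a, h, k, i) \<in> orb G v"
        using step(5)[OF t[rule_format, of "s + y"]] by simp
    qed
  qed (use s in simp_all)
  then show ?thesis ..
qed

text \<open>\<open>gx\<close> and \<open>gw\<close> reach every element of GL(2,3) over a fixed
  point of the radical. Different choices of that element turn \<open>ry_G\<close> into shifts of
  the radical in different directions, and these generate all shifts.\<close>

lemma G_right_orbit:
  assumes step: "\<And>u. u \<in> S \<Longrightarrow> rx_G u \<in> S" "\<And>u. u \<in> S \<Longrightarrow> rw_G u \<in> S" "\<And>u. u \<in> S \<Longrightarrow> ry_G u \<in> S"
    and 0: "o_G \<in> S"
  shows "u \<in> S"
proof -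
  have g: "(y, p, q, r, s, g') \<in> S" if "(y, p, q, r, s, g) \<in> S" for y p q r s g g'
  proof -
    define C where "C = (\<lambda>a h k i. (y, p, q, r, s, a, h, k, i) \<in> S)"
    have x: "C a h k None \<Longrightarrow> C (a + sg (h \<noteq> k) Z1) h k None"
      "C a h k (Some c) \<Longrightarrow> C a h k (Some (c + Z1))" for a h k c
      using step(1)[of "(y, p, q, r, s, a, h, k, None)"] step(1)[of "(y, p, q, r, s, a, h, k, Some c)"]
      by (simp_all add: C_def)
    have w: "C a h k None \<Longrightarrow> C a h k (Some Z0)" "C a h k (Some Z0) \<Longrightarrow> C a h k None"
      "C a h k (Some Z1) \<Longrightarrow> C (a + sg (h \<noteq> k) Z1) h (\<not> k) (Some Z1)"
      "C a h k (Some Z2) \<Longrightarrow> C (a + sg (h \<noteq> k) Z2) (\<not> h) k (Some Z2)" for a h k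
      using step(2)[of "(y, p, q, r, s, a, h, k, None)"] step(2)[of "(y, p, q, r, s, a, h, k, Some Z0)"]
        step(2)[of "(y, p, q, r, s, a, h, k, Some Z1)"] step(2)[of "(y, p, q, r, s, a, h, k, Some Z2)"]
      by (simp_all add: C_def)
    have some: "C a h k (Some c')" if "C a h k (Some c)" for a h k c c'
      by (rule z3_step[where P = "\<lambda>t. C a h k (Some t)" and ?t0.0 = c and d = Z1], rule that, erule x(2)) simp
    have none: "C a' h k None" if "C a h k None" for a a' h k
      by (rule z3_step[where P = "\<lambda>t. C t h k None" and ?t0.0 = a and d = "sg (h \<noteq> k) Z1"], rule that, erule x(1)) (cases h; cases k; simp)
    have all: "C a' h k i'" if "C a h k i" for a a' h k i i'
    proof -
      have "C a h k None" using that w(2) some by (cases i) blast+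
      then have "C a' h k None" by (rule none)
      then show ?thesis using w(1) some by (cases i') blast+
    qed
    have every: "C a' h' k' i'" if "C a h k i" for a h k i a' h' k' i'
    proof -
      have k: "C a'' h (\<not> k) i''" for a'' i'' by (rule all[OF w(3)[OF all[OF that]]])
      then have k': "C a'' h k' i''" for a'' i'' using all[OF that] by (cases "k' = k") auto
      have "C a'' (\<not> h) k' i''" for a'' i'' by (rule all[OF w(4)[OF k']])
      then show ?thesis using k' by (cases "h' = h") auto
    qed
    obtain a h k i a' h' k' i' where eq: "g = (a, h, k, i)" "g' = (a', h', k', i')"
      by (cases g, cases g') blast
    show ?thesis using every[of a h k i a' h' k' i'] that unfolding C_def eq by simp
  qed
  \<comment> \<open>\<open>T\<close> asserts that all linear parts are reached over the given
    radical coordinates, so that the linear part can be chosen before each use of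
    \<open>ry_G\<close> and forgotten afterwards.\<close>
  define T where "T = (\<lambda>y p q r s. \<forall>g. (y, p, q, r, s, g) \<in> S)"
  have move: "T (y + y') (p + p') (q + q') (r + r') (s + r' * y - r * y')"
    if "rv g = (y', p', q', r')" "T y p q r s" for y p q r s y' p' q' r' g
  proof -
    have "(y, p, q, r, s, g) \<in> S" using that(2) unfolding T_def by blast
    from step(3)[OF this] have "(y + y', p + p', q + q', r + r', s + r' * y - r * y', g) \<in> S"
      by (simp add: that(1))
    then show ?thesis unfolding T_def using g by blast
  qed
  have my: "T (y + Z1) p q r (s - r)" if "T y p q r s" for y p q r s
    using move[of "(Z0, False, False, None)" _ _ _ _ y p q r s] that by (simp add: z3_mult_right)
  have mr: "T y p q (r + Z1) (s + y)" if "T y p q r s" for y p q r s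
    using move[of "(Z0, False, False, Some Z0)" _ _ _ _ y p q r s] that by (simp add: z3_mult_right Let_def)
  have m3: "T (y + Z1) (p + Z2) (q + Z2) (r + Z1) (s + y - r)" if "T y p q r s" for y p q r s
    using move[of "(Z1, False, False, None)" _ _ _ _ y p q r s] that by (simp add: z3_mult_right)
  have m4: "T (y + Z1) (p + Z1) (q + Z2) (r + Z2) (s + Z2 * y - r * Z1)" if "T y p q r s" for y p q r s
    using move[of "(Z2, False, False, None)" Z1 Z1 Z2 Z2 y p q r s] that by simp
  \<comment> \<open>Three shifts of each of the kinds \<open>my\<close> and \<open>mr\<close>,
    suitably interleaved, restore \<open>y\<close> and \<open>r\<close>; as the shifts do not
    commute, a nonzero shift of the central coordinate \<open>s\<close> is left over.\<close>
  have s: "T y p q r s'" if "T y p q r s" for y p q r s s'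
  proof (rule z3_step[where P = "\<lambda>t. T y p q r t" and ?t0.0 = s and d = Z2])
    fix t assume "T y p q r t"
    then have "T (y + Z1 + Z1 + Z1) p q (r + Z1 + Z1 + Z1)
      (t - r + (y + Z1) - (r + Z1) - (r + Z1) + (y + Z1 + Z1 + Z1) + (y + Z1 + Z1 + Z1))"
      by (intro my mr)
    then show "T y p q r (t + Z2)" by (simp only: z3_norm)
  qed (use that in simp_all)
  have r: "T y p q r' s'" if "T y p q r s" for y p q r s r' s'
  proof -
    have "\<forall>s. T y p q r' s"

      by (rule z3_step[where P = "\<lambda>t. \<forall>s. T y p q t s" and ?t0.0 = r and d = Z1],
        rule allI, rule s[OF that], rule allI, rule s, rule mr, erule spec) simp
    then show ?thesis ..
  qed
  have y: "T y' p q r' s'" if "T y p q r s" for y p q r s y' r' s'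
  proof -
    have "\<forall>r s. T y' p q r s"

      by (rule z3_step[where P = "\<lambda>t. \<forall>r s. T t p q r s" and ?t0.0 = y and d = Z1],
        intro allI, rule r[OF that], intro allI, rule r, rule my, drule spec, erule spec) simp
    then show ?thesis by blast
  qed
  \<comment> \<open>Applying \<open>m3\<close> and then \<open>m4\<close>, the shifts of
    \<open>p\<close> cancel and those of \<open>q\<close> add up to \<open>Z1\<close>; the other
    coordinates are restored by the preceding step.\<close>
  have q: "T y p q' r s" if "T y p q r s" for y p q r s q'
  proof (rule z3_step[where P = "\<lambda>t. T y p t r s" and ?t0.0 = q and d = Z1])
    fix t assume "T y p t r s"
    from m4[OF m3[OF this]] have "T y (p + Z2 + Z1) (t + Z2 + Z2) r s" by (rule y)
    then show "T y p (t + Z1) r s" by (simp only: z3_norm)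
  qed (use that in simp_all)
  have p: "T y p' q r s" if "T y p q r s" for y p q r s p'
  proof (rule z3_step[where P = "\<lambda>t. T y t q r s" and ?t0.0 = p and d = Z1])
    fix t assume "T y t q r s"
    from m4[OF this] have "T y (t + Z1) (q + Z2) r s" by (rule y)
    then show "T y (t + Z1) q r s" by (rule q)
  qed (use that in simp_all)
  have "T Z0 Z0 Z0 Z0 Z0" unfolding T_def by (intro allI g[OF 0[unfolded o_G_def]])
  then have "T y' p' q' r' s'" for y' p' q' r' s' by - (rule y, rule q, rule p)
  moreover obtain y p q r s g where "u = (y, p, q, r, s, g)" by (cases u) blast
  ultimately show ?thesis unfolding T_def by blast
qed

definition LP_G :: "((ptG \<Rightarrow> ptG) \<times> (nat \<Rightarrow> nat)) list" where
  "LP_G = [(lw_G, Transposition.transpose 1 2), (lx_G, Transposition.transpose 2 3 \<circ> Transposition.transpose 3 4), (ly_G, id), (lp_G, id), (lq_G, id), (lr_G, id), (ls_G, id), (lh_G, Transposition.transpose 3 4), (lk_G, Transposition.transpose 3 4)]"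

lemma fst_LP_G: "map fst LP_G = [lw_G, lx_G, ly_G, lp_G, lq_G, lr_G, ls_G, lh_G, lk_G]" "fst ` set LP_G = {lw_G, lx_G, ly_G, lp_G, lq_G, lr_G, ls_G, lh_G, lk_G}"
  by (simp_all add: LP_G_def)

lemma G_bij: "bij lw_G" "bij lx_G" "bij ly_G" "bij lp_G" "bij lq_G" "bij lr_G" "bij ls_G" "bij lh_G" "bij lk_G" "bij rw_G" "bij rx_G" "bij ry_G"
  by (rule bij_it, rule G_order)+

lemma range_kappa_G: "range kappa_G = {1..4}"
proof
  have "kappa_G x \<in> {1..4}" for x
    by (cases x rule: kappa_G.cases) (auto split: z3.split)
  then show "range kappa_G \<subseteq> {1..4}" by blast
  have "{1..4} = {kappa_G o_G, kappa_G (lw_G o_G), kappa_G (lx_G (lw_G o_G)), kappa_G (lx_G (lx_G (lw_G o_G)))}"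
    by (auto simp: o_G_def)
  then show "{1..4} \<subseteq> range kappa_G" by auto
qed

lemma G_left_orbit: "orb (fst ` set LP_G) o_G = UNIV"
proof -
  let ?O = "orb (fst ` set LP_G) o_G"
  have B: "{lx_G, ly_G, lp_G, lq_G, lr_G, ls_G, lh_G, lk_G} \<subseteq> fst ` set LP_G" unfolding fst_LP_G by blast
  have "o_G \<in> ?O" by (rule orb_self)
  then have None: "(y, p, q, r, s, a, h, k, None) \<in> ?O" for y p q r s a h k
    unfolding o_G_def by (rule G_borel_orbit[OF B])
  have Some: "(y, p, q, r, s, a, h, k, Some c) \<in> ?O" for y p q r s a h k c
  proof (rule G_borel_orbit[OF B])
    have "lw_G (Z0, Z0, Z0, Z0, Z0, c, False, False, None) \<in> ?O"
      by (rule orb_step[OF None]) (simp add: fst_LP_G)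
    then show "(Z0, Z0, Z0, Z0, Z0, Z0, False, False, Some c) \<in> ?O" by simp
  qed
  have "(y, p, q, r, s, a, h, k, i) \<in> ?O" for y p q r s a h k i
    using None Some by (cases i) simp_all
  then show ?thesis by auto
qed

lemma gen_data_G: "gen_data LP_G [rw_G, rx_G, ry_G] [lx_G, ly_G, lp_G, lq_G, lr_G, ls_G, lh_G, lk_G] tau_G lw_G o_G kappa_G {1..4}"
proof
  show "list_all (\<lambda>(l, \<rho>). bij l \<and> (\<forall>v. \<rho> (kappa_G v) = kappa_G (l v)) \<and> (\<forall>k. k \<notin> {1..4} \<longrightarrow> \<rho> k = k)) LP_G"
    unfolding LP_G_def list.pred_inject prod.case
    by (intro conjI list.pred_inject(1) G_bij G_pi) (auto simp: Transposition.transpose_def)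
  show "list_all bij [rw_G, rx_G, ry_G]"
    unfolding list.pred_inject by (intro conjI list.pred_inject(1) G_bij)
  show "list_all (\<lambda>l. list_all (\<lambda>r. \<forall>x. l (r x) = r (l x)) [rw_G, rx_G, ry_G]) (map fst LP_G)"
    unfolding fst_LP_G list.pred_inject
    by (intro conjI list.pred_inject(1) G_comm_lw G_comm_lx G_comm_ly G_comm_lp G_comm_lq G_comm_lr G_comm_ls G_comm_lh G_comm_lk)
  show "orb (fst ` set LP_G) o_G = UNIV" by (rule G_left_orbit)
  show "orb (set [rw_G, rx_G, ry_G]) o_G = UNIV"
  proof -
    have "u \<in> orb (set [rw_G, rx_G, ry_G]) o_G" for u
      by (rule G_right_orbit) (auto intro: orb_self orb_step)
    then show ?thesis by blast
  qed
  show "v \<in> orb (set [lx_G, ly_G, lp_G, lq_G, lr_G, ls_G, lh_G, lk_G]) o_G" if v: "kappa_G v = kappa_G o_G" for v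
  proof -
    obtain y p q r s a h k where v': "v = (y, p, q, r, s, a, h, k, None)"
      using v by (cases v rule: kappa_G.cases) (auto simp: o_G_def split: z3.splits)
    show ?thesis unfolding v'
      by (rule G_borel_orbit) (auto simp: o_G_def[symmetric] orb_self)
  qed
  show "\<exists>u\<in>orb (set [lx_G, ly_G, lp_G, lq_G, lr_G, ls_G, lh_G, lk_G]) (lw_G o_G). kappa_G u = kappa_G v" if v: "kappa_G v \<noteq> kappa_G o_G" for v
  proof -
    obtain y p q r s a h k c where v': "v = (y, p, q, r, s, a, h, k, Some c)"
      using v by (cases v rule: kappa_G.cases) (auto simp: o_G_def)
    have "lw_G o_G = (Z0, Z0, Z0, Z0, Z0, Z0, False, False, Some Z0)" by (simp add: o_G_def)
    then have "(Z0, Z0, Z0, Z0, Z0, Z0, False, False, Some Z0) \<in> orb (set [lx_G, ly_G, lp_G, lq_G, lr_G, ls_G, lh_G, lk_G]) (lw_G o_G)"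
      by (simp only: orb_self)
    then have "(Z0, Z0, Z0, Z0, Z0, a, False, False, Some Z0) \<in> orb (set [lx_G, ly_G, lp_G, lq_G, lr_G, ls_G, lh_G, lk_G]) (lw_G o_G)"
      by (rule G_borel_orbit[rotated]) auto
    then show ?thesis by (rule bexI[rotated]) (simp add: v')
  qed
  show "list_all (\<lambda>b. \<exists>ls. set ls \<subseteq> fst ` set LP_G \<and> (\<forall>x. tau_G (b (tau_G x)) = act ls x)) [lx_G, ly_G, lp_G, lq_G, lr_G, ls_G, lh_G, lk_G]"
    unfolding list.pred_inject fst_LP_G
    by (intro conjI list.pred_inject(1); rule exI, rule conjI[rotated], rule G_conj, simp)
  have nc: "tau_G (lw_G (tau_G (ry_G (Z0, Z0, Z0, Z0, Z0, Z0, False, False, Some Z0)))) \<noteq> ry_G (tau_G (lw_G (tau_G (Z0, Z0, Z0, Z0, Z0, Z0, False, False, Some Z0))))" by code_simp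
  show "\<exists>r\<in>set [rw_G, rx_G, ry_G]. \<exists>u. tau_G (lw_G (tau_G (r u))) \<noteq> r (tau_G (lw_G (tau_G u)))"
    by (rule bexI[of _ ry_G], rule exI, rule nc, simp)
  show "tau_G (tau_G x) = x" for x using G_tau by blast
  show "range kappa_G = {1..4}" by (rule range_kappa_G)
  show "1 < card ({1..4} :: nat set)" by simp
qed (simp_all add: fst_LP_G)

lemma sym4_mgen:
  "carrier (sym_group 4) = mgen {Transposition.transpose 1 2,
     Transposition.transpose 2 3 \<circ> Transposition.transpose 3 4, Transposition.transpose 3 4, id}"
    (is "_ = mgen ?G")
proof -
  let ?t = "Transposition.transpose :: nat \<Rightarrow> nat \<Rightarrow> nat \<Rightarrow> nat"
  have t12: "?t 1 2 \<in> mgen ?G" and t34: "?t 3 4 \<in> mgen ?G" and c: "?t 2 3 \<circ> ?t 3 4 \<in> mgen ?G"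
    by (rule mgen_incl; simp)+
  have conj: "?t a c \<in> mgen ?G" if "?t a b \<in> mgen ?G" "?t b c \<in> mgen ?G" "distinct [a, b, c]" for a b c
  proof -
    have "?t a c = ?t a b \<circ> (?t b c \<circ> ?t a b)"
      using that(3) by (auto simp: fun_eq_iff Transposition.transpose_def)
    then show ?thesis using mgen_comp[OF that(1) mgen_comp[OF that(2,1)]] by simp
  qed
  have "(?t 2 3 \<circ> ?t 3 4) \<circ> ?t 3 4 = ?t 2 3" by (simp add: fun_eq_iff)
  then have t23: "?t 2 3 \<in> mgen ?G" using mgen_comp[OF c t34] by metis
  have t13: "?t 1 3 \<in> mgen ?G" by (rule conj[OF t12 t23]) simp
  have t24: "?t 2 4 \<in> mgen ?G" by (rule conj[OF t23 t34]) simp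
  have t14: "?t 1 4 \<in> mgen ?G" by (rule conj[OF t12 t24]) simp
  have "mgen ?G = {p. p permutes {1..4}}"
  proof (rule mgen_transpositions)
    fix a b :: nat assume ab: "a \<in> {1..4}" "b \<in> {1..4}" "a \<noteq> b"
    have "{1..4::nat} = {1, 2, 3, 4}" by auto
    then have "a \<in> {1, 2, 3, 4}" "b \<in> {1, 2, 3, 4}" using ab by simp_all
    then show "?t a b \<in> mgen ?G"
      using t12 t13 t14 t23 t24 t34 ab(3) by (elim insertE emptyE) (simp_all add: transpose_commute)
  next
    fix g assume "g \<in> ?G"
    then have "g = ?t 1 2 \<or> g = ?t 2 3 \<circ> ?t 3 4 \<or> g = ?t 3 4 \<or> g = id" by simp
    then show "g permutes {1..4}"
      by (elim disjE; simp only:; intro permutes_compose permutes_swap_id permutes_id; simp)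
  qed simp
  then show ?thesis by (auto simp: sym_group_carrier)
qed

lemma card_z3: "card (UNIV :: z3 set) = 3"
  by (simp add: z3_UNIV)

lemma card_z3_option: "card (UNIV :: z3 option set) = 4"
  by (simp add: UNIV_option_conv card_image card_z3)

lemma card_ptG: "card (UNIV :: ptG set) = 11664"
  by (simp add: UNIV_Times_UNIV[symmetric] card_cartesian_product card_z3 card_z3_option del: UNIV_Times_UNIV)

text \<open>All 11664 points are moved, and 4 divides 11664.\<close>

lemma evenperm_free_involution:
  fixes f :: "ptG \<Rightarrow> ptG"
  assumes "\<And>x. f (f x) = x" "\<And>x. f x \<noteq> x"
  shows "evenperm f"
proof -
  have "{x. f x \<noteq> x} = UNIV" using assms(2) by blast
  then show ?thesis unfolding evenperm_involution[OF assms(1)] by (simp only: card_ptG) simp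
qed

lemma ptG_exhaust:
  fixes x :: ptG
  obtains y p q r s a h k i where "x = (y, p, q, r, s, a, h, k, i)"
  by (cases x rule: prod_cases7; metis prod_cases3)

text \<open>At a fixed point \<open>k\<close> is false, \<open>a\<close> equals \<open>y\<close>,
  and \<open>p\<close> and \<open>q\<close> are determined by the remaining coordinates, which
  leaves 3 * 3 * 3 * 2 * 4 possibilities.\<close>

lemma card_fixed_tau_G: "card {x. tau_G x = x} = 216"
proof -
  define g :: "z3 \<times> z3 \<times> z3 \<times> bool \<times> z3 option \<Rightarrow> ptG" where
    "g = (\<lambda>(y, r, s, h, i). (y, r + kk False i - y * y, s + r * y - kk False i * y - y * y * y, r, s, y, h, False, i))"
  have g1: "tau_G (g (y, r, s, h, i)) = g (y, r, s, h, i)" for y r s h i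
    by (simp add: g_def Let_def) (simp only: z3_norm simp_thms)
  have g2: "(y, p, q, r, s, a, h, k, i) = g (y, r, s, h, i)"
    if "tau_G (y, p, q, r, s, a, h, k, i) = (y, p, q, r, s, a, h, k, i)" for y p q r s a h k i
  proof -
    have eq: "a = y" "r + kk k i - a * y = p" "s + r * y - kk k i * y - a * y * y = q" "(h \<noteq> k) = h"
      using that unfolding tau_G.simps Let_def prod.inject by blast+
    have k: "k = False" using eq(4) by blast
    show ?thesis unfolding g_def prod.case
      by (simp only: eq(2,3)[unfolded eq(1) k] eq(1) k)
  qed
  have "{x. tau_G x = x} = range g"
  proof (intro equalityI subsetI)
    fix x assume "x \<in> {x. tau_G x = x}"
    then have x: "tau_G x = x" by (simp only: mem_Collect_eq)
    obtain y p q r s a h k i where eq: "x = (y, p, q, r, s, a, h, k, i)" by (rule ptG_exhaust)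
    show "x \<in> range g" unfolding eq by (rule range_eqI, rule g2, rule x[unfolded eq])
  next
    fix x assume "x \<in> range g"
    then obtain u where u: "x = g u" by blast
    obtain y r s h i where eq: "u = (y, r, s, h, i)" by (cases u) blast
    show "x \<in> {x. tau_G x = x}" unfolding u eq mem_Collect_eq by (rule g1)
  qed
  moreover have "inj g"
  proof (rule inj_on_inverseI[where g = "\<lambda>(y, p, q, r, s, a, h, k, i). (y, r, s, h, i)"])
    show "(case g u of (y, p, q, r, s, a, h, k, i) \<Rightarrow> (y, r, s, h, i)) = u" for u
      by (cases u) (simp only: g_def prod.case)
  qed
  ultimately show ?thesis
    by (simp add: card_image UNIV_Times_UNIV[symmetric] card_cartesian_product card_z3 card_z3_option del: UNIV_Times_UNIV)
qed

lemma G_parity: "evenperm tau_G" "evenperm lw_G" "evenperm lx_G" "evenperm ly_G" "evenperm lp_G" "evenperm lq_G" "evenperm lr_G" "evenperm ls_G" "evenperm lh_G" "evenperm lk_G"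
proof -
  have "card {x. tau_G x \<noteq> x} = card (UNIV - {x. tau_G x = x})" by (rule arg_cong[where f = card]) blast
  also have "\<dots> = 11664 - 216"
    by (subst card_Diff_subset) (simp_all only: finite subset_UNIV card_ptG card_fixed_tau_G)
  finally have "4 dvd card {x. tau_G x \<noteq> x}" by simp
  then show "evenperm tau_G" by (subst evenperm_involution) (use G_tau in blast)
  have "\<forall>x. lw_G (lw_G x) = x" "\<forall>x. lh_G (lh_G x) = x" "\<forall>x. lk_G (lk_G x) = x"
    using G_order(1,8,9) by (simp_all only: it.simps simp_thms)
  note inv = this[THEN spec]
  have "lw_G (y, p, q, r, s, a, h, k, i) \<noteq> (y, p, q, r, s, a, h, k, i)" for y p q r s a h k i
    by (cases i; cases a; cases h; cases k) auto
  then have "\<forall>x. lw_G x \<noteq> x" by (rule ptG_all)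
  then show "evenperm lw_G" by (intro evenperm_free_involution[OF inv(1)]) (rule spec)
  have "\<forall>x. lh_G x \<noteq> x" by (rule ptG_all, unfold lh_G.simps prod.inject, blast)
  then show "evenperm lh_G" by (intro evenperm_free_involution[OF inv(2)]) (rule spec)
  have "\<forall>x. lk_G x \<noteq> x" by (rule ptG_all, unfold lk_G.simps prod.inject, blast)
  then show "evenperm lk_G" by (intro evenperm_free_involution[OF inv(3)]) (rule spec)
  show "evenperm lx_G" "evenperm ly_G" "evenperm lp_G" "evenperm lq_G" "evenperm lr_G" "evenperm ls_G"
    by (rule evenperm_odd_order, rule G_order)+
qed

section \<open>The cycle type of the word on 11664 points\<close>

lemma prime_dvd_prod_list_nat: "prime q \<Longrightarrow> q dvd prod_list qs \<Longrightarrow> \<exists>r\<in>set qs. q dvd (r :: nat)"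
  by (induction qs) (auto simp: prime_dvd_mult_iff)

text \<open>A certificate of exact period with one test per prime factor. The gcd of two periods is
  a period by Bezout; if it were a proper divisor of the product, the quotient of the product by
  some prime \<open>q\<close> in the list would be a period as well, contrary to the test for
  \<open>q\<close>.\<close>

lemma exact_period_dvd:
  fixes qs :: "nat list"
  assumes l: "(f ^^ prod_list qs) x = x"
    and qs: "\<And>q. q \<in> set qs \<Longrightarrow> prime q \<and> (f ^^ (prod_list qs div q)) x \<noteq> x"
    and m: "(f ^^ m) x = x"
  shows "prod_list qs dvd m"
proof -
  let ?l = "prod_list qs"
  have per: "(f ^^ (k * j)) x = x" if "(f ^^ k) x = x" for k j
  proof (induction j)
    case (Suc j)
    have "(f ^^ (k * Suc j)) x = (f ^^ k) ((f ^^ (k * j)) x)"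
      by (simp only: mult_Suc_right funpow_add comp_apply)
    then show ?case by (simp only: Suc that)
  qed simp
  have "0 \<notin> set qs" using qs by (metis not_prime_0)
  then have l0: "?l \<noteq> 0" using prod_list_zero_iff[of qs] by blast
  obtain a b where ab: "?l * a = m * b + gcd ?l m" using bezout_nat[OF l0] by blast
  have "(f ^^ gcd ?l m) x = (f ^^ gcd ?l m) ((f ^^ (m * b)) x)" by (simp only: per[OF m])
  also have "\<dots> = (f ^^ (?l * a)) x" unfolding ab by (simp only: add.commute[of "m * b"] funpow_add comp_apply)
  also have "\<dots> = x" by (rule per[OF l])
  finally have g: "(f ^^ gcd ?l m) x = x" .
  show ?thesis
  proof (rule ccontr)
    assume "\<not> ?l dvd m"
    then have ne: "gcd ?l m \<noteq> ?l" by (metis gcd_dvd2)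
    obtain k where k: "?l = gcd ?l m * k" using gcd_dvd1[of ?l m] by (elim dvdE)
    then have "k \<noteq> 1" using ne by (metis mult.right_neutral)
    then obtain q where q: "prime q" "q dvd k" using prime_factor_nat by blast
    then have "q dvd ?l" using k by (metis dvd_mult)
    then obtain r where r: "r \<in> set qs" "q dvd r" using prime_dvd_prod_list_nat[OF q(1)] by blast
    then have qr: "q = r" using q(1) qs primes_dvd_imp_eq by blast
    obtain j where j: "k = q * j" using q(2) by (elim dvdE)
    have "?l = q * (gcd ?l m * j)" using k j by (metis mult.left_commute)
    then have "?l div q = gcd ?l m * j" using q(1) by (metis nonzero_mult_div_cancel_left not_prime_0)
    then have "(f ^^ (?l div q)) x = x" using per[OF g] by simp
    then show False using qs r(1) qr by blast
  qed
qed

text \<open>Cycles of different lengths are disjoint, so they exhaust the type as soon as their lengths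
  add up to its cardinality.\<close>

lemma cycles_cover:
  fixes f :: "'v::finite \<Rightarrow> 'v" and xs :: "('v \<times> nat list) list"
  assumes f: "bij f"
    and per: "\<And>x qs. (x, qs) \<in> set xs \<Longrightarrow> (f ^^ prod_list qs) x = x"
    and exact: "\<And>x qs q. (x, qs) \<in> set xs \<Longrightarrow> q \<in> set qs \<Longrightarrow> prime q \<and> (f ^^ (prod_list qs div q)) x \<noteq> x"
    and len: "distinct (map (\<lambda>e. prod_list (snd e)) xs)"
      "(\<Sum>e\<leftarrow>xs. prod_list (snd e)) = card (UNIV :: 'v set)"
  obtains x qs j where "(x, qs) \<in> set xs" "u = (f ^^ j) x"
proof -
  define Ob where "Ob e = (\<lambda>j. (f ^^ j) (fst e)) ` {..<prod_list (snd e)}" for e :: "'v \<times> nat list"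
  have inj: "(f ^^ j) x = (f ^^ j) y \<Longrightarrow> x = y" for j x y
    using inj_fn[OF bij_is_inj[OF f]] by (blast dest: injD)
  have dvd: "prod_list (snd e) dvd m" if "e \<in> set xs" "(f ^^ m) (fst e) = fst e" for e m
    using exact_period_dvd[of "snd e" f "fst e" m] per[of "fst e" "snd e"] exact[of "fst e" "snd e"] that by simp
  have shift: "(f ^^ m) x = x" if "(f ^^ m) ((f ^^ j) x) = (f ^^ j) x" for m j x
  proof (rule inj[of j])
    show "(f ^^ j) ((f ^^ m) x) = (f ^^ j) x"
      using that by (simp only: funpow_add[symmetric, THEN fun_cong, unfolded comp_apply] add.commute)
  qed
  have period: "(f ^^ prod_list (snd e)) ((f ^^ j) (fst e)) = (f ^^ j) (fst e)" if "e \<in> set xs" for e j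
  proof -
    have "(f ^^ prod_list (snd e)) ((f ^^ j) (fst e)) = (f ^^ j) ((f ^^ prod_list (snd e)) (fst e))"
      by (simp only: funpow_add[symmetric, THEN fun_cong, unfolded comp_apply] add.commute)
    then show ?thesis using per[of "fst e" "snd e"] that by simp
  qed
  have card: "card (Ob e) = prod_list (snd e)" if e: "e \<in> set xs" for e
  proof -
    have "inj_on (\<lambda>j. (f ^^ j) (fst e)) {..<prod_list (snd e)}"
    proof (rule linorder_inj_onI')
      fix i j assume ij: "i \<in> {..<prod_list (snd e)}" "j \<in> {..<prod_list (snd e)}" "i < j"
      show "(f ^^ i) (fst e) \<noteq> (f ^^ j) (fst e)"
      proof
        assume eq: "(f ^^ i) (fst e) = (f ^^ j) (fst e)"
        have "(f ^^ i) ((f ^^ (j - i)) (fst e)) = (f ^^ (i + (j - i))) (fst e)"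
          by (simp only: funpow_add comp_apply)
        also have "\<dots> = (f ^^ i) (fst e)" using eq ij(3) by simp
        finally have "(f ^^ (j - i)) (fst e) = fst e" by (rule inj)
        then have "prod_list (snd e) dvd j - i" by (rule dvd[OF e])
        then have "prod_list (snd e) \<le> j - i" using ij(3) by (intro dvd_imp_le) simp_all
        then show False using ij by simp
      qed
    qed
    then show ?thesis by (simp add: Ob_def card_image)
  qed
  have disj: "e = e'" if e: "e \<in> set xs" "e' \<in> set xs" "v \<in> Ob e" "v \<in> Ob e'" for e e' v
  proof -
    obtain i where v1: "v = (f ^^ i) (fst e)" using e(3) unfolding Ob_def by blast
    obtain j where v2: "v = (f ^^ j) (fst e')" using e(4) unfolding Ob_def by blast
    have "(f ^^ prod_list (snd e)) v = v" unfolding v1 by (rule period[OF e(1)])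
    then have 1: "(f ^^ prod_list (snd e)) (fst e') = fst e'" unfolding v2 by (rule shift)
    have "(f ^^ prod_list (snd e')) v = v" unfolding v2 by (rule period[OF e(2)])
    then have "(f ^^ prod_list (snd e')) (fst e) = fst e" unfolding v1 by (rule shift)
    then have "prod_list (snd e) = prod_list (snd e')"
      by (rule dvd_antisym[OF dvd[OF e(1)] dvd[OF e(2) 1]])
    then show ?thesis using len(1) e(1,2) by (auto simp: distinct_map inj_on_def)
  qed
  have "card (\<Union>e\<in>set xs. Ob e) = (\<Sum>e\<in>set xs. card (Ob e))"
  proof (rule card_UN_disjoint)
    show "\<forall>e\<in>set xs. finite (Ob e)" by (simp add: Ob_def)
    show "\<forall>e\<in>set xs. \<forall>e'\<in>set xs. e \<noteq> e' \<longrightarrow> Ob e \<inter> Ob e' = {}" using disj by blast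
  qed simp
  also have "\<dots> = (\<Sum>e\<in>set xs. prod_list (snd e))" using card by simp
  also have "\<dots> = card (UNIV :: 'v set)"
    using len by (simp add: sum.distinct_set_conv_list distinct_map)
  finally have "(\<Union>e\<in>set xs. Ob e) = UNIV" by (intro card_subset_eq) simp_all
  then obtain e where "e \<in> set xs" "u \<in> Ob e" by blast
  then show ?thesis using that[of "fst e" "snd e"] by (auto simp: Ob_def)
qed

abbreviation "G_word \<equiv> [lw_G, tau_G, lw_G, tau_G, ly_G, lw_G, tau_G, lw_G, tau_G, ly_G, ly_G, lw_G, tau_G]"
abbreviation "c_G \<equiv> (Z0, Z0, Z0, Z2, Z2, Z0, True, False, None) :: ptG"
abbreviation "d_G \<equiv> (Z1, Z2, Z1, Z1, Z1, Z0, True, False, Some Z2) :: ptG"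
abbreviation "e_G \<equiv> (Z1, Z2, Z2, Z2, Z2, Z2, False, True, Some Z0) :: ptG"

text \<open>The word as a plain composition, without a list to unfold in each of the thousands of
  evaluations below.\<close>

definition word_G :: "ptG \<Rightarrow> ptG" where
  "word_G x = lw_G (tau_G (lw_G (tau_G (ly_G (lw_G (tau_G (lw_G (tau_G (ly_G (ly_G (lw_G (tau_G x))))))))))))"

lemma act_G_word: "act G_word = word_G"
  by (intro ext) (simp only: act_simps word_G_def)

text \<open>The numerals are 3592 and its quotients 1796 and 8 by the prime factors 2 and 449. The
  lemmas for the other cycles have the same form.\<close>

lemma G_cycle_3592:
  "it (num.Bit0 (num.Bit0 (num.Bit0 (num.Bit1 (num.Bit0 (num.Bit0 (num.Bit0 (num.Bit0 (num.Bit0 (num.Bit1 (num.Bit1 num.One))))))))))) word_G (Z0, Z0, Z0, Z0, Z0, Z0, False, False, Some Z0) = (Z0, Z0, Z0, Z0, Z0, Z0, False, False, Some Z0)"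
  "it (num.Bit0 (num.Bit0 (num.Bit1 (num.Bit0 (num.Bit0 (num.Bit0 (num.Bit0 (num.Bit0 (num.Bit1 (num.Bit1 num.One)))))))))) word_G (Z0, Z0, Z0, Z0, Z0, Z0, False, False, Some Z0) \<noteq> (Z0, Z0, Z0, Z0, Z0, Z0, False, False, Some Z0)"
  "it (num.Bit0 (num.Bit0 (num.Bit0 num.One))) word_G (Z0, Z0, Z0, Z0, Z0, Z0, False, False, Some Z0) \<noteq> (Z0, Z0, Z0, Z0, Z0, Z0, False, False, Some Z0)"
  by code_simp+

lemma G_cycle_2786:
  "it (num.Bit0 (num.Bit1 (num.Bit0 (num.Bit0 (num.Bit0 (num.Bit1 (num.Bit1 (num.Bit1 (num.Bit0 (num.Bit1 (num.Bit0 num.One))))))))))) word_G (Z0, Z0, Z0, Z0, Z0, Z0, False, False, Some Z2) = (Z0, Z0, Z0, Z0, Z0, Z0, False, False, Some Z2)"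
  "it (num.Bit1 (num.Bit0 (num.Bit0 (num.Bit0 (num.Bit1 (num.Bit1 (num.Bit1 (num.Bit0 (num.Bit1 (num.Bit0 num.One)))))))))) word_G (Z0, Z0, Z0, Z0, Z0, Z0, False, False, Some Z2) \<noteq> (Z0, Z0, Z0, Z0, Z0, Z0, False, False, Some Z2)"
  "it (num.Bit0 (num.Bit1 (num.Bit1 (num.Bit1 (num.Bit0 (num.Bit0 (num.Bit0 (num.Bit1 num.One)))))))) word_G (Z0, Z0, Z0, Z0, Z0, Z0, False, False, Some Z2) \<noteq> (Z0, Z0, Z0, Z0, Z0, Z0, False, False, Some Z2)"
  "it (num.Bit0 (num.Bit1 (num.Bit1 num.One))) word_G (Z0, Z0, Z0, Z0, Z0, Z0, False, False, Some Z2) \<noteq> (Z0, Z0, Z0, Z0, Z0, Z0, False, False, Some Z2)"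
  by code_simp+

lemma G_cycle_3292:
  "it (num.Bit0 (num.Bit0 (num.Bit1 (num.Bit1 (num.Bit1 (num.Bit0 (num.Bit1 (num.Bit1 (num.Bit0 (num.Bit0 (num.Bit1 num.One))))))))))) word_G (Z0, Z0, Z0, Z0, Z0, Z0, False, True, Some Z2) = (Z0, Z0, Z0, Z0, Z0, Z0, False, True, Some Z2)"
  "it (num.Bit0 (num.Bit1 (num.Bit1 (num.Bit1 (num.Bit0 (num.Bit1 (num.Bit1 (num.Bit0 (num.Bit0 (num.Bit1 num.One)))))))))) word_G (Z0, Z0, Z0, Z0, Z0, Z0, False, True, Some Z2) \<noteq> (Z0, Z0, Z0, Z0, Z0, Z0, False, True, Some Z2)"
  "it (num.Bit0 (num.Bit0 num.One)) word_G (Z0, Z0, Z0, Z0, Z0, Z0, False, True, Some Z2) \<noteq> (Z0, Z0, Z0, Z0, Z0, Z0, False, True, Some Z2)"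
  by code_simp+

lemma G_cycle_620:
  "it (num.Bit0 (num.Bit0 (num.Bit1 (num.Bit1 (num.Bit0 (num.Bit1 (num.Bit1 (num.Bit0 (num.Bit0 num.One))))))))) word_G (Z0, Z0, Z0, Z0, Z0, Z0, False, True, None) = (Z0, Z0, Z0, Z0, Z0, Z0, False, True, None)"
  "it (num.Bit0 (num.Bit1 (num.Bit1 (num.Bit0 (num.Bit1 (num.Bit1 (num.Bit0 (num.Bit0 num.One)))))))) word_G (Z0, Z0, Z0, Z0, Z0, Z0, False, True, None) \<noteq> (Z0, Z0, Z0, Z0, Z0, Z0, False, True, None)"
  "it (num.Bit0 (num.Bit0 (num.Bit1 (num.Bit1 (num.Bit1 (num.Bit1 num.One)))))) word_G (Z0, Z0, Z0, Z0, Z0, Z0, False, True, None) \<noteq> (Z0, Z0, Z0, Z0, Z0, Z0, False, True, None)"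
  "it (num.Bit0 (num.Bit0 (num.Bit1 (num.Bit0 num.One)))) word_G (Z0, Z0, Z0, Z0, Z0, Z0, False, True, None) \<noteq> (Z0, Z0, Z0, Z0, Z0, Z0, False, True, None)"
  by code_simp+

lemma G_cycle_1163:
  "it (num.Bit1 (num.Bit1 (num.Bit0 (num.Bit1 (num.Bit0 (num.Bit0 (num.Bit0 (num.Bit1 (num.Bit0 (num.Bit0 num.One)))))))))) word_G (Z0, Z0, Z0, Z0, Z0, Z0, True, True, Some Z1) = (Z0, Z0, Z0, Z0, Z0, Z0, True, True, Some Z1)"
  "it num.One word_G (Z0, Z0, Z0, Z0, Z0, Z0, True, True, Some Z1) \<noteq> (Z0, Z0, Z0, Z0, Z0, Z0, True, True, Some Z1)"
  by code_simp+

lemma G_cycle_113: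
  "it (num.Bit1 (num.Bit0 (num.Bit0 (num.Bit0 (num.Bit1 (num.Bit1 num.One)))))) word_G (Z0, Z0, Z0, Z0, Z2, Z0, False, False, Some Z0) = (Z0, Z0, Z0, Z0, Z2, Z0, False, False, Some Z0)"
  "it num.One word_G (Z0, Z0, Z0, Z0, Z2, Z0, False, False, Some Z0) \<noteq> (Z0, Z0, Z0, Z0, Z2, Z0, False, False, Some Z0)"
  by code_simp+

lemma G_cycle_80:
  "it (num.Bit0 (num.Bit0 (num.Bit0 (num.Bit0 (num.Bit1 (num.Bit0 num.One)))))) word_G (Z0, Z0, Z0, Z0, Z2, Z1, True, True, None) = (Z0, Z0, Z0, Z0, Z2, Z1, True, True, None)"
  "it (num.Bit0 (num.Bit0 (num.Bit0 (num.Bit1 (num.Bit0 num.One))))) word_G (Z0, Z0, Z0, Z0, Z2, Z1, True, True, None) \<noteq> (Z0, Z0, Z0, Z0, Z2, Z1, True, True, None)"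
  "it (num.Bit0 (num.Bit0 (num.Bit0 (num.Bit0 num.One)))) word_G (Z0, Z0, Z0, Z0, Z2, Z1, True, True, None) \<noteq> (Z0, Z0, Z0, Z0, Z2, Z1, True, True, None)"
  by code_simp+

lemma G_cycle_14:
  "it (num.Bit0 (num.Bit1 (num.Bit1 num.One))) word_G (Z0, Z0, Z0, Z1, Z1, Z2, False, False, Some Z0) = (Z0, Z0, Z0, Z1, Z1, Z2, False, False, Some Z0)"
  "it (num.Bit1 (num.Bit1 num.One)) word_G (Z0, Z0, Z0, Z1, Z1, Z2, False, False, Some Z0) \<noteq> (Z0, Z0, Z0, Z1, Z1, Z2, False, False, Some Z0)"
  "it (num.Bit0 num.One) word_G (Z0, Z0, Z0, Z1, Z1, Z2, False, False, Some Z0) \<noteq> (Z0, Z0, Z0, Z1, Z1, Z2, False, False, Some Z0)"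
  by code_simp+

lemma G_cycle_3:
  "it (num.Bit1 num.One) word_G (Z0, Z0, Z0, Z2, Z2, Z0, True, False, None) = (Z0, Z0, Z0, Z2, Z2, Z0, True, False, None)"
  "it num.One word_G (Z0, Z0, Z0, Z2, Z2, Z0, True, False, None) \<noteq> (Z0, Z0, Z0, Z2, Z2, Z0, True, False, None)"
  by code_simp+

lemma G_cycle_1:
  "it num.One word_G (Z0, Z1, Z1, Z1, Z1, Z0, False, True, Some Z0) = (Z0, Z1, Z1, Z1, Z1, Z0, False, True, Some Z0)"
  by code_simp+

lemma prime_by_trial_division:
  assumes "1 < p" "p < k * k" "\<forall>n\<in>set [2..<k]. \<not> n dvd p"
  shows "prime (p :: nat)"
proof (rule ccontr)
  assume "\<not> prime p"
  then obtain a where a: "a dvd p" "a \<noteq> 1" "a \<noteq> p" using assms(1) unfolding prime_nat_iff by blast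
  then obtain b where p: "p = a * b" by (elim dvdE)
  have "a < k \<or> b < k"
  proof (rule ccontr)
    assume "\<not> (a < k \<or> b < k)"
    then have "k * k \<le> a * b" by (intro mult_le_mono) simp_all
    then show False using assms(2) p by simp
  qed
  moreover have "2 \<le> a" using a(2) p assms(1) by (cases "a = 0") simp_all
  moreover have "2 \<le> b"
  proof -
    have "b \<noteq> 0" using p assms(1) by (intro notI) simp
    moreover have "b \<noteq> 1" using p a(3) by (intro notI) simp
    ultimately show ?thesis by simp
  qed
  moreover have "b dvd p" using p by simp
  ultimately show False using assms(3) a(1) by auto
qed

lemma G_primes: "prime (2 :: nat)" "prime (3 :: nat)" "prime (5 :: nat)" "prime (7 :: nat)" "prime (31 :: nat)" "prime (113 :: nat)" "prime (199 :: nat)" "prime (449 :: nat)" "prime (823 :: nat)" "prime (1163 :: nat)"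
proof -
  show "prime (2 :: nat)" by (rule prime_by_trial_division[where k = 2]) simp_all
  show "prime (3 :: nat)" by (rule prime_by_trial_division[where k = 2]) simp_all
  show "prime (5 :: nat)" by (rule prime_by_trial_division[where k = 3]) simp_all
  show "prime (7 :: nat)" by (rule prime_by_trial_division[where k = 3]) simp_all
  show "prime (31 :: nat)" by (rule prime_by_trial_division[where k = 6]) simp_all
  show "prime (113 :: nat)" by (rule prime_by_trial_division[where k = 11]) simp_all
  show "prime (199 :: nat)" by (rule prime_by_trial_division[where k = 15]) simp_all
  show "prime (449 :: nat)" by (rule prime_by_trial_division[where k = 22]) simp_all
  show "prime (823 :: nat)" by (rule prime_by_trial_division[where k = 29]) simp_all
  show "prime (1163 :: nat)" by (rule prime_by_trial_division[where k = 35]) simp_all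
qed

text \<open>A starting point for each cycle with the prime factors of its length, repeated according
  to multiplicity. The lengths are distinct and add up to 11664.\<close>

definition "G_cycles = [((Z0, Z0, Z0, Z0, Z0, Z0, False, False, Some Z0) :: ptG, [2, 2, 2, 449] :: nat list),
  ((Z0, Z0, Z0, Z0, Z0, Z0, False, False, Some Z2) :: ptG, [2, 7, 199] :: nat list),
  ((Z0, Z0, Z0, Z0, Z0, Z0, False, True, Some Z2) :: ptG, [2, 2, 823] :: nat list),
  ((Z0, Z0, Z0, Z0, Z0, Z0, False, True, None) :: ptG, [2, 2, 5, 31] :: nat list),
  ((Z0, Z0, Z0, Z0, Z0, Z0, True, True, Some Z1) :: ptG, [1163] :: nat list),
  ((Z0, Z0, Z0, Z0, Z2, Z0, False, False, Some Z0) :: ptG, [113] :: nat list),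
  ((Z0, Z0, Z0, Z0, Z2, Z1, True, True, None) :: ptG, [2, 2, 2, 2, 5] :: nat list),
  ((Z0, Z0, Z0, Z1, Z1, Z2, False, False, Some Z0) :: ptG, [2, 7] :: nat list),
  ((Z0, Z0, Z0, Z2, Z2, Z0, True, False, None) :: ptG, [3] :: nat list),
  ((Z0, Z1, Z1, Z1, Z1, Z0, False, True, Some Z0) :: ptG, [] :: nat list)]"

lemma G_exact_3592:
  "(word_G ^^ prod_list [2, 2, 2, 449]) ((Z0, Z0, Z0, Z0, Z0, Z0, False, False, Some Z0) :: ptG) = (Z0, Z0, Z0, Z0, Z0, Z0, False, False, Some Z0)"
  "\<forall>q\<in>set [2, 2, 2, 449]. prime q \<and> (word_G ^^ (prod_list [2, 2, 2, 449] div q)) ((Z0, Z0, Z0, Z0, Z0, Z0, False, False, Some Z0) :: ptG) \<noteq> (Z0, Z0, Z0, Z0, Z0, Z0, False, False, Some Z0)"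
proof -
  have p: "prod_list [2, 2, 2, 449] = (3592 :: nat)" by simp
  show "(word_G ^^ prod_list [2, 2, 2, 449]) ((Z0, Z0, Z0, Z0, Z0, Z0, False, False, Some Z0) :: ptG) = (Z0, Z0, Z0, Z0, Z0, Z0, False, False, Some Z0)" unfolding p by (rule G_cycle_3592(1)[unfolded it_eq])
  have d: "3592 div 2 = (1796 :: nat)" "3592 div 449 = (8 :: nat)" by simp_all
  show "\<forall>q\<in>set [2, 2, 2, 449]. prime q \<and> (word_G ^^ (prod_list [2, 2, 2, 449] div q)) ((Z0, Z0, Z0, Z0, Z0, Z0, False, False, Some Z0) :: ptG) \<noteq> (Z0, Z0, Z0, Z0, Z0, Z0, False, False, Some Z0)"
    unfolding p list.set ball_simps d
    by (intro conjI TrueI G_primes G_cycle_3592(2)[unfolded it_eq] G_cycle_3592(3)[unfolded it_eq])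
qed

lemma G_exact_2786:
  "(word_G ^^ prod_list [2, 7, 199]) ((Z0, Z0, Z0, Z0, Z0, Z0, False, False, Some Z2) :: ptG) = (Z0, Z0, Z0, Z0, Z0, Z0, False, False, Some Z2)"
  "\<forall>q\<in>set [2, 7, 199]. prime q \<and> (word_G ^^ (prod_list [2, 7, 199] div q)) ((Z0, Z0, Z0, Z0, Z0, Z0, False, False, Some Z2) :: ptG) \<noteq> (Z0, Z0, Z0, Z0, Z0, Z0, False, False, Some Z2)"
proof -
  have p: "prod_list [2, 7, 199] = (2786 :: nat)" by simp
  show "(word_G ^^ prod_list [2, 7, 199]) ((Z0, Z0, Z0, Z0, Z0, Z0, False, False, Some Z2) :: ptG) = (Z0, Z0, Z0, Z0, Z0, Z0, False, False, Some Z2)" unfolding p by (rule G_cycle_2786(1)[unfolded it_eq])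
  have d: "2786 div 2 = (1393 :: nat)" "2786 div 7 = (398 :: nat)" "2786 div 199 = (14 :: nat)" by simp_all
  show "\<forall>q\<in>set [2, 7, 199]. prime q \<and> (word_G ^^ (prod_list [2, 7, 199] div q)) ((Z0, Z0, Z0, Z0, Z0, Z0, False, False, Some Z2) :: ptG) \<noteq> (Z0, Z0, Z0, Z0, Z0, Z0, False, False, Some Z2)"
    unfolding p list.set ball_simps d
    by (intro conjI TrueI G_primes G_cycle_2786(2)[unfolded it_eq] G_cycle_2786(3)[unfolded it_eq] G_cycle_2786(4)[unfolded it_eq])
qed

lemma G_exact_3292:
  "(word_G ^^ prod_list [2, 2, 823]) ((Z0, Z0, Z0, Z0, Z0, Z0, False, True, Some Z2) :: ptG) = (Z0, Z0, Z0, Z0, Z0, Z0, False, True, Some Z2)"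
  "\<forall>q\<in>set [2, 2, 823]. prime q \<and> (word_G ^^ (prod_list [2, 2, 823] div q)) ((Z0, Z0, Z0, Z0, Z0, Z0, False, True, Some Z2) :: ptG) \<noteq> (Z0, Z0, Z0, Z0, Z0, Z0, False, True, Some Z2)"
proof -
  have p: "prod_list [2, 2, 823] = (3292 :: nat)" by simp
  show "(word_G ^^ prod_list [2, 2, 823]) ((Z0, Z0, Z0, Z0, Z0, Z0, False, True, Some Z2) :: ptG) = (Z0, Z0, Z0, Z0, Z0, Z0, False, True, Some Z2)" unfolding p by (rule G_cycle_3292(1)[unfolded it_eq])
  have d: "3292 div 2 = (1646 :: nat)" "3292 div 823 = (4 :: nat)" by simp_all
  show "\<forall>q\<in>set [2, 2, 823]. prime q \<and> (word_G ^^ (prod_list [2, 2, 823] div q)) ((Z0, Z0, Z0, Z0, Z0, Z0, False, True, Some Z2) :: ptG) \<noteq> (Z0, Z0, Z0, Z0, Z0, Z0, False, True, Some Z2)"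
    unfolding p list.set ball_simps d
    by (intro conjI TrueI G_primes G_cycle_3292(2)[unfolded it_eq] G_cycle_3292(3)[unfolded it_eq])
qed

lemma G_exact_620:
  "(word_G ^^ prod_list [2, 2, 5, 31]) ((Z0, Z0, Z0, Z0, Z0, Z0, False, True, None) :: ptG) = (Z0, Z0, Z0, Z0, Z0, Z0, False, True, None)"
  "\<forall>q\<in>set [2, 2, 5, 31]. prime q \<and> (word_G ^^ (prod_list [2, 2, 5, 31] div q)) ((Z0, Z0, Z0, Z0, Z0, Z0, False, True, None) :: ptG) \<noteq> (Z0, Z0, Z0, Z0, Z0, Z0, False, True, None)"
proof -
  have p: "prod_list [2, 2, 5, 31] = (620 :: nat)" by simp
  show "(word_G ^^ prod_list [2, 2, 5, 31]) ((Z0, Z0, Z0, Z0, Z0, Z0, False, True, None) :: ptG) = (Z0, Z0, Z0, Z0, Z0, Z0, False, True, None)" unfolding p by (rule G_cycle_620(1)[unfolded it_eq])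
  have d: "620 div 2 = (310 :: nat)" "620 div 5 = (124 :: nat)" "620 div 31 = (20 :: nat)" by simp_all
  show "\<forall>q\<in>set [2, 2, 5, 31]. prime q \<and> (word_G ^^ (prod_list [2, 2, 5, 31] div q)) ((Z0, Z0, Z0, Z0, Z0, Z0, False, True, None) :: ptG) \<noteq> (Z0, Z0, Z0, Z0, Z0, Z0, False, True, None)"
    unfolding p list.set ball_simps d
    by (intro conjI TrueI G_primes G_cycle_620(2)[unfolded it_eq] G_cycle_620(3)[unfolded it_eq] G_cycle_620(4)[unfolded it_eq])
qed

lemma G_exact_1163:
  "(word_G ^^ prod_list [1163]) ((Z0, Z0, Z0, Z0, Z0, Z0, True, True, Some Z1) :: ptG) = (Z0, Z0, Z0, Z0, Z0, Z0, True, True, Some Z1)"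
  "\<forall>q\<in>set [1163]. prime q \<and> (word_G ^^ (prod_list [1163] div q)) ((Z0, Z0, Z0, Z0, Z0, Z0, True, True, Some Z1) :: ptG) \<noteq> (Z0, Z0, Z0, Z0, Z0, Z0, True, True, Some Z1)"
proof -
  have p: "prod_list [1163] = (1163 :: nat)" by simp
  show "(word_G ^^ prod_list [1163]) ((Z0, Z0, Z0, Z0, Z0, Z0, True, True, Some Z1) :: ptG) = (Z0, Z0, Z0, Z0, Z0, Z0, True, True, Some Z1)" unfolding p by (rule G_cycle_1163(1)[unfolded it_eq])
  \<comment> \<open>The quotient 1 is kept in the form \<open>numeral num.One\<close>, in which
    \<open>it_eq\<close> delivers the exponent.\<close>
  have d: "1163 div 1163 = (numeral num.One :: nat)" by simp_all
  show "\<forall>q\<in>set [1163]. prime q \<and> (word_G ^^ (prod_list [1163] div q)) ((Z0, Z0, Z0, Z0, Z0, Z0, True, True, Some Z1) :: ptG) \<noteq> (Z0, Z0, Z0, Z0, Z0, Z0, True, True, Some Z1)"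
    unfolding p list.set ball_simps d
    by (intro conjI TrueI G_primes G_cycle_1163(2)[unfolded it_eq])
qed

lemma G_exact_113:
  "(word_G ^^ prod_list [113]) ((Z0, Z0, Z0, Z0, Z2, Z0, False, False, Some Z0) :: ptG) = (Z0, Z0, Z0, Z0, Z2, Z0, False, False, Some Z0)"
  "\<forall>q\<in>set [113]. prime q \<and> (word_G ^^ (prod_list [113] div q)) ((Z0, Z0, Z0, Z0, Z2, Z0, False, False, Some Z0) :: ptG) \<noteq> (Z0, Z0, Z0, Z0, Z2, Z0, False, False, Some Z0)"
proof -
  have p: "prod_list [113] = (113 :: nat)" by simp
  show "(word_G ^^ prod_list [113]) ((Z0, Z0, Z0, Z0, Z2, Z0, False, False, Some Z0) :: ptG) = (Z0, Z0, Z0, Z0, Z2, Z0, False, False, Some Z0)" unfolding p by (rule G_cycle_113(1)[unfolded it_eq])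
  have d: "113 div 113 = (numeral num.One :: nat)" by simp_all
  show "\<forall>q\<in>set [113]. prime q \<and> (word_G ^^ (prod_list [113] div q)) ((Z0, Z0, Z0, Z0, Z2, Z0, False, False, Some Z0) :: ptG) \<noteq> (Z0, Z0, Z0, Z0, Z2, Z0, False, False, Some Z0)"
    unfolding p list.set ball_simps d
    by (intro conjI TrueI G_primes G_cycle_113(2)[unfolded it_eq])
qed

lemma G_exact_80:
  "(word_G ^^ prod_list [2, 2, 2, 2, 5]) ((Z0, Z0, Z0, Z0, Z2, Z1, True, True, None) :: ptG) = (Z0, Z0, Z0, Z0, Z2, Z1, True, True, None)"
  "\<forall>q\<in>set [2, 2, 2, 2, 5]. prime q \<and> (word_G ^^ (prod_list [2, 2, 2, 2, 5] div q)) ((Z0, Z0, Z0, Z0, Z2, Z1, True, True, None) :: ptG) \<noteq> (Z0, Z0, Z0, Z0, Z2, Z1, True, True, None)"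
proof -
  have p: "prod_list [2, 2, 2, 2, 5] = (80 :: nat)" by simp
  show "(word_G ^^ prod_list [2, 2, 2, 2, 5]) ((Z0, Z0, Z0, Z0, Z2, Z1, True, True, None) :: ptG) = (Z0, Z0, Z0, Z0, Z2, Z1, True, True, None)" unfolding p by (rule G_cycle_80(1)[unfolded it_eq])
  have d: "80 div 2 = (40 :: nat)" "80 div 5 = (16 :: nat)" by simp_all
  show "\<forall>q\<in>set [2, 2, 2, 2, 5]. prime q \<and> (word_G ^^ (prod_list [2, 2, 2, 2, 5] div q)) ((Z0, Z0, Z0, Z0, Z2, Z1, True, True, None) :: ptG) \<noteq> (Z0, Z0, Z0, Z0, Z2, Z1, True, True, None)"
    unfolding p list.set ball_simps d
    by (intro conjI TrueI G_primes G_cycle_80(2)[unfolded it_eq] G_cycle_80(3)[unfolded it_eq])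
qed

lemma G_exact_14:
  "(word_G ^^ prod_list [2, 7]) ((Z0, Z0, Z0, Z1, Z1, Z2, False, False, Some Z0) :: ptG) = (Z0, Z0, Z0, Z1, Z1, Z2, False, False, Some Z0)"
  "\<forall>q\<in>set [2, 7]. prime q \<and> (word_G ^^ (prod_list [2, 7] div q)) ((Z0, Z0, Z0, Z1, Z1, Z2, False, False, Some Z0) :: ptG) \<noteq> (Z0, Z0, Z0, Z1, Z1, Z2, False, False, Some Z0)"
proof -
  have p: "prod_list [2, 7] = (14 :: nat)" by simp
  show "(word_G ^^ prod_list [2, 7]) ((Z0, Z0, Z0, Z1, Z1, Z2, False, False, Some Z0) :: ptG) = (Z0, Z0, Z0, Z1, Z1, Z2, False, False, Some Z0)" unfolding p by (rule G_cycle_14(1)[unfolded it_eq])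
  have d: "14 div 2 = (7 :: nat)" "14 div 7 = (2 :: nat)" by simp_all
  show "\<forall>q\<in>set [2, 7]. prime q \<and> (word_G ^^ (prod_list [2, 7] div q)) ((Z0, Z0, Z0, Z1, Z1, Z2, False, False, Some Z0) :: ptG) \<noteq> (Z0, Z0, Z0, Z1, Z1, Z2, False, False, Some Z0)"
    unfolding p list.set ball_simps d
    by (intro conjI TrueI G_primes G_cycle_14(2)[unfolded it_eq] G_cycle_14(3)[unfolded it_eq])
qed

lemma G_exact_3:
  "(word_G ^^ prod_list [3]) ((Z0, Z0, Z0, Z2, Z2, Z0, True, False, None) :: ptG) = (Z0, Z0, Z0, Z2, Z2, Z0, True, False, None)"
  "\<forall>q\<in>set [3]. prime q \<and> (word_G ^^ (prod_list [3] div q)) ((Z0, Z0, Z0, Z2, Z2, Z0, True, False, None) :: ptG) \<noteq> (Z0, Z0, Z0, Z2, Z2, Z0, True, False, None)"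
proof -
  have p: "prod_list [3] = (3 :: nat)" by simp
  show "(word_G ^^ prod_list [3]) ((Z0, Z0, Z0, Z2, Z2, Z0, True, False, None) :: ptG) = (Z0, Z0, Z0, Z2, Z2, Z0, True, False, None)" unfolding p by (rule G_cycle_3(1)[unfolded it_eq])
  have d: "3 div 3 = (numeral num.One :: nat)" by simp_all
  show "\<forall>q\<in>set [3]. prime q \<and> (word_G ^^ (prod_list [3] div q)) ((Z0, Z0, Z0, Z2, Z2, Z0, True, False, None) :: ptG) \<noteq> (Z0, Z0, Z0, Z2, Z2, Z0, True, False, None)"
    unfolding p list.set ball_simps d
    by (intro conjI TrueI G_primes G_cycle_3(2)[unfolded it_eq])
qed

lemma G_exact_1:
  "(word_G ^^ prod_list []) ((Z0, Z1, Z1, Z1, Z1, Z0, False, True, Some Z0) :: ptG) = (Z0, Z1, Z1, Z1, Z1, Z0, False, True, Some Z0)"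
  "\<forall>q\<in>set []. prime q \<and> (word_G ^^ (prod_list [] div q)) ((Z0, Z1, Z1, Z1, Z1, Z0, False, True, Some Z0) :: ptG) \<noteq> (Z0, Z1, Z1, Z1, Z1, Z0, False, True, Some Z0)"
proof -
  have p: "prod_list [] = (numeral num.One :: nat)" by simp
  show "(word_G ^^ prod_list []) ((Z0, Z1, Z1, Z1, Z1, Z0, False, True, Some Z0) :: ptG) = (Z0, Z1, Z1, Z1, Z1, Z0, False, True, Some Z0)" unfolding p by (rule G_cycle_1(1)[unfolded it_eq])
  show "\<forall>q\<in>set []. prime q \<and> (word_G ^^ (prod_list [] div q)) ((Z0, Z1, Z1, Z1, Z1, Z0, False, True, Some Z0) :: ptG) \<noteq> (Z0, Z1, Z1, Z1, Z1, Z0, False, True, Some Z0)"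
    by simp
qed

text \<open>The exponent is the product of the lengths of all cycles except the 3-cycle.\<close>

lemma G_word:
  assumes f: "bij word_G" and n: "card (UNIV :: ptG set) = 11664" and x: "x \<notin> {c_G, d_G, e_G}"
  shows "\<exists>l. l dvd 3006388745761270374400 \<and> (act G_word ^^ l) x = x"
proof -
  have "list_all (\<lambda>e. (word_G ^^ prod_list (snd e)) (fst e) = fst e) G_cycles"
    unfolding G_cycles_def list.pred_inject fst_conv snd_conv
    by (intro conjI list.pred_inject(1) G_exact_3592(1) G_exact_2786(1) G_exact_3292(1) G_exact_620(1) G_exact_1163(1) G_exact_113(1) G_exact_80(1) G_exact_14(1) G_exact_3(1) G_exact_1(1))
  then have exact1: "(word_G ^^ prod_list qs) y = y" if "(y, qs) \<in> set G_cycles" for y qs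
    using that unfolding list_all_iff by fastforce
  have "list_all (\<lambda>e. \<forall>q\<in>set (snd e). prime q \<and> (word_G ^^ (prod_list (snd e) div q)) (fst e) \<noteq> fst e) G_cycles"
    unfolding G_cycles_def list.pred_inject fst_conv snd_conv
    by (intro conjI list.pred_inject(1) G_exact_3592(2) G_exact_2786(2) G_exact_3292(2) G_exact_620(2) G_exact_1163(2) G_exact_113(2) G_exact_80(2) G_exact_14(2) G_exact_3(2) G_exact_1(2))
  then have exact2: "prime q \<and> (word_G ^^ (prod_list qs div q)) y \<noteq> y"
    if "(y, qs) \<in> set G_cycles" "q \<in> set qs" for y qs q
    using that unfolding list_all_iff by fastforce
  have dvd: "list_all (\<lambda>(x, qs). x = c_G \<and> prod_list qs = 3 \<or> prod_list qs dvd 3006388745761270374400) G_cycles"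
    unfolding G_cycles_def by simp
  obtain y qs j where y: "(y, qs) \<in> set G_cycles" "x = (word_G ^^ j) y"
  proof (rule cycles_cover[OF f])
    show "distinct (map (\<lambda>e. prod_list (snd e)) G_cycles)" by (simp add: G_cycles_def)
    show "(\<Sum>e\<leftarrow>G_cycles. prod_list (snd e)) = card (UNIV :: ptG set)" unfolding n by (simp add: G_cycles_def)
  qed (rule exact1 exact2, assumption+)+
  have per: "(word_G ^^ prod_list qs) y = y" using y(1) by (rule exact1)
  \<comment> \<open>The only cycle length that does not divide the exponent is 3. Its cycle consists
    of \<open>c_G\<close>, \<open>d_G\<close> and \<open>e_G\<close>, and \<open>x\<close> is none
    of them.\<close>
  have "\<not> (y = c_G \<and> prod_list qs = 3)"
  proof
    assume *: "y = c_G \<and> prod_list qs = 3"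
    then have "y = c_G" "prod_list qs = 3" by simp_all
    then have p3: "(word_G ^^ 3) c_G = c_G" using per by (simp only:)
    have "x = (word_G ^^ (j mod 3)) c_G"
      unfolding funpow_mod_eq[OF p3] using y(2) \<open>y = c_G\<close> by (simp only:)
    moreover have "j mod 3 = 0 \<or> j mod 3 = 1 \<or> j mod 3 = 2" by linarith
    moreover have "word_G c_G = d_G" "word_G d_G = e_G" by code_simp+
    ultimately show False using x by (auto simp: numeral_2_eq_2)
  qed
  then have "prod_list qs dvd 3006388745761270374400" using dvd y(1) by (auto simp: list_all_iff)
  moreover have "(word_G ^^ prod_list qs) x = x"
    unfolding y(2) using per by (metis funpow_add add.commute comp_apply)
  ultimately show ?thesis unfolding act_G_word by blast
qed

lemma G_word_cycle: "act G_word c_G = d_G" "act G_word d_G = e_G" "act G_word e_G = c_G"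
  by code_simp+

lemma G_links:
  "act [lx_G, ls_G, lw_G, lx_G, tau_G, lw_G, lx_G, lw_G, tau_G, lw_G, tau_G, lw_G, tau_G, lw_G, tau_G, ly_G, lx_G, lw_G, tau_G, lw_G, tau_G, lw_G, tau_G, lx_G, lw_G, tau_G, ls_G, lw_G, tau_G, ly_G, lx_G] c_G = o_G"
  "act [lx_G, ls_G, lw_G, lx_G, tau_G, lw_G, lx_G, lw_G, tau_G, lw_G, tau_G, lw_G, tau_G, lw_G, tau_G, ly_G, lx_G, lw_G, tau_G, lw_G, tau_G, lw_G, tau_G, lx_G, lw_G, tau_G, ls_G, lw_G, tau_G, ly_G, lx_G] d_G = lw_G o_G"
  "act [ly_G, lk_G, ls_G, tau_G, lw_G, lx_G, ly_G, tau_G, lw_G, tau_G, lw_G, tau_G, lw_G, tau_G, lw_G, tau_G, lw_G, tau_G, lw_G, tau_G, lw_G, tau_G, ls_G, lw_G, tau_G, lw_G, lx_G, lk_G, tau_G] c_G = o_G"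
  "act [ly_G, lk_G, ls_G, tau_G, lw_G, lx_G, ly_G, tau_G, lw_G, tau_G, lw_G, tau_G, lw_G, tau_G, lw_G, tau_G, lw_G, tau_G, lw_G, tau_G, lw_G, tau_G, ls_G, lw_G, tau_G, lw_G, lx_G, lk_G, tau_G] d_G = lx_G o_G"
  "act [lx_G, lw_G, tau_G, lk_G, lr_G, ly_G, lx_G, lw_G, tau_G, lw_G, tau_G, lw_G, tau_G, lw_G, tau_G, lw_G, tau_G, lw_G, tau_G, lw_G, tau_G, ls_G, lw_G, tau_G, lw_G, lx_G, lk_G, tau_G] c_G = o_G"
  "act [lx_G, lw_G, tau_G, lk_G, lr_G, ly_G, lx_G, lw_G, tau_G, lw_G, tau_G, lw_G, tau_G, lw_G, tau_G, lw_G, tau_G, lw_G, tau_G, lw_G, tau_G, ls_G, lw_G, tau_G, lw_G, lx_G, lk_G, tau_G] d_G = ly_G o_G"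
  "act [ly_G, lp_G, lr_G, tau_G, lw_G, tau_G, lw_G, tau_G, lw_G, tau_G, lw_G, tau_G, lw_G, tau_G, ly_G, ly_G, lx_G, lw_G, tau_G, lw_G, lx_G, lw_G, tau_G, lw_G, tau_G, lw_G] c_G = o_G"
  "act [ly_G, lp_G, lr_G, tau_G, lw_G, tau_G, lw_G, tau_G, lw_G, tau_G, lw_G, tau_G, lw_G, tau_G, ly_G, ly_G, lx_G, lw_G, tau_G, lw_G, lx_G, lw_G, tau_G, lw_G, tau_G, lw_G] d_G = lp_G o_G"
  "act [ls_G, tau_G, lw_G, tau_G, lw_G, ls_G, tau_G, lw_G, tau_G, lw_G, tau_G, lw_G, tau_G, lx_G, lw_G, tau_G, lw_G, tau_G, lw_G, tau_G, lx_G, lw_G, tau_G, lp_G, lx_G, lx_G, lw_G] c_G = o_G"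
  "act [ls_G, tau_G, lw_G, tau_G, lw_G, ls_G, tau_G, lw_G, tau_G, lw_G, tau_G, lw_G, tau_G, lx_G, lw_G, tau_G, lw_G, tau_G, lw_G, tau_G, lx_G, lw_G, tau_G, lp_G, lx_G, lx_G, lw_G] d_G = lq_G o_G"
  "act [lw_G, ly_G, lx_G, lw_G, tau_G, lw_G, ls_G, tau_G, lw_G, tau_G, lw_G, tau_G, lw_G, tau_G, ls_G, ly_G, lx_G, lw_G, tau_G, lw_G, tau_G, lw_G, tau_G, lp_G, lw_G] c_G = o_G"
  "act [lw_G, ly_G, lx_G, lw_G, tau_G, lw_G, ls_G, tau_G, lw_G, tau_G, lw_G, tau_G, lw_G, tau_G, ls_G, ly_G, lx_G, lw_G, tau_G, lw_G, tau_G, lw_G, tau_G, lp_G, lw_G] d_G = lr_G o_G"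
  "act [lw_G, lx_G, lx_G, ly_G, lh_G, tau_G, lw_G, tau_G, lw_G, lx_G, tau_G, lw_G, tau_G, lw_G, tau_G, lw_G, tau_G, lw_G, tau_G, lx_G, lw_G, tau_G, lw_G, tau_G, lr_G, lw_G] c_G = o_G"
  "act [lw_G, lx_G, lx_G, ly_G, lh_G, tau_G, lw_G, tau_G, lw_G, lx_G, tau_G, lw_G, tau_G, lw_G, tau_G, lw_G, tau_G, lw_G, tau_G, lx_G, lw_G, tau_G, lw_G, tau_G, lr_G, lw_G] d_G = ls_G o_G"
  "act [lr_G, ly_G, ly_G, lx_G, lw_G, tau_G, lw_G, tau_G, lw_G, tau_G, lw_G, tau_G, lw_G, tau_G, lw_G, tau_G, lw_G, tau_G, lx_G, lw_G, tau_G, lr_G, lk_G, lq_G, ly_G, lx_G, lw_G] c_G = o_G"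
  "act [lr_G, ly_G, ly_G, lx_G, lw_G, tau_G, lw_G, tau_G, lw_G, tau_G, lw_G, tau_G, lw_G, tau_G, lw_G, tau_G, lw_G, tau_G, lx_G, lw_G, tau_G, lr_G, lk_G, lq_G, ly_G, lx_G, lw_G] d_G = lh_G o_G"
  "act [ly_G, lr_G, tau_G, lw_G, lx_G, ly_G, tau_G, lw_G, tau_G, lw_G, tau_G, lw_G, ls_G, tau_G, lw_G, tau_G, lw_G, tau_G, lw_G, tau_G, lw_G, tau_G, lw_G, tau_G, ls_G, lx_G, lw_G, tau_G, ls_G, lx_G] c_G = o_G"
  "act [ly_G, lr_G, tau_G, lw_G, lx_G, ly_G, tau_G, lw_G, tau_G, lw_G, tau_G, lw_G, ls_G, tau_G, lw_G, tau_G, lw_G, tau_G, lw_G, tau_G, lw_G, tau_G, lw_G, tau_G, ls_G, lx_G, lw_G, tau_G, ls_G, lx_G] d_G = lk_G o_G"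
  by code_simp+

lemma bij_act: "list_all bij fs \<Longrightarrow> bij (act fs)"
proof (induction fs)
  case Nil
  have "act [] = (id :: 'a \<Rightarrow> 'a)" by (simp add: fun_eq_iff)
  then show ?case by (simp only: bij_id)
next
  case (Cons f fs)
  have "act (f # fs) = f \<circ> act fs" by (simp add: fun_eq_iff)
  moreover have "bij f" "bij (act fs)" using Cons by simp_all
  ultimately show ?case using bij_comp by metis
qed

lemma bij_tau_G: "bij tau_G"
  by (rule o_bij[where g = tau_G]) (simp_all only: fun_eq_iff comp_apply id_apply G_tau simp_thms)

theorem lattice_4_11663:
  "\<exists>\<Gamma>. regular_reducible_lattice 4 11663 (sym_group 4) {1..4} (alt_group 11663) {1..11663} \<Gamma>"
proof -
  have "bij (act G_word)"
    by (rule bij_act, unfold list.pred_inject) (intro conjI list.pred_inject(1) G_bij bij_tau_G)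
  then have bij: "bij word_G" by (simp only: act_G_word)
  have "\<exists>\<Gamma>. regular_reducible_lattice 4 11663 (sym_group 4) {1..4}
      (if True then alt_group 11663 else sym_group 11663) {1..11663} \<Gamma>"
  proof (rule complete_graph_lattice[OF gen_data_G, where ws = G_word and c = c_G and d = d_G and e = e_G and M = 3006388745761270374400])
    show "\<exists>l. l dvd 3006388745761270374400 \<and> (act G_word ^^ l) x = x" if "x \<notin> {c_G, d_G, e_G}" for x
      by (rule G_word[OF bij card_ptG that])
    show "list_all (\<lambda>g. \<exists>fs. set fs \<subseteq> insert tau_G (fst ` set LP_G) \<and> act fs c_G = o_G \<and>
        act fs d_G = g o_G) (map fst LP_G)"
      unfolding fst_LP_G list.pred_inject
      by (intro conjI list.pred_inject(1); rule linkI[rotated], rule G_links, rule G_links, simp)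
    show "if True then list_all evenperm (tau_G # map fst LP_G) else \<not> list_all evenperm (tau_G # map fst LP_G)"
      unfolding if_True fst_LP_G list.pred_inject by (intro conjI list.pred_inject(1) G_parity)
    show "carrier (sym_group 4) = mgen (snd ` set LP_G)"
      unfolding sym4_mgen LP_G_def by (rule arg_cong[where f = mgen]) auto
    show "card (UNIV :: ptG set) = 11663 + 1" unfolding card_ptG by simp
    show "set G_word \<subseteq> insert tau_G (fst ` set LP_G)" by (simp add: fst_LP_G)
    show "\<not> 3 dvd (3006388745761270374400 :: nat)" by simp
    show "card ({1..4} :: nat set) = 4" by simp
    show "monoid.mult (sym_group 4) = (\<circ>)" by (rule sym_group_mult)
    show "0 < (11663 :: nat)" by simp
    show "distinct [c_G, d_G, e_G]" by simp
  qed (rule G_word_cycle)+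
  then show ?thesis by (simp only: if_True)
qed

theorem proposition2p3:
  shows
    "(\<exists>\<Gamma>. regular_reducible_lattice 3 23 (sym_group 3) {1..3} (sym_group 23) {1..23} \<Gamma>) \<and>
     (\<exists>\<Gamma>. regular_reducible_lattice 3 24 (sym_group 3) {1..3} (sym_group 24) {1..24} \<Gamma>) \<and>
     (\<exists>\<Gamma>. regular_reducible_lattice 3 47 (sym_group 3) {1..3} (alt_group 47) {1..47} \<Gamma>) \<and>
     (\<exists>\<Gamma>. regular_reducible_lattice 4 11663
            (sym_group 4) {1..4} (alt_group 11663) {1..11663} \<Gamma>) \<and>
     (\<forall>n\<in>{19, 39, 79}. \<exists>\<Gamma>. regular_reducible_lattice 5 n
            affine_group_5 {0..<5} (if n = 19 then sym_group n else alt_group n) {1..n} \<Gamma>)"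
proof (intro conjI ballI)
  fix n :: nat assume "n \<in> {19, 39, 79}"
  then consider "n = 19" | "n = 39" | "n = 79" by blast
  then show "\<exists>\<Gamma>. regular_reducible_lattice 5 n
            affine_group_5 {0..<5} (if n = 19 then sym_group n else alt_group n) {1..n} \<Gamma>"
  proof cases
    case 1
    show ?thesis unfolding 1 if_P[OF refl] by (rule lattice_5_19)
  next
    case 2
    then have "n \<noteq> 19" by simp
    then show ?thesis unfolding if_not_P[OF \<open>n \<noteq> 19\<close>] unfolding 2 by (intro lattice_5_39)
  next
    case 3
    then have "n \<noteq> 19" by simp
    then show ?thesis unfolding if_not_P[OF \<open>n \<noteq> 19\<close>] unfolding 3 by (intro lattice_5_79)
  qed
qed (rule lattice_3_23 lattice_3_24 lattice_3_47 lattice_4_11663)+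

end
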